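(* Let $\sigma$ be the smallest positive solution of $x\cot(x)=1$. Let $\kappa=\sigma/\sqrt3$ and $\Lambda^*=(1/(2\kappa),-4\kappa^2,\pi/2)$ (for which $M(\Lambda^* )=\{1,2\}$, i.e. $n_1=1$, $n_2=2$). Then $$\Psi_{1r}(0,v,\Lambda^* )=\Big(1+\tfrac13\kappa^2\Big)\sin(v)\,\tilde w_1^*,\qquad \Psi_{2r}(0,v,\Lambda^* )=\Big(\tfrac1{16}+\tfrac12\cos^2(\sigma)\Big)\cos^2(v)\,\tilde w_2^*,$$ and so $$\begin{bmatrix}\overline\alpha_r(0,v)\\ \overline\lambda_r(0,v)\end{bmatrix}=\mathbb{M}\begin{bmatrix}\big(1+\tfrac13\kappa^2\big)\sin(v)\\ \big(\tfrac1{16}+\tfrac12\cos^2(\sigma)\big)\cos(v)\cot(v)\end{bmatrix}$$ for a nonsingular matrix $\mathbb{M}$ not depending on $v$. In particular, $\overline\alpha_r(0,v)$ and $\overline\lambda_r(0,v)$ are both nonzero, except possibly for isolated values of $v$.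
   Context: Fix $\kappa>0$ and $\beta\in(0,1)$. Let $\hat\Omega=\{(x,s):x\in\mathbb{R},\ s\in[0,1]\}$; the subscript $\kappa$ on a function space means $2\pi/\kappa$-periodic in $x$, and e means even in $x$. Set $X=X_1\times X_2=C^{2,\beta}_{\kappa,\mathrm{e}}(\mathbb{R})\times\{\hat\phi\in C^{2,\beta}_{\kappa,\mathrm{e}}(\overline{\hat\Omega}):\hat\phi|_{s=0}=\hat\phi|_{s=1}=0\}$, $Y=C^{1,\beta}_{\kappa,\mathrm{e}}(\mathbb{R})\times C^{\beta}_{\kappa,\mathrm{e}}(\overline{\hat\Omega})$, $\tilde X_2=\{\phi\in C^{2,\beta}_{\kappa,\mathrm{e}}(\overline{\hat\Omega}):\phi|_{s=0}=0\}$, $\mathcal{O}=\{w=(\eta,\hat\phi)\in X:\min\eta>-1\}$, and $\mathcal{U}=\{(\mu,\alpha,\lambda)\in\mathbb{R}^3:\mu\ne0,\ \alpha<0,\ 0<\lambda<\pi\}$. For $\Lambda=(\mu,\alpha,\lambda)\in\mathcal{U}$ let $\psi_0(s)=\psi_0(s,\Lambda)=\mu\cos(|\alpha|^{1/2}(s-1)+\lambda)$ and $Q(\Lambda)=\tfrac12\mu^2|\alpha|\sin^2(\lambda)$. The smooth map $\mathcal{F}=(\mathcal{F}_1,\mathcal{F}_2):\mathcal{O}\times\mathcal{U}\to Y$ is $$\mathcal{F}_1(w,\Lambda)=\left[\frac{(1+\eta_x^2)(\psi_{0s}+\hat\phi_s)^2}{2(1+\eta)^2}\right]_{s=1}+\eta-Q(\Lambda),$$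 $$\mathcal{F}_2(w,\Lambda)=\Big(\partial_x-\frac{s\eta_x}{1+\eta}\partial_s\Big)^2(\psi_0+\hat\phi)+\frac{\psi_{0ss}+\hat\phi_{ss}}{(1+\eta)^2}-\alpha(\psi_0+\hat\phi).$$ One has $\mathcal{F}(0,\Lambda)=0$ for all $\Lambda$; a solution of $\mathcal F(w,\Lambda)=0$ is nontrivial if $w\ne0$. The isomorphism $\mathcal{T}(\Lambda):\tilde X_2\to X$ is $$\mathcal{T}(\Lambda)\phi=(\eta_\phi,\hat\phi)=\Big(-\frac{\phi|_{s=1}}{\psi_{0s}(1)},\ \phi-\frac{s\psi_{0s}}{\psi_{0s}(1)}\phi|_{s=1}\Big),$$ and $\mathcal{L}(\Lambda)=D_w\mathcal{F}(0,\Lambda)\mathcal{T}(\Lambda):\tilde X_2\to Y$. For $n\in\mathbb{N}_0$ let $\theta_n=\theta(n,\alpha)=\sqrt{\alpha+n^2\kappa^2}$ (equal to $i\sqrt{|\alpha|-n^2\kappa^2}$ if the radicand is negative), $\phi_n(x,s)=\cos(n\kappa x)\sinh(\theta_ns)/\theta_n$ (with $\sinh(\theta_ns)/\theta_n:=s$ if $\theta_n=0$), $l(n,\alpha)=\theta_n\coth(\theta_n)$ (equal to $1$ if $\theta_n=0$; defined when $\sinh(\theta_n)/\theta_n\ne0$), and $r(\Lambda)=\frac{1}{\mu^2|\alpha|\sin^2(\lambda)}+|\alpha|^{1/2}\cot(\lambda)$. $M(\Lambda)$ is the finite set of $n\in\mathbb{N}_0$ with $l(n,\alpha)=r(\Lambda)$;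 $\{\phi_n\}_{n\in M(\Lambda)}$ is a basis of $\ker\mathcal{L}(\Lambda)$. Lyapunov–Schmidt reduction. Let $M(\Lambda^* )=\{n_1,n_2\}$ with $1\le n_1<n_2$ and $n_1\mid n_2$, let $\phi_j^*=\phi_{n_j}$ at $\alpha=\alpha^*$, $w_j^*=\mathcal{T}(\Lambda^* )\phi_j^*$, $\tilde w_j^*=(\eta_{\phi_j^*},\phi_j^* )$ and $Z=\operatorname{span}\{\tilde w_1^*,\tilde w_2^*\}$. With the inner product $\langle(\eta_1,\hat\phi_1),(\eta_2,\hat\phi_2)\rangle_Y=\int_0^{2\pi/\kappa}\eta_1\eta_2\,dx+\int_0^1\int_0^{2\pi/\kappa}\hat\phi_1\hat\phi_2\,dx\,ds$ one has the orthogonal decomposition $Y=Z\oplus\operatorname{ran}\mathcal{L}(\Lambda^* )$; let $\Pi_jw=\frac{\langle w,\tilde w_j^*\rangle_Y}{\|\tilde w_j^*\|_Y^2}\tilde w_j^*$ and $\Pi_Z=\Pi_1+\Pi_2$. Let $X_0$ be a closed subspace with $X=\ker D_w\mathcal{F}(0,\Lambda^* )\oplus X_0$, and let $\psi(w,\Lambda)\in X_0$ be the unique smooth function near $(0,\Lambda^* )$ in $\ker D_w\mathcal{F}(0,\Lambda^* )\times\mathcal{U}$ with small values and $(I-\Pi_Z)\mathcal{F}(w+\psi(w,\Lambda),\Lambda)=0$. Put $\Phi_j(t_1,t_2,\Lambda)=\Pi_j\mathcal{F}(w+\psi(w,\Lambda),\Lambda)$ with $w=t_1w_1^*+t_2w_2^*$,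 and, in polar coordinates $(t_1,t_2)=(r\cos v,r\sin v)$, $$\Psi_1(r,v,\Lambda)=\int_0^1\Phi_{1t_1}(zr\cos v,r\sin v,\Lambda)\,dz,$$ $$\Psi_2(r,v,\Lambda)=\int_0^1\big[\Phi_{2t_1}(zr\cos v,zr\sin v,\Lambda)\cos v+\Phi_{2t_2}(zr\cos v,zr\sin v,\Lambda)\sin v\big]\,dz.$$ Solution sheet. Under the assumptions $\cot(\lambda^* )\ne-(\mu^* )^2|\alpha^*|^{3/2}/2$ and either $r(\Lambda^* )\notin\{0,1\}$ or $\theta(n_2,\alpha^* )=0$ (satisfied here), for any $0<\delta<1$ the equations $\Psi_1=\Psi_2=0$ with $\mu=\mu^*$ are solved near $r=0$, $(\alpha,\lambda)=(\alpha^*,\lambda^* )$, for $|\sin v|>\delta$, by unique smooth functions $\alpha=\overline\alpha(r,v)$, $\lambda=\overline\lambda(r,v)$ with $\overline\alpha(0,v)=\alpha^*$, $\overline\lambda(0,v)=\lambda^*$; these give the sheet of nontrivial solutions $\overline w(r,v)=r\cos(v)w_1^*+r\sin(v)w_2^*+O(r^2)$ of $\mathcal{F}(w,\mu^*,\overline\alpha,\overline\lambda)=0$. Subscripts $r$ denote partial derivatives with respect to $r$. *)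

theory Defs
  imports "HOL-Analysis.Analysis" "HOL-Library.Function_Algebras"
begin

instantiation "fun" :: (type, real_vector) real_vector
begin

definition scaleR_fun :: "real \<Rightarrow> ('a \<Rightarrow> 'b) \<Rightarrow> 'a \<Rightarrow> 'b" where
  "scaleR_fun c f = (\<lambda>x. c *\<^sub>R f x)"

instance
  by standard (simp_all add: scaleR_fun_def plus_fun_def fun_eq_iff algebra_simps)

end

section \<open>Calculus in normed spaces given by a carrier and a norm\<close>

text \<open>The Hoelder spaces depend on real parameters and hence cannot be types.  A normed space is
  represented by a carrier set together with a norm that is only meaningful on that carrier.\<close>

type_synonym 'a nspace = "'a set \<times> ('a \<Rightarrow> real)"

definition bounded_linear_between ::
  "'a::real_vector nspace \<Rightarrow> 'b::real_vector nspace \<Rightarrow> ('a \<Rightarrow> 'b) \<Rightarrow> bool" where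
  "bounded_linear_between E G L \<longleftrightarrow>
     (\<forall>h\<in>fst E. L h \<in> fst G) \<and>
     (\<forall>h\<in>fst E. \<forall>k\<in>fst E. L (h + k) = L h + L k) \<and>
     (\<forall>c. \<forall>h\<in>fst E. L (c *\<^sub>R h) = c *\<^sub>R L h) \<and>
     (\<exists>C. \<forall>h\<in>fst E. snd G (L h) \<le> C * snd E h)"

definition has_fderiv ::
  "'a::real_vector nspace \<Rightarrow> 'b::real_vector nspace \<Rightarrow> 'a set \<Rightarrow> ('a \<Rightarrow> 'b) \<Rightarrow> ('a \<Rightarrow> 'b) \<Rightarrow> 'a \<Rightarrow> bool" where
  "has_fderiv E G A f L x \<longleftrightarrow>
     bounded_linear_between E G L \<and>
     (\<forall>e>0. \<exists>d>0. \<forall>h\<in>fst E. snd E h < d \<and> x + h \<in> A \<longrightarrow>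
        snd G (f (x + h) - f x - L h) \<le> e * snd E h)"

definition ncontinuous_on ::
  "'a::real_vector nspace \<Rightarrow> 'b::real_vector nspace \<Rightarrow> 'a set \<Rightarrow> ('a \<Rightarrow> 'b) \<Rightarrow> bool" where
  "ncontinuous_on E G A f \<longleftrightarrow>
     (\<forall>x\<in>A. f x \<in> fst G) \<and>
     (\<forall>x\<in>A. \<forall>e>0. \<exists>d>0. \<forall>y\<in>A. snd E (y - x) < d \<longrightarrow> snd G (f y - f x) < e)"

text \<open>Maps of class \<open>C\<^sup>k\<close> on a relatively open subset \<open>A\<close> of a \<^emph>\<open>finite-dimensional\<close> space \<open>E\<close>
  (only used in that case): for such \<open>E\<close>, continuity of the derivative in operator norm is the same
  as continuity of its value in every fixed direction, which makes the recursion well-typed.\<close>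

primrec Ck_map ::
  "nat \<Rightarrow> 'a::real_vector nspace \<Rightarrow> 'b::real_vector nspace \<Rightarrow> 'a set \<Rightarrow> ('a \<Rightarrow> 'b) \<Rightarrow> bool" where
  "Ck_map 0 E G A f \<longleftrightarrow> ncontinuous_on E G A f"
| "Ck_map (Suc k) E G A f \<longleftrightarrow> ncontinuous_on E G A f \<and>
     (\<exists>D. (\<forall>x\<in>A. has_fderiv E G A f (D x) x) \<and> (\<forall>h\<in>fst E. Ck_map k E G A (\<lambda>x. D x h)))"

definition smooth_map ::
  "'a::real_vector nspace \<Rightarrow> 'b::real_vector nspace \<Rightarrow> 'a set \<Rightarrow> ('a \<Rightarrow> 'b) \<Rightarrow> bool" where
  "smooth_map E G A f \<longleftrightarrow> (\<forall>k. Ck_map k E G A f)"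

text \<open>Derivative of a curve in \<open>G\<close>, with the limit taken in the norm of \<open>G\<close>.\<close>

definition has_nderiv :: "'b::real_vector nspace \<Rightarrow> (real \<Rightarrow> 'b) \<Rightarrow> 'b \<Rightarrow> real \<Rightarrow> bool" where
  "has_nderiv G f d t \<longleftrightarrow>
     d \<in> fst G \<and> (\<forall>\<^sub>F \<tau> in nhds t. f \<tau> \<in> fst G) \<and>
     ((\<lambda>h. snd G ((1 / h) *\<^sub>R (f (t + h) - f t) - d)) \<longlongrightarrow> 0) (at 0)"

definition nderiv :: "'b::real_vector nspace \<Rightarrow> (real \<Rightarrow> 'b) \<Rightarrow> real \<Rightarrow> 'b" where
  "nderiv G f t = (THE d. has_nderiv G f d t)"

definition closed_subspace :: "'a::real_vector nspace \<Rightarrow> 'a set \<Rightarrow> bool" where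
  "closed_subspace E S \<longleftrightarrow> subspace S \<and> S \<subseteq> fst E \<and>
     (\<forall>f x. (\<forall>n::nat. f n \<in> S) \<and> x \<in> fst E \<and> (\<lambda>n. snd E (f n - x)) \<longlonglongrightarrow> 0 \<longrightarrow> x \<in> S)"

definition direct_sum :: "'a::real_vector set \<Rightarrow> 'a set \<Rightarrow> 'a set \<Rightarrow> bool" where
  "direct_sum V S T \<longleftrightarrow> S \<inter> T = {0} \<and> V = {a + b | a b. a \<in> S \<and> b \<in> T}"

section \<open>Hoelder spaces\<close>

text \<open>Functions on the closed strip are represented by functions on the plane that vanish off the
  strip, so that equality of functions is equality on the strip.\<close>

definition strip :: "(real \<times> real) set" where
  "strip = UNIV \<times> {0..1}"

definition on_strip :: "(real \<times> real \<Rightarrow> real) \<Rightarrow> real \<times> real \<Rightarrow> real" where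
  "on_strip u p = (if p \<in> strip then u p else 0)"

text \<open>At \<open>s = 0\<close> and \<open>s = 1\<close> the derivative in \<open>s\<close> is one-sided.\<close>

definition dx :: "(real \<times> real \<Rightarrow> real) \<Rightarrow> real \<times> real \<Rightarrow> real" where
  "dx u = on_strip (\<lambda>(x, s). deriv (\<lambda>t. u (t, s)) x)"

definition ds :: "(real \<times> real \<Rightarrow> real) \<Rightarrow> real \<times> real \<Rightarrow> real" where
  "ds u = on_strip (\<lambda>(x, s). vector_derivative (\<lambda>t. u (x, t)) (at s within {0..1}))"

definition hoelder_quotients :: "real \<Rightarrow> 'a::metric_space set \<Rightarrow> ('a \<Rightarrow> real) \<Rightarrow> real set" where
  "hoelder_quotients \<beta> S f = {\<bar>f p - f q\<bar> / dist p q powr \<beta> | p q. p \<in> S \<and> q \<in> S \<and> p \<noteq> q}"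

primrec hoelder_line :: "nat \<Rightarrow> real \<Rightarrow> (real \<Rightarrow> real) \<Rightarrow> bool" where
  "hoelder_line 0 \<beta> f \<longleftrightarrow> bounded (range f) \<and> bdd_above (hoelder_quotients \<beta> UNIV f)"
| "hoelder_line (Suc k) \<beta> f \<longleftrightarrow> bounded (range f) \<and> (\<forall>x. f differentiable (at x)) \<and>
     hoelder_line k \<beta> (deriv f)"

primrec hoelder_line_norm :: "nat \<Rightarrow> real \<Rightarrow> (real \<Rightarrow> real) \<Rightarrow> real" where
  "hoelder_line_norm 0 \<beta> f = (SUP x. \<bar>f x\<bar>) + Sup (hoelder_quotients \<beta> UNIV f)"
| "hoelder_line_norm (Suc k) \<beta> f = (SUP x. \<bar>f x\<bar>) + hoelder_line_norm k \<beta> (deriv f)"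

primrec hoelder_strip :: "nat \<Rightarrow> real \<Rightarrow> (real \<times> real \<Rightarrow> real) \<Rightarrow> bool" where
  "hoelder_strip 0 \<beta> u \<longleftrightarrow> (\<forall>p. p \<notin> strip \<longrightarrow> u p = 0) \<and> bounded (u ` strip) \<and>
     bdd_above (hoelder_quotients \<beta> strip u)"
| "hoelder_strip (Suc k) \<beta> u \<longleftrightarrow> (\<forall>p. p \<notin> strip \<longrightarrow> u p = 0) \<and> bounded (u ` strip) \<and>
     (\<forall>(x, s)\<in>strip. (\<lambda>t. u (t, s)) differentiable (at x) \<and>
        (\<lambda>t. u (x, t)) differentiable (at s within {0..1})) \<and>
     hoelder_strip k \<beta> (dx u) \<and> hoelder_strip k \<beta> (ds u)"

primrec hoelder_strip_norm :: "nat \<Rightarrow> real \<Rightarrow> (real \<times> real \<Rightarrow> real) \<Rightarrow> real" where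
  "hoelder_strip_norm 0 \<beta> u = (SUP p\<in>strip. \<bar>u p\<bar>) + Sup (hoelder_quotients \<beta> strip u)"
| "hoelder_strip_norm (Suc k) \<beta> u = (SUP p\<in>strip. \<bar>u p\<bar>) +
     hoelder_strip_norm k \<beta> (dx u) + hoelder_strip_norm k \<beta> (ds u)"

definition C_line :: "nat \<Rightarrow> real \<Rightarrow> real \<Rightarrow> (real \<Rightarrow> real) set" where
  "C_line k \<kappa> \<beta> = {\<eta>. hoelder_line k \<beta> \<eta> \<and> (\<forall>x. \<eta> (x + 2 * pi / \<kappa>) = \<eta> x) \<and> (\<forall>x. \<eta> (- x) = \<eta> x)}"

definition C_strip :: "nat \<Rightarrow> real \<Rightarrow> real \<Rightarrow> (real \<times> real \<Rightarrow> real) set" where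
  "C_strip k \<kappa> \<beta> = {\<phi>. hoelder_strip k \<beta> \<phi> \<and>
     (\<forall>x s. \<phi> (x + 2 * pi / \<kappa>, s) = \<phi> (x, s)) \<and> (\<forall>x s. \<phi> (- x, s) = \<phi> (x, s))}"

type_synonym fpair = "(real \<Rightarrow> real) \<times> (real \<times> real \<Rightarrow> real)"

definition X_space :: "real \<Rightarrow> real \<Rightarrow> fpair nspace" where
  "X_space \<kappa> \<beta> =
     ({(\<eta>, \<phi>). \<eta> \<in> C_line 2 \<kappa> \<beta> \<and> \<phi> \<in> C_strip 2 \<kappa> \<beta> \<and> (\<forall>x. \<phi> (x, 0) = 0 \<and> \<phi> (x, 1) = 0)},
      \<lambda>(\<eta>, \<phi>). hoelder_line_norm 2 \<beta> \<eta> + hoelder_strip_norm 2 \<beta> \<phi>)"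

definition Y_space :: "real \<Rightarrow> real \<Rightarrow> fpair nspace" where
  "Y_space \<kappa> \<beta> =
     (C_line 1 \<kappa> \<beta> \<times> C_strip 0 \<kappa> \<beta>,
      \<lambda>(\<eta>, \<phi>). hoelder_line_norm 1 \<beta> \<eta> + hoelder_strip_norm 0 \<beta> \<phi>)"

section \<open>The water-wave operator\<close>

text \<open>Parameters are triples \<open>\<Lambda> = (\<mu>, \<alpha>, \<lambda>)\<close>.\<close>

type_synonym param = "real \<times> real \<times> real"

definition O_set :: "real \<Rightarrow> real \<Rightarrow> fpair set" where
  "O_set \<kappa> \<beta> = {(\<eta>, \<phi>). (\<eta>, \<phi>) \<in> fst (X_space \<kappa> \<beta>) \<and> (\<forall>x. \<eta> x > -1)}"

definition U_set :: "param set" where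
  "U_set = {(\<mu>, \<alpha>, l). \<mu> \<noteq> 0 \<and> \<alpha> < 0 \<and> 0 < l \<and> l < pi}"

definition psi0 :: "param \<Rightarrow> real \<Rightarrow> real" where
  "psi0 = (\<lambda>(\<mu>, \<alpha>, l) s. \<mu> * cos (sqrt \<bar>\<alpha>\<bar> * (s - 1) + l))"

definition Q_const :: "param \<Rightarrow> real" where
  "Q_const = (\<lambda>(\<mu>, \<alpha>, l). \<mu>\<^sup>2 * \<bar>\<alpha>\<bar> * (sin l)\<^sup>2 / 2)"

definition F1 :: "fpair \<Rightarrow> param \<Rightarrow> real \<Rightarrow> real" where
  "F1 = (\<lambda>(\<eta>, \<phi>) \<Lambda> x.
     (1 + (deriv \<eta> x)\<^sup>2) * (deriv (psi0 \<Lambda>) 1 + ds \<phi> (x, 1))\<^sup>2 / (2 * (1 + \<eta> x)\<^sup>2)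
     + \<eta> x - Q_const \<Lambda>)"

text \<open>The operator \<open>\<partial>\<^sub>x - s \<eta>\<^sub>x / (1 + \<eta>) \<partial>\<^sub>s\<close>.\<close>

definition flat_dx :: "(real \<Rightarrow> real) \<Rightarrow> (real \<times> real \<Rightarrow> real) \<Rightarrow> real \<times> real \<Rightarrow> real" where
  "flat_dx \<eta> u = on_strip (\<lambda>(x, s). dx u (x, s) - s * deriv \<eta> x / (1 + \<eta> x) * ds u (x, s))"

definition F2 :: "fpair \<Rightarrow> param \<Rightarrow> real \<times> real \<Rightarrow> real" where
  "F2 = (\<lambda>(\<eta>, \<phi>) \<Lambda>. on_strip (\<lambda>(x, s).
     flat_dx \<eta> (flat_dx \<eta> (on_strip (\<lambda>(x, s). psi0 \<Lambda> s + \<phi> (x, s)))) (x, s)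
     + (deriv (deriv (psi0 \<Lambda>)) s + ds (ds \<phi>) (x, s)) / (1 + \<eta> x)\<^sup>2
     - fst (snd \<Lambda>) * (psi0 \<Lambda> s + \<phi> (x, s))))"

definition F_map :: "fpair \<Rightarrow> param \<Rightarrow> fpair" where
  "F_map w \<Lambda> = (F1 w \<Lambda>, F2 w \<Lambda>)"

text \<open>The partial derivative \<open>D\<^sub>w F(0, \<Lambda>) : X \<rightarrow> Y\<close>; it is determined on the carrier of \<open>X\<close> only.\<close>

definition DwF :: "real \<Rightarrow> real \<Rightarrow> param \<Rightarrow> fpair \<Rightarrow> fpair" where
  "DwF \<kappa> \<beta> \<Lambda> = (SOME L. has_fderiv (X_space \<kappa> \<beta>) (Y_space \<kappa> \<beta>) (O_set \<kappa> \<beta>) (\<lambda>w. F_map w \<Lambda>) L 0)"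

definition ker_DwF :: "real \<Rightarrow> real \<Rightarrow> param \<Rightarrow> fpair set" where
  "ker_DwF \<kappa> \<beta> \<Lambda> = {w \<in> fst (X_space \<kappa> \<beta>). DwF \<kappa> \<beta> \<Lambda> w = 0}"

definition T_map :: "param \<Rightarrow> (real \<times> real \<Rightarrow> real) \<Rightarrow> fpair" where
  "T_map \<Lambda> \<phi> =
     (\<lambda>x. - \<phi> (x, 1) / deriv (psi0 \<Lambda>) 1,
      on_strip (\<lambda>(x, s). \<phi> (x, s) - s * deriv (psi0 \<Lambda>) s / deriv (psi0 \<Lambda>) 1 * \<phi> (x, 1)))"

text \<open>The principal branch \<open>csqrt\<close> sends a negative real \<open>- a\<close> to \<open>\<i> * sqrt a\<close>.\<close>

definition theta :: "real \<Rightarrow> nat \<Rightarrow> real \<Rightarrow> complex" where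
  "theta \<kappa> n \<alpha> = csqrt (complex_of_real (\<alpha> + (real n)\<^sup>2 * \<kappa>\<^sup>2))"

text \<open>The quotient \<open>sinh (\<theta> s) / \<theta>\<close> is real since \<open>\<theta>\<close> is real or imaginary.\<close>

definition phi_mode :: "real \<Rightarrow> nat \<Rightarrow> real \<Rightarrow> real \<times> real \<Rightarrow> real" where
  "phi_mode \<kappa> n \<alpha> = on_strip (\<lambda>(x, s). cos (real n * \<kappa> * x) *
     (let \<theta> = theta \<kappa> n \<alpha> in if \<theta> = 0 then s else Re (sinh (\<theta> * complex_of_real s) / \<theta>)))"

definition disp_l :: "real \<Rightarrow> nat \<Rightarrow> real \<Rightarrow> complex" where
  "disp_l \<kappa> n \<alpha> = (let \<theta> = theta \<kappa> n \<alpha> in if \<theta> = 0 then 1 else \<theta> * (cosh \<theta> / sinh \<theta>))"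

definition disp_r :: "param \<Rightarrow> real" where
  "disp_r = (\<lambda>(\<mu>, \<alpha>, l). 1 / (\<mu>\<^sup>2 * \<bar>\<alpha>\<bar> * (sin l)\<^sup>2) + sqrt \<bar>\<alpha>\<bar> * cot l)"

definition M_set :: "real \<Rightarrow> param \<Rightarrow> nat set" where
  "M_set \<kappa> \<Lambda> = {n. (let \<alpha> = fst (snd \<Lambda>); \<theta> = theta \<kappa> n \<alpha> in
     (\<theta> = 0 \<or> sinh \<theta> \<noteq> 0) \<and> disp_l \<kappa> n \<alpha> = complex_of_real (disp_r \<Lambda>))}"

section \<open>Lyapunov-Schmidt reduction\<close>

definition inner_Y :: "real \<Rightarrow> fpair \<Rightarrow> fpair \<Rightarrow> real" where
  "inner_Y \<kappa> = (\<lambda>(\<eta>1, \<phi>1) (\<eta>2, \<phi>2).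
     integral {0..2 * pi / \<kappa>} (\<lambda>x. \<eta>1 x * \<eta>2 x)
     + integral {0..1} (\<lambda>s. integral {0..2 * pi / \<kappa>} (\<lambda>x. \<phi>1 (x, s) * \<phi>2 (x, s))))"

text \<open>Below, \<open>\<Lambda>s\<close> is the bifurcation point \<open>\<Lambda>\<^sup>*\<close>, and the index \<open>j\<close> of \<open>w\<^sub>j\<^sup>*\<close>, \<open>\<Pi>\<^sub>j\<close> and \<open>\<Phi>\<^sub>j\<close>
  is replaced by the mode \<open>n = n\<^sub>j\<close>.\<close>

definition w_star :: "real \<Rightarrow> param \<Rightarrow> nat \<Rightarrow> fpair" where
  "w_star \<kappa> \<Lambda>s n = T_map \<Lambda>s (phi_mode \<kappa> n (fst (snd \<Lambda>s)))"

definition wt_star :: "real \<Rightarrow> param \<Rightarrow> nat \<Rightarrow> fpair" where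
  "wt_star \<kappa> \<Lambda>s n =
     (let \<phi> = phi_mode \<kappa> n (fst (snd \<Lambda>s)) in (fst (T_map \<Lambda>s \<phi>), \<phi>))"

definition Pi_mode :: "real \<Rightarrow> param \<Rightarrow> nat \<Rightarrow> fpair \<Rightarrow> fpair" where
  "Pi_mode \<kappa> \<Lambda>s n w =
     (inner_Y \<kappa> w (wt_star \<kappa> \<Lambda>s n) / inner_Y \<kappa> (wt_star \<kappa> \<Lambda>s n) (wt_star \<kappa> \<Lambda>s n))
       *\<^sub>R wt_star \<kappa> \<Lambda>s n"

definition Pi_Z :: "real \<Rightarrow> param \<Rightarrow> nat \<Rightarrow> nat \<Rightarrow> fpair \<Rightarrow> fpair" where
  "Pi_Z \<kappa> \<Lambda>s n1 n2 w = Pi_mode \<kappa> \<Lambda>s n1 w + Pi_mode \<kappa> \<Lambda>s n2 w"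

text \<open>\<open>\<psi>\<close> is the smooth function with small values in \<open>X0\<close>, defined near \<open>(0, \<Lambda>s)\<close>, that solves the
  projected equation uniquely among small elements of \<open>X0\<close>.\<close>

definition LS_function ::
  "real \<Rightarrow> real \<Rightarrow> param \<Rightarrow> nat \<Rightarrow> nat \<Rightarrow> fpair set \<Rightarrow> (fpair \<times> param \<Rightarrow> fpair) \<Rightarrow> bool" where
  "LS_function \<kappa> \<beta> \<Lambda>s n1 n2 X0 \<psi> \<longleftrightarrow>
     (\<exists>\<rho>>0. \<exists>\<epsilon>>0.
        let K = ker_DwF \<kappa> \<beta> \<Lambda>s;
            nX = snd (X_space \<kappa> \<beta>);
            N = {(w, \<Lambda>). w \<in> K \<and> \<Lambda> \<in> U_set \<and> nX w < \<rho> \<and> dist \<Lambda> \<Lambda>s < \<rho>};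
            solves = (\<lambda>w \<Lambda> y. y \<in> X0 \<and> nX y < \<epsilon> \<and> w + y \<in> O_set \<kappa> \<beta> \<and>
                        F_map (w + y) \<Lambda> - Pi_Z \<kappa> \<Lambda>s n1 n2 (F_map (w + y) \<Lambda>) = 0)
        in smooth_map (K \<times> UNIV, \<lambda>(w, \<Lambda>). nX w + norm \<Lambda>) (X0, nX) N \<psi> \<and>
           (\<forall>(w, \<Lambda>)\<in>N. solves w \<Lambda> (\<psi> (w, \<Lambda>)) \<and> (\<forall>y. solves w \<Lambda> y \<longrightarrow> y = \<psi> (w, \<Lambda>))))"

text \<open>\<open>Phi \<kappa> \<Lambda>s n1 n2 \<psi> n1\<close> is \<open>\<Phi>\<^sub>1\<close> and \<open>Phi \<kappa> \<Lambda>s n1 n2 \<psi> n2\<close> is \<open>\<Phi>\<^sub>2\<close>.\<close>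

definition Phi ::
  "real \<Rightarrow> param \<Rightarrow> nat \<Rightarrow> nat \<Rightarrow> (fpair \<times> param \<Rightarrow> fpair) \<Rightarrow> nat \<Rightarrow> real \<Rightarrow> real \<Rightarrow> param \<Rightarrow> fpair" where
  "Phi \<kappa> \<Lambda>s n1 n2 \<psi> n t1 t2 \<Lambda> =
     (let w = t1 *\<^sub>R w_star \<kappa> \<Lambda>s n1 + t2 *\<^sub>R w_star \<kappa> \<Lambda>s n2
      in Pi_mode \<kappa> \<Lambda>s n (F_map (w + \<psi> (w, \<Lambda>)) \<Lambda>))"

text \<open>Integrals over \<open>[0, 1]\<close> of \<open>Y\<close>-valued functions are taken pointwise.\<close>

definition integral01 :: "(real \<Rightarrow> fpair) \<Rightarrow> fpair" where
  "integral01 g = (\<lambda>x. integral {0..1} (\<lambda>z. fst (g z) x), \<lambda>p. integral {0..1} (\<lambda>z. snd (g z) p))"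

definition Psi1 ::
  "real \<Rightarrow> real \<Rightarrow> param \<Rightarrow> nat \<Rightarrow> nat \<Rightarrow> (fpair \<times> param \<Rightarrow> fpair) \<Rightarrow> real \<Rightarrow> real \<Rightarrow> param \<Rightarrow> fpair" where
  "Psi1 \<kappa> \<beta> \<Lambda>s n1 n2 \<psi> r v \<Lambda> =
     integral01 (\<lambda>z. nderiv (Y_space \<kappa> \<beta>)
       (\<lambda>t1. Phi \<kappa> \<Lambda>s n1 n2 \<psi> n1 t1 (r * sin v) \<Lambda>) (z * r * cos v))"

definition Psi2 ::
  "real \<Rightarrow> real \<Rightarrow> param \<Rightarrow> nat \<Rightarrow> nat \<Rightarrow> (fpair \<times> param \<Rightarrow> fpair) \<Rightarrow> real \<Rightarrow> real \<Rightarrow> param \<Rightarrow> fpair" where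
  "Psi2 \<kappa> \<beta> \<Lambda>s n1 n2 \<psi> r v \<Lambda> =
     integral01 (\<lambda>z.
       cos v *\<^sub>R nderiv (Y_space \<kappa> \<beta>)
         (\<lambda>t1. Phi \<kappa> \<Lambda>s n1 n2 \<psi> n2 t1 (z * r * sin v) \<Lambda>) (z * r * cos v)
       + sin v *\<^sub>R nderiv (Y_space \<kappa> \<beta>)
         (\<lambda>t2. Phi \<kappa> \<Lambda>s n1 n2 \<psi> n2 (z * r * cos v) t2 \<Lambda>) (z * r * sin v))"

text \<open>The functions \<open>\<alpha>(r, v)\<close> and \<open>\<lambda>(r, v)\<close> parametrising the solution sheet for
  \<open>\<bar>r\<bar> < \<epsilon>\<close>, \<open>\<bar>sin v\<bar> > \<delta>\<close>.\<close>

definition sheet_functions ::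
  "real \<Rightarrow> real \<Rightarrow> param \<Rightarrow> nat \<Rightarrow> nat \<Rightarrow> (fpair \<times> param \<Rightarrow> fpair) \<Rightarrow> real \<Rightarrow>
     (real \<times> real \<Rightarrow> real) \<Rightarrow> (real \<times> real \<Rightarrow> real) \<Rightarrow> bool" where
  "sheet_functions \<kappa> \<beta> \<Lambda>s n1 n2 \<psi> \<delta> a l \<longleftrightarrow>
     (\<exists>\<epsilon>>0. let A = {(r, v). \<bar>r\<bar> < \<epsilon> \<and> \<bar>sin v\<bar> > \<delta>}
        in smooth_map (UNIV, norm) (UNIV, norm) A a \<and> smooth_map (UNIV, norm) (UNIV, norm) A l \<and>
           (\<forall>v. \<bar>sin v\<bar> > \<delta> \<longrightarrow> a (0, v) = fst (snd \<Lambda>s) \<and> l (0, v) = snd (snd \<Lambda>s)) \<and>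
           (\<forall>(r, v)\<in>A. Psi1 \<kappa> \<beta> \<Lambda>s n1 n2 \<psi> r v (fst \<Lambda>s, a (r, v), l (r, v)) = 0 \<and>
                       Psi2 \<kappa> \<beta> \<Lambda>s n1 n2 \<psi> r v (fst \<Lambda>s, a (r, v), l (r, v)) = 0))"

end

theory Submission
  imports Defs
begin

text \<open>
  Why the result holds. Write \<open>\<phi>\<^sub>n\<close> for the kernel modes and \<open>w\<^sub>n\<close>, \<open>wt\<^sub>n\<close> for the two pairs built from them.
  Since \<open>\<Pi>\<^sub>n\<close> projects onto a line, \<open>\<Phi>\<^sub>n = c\<^sub>n wt\<^sub>n\<close> with a scalar function \<open>c\<^sub>n\<close> (constant \<open>coef\<close> below) of
  \<open>P = (t\<^sub>1, t\<^sub>2, \<Lambda>)\<close>, and \<open>\<Psi>\<^sub>1\<close>, \<open>\<Psi>\<^sub>2\<close> are means of first derivatives of \<open>c\<^sub>1\<close>, \<open>c\<^sub>2\<close> along segments that shrink to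
  \<open>P\<^sub>0 = (0, 0, \<Lambda>\<^sup>*)\<close> as \<open>r\<close> tends to \<open>0\<close>. Their \<open>r\<close>-derivatives at \<open>0\<close> are therefore values of the Hessians of
  \<open>c\<^sub>1\<close>, \<open>c\<^sub>2\<close> at \<open>P\<^sub>0\<close>, with a factor \<open>1/2\<close> for the part of the segment that is averaged (\<open>average_along_segment\<close>).

  The Hessian is explicit. Along any two directions the second derivative of \<open>F\<close> at \<open>P\<^sub>0\<close> consists of \<open>L\<close>
  applied to the unknown second derivative of \<open>\<psi>\<close> and of a quadratic expression in first derivatives.
  Green's identity makes \<open>wt\<^sub>n\<close> orthogonal to the range of \<open>L\<close>, so the unknown term disappears
  (\<open>inner_L_op_wt\<close>); the same orthogonality, applied to first derivatives, shows that \<open>\<psi>\<close> has derivative zero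
  at the base point (\<open>Dstate_kernel_dir\<close>, \<open>Dpsi_parameter\<close>). What remains is quadratic in the kernel modes and bilinear in
  modes and parameters.

  The interior part of the quadratic expression need not be integrated term by term. The vorticity equation is
  the linear equation \<open>\<Delta>\<psi> = \<alpha>\<psi>\<close> pulled back by the flattening map, so the second variation, up to an explicit
  multiple of the mode, is \<open>(\<Delta> - \<alpha>) Z\<close>, where \<open>Z\<close> is minus the second-order displacement term of the pullback
  (\<open>vorticity_identity\<close>). A second use of Green's identity turns it into surface terms (\<open>second_var_green\<close>), and one is
  left with integrals of products of three cosines of frequencies \<open>\<kappa>\<close> and \<open>2\<kappa>\<close>. Only the resonances
  \<open>1 + 1 = 2\<close> and \<open>2 - 1 = 1\<close> survive: \<open>\<Psi>\<^sub>1\<close> sees \<open>t\<^sub>1 t\<^sub>2\<close>, hence \<open>sin v\<close>, and \<open>\<Psi>\<^sub>2\<close> sees \<open>t\<^sub>1\<^sup>2\<close>, hence \<open>(cos v)\<^sup>2\<close>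
  (\<open>coef_hessian\<close>, \<open>Psi_expansion\<close>). The identities \<open>sin \<sigma> = \<sigma> cos \<sigma>\<close> and \<open>\<sigma>\<^sup>2 = 3\<kappa>\<^sup>2\<close> give the constants
  their final form.

  On the sheet, \<open>\<Psi>\<^sub>1 = \<Psi>\<^sub>2 = 0\<close> along \<open>\<alpha> = a(r, v)\<close>, \<open>\<lambda> = l(r, v)\<close>. Differentiating at \<open>r = 0\<close> gives two linear
  equations for the two slopes, the second one divisible by \<open>sin v\<close>; the coefficients do not involve \<open>v\<close> and the
  determinant is \<open>\<kappa>/6\<close>. Each slope times \<open>sin v\<close> is a nonzero quadratic form in \<open>sin v\<close> and \<open>cos v\<close>, and such
  a form has isolated zeros.

  The derivative \<open>D\<^sub>wF(0, \<Lambda>\<^sup>*)\<close> enters through its kernel, so it is computed first: \<open>F\<close> is a rational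
  expression in the derivatives of \<open>w\<close> up to order two, and a calculus of Hoelder bounds shows that \<open>F - L\<close> is
  quadratically small.
\<close>

section \<open>Hoelder bounds\<close>

text \<open>A common bound \<open>B\<close> for the size and the Hoelder quotient replaces their sum. It is equivalent to a
  bound on the norm up to a constant factor, and it is stable under sums, products and reciprocals without any
  discussion of suprema.\<close>

definition hoelder_le :: "'a::metric_space set \<Rightarrow> real \<Rightarrow> real \<Rightarrow> ('a \<Rightarrow> real) \<Rightarrow> bool" where
  "hoelder_le S \<beta> B f \<longleftrightarrow> (\<forall>p\<in>S. \<bar>f p\<bar> \<le> B) \<and> (\<forall>p\<in>S. \<forall>q\<in>S. \<bar>f p - f q\<bar> \<le> B * dist p q powr \<beta>)"

lemma hoelder_le_mono: "hoelder_le S \<beta> A f \<Longrightarrow> A \<le> B \<Longrightarrow> hoelder_le S \<beta> B f"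
  unfolding hoelder_le_def by (meson mult_right_mono order_trans powr_ge_zero)

lemma hoelder_le_cong: "hoelder_le S \<beta> B f \<Longrightarrow> (\<And>p. p \<in> S \<Longrightarrow> f p = g p) \<Longrightarrow> hoelder_le S \<beta> B g"
  unfolding hoelder_le_def by auto

lemma hoelder_le_bound: "hoelder_le S \<beta> B f \<Longrightarrow> p \<in> S \<Longrightarrow> \<bar>f p\<bar> \<le> B"
  unfolding hoelder_le_def by auto

lemma hoelder_le_add: "hoelder_le S \<beta> A f \<Longrightarrow> hoelder_le S \<beta> B g \<Longrightarrow> hoelder_le S \<beta> (A + B) (\<lambda>p. f p + g p)"
  unfolding hoelder_le_def
proof (intro conjI ballI; elim conjE)
  fix p q assume "p \<in> S" "q \<in> S" and
    "\<forall>p\<in>S. \<forall>q\<in>S. \<bar>f p - f q\<bar> \<le> A * dist p q powr \<beta>" "\<forall>p\<in>S. \<forall>q\<in>S. \<bar>g p - g q\<bar> \<le> B * dist p q powr \<beta>"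
  then have "\<bar>f p - f q\<bar> \<le> A * dist p q powr \<beta>" "\<bar>g p - g q\<bar> \<le> B * dist p q powr \<beta>" by auto
  then show "\<bar>f p + g p - (f q + g q)\<bar> \<le> (A + B) * dist p q powr \<beta>"
    unfolding distrib_right by linarith
next
  fix p assume "p \<in> S" "\<forall>p\<in>S. \<bar>f p\<bar> \<le> A" "\<forall>p\<in>S. \<bar>g p\<bar> \<le> B"
  then have "\<bar>f p\<bar> \<le> A" "\<bar>g p\<bar> \<le> B" by auto
  then show "\<bar>f p + g p\<bar> \<le> A + B" by linarith
qed

lemma hoelder_le_scale: assumes "hoelder_le S \<beta> B f" shows "hoelder_le S \<beta> (\<bar>c\<bar> * B) (\<lambda>p. c * f p)"
  using assms unfolding hoelder_le_def
  by (auto simp: abs_mult mult.assoc right_diff_distrib[symmetric] intro!: mult_left_mono)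

lemma hoelder_le_mult:
  assumes f: "hoelder_le S \<beta> A f" and g: "hoelder_le S \<beta> B g" and "0 \<le> A"
  shows "hoelder_le S \<beta> (2 * (A * B)) (\<lambda>p. f p * g p)"
  unfolding hoelder_le_def
proof (intro conjI ballI)
  fix p assume p: "p \<in> S"
  have "\<bar>f p * g p\<bar> \<le> A * B"
    using hoelder_le_bound[OF f p] hoelder_le_bound[OF g p] assms(3) by (simp add: abs_mult mult_mono)
  moreover have "0 \<le> A * B" using hoelder_le_bound[OF g p] assms(3) by simp
  ultimately show "\<bar>f p * g p\<bar> \<le> 2 * (A * B)" by linarith
next
  fix p q assume p: "p \<in> S" and q: "q \<in> S"
  let ?d = "dist p q powr \<beta>"
  have df: "\<bar>f p - f q\<bar> \<le> A * ?d" and dg: "\<bar>g p - g q\<bar> \<le> B * ?d"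
    using f g p q unfolding hoelder_le_def by auto
  have "\<bar>f p * g p - f q * g q\<bar> = \<bar>f p * (g p - g q) + (f p - f q) * g q\<bar>"
    by (simp add: algebra_simps)
  also have "\<dots> \<le> \<bar>f p\<bar> * \<bar>g p - g q\<bar> + \<bar>f p - f q\<bar> * \<bar>g q\<bar>"
    by (metis abs_mult abs_triangle_ineq)
  also have "\<dots> \<le> A * (B * ?d) + (A * ?d) * B"
    using hoelder_le_bound[OF f p] hoelder_le_bound[OF g q] df dg assms(3)
    by (intro add_mono mult_mono) auto
  finally show "\<bar>f p * g p - f q * g q\<bar> \<le> 2 * (A * B) * ?d" by (simp add: algebra_simps)
qed

text \<open>Points at distance at most \<open>1\<close> are handled by the Lipschitz bound, since there \<open>d \<le> d\<^sup>\<beta>\<close>; for distant points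
  the bound on the values suffices.\<close>

lemma hoelder_le_lipschitz:
  assumes "0 < \<beta>" "\<beta> < 1" and B: "\<And>p. p \<in> S \<Longrightarrow> \<bar>f p\<bar> \<le> B" "0 \<le> B" and "0 \<le> L"
    and L: "\<And>p q. p \<in> S \<Longrightarrow> q \<in> S \<Longrightarrow> \<bar>f p - f q\<bar> \<le> L * dist p q"
  shows "hoelder_le S \<beta> (2 * B + L) f"
  unfolding hoelder_le_def
proof (intro conjI ballI)
  fix p assume p: "p \<in> S"
  show "\<bar>f p\<bar> \<le> 2 * B + L" using B(1)[OF p] B(2) assms(5) by linarith
next
  fix p q assume p: "p \<in> S" and q: "q \<in> S"
  show "\<bar>f p - f q\<bar> \<le> (2 * B + L) * dist p q powr \<beta>"
  proof (cases "dist p q \<le> 1")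
    case True
    have "dist p q \<le> dist p q powr \<beta>"
    proof (cases "dist p q = 0")
      case False
      then have "dist p q powr 1 \<le> dist p q powr \<beta>"
        using True assms(2) by (intro powr_mono') auto
      then show ?thesis by simp
    qed auto
    then have "L * dist p q \<le> (2 * B + L) * dist p q powr \<beta>"
      using assms(4,5) by (intro mult_mono) auto
    then show ?thesis using L[OF p q] by linarith
  next
    case False
    then have "1 \<le> dist p q powr \<beta>" using assms(1) by (intro ge_one_powr_ge_zero) auto
    then have "2 * B + L \<le> (2 * B + L) * dist p q powr \<beta>"
      using assms(4,5) mult_left_mono[of 1 "dist p q powr \<beta>" "2*B+L"] by simp
    then show ?thesis using B(1)[OF p] B(1)[OF q] assms(5) by linarith
  qed
qed

lemma hoelder_le_continuous:
  assumes "hoelder_le S \<beta> B f" "0 < \<beta>" shows "continuous_on S f"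
  unfolding continuous_on_def
proof
  fix p assume p: "p \<in> S"
  have "((\<lambda>q. B * dist q p powr \<beta>) \<longlongrightarrow> B * (0::real)) (at p within S)"
    using assms(2) tendsto_dist_iff[of "\<lambda>q. q" p "at p within S"]
    by (intro tendsto_mult tendsto_const tendsto_zero_powrI[where b = \<beta>]) auto
  then have lim: "((\<lambda>q. B * dist q p powr \<beta>) \<longlongrightarrow> 0) (at p within S)" by simp
  have "norm (f q - f p) \<le> B * dist q p powr \<beta>" if "q \<in> S" for q
    using assms(1) p that unfolding hoelder_le_def by auto
  then have "eventually (\<lambda>q. norm (f q - f p) \<le> B * dist q p powr \<beta>) (at p within S)"
    by (simp add: eventually_at_filter)
  then have "((\<lambda>q. f q - f p) \<longlongrightarrow> 0) (at p within S)"
    using lim by (rule Lim_null_comparison)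
  then show "(f \<longlongrightarrow> f p) (at p within S)" by (rule LIM_zero_cancel)
qed

lemma hoelder_norm0_le:
  assumes "hoelder_le S \<beta> B f" and S: "a \<in> S" "b \<in> S" "a \<noteq> b"
  shows "bounded (f ` S)" "bdd_above (hoelder_quotients \<beta> S f)"
    "(SUP p\<in>S. \<bar>f p\<bar>) + Sup (hoelder_quotients \<beta> S f) \<le> 2 * B"
proof -
  have q: "x \<le> B" if "x \<in> hoelder_quotients \<beta> S f" for x
    using that assms(1) unfolding hoelder_quotients_def hoelder_le_def by (auto simp: divide_le_eq)
  show "bounded (f ` S)" using hoelder_le_bound[OF assms(1)] unfolding bounded_iff by auto
  show "bdd_above (hoelder_quotients \<beta> S f)" using q by (auto simp: bdd_above_def)
  have "(SUP p\<in>S. \<bar>f p\<bar>) \<le> B" using S(1) hoelder_le_bound[OF assms(1)] by (intro cSUP_least) auto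
  moreover have "hoelder_quotients \<beta> S f \<noteq> {}" using S unfolding hoelder_quotients_def by auto
  then have "Sup (hoelder_quotients \<beta> S f) \<le> B" using q by (rule cSup_least)
  ultimately show "(SUP p\<in>S. \<bar>f p\<bar>) + Sup (hoelder_quotients \<beta> S f) \<le> 2 * B" by linarith
qed

lemma hoelder_le_norm0:
  assumes "bounded (f ` S)" "bdd_above (hoelder_quotients \<beta> S f)" and S: "a \<in> S" "b \<in> S" "a \<noteq> b"
  shows "hoelder_le S \<beta> ((SUP p\<in>S. \<bar>f p\<bar>) + Sup (hoelder_quotients \<beta> S f)) f"
proof -
  let ?A = "SUP p\<in>S. \<bar>f p\<bar>" and ?B = "Sup (hoelder_quotients \<beta> S f)"
  have "bdd_above ((\<lambda>p. \<bar>f p\<bar>) ` S)"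
    using assms(1) unfolding bounded_iff bdd_above_def by auto
  then have A: "\<bar>f p\<bar> \<le> ?A" if "p \<in> S" for p using that by (intro cSUP_upper) auto
  have B: "\<bar>f p - f q\<bar> / dist p q powr \<beta> \<le> ?B" if "p \<in> S" "q \<in> S" "p \<noteq> q" for p q
    using that assms(2) by (intro cSup_upper) (auto simp: hoelder_quotients_def)
  have "0 \<le> \<bar>f a - f b\<bar> / dist a b powr \<beta>" by simp
  then have B0: "0 \<le> ?B" using B[OF S] by linarith
  have A0: "0 \<le> ?A" using A[OF S(1)] by linarith
  show ?thesis unfolding hoelder_le_def
  proof (intro conjI ballI)
    fix p q assume pq: "p \<in> S" "q \<in> S"
    show "\<bar>f p\<bar> \<le> ?A + ?B" using A[OF pq(1)] B0 by linarith
    show "\<bar>f p - f q\<bar> \<le> (?A + ?B) * dist p q powr \<beta>"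
    proof (cases "p = q")
      case False
      then have "\<bar>f p - f q\<bar> \<le> ?B * dist p q powr \<beta>"
        using B[OF pq] by (simp add: divide_le_eq)
      also have "\<dots> \<le> (?A + ?B) * dist p q powr \<beta>" using A0 by (intro mult_right_mono) auto
      finally show ?thesis .
    qed auto
  qed
qed

primrec hoelder_le_line :: "nat \<Rightarrow> real \<Rightarrow> real \<Rightarrow> (real \<Rightarrow> real) \<Rightarrow> bool" where
  "hoelder_le_line 0 \<beta> B f \<longleftrightarrow> hoelder_le UNIV \<beta> B f"
| "hoelder_le_line (Suc k) \<beta> B f \<longleftrightarrow> (\<forall>x. \<bar>f x\<bar> \<le> B) \<and> (\<forall>x. f differentiable (at x)) \<and> hoelder_le_line k \<beta> B (deriv f)"

lemma hoelder_le_line_bound: "hoelder_le_line k \<beta> B f \<Longrightarrow> \<bar>f x\<bar> \<le> B"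
  by (cases k) (auto intro: hoelder_le_bound)

lemma hoelder_le_line_nonneg: "hoelder_le_line k \<beta> B f \<Longrightarrow> 0 \<le> B"
  using hoelder_le_line_bound[of k \<beta> B f 0] by linarith

lemma hoelder_le_line_mono: "hoelder_le_line k \<beta> A f \<Longrightarrow> A \<le> B \<Longrightarrow> hoelder_le_line k \<beta> B f"
  by (induction k arbitrary: f) (auto intro: hoelder_le_mono, meson order_trans)

lemma hoelder_le_line_norm_le:
  "hoelder_le_line k \<beta> B f \<Longrightarrow> hoelder_line k \<beta> f \<and> hoelder_line_norm k \<beta> f \<le> (real k + 2) * B"
proof (induction k arbitrary: f)
  case 0
  then show ?case using hoelder_norm0_le[of UNIV \<beta> B f 0 1] by simp
next
  case (Suc k)
  have "(SUP x. \<bar>f x\<bar>) \<le> B" using Suc.prems by (intro cSUP_least) auto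
  moreover have "bounded (range f)" using Suc.prems unfolding bounded_iff by auto
  moreover have "hoelder_line k \<beta> (deriv f) \<and> hoelder_line_norm k \<beta> (deriv f) \<le> (real k + 2) * B"
    using Suc by simp
  ultimately show ?case using Suc.prems by (auto simp: algebra_simps)
qed

lemma hoelder_le_line_norm: "hoelder_line k \<beta> f \<Longrightarrow> hoelder_le_line k \<beta> (hoelder_line_norm k \<beta> f) f"
proof (induction k arbitrary: f)
  case 0
  then show ?case using hoelder_le_norm0[of f UNIV \<beta> 0 1] by simp
next
  case (Suc k)
  let ?A = "SUP x. \<bar>f x\<bar>" and ?B = "hoelder_line_norm k \<beta> (deriv f)"
  have h: "hoelder_le_line k \<beta> ?B (deriv f)" using Suc by simp
  have "bdd_above (range (\<lambda>x. \<bar>f x\<bar>))" using Suc.prems unfolding hoelder_line.simps bounded_iff bdd_above_def by auto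
  then have A: "\<bar>f x\<bar> \<le> ?A" for x by (intro cSUP_upper) auto
  have A0: "0 \<le> ?A" using A[of 0] by linarith
  have "hoelder_le_line k \<beta> (?A + ?B) (deriv f)" using A0 by (intro hoelder_le_line_mono[OF h]) simp
  moreover have "\<bar>f x\<bar> \<le> ?A + ?B" for x using A[of x] hoelder_le_line_nonneg[OF h] by linarith
  ultimately show ?case using Suc.prems by simp
qed

lemma deriv_fun_add:
  assumes "\<And>x. f differentiable (at (x::real))" "\<And>x. g differentiable (at x)"
  shows "deriv (\<lambda>x. f x + g x :: real) = (\<lambda>x. deriv f x + deriv g x)"
  using assms by (intro ext DERIV_imp_deriv DERIV_add) (auto simp: DERIV_deriv_iff_real_differentiable)

lemma deriv_fun_scale:
  assumes "\<And>x. f differentiable (at (x::real))"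
  shows "deriv (\<lambda>x. c * f x :: real) = (\<lambda>x. c * deriv f x)"
  using assms by (intro ext DERIV_imp_deriv DERIV_cmult) (auto simp: DERIV_deriv_iff_real_differentiable)

lemma hoelder_le_line_add: "hoelder_le_line k \<beta> A f \<Longrightarrow> hoelder_le_line k \<beta> B g \<Longrightarrow> hoelder_le_line k \<beta> (A + B) (\<lambda>x. f x + g x)"
proof (induction k arbitrary: f g)
  case (Suc k)
  have "\<bar>f x + g x\<bar> \<le> A + B" for x
    using hoelder_le_line_bound[OF Suc.prems(1), of x] hoelder_le_line_bound[OF Suc.prems(2), of x] by linarith
  moreover have "deriv (\<lambda>x. f x + g x) = (\<lambda>x. deriv f x + deriv g x)"
    using Suc.prems by (intro deriv_fun_add) auto
  ultimately show ?case using Suc by (simp add: differentiable_add)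
qed (auto intro: hoelder_le_add)

lemma hoelder_le_line_scale: "hoelder_le_line k \<beta> B f \<Longrightarrow> hoelder_le_line k \<beta> (\<bar>c\<bar> * B) (\<lambda>x. c * f x)"
proof (induction k arbitrary: f)
  case (Suc k)
  moreover have "deriv (\<lambda>x. c * f x) = (\<lambda>x. c * deriv f x)"
    using Suc.prems by (intro deriv_fun_scale) auto
  ultimately show ?case by (simp add: abs_mult mult_left_mono differentiable_mult)
qed (auto intro: hoelder_le_scale)

text \<open>In the recursive definition only the derivative of top order carries a Hoelder estimate; for the lower
  ones it comes from the bound on the next derivative.\<close>

lemma hoelder_le_line_base:
  assumes "0 < \<beta>" "\<beta> < 1" "hoelder_le_line k \<beta> B f"
  shows "hoelder_le UNIV \<beta> (3 * B) f"
proof (cases k)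
  case 0
  have "0 \<le> B" using hoelder_le_line_nonneg[OF assms(3)] .
  then show ?thesis using assms(3) 0 by (auto intro: hoelder_le_mono)
next
  case (Suc m)
  have B0: "0 \<le> B" using hoelder_le_line_nonneg[OF assms(3)] .
  have d: "(f has_real_derivative deriv f x) (at x)" for x
    using assms(3) Suc by (simp add: DERIV_deriv_iff_real_differentiable)
  have "hoelder_le_line m \<beta> B (deriv f)" using assms(3) Suc by simp
  then have b: "\<bar>deriv f x\<bar> \<le> B" for x by (cases m) (auto simp: hoelder_le_def)
  have "norm (f x - f y) \<le> B * norm (x - y)" for x y
    by (rule field_differentiable_bound[of UNIV f "deriv f"]) (use d b in auto)
  then have "hoelder_le UNIV \<beta> (2 * B + B) f"
    using assms(3) Suc B0 by (intro hoelder_le_lipschitz assms) (auto simp: dist_real_def)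
  then show ?thesis by simp
qed

section \<open>Partial derivatives on the strip\<close>

definition pdiff :: "(real \<times> real \<Rightarrow> real) \<Rightarrow> bool" where
  "pdiff u \<longleftrightarrow> (\<forall>x. \<forall>s\<in>{0..1}. (\<lambda>t. u (t, s)) differentiable (at x) \<and>
        (\<lambda>t. u (x, t)) differentiable (at s within {0..1}))"

lemma on_strip_simps [simp]:
  "s \<in> {0..1} \<Longrightarrow> on_strip u (x, s) = u (x, s)" "p \<notin> strip \<Longrightarrow> on_strip u p = 0"
  "p \<in> strip \<Longrightarrow> on_strip u p = u p"
  by (auto simp: on_strip_def strip_def)

lemma strip_iff [simp]: "(x, s) \<in> strip \<longleftrightarrow> 0 \<le> s \<and> s \<le> 1"
  by (auto simp: strip_def)

lemma dx_deriv:
  assumes "pdiff u" "s \<in> {0..1}"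
  shows "((\<lambda>t. u (t, s)) has_real_derivative dx u (x, s)) (at x)"
  using assms by (auto simp: dx_def pdiff_def DERIV_deriv_iff_real_differentiable)

lemma ds_deriv:
  assumes "pdiff u" "s \<in> {0..1}"
  shows "((\<lambda>t. u (x, t)) has_real_derivative ds u (x, s)) (at s within {0..1})"
proof -
  have "(\<lambda>t. u (x, t)) differentiable (at s within {0..1})" using assms by (auto simp: pdiff_def)
  then show ?thesis using assms
    by (simp add: vector_derivative_works has_real_derivative_iff_has_vector_derivative ds_def)
qed

lemma dx_eqI:
  assumes "\<And>x s. s \<in> {0..1} \<Longrightarrow> ((\<lambda>t. u (t, s)) has_real_derivative v (x, s)) (at x)"
  shows "dx u = on_strip v"
proof
  fix p :: "real \<times> real"
  obtain x s where p: "p = (x, s)" by (cases p)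
  show "dx u p = on_strip v p"
    using assms[of s x] by (cases "p \<in> strip") (auto simp: dx_def p intro!: DERIV_imp_deriv)
qed

lemma ds_eqI:
  assumes "\<And>x s. s \<in> {0..1} \<Longrightarrow> ((\<lambda>t. u (x, t)) has_real_derivative v (x, s)) (at s within {0..1})"
  shows "ds u = on_strip v"
proof
  fix p :: "real \<times> real"
  obtain x s where p: "p = (x, s)" by (cases p)
  show "ds u p = on_strip v p"
  proof (cases "p \<in> strip")
    case True
    then have "vector_derivative (\<lambda>t. u (x, t)) (at s within {0..1}) = v (x, s)"
      using assms[of s x] p
      by (intro vector_derivative_within_closed_interval) (auto simp: has_real_derivative_iff_has_vector_derivative)
    then show ?thesis using True by (simp add: ds_def p)
  qed (auto simp: ds_def)
qed

lemma pdiffI: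
  assumes "\<And>x s. s \<in> {0..1} \<Longrightarrow> ((\<lambda>t. u (t, s)) has_real_derivative v (x, s)) (at x)"
    "\<And>x s. s \<in> {0..1} \<Longrightarrow> ((\<lambda>t. u (x, t)) has_real_derivative w (x, s)) (at s within {0..1})"
  shows "pdiff u"
  unfolding pdiff_def using assms by (meson real_differentiable_def)

lemma on_strip_off: "p \<notin> strip \<Longrightarrow> dx u p = 0" "p \<notin> strip \<Longrightarrow> ds u p = 0"
  by (auto simp: dx_def ds_def)

lemma dx_ds_add:
  assumes "pdiff u" "pdiff v"
  shows "dx (\<lambda>p. u p + v p) = (\<lambda>p. dx u p + dx v p)" "ds (\<lambda>p. u p + v p) = (\<lambda>p. ds u p + ds v p)"
    "pdiff (\<lambda>p. u p + v p)"
proof -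
  have 1: "((\<lambda>t. u (t, s) + v (t, s)) has_real_derivative dx u (x, s) + dx v (x, s)) (at x)"
    if "s \<in> {0..1}" for x s using that assms by (intro DERIV_add dx_deriv)
  have 2: "((\<lambda>t. u (x, t) + v (x, t)) has_real_derivative ds u (x, s) + ds v (x, s)) (at s within {0..1})"
    if "s \<in> {0..1}" for x s using that assms by (intro DERIV_add ds_deriv)
  have "dx (\<lambda>p. u p + v p) = on_strip (\<lambda>p. dx u p + dx v p)" using 1 by (intro dx_eqI)
  then show "dx (\<lambda>p. u p + v p) = (\<lambda>p. dx u p + dx v p)"
    by (auto simp: fun_eq_iff on_strip_def on_strip_off)
  have "ds (\<lambda>p. u p + v p) = on_strip (\<lambda>p. ds u p + ds v p)" using 2 by (intro ds_eqI)
  then show "ds (\<lambda>p. u p + v p) = (\<lambda>p. ds u p + ds v p)"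
    by (auto simp: fun_eq_iff on_strip_def on_strip_off)
  show "pdiff (\<lambda>p. u p + v p)"
    using 1 2 by (intro pdiffI[where v = "\<lambda>p. dx u p + dx v p" and w = "\<lambda>p. ds u p + ds v p"])
qed

lemma dx_ds_scale:
  assumes "pdiff u"
  shows "dx (\<lambda>p. c * u p) = (\<lambda>p. c * dx u p)" "ds (\<lambda>p. c * u p) = (\<lambda>p. c * ds u p)"
    "pdiff (\<lambda>p. c * u p)"
proof -
  have 1: "((\<lambda>t. c * u (t, s)) has_real_derivative c * dx u (x, s)) (at x)"
    if "s \<in> {0..1}" for x s using that assms by (intro DERIV_cmult dx_deriv)
  have 2: "((\<lambda>t. c * u (x, t)) has_real_derivative c * ds u (x, s)) (at s within {0..1})"
    if "s \<in> {0..1}" for x s using that assms by (intro DERIV_cmult ds_deriv)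
  have "dx (\<lambda>p. c * u p) = on_strip (\<lambda>p. c * dx u p)" using 1 by (intro dx_eqI)
  then show "dx (\<lambda>p. c * u p) = (\<lambda>p. c * dx u p)"
    by (auto simp: fun_eq_iff on_strip_def on_strip_off)
  have "ds (\<lambda>p. c * u p) = on_strip (\<lambda>p. c * ds u p)" using 2 by (intro ds_eqI)
  then show "ds (\<lambda>p. c * u p) = (\<lambda>p. c * ds u p)"
    by (auto simp: fun_eq_iff on_strip_def on_strip_off)
  show "pdiff (\<lambda>p. c * u p)"
    using 1 2 by (intro pdiffI[where v = "\<lambda>p. c * dx u p" and w = "\<lambda>p. c * ds u p"])
qed

primrec hoelder_le_strip :: "nat \<Rightarrow> real \<Rightarrow> real \<Rightarrow> (real \<times> real \<Rightarrow> real) \<Rightarrow> bool" where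
  "hoelder_le_strip 0 \<beta> B u \<longleftrightarrow> (\<forall>p. p \<notin> strip \<longrightarrow> u p = 0) \<and> hoelder_le strip \<beta> B u"
| "hoelder_le_strip (Suc k) \<beta> B u \<longleftrightarrow> (\<forall>p. p \<notin> strip \<longrightarrow> u p = 0) \<and> (\<forall>p\<in>strip. \<bar>u p\<bar> \<le> B) \<and> pdiff u \<and>
     hoelder_le_strip k \<beta> B (dx u) \<and> hoelder_le_strip k \<beta> B (ds u)"

lemma hoelder_le_strip_bound: "hoelder_le_strip k \<beta> B u \<Longrightarrow> p \<in> strip \<Longrightarrow> \<bar>u p\<bar> \<le> B"
  by (cases k) (auto intro: hoelder_le_bound)

lemma hoelder_le_strip_nonneg: "hoelder_le_strip k \<beta> B u \<Longrightarrow> 0 \<le> B"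
  using hoelder_le_strip_bound[of k \<beta> B u "(0,0)"] by auto

lemma hoelder_le_strip_mono: "hoelder_le_strip k \<beta> A u \<Longrightarrow> A \<le> B \<Longrightarrow> hoelder_le_strip k \<beta> B u"
proof (induction k arbitrary: u)
  case (Suc k)
  then have "\<bar>u p\<bar> \<le> B" if "p \<in> strip" for p using that by (simp) (meson order_trans)
  then show ?case using Suc by simp
qed (auto intro: hoelder_le_mono)

lemma pdiff_alt: "pdiff u \<longleftrightarrow> (\<forall>(x, s)\<in>strip. (\<lambda>t. u (t, s)) differentiable (at x) \<and>
        (\<lambda>t. u (x, t)) differentiable (at s within {0..1}))"
  by (auto simp: pdiff_def)

lemma hoelder_le_strip_norm_le:
  "hoelder_le_strip k \<beta> B u \<Longrightarrow> hoelder_strip k \<beta> u \<and> hoelder_strip_norm k \<beta> u \<le> 2 * 3 ^ k * B"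
proof (induction k arbitrary: u)
  case 0
  then show ?case using hoelder_norm0_le[of strip \<beta> B u "(0,0)" "(1,0)"] by simp
next
  case (Suc k)
  have B0: "0 \<le> B" using hoelder_le_strip_nonneg[OF Suc.prems] .
  have "(SUP p\<in>strip. \<bar>u p\<bar>) \<le> B" using Suc.prems by (intro cSUP_least) (auto intro: exI[of _ "(0,0)"] simp: strip_def)
  moreover have "bounded (u ` strip)" using Suc.prems unfolding bounded_iff by auto
  moreover have "hoelder_strip k \<beta> (dx u) \<and> hoelder_strip_norm k \<beta> (dx u) \<le> 2 * 3 ^ k * B"
    "hoelder_strip k \<beta> (ds u) \<and> hoelder_strip_norm k \<beta> (ds u) \<le> 2 * 3 ^ k * B"
    using Suc by simp_all
  moreover have "B \<le> 2 * 3 ^ k * B" 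
    using mult_right_mono[of 1 "2 * 3 ^ k" B] one_le_power[of "3::real" k] B0 by linarith
  moreover have "2 * 3 ^ Suc k * B = 3 * (2 * 3 ^ k * B)" by simp
  ultimately have "hoelder_strip_norm (Suc k) \<beta> u \<le> 2 * 3 ^ Suc k * B"
    unfolding hoelder_strip_norm.simps by linarith
  moreover have "hoelder_strip (Suc k) \<beta> u"
    using Suc.prems pdiff_alt[of u] \<open>bounded (u ` strip)\<close> Suc.IH by simp
  ultimately show ?case by blast
qed

lemma hoelder_le_strip_norm: "hoelder_strip k \<beta> u \<Longrightarrow> hoelder_le_strip k \<beta> (hoelder_strip_norm k \<beta> u) u"
proof (induction k arbitrary: u)
  case 0
  then show ?case using hoelder_le_norm0[of u strip \<beta> "(0,0)" "(1,0)"] by simp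
next
  case (Suc k)
  let ?A = "SUP p\<in>strip. \<bar>u p\<bar>" and ?B = "hoelder_strip_norm k \<beta> (dx u)" and ?C = "hoelder_strip_norm k \<beta> (ds u)"
  have h: "hoelder_le_strip k \<beta> ?B (dx u)" "hoelder_le_strip k \<beta> ?C (ds u)" using Suc by simp_all
  have "bdd_above ((\<lambda>x. \<bar>u x\<bar>) ` strip)" using Suc.prems unfolding hoelder_strip.simps bounded_iff bdd_above_def by auto
  then have A: "\<bar>u x\<bar> \<le> ?A" if "x \<in> strip" for x using that by (intro cSUP_upper) auto
  have A0: "0 \<le> ?A" using A[of "(0,0)"] by auto
  note B0 = hoelder_le_strip_nonneg[OF h(1)] and C0 = hoelder_le_strip_nonneg[OF h(2)]
  have "hoelder_le_strip k \<beta> (?A + ?B + ?C) (dx u)" "hoelder_le_strip k \<beta> (?A + ?B + ?C) (ds u)"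
    using h A0 B0 C0 by (auto intro: hoelder_le_strip_mono)
  moreover have "\<bar>u x\<bar> \<le> ?A + ?B + ?C" if "x \<in> strip" for x using A[OF that] B0 C0 by linarith
  ultimately show ?case using Suc.prems pdiff_alt[of u] by simp
qed

lemma hoelder_le_strip_add: "hoelder_le_strip k \<beta> A u \<Longrightarrow> hoelder_le_strip k \<beta> B v \<Longrightarrow> hoelder_le_strip k \<beta> (A + B) (\<lambda>x. u x + v x)"
proof (induction k arbitrary: u v)
  case (Suc k)
  have "\<bar>u x + v x\<bar> \<le> A + B" if "x \<in> strip" for x
    using hoelder_le_strip_bound[OF Suc.prems(1) that] hoelder_le_strip_bound[OF Suc.prems(2) that] by linarith
  then show ?case using Suc by (simp add: dx_ds_add)
qed (auto intro: hoelder_le_add)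

lemma hoelder_le_strip_scale: "hoelder_le_strip k \<beta> B u \<Longrightarrow> hoelder_le_strip k \<beta> (\<bar>c\<bar> * B) (\<lambda>x. c * u x)"
proof (induction k arbitrary: u)
  case (Suc k)
  then show ?case by (simp add: dx_ds_scale abs_mult mult_left_mono)
qed (auto intro: hoelder_le_scale)

lemma strip_lipschitz:
  assumes "pdiff u" and "\<And>p. p \<in> strip \<Longrightarrow> \<bar>dx u p\<bar> \<le> B" "\<And>p. p \<in> strip \<Longrightarrow> \<bar>ds u p\<bar> \<le> B"
    and "p \<in> strip" "q \<in> strip"
  shows "\<bar>u p - u q\<bar> \<le> 2 * B * dist p q"
proof -
  obtain x s y t where pq: "p = (x, s)" "q = (y, t)" by (cases p, cases q)
  have st: "s \<in> {0..1}" "t \<in> {0..1}" using assms(4,5) pq by auto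
  have B0: "0 \<le> B" using assms(2)[OF assms(4)] by linarith
  have 1: "norm (u (x, s) - u (y, s)) \<le> B * norm (x - y)"
    by (rule field_differentiable_bound[of UNIV "\<lambda>t. u (t, s)" "\<lambda>z. dx u (z, s)"])
      (use dx_deriv[OF assms(1)] st assms(2) in auto)
  have 2: "norm (u (y, s) - u (y, t)) \<le> B * norm (s - t)"
    by (rule field_differentiable_bound[of "{0..1}" "\<lambda>t. u (y, t)" "\<lambda>z. ds u (y, z)"])
      (use ds_deriv[OF assms(1)] st assms(3) in auto)
  have "\<bar>u p - u q\<bar> \<le> B * dist x y + B * dist s t"
    using 1 2 unfolding pq by (simp add: dist_real_def)
  also have "\<dots> \<le> B * dist p q + B * dist p q"
    using B0 dist_fst_le[of p q] dist_snd_le[of p q] unfolding pq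
    by (intro add_mono mult_left_mono) auto
  finally show ?thesis by simp
qed

lemma hoelder_le_strip_base:
  assumes "0 < \<beta>" "\<beta> < 1" "hoelder_le_strip k \<beta> B u"
  shows "hoelder_le strip \<beta> (4 * B) u"
proof (cases k)
  case 0
  then show ?thesis using assms(3) hoelder_le_strip_nonneg[OF assms(3)] by (auto intro: hoelder_le_mono)
next
  case (Suc m)
  have B0: "0 \<le> B" using hoelder_le_strip_nonneg[OF assms(3)] .
  have "hoelder_le strip \<beta> (2 * B + 2 * B) u"
    using assms Suc B0 by (intro hoelder_le_lipschitz strip_lipschitz) (auto intro: hoelder_le_strip_bound)
  then show ?thesis by simp
qed

section \<open>The spaces X and Y\<close>

lemma hoelder_le_strip_off: "hoelder_le_strip k \<beta> B u \<Longrightarrow> p \<notin> strip \<Longrightarrow> u p = 0"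
  by (cases k) (auto simp del: split_paired_All)

lemma X_carrier: "w \<in> fst (X_space \<kappa> \<beta>) \<longleftrightarrow>
    fst w \<in> C_line 2 \<kappa> \<beta> \<and> snd w \<in> C_strip 2 \<kappa> \<beta> \<and> (\<forall>x. snd w (x, 0) = 0 \<and> snd w (x, 1) = 0)"
  by (cases w) (auto simp: X_space_def)

lemma X_norm: "snd (X_space \<kappa> \<beta>) w = hoelder_line_norm 2 \<beta> (fst w) + hoelder_strip_norm 2 \<beta> (snd w)"
  by (cases w) (auto simp: X_space_def)

lemma Y_carrier: "w \<in> fst (Y_space \<kappa> \<beta>) \<longleftrightarrow> fst w \<in> C_line 1 \<kappa> \<beta> \<and> snd w \<in> C_strip 0 \<kappa> \<beta>"
  by (cases w) (auto simp: Y_space_def)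

lemma Y_norm: "snd (Y_space \<kappa> \<beta>) w = hoelder_line_norm 1 \<beta> (fst w) + hoelder_strip_norm 0 \<beta> (snd w)"
  by (cases w) (auto simp: Y_space_def)

lemma X_hoelder_le:
  assumes "w \<in> fst (X_space \<kappa> \<beta>)"
  shows "hoelder_le_line 2 \<beta> (snd (X_space \<kappa> \<beta>) w) (fst w)" "hoelder_le_strip 2 \<beta> (snd (X_space \<kappa> \<beta>) w) (snd w)"
proof -
  have 1: "hoelder_le_line 2 \<beta> (hoelder_line_norm 2 \<beta> (fst w)) (fst w)"
    using assms by (intro hoelder_le_line_norm) (auto simp: X_carrier C_line_def)
  have 2: "hoelder_le_strip 2 \<beta> (hoelder_strip_norm 2 \<beta> (snd w)) (snd w)"
    using assms by (intro hoelder_le_strip_norm) (auto simp: X_carrier C_strip_def)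
  show "hoelder_le_line 2 \<beta> (snd (X_space \<kappa> \<beta>) w) (fst w)" "hoelder_le_strip 2 \<beta> (snd (X_space \<kappa> \<beta>) w) (snd w)"
    using hoelder_le_line_mono[OF 1] hoelder_le_strip_mono[OF 2] hoelder_le_line_nonneg[OF 1] hoelder_le_strip_nonneg[OF 2]
    by (auto simp: X_norm)
qed

lemma X_norm_nonneg: "w \<in> fst (X_space \<kappa> \<beta>) \<Longrightarrow> 0 \<le> snd (X_space \<kappa> \<beta>) w"
  using X_hoelder_le(1) hoelder_le_line_nonneg by blast

text \<open>The constant is \<open>4 + 18\<close>: the norm of order two on the line sums four quantities, each at most \<open>B\<close>,
  and that on the strip is at most \<open>2 \<cdot> 3\<^sup>2\<close> times \<open>B\<close>. The lemma replaces the triangle inequality and homogeneity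
  of the norm, at the price of a constant factor.\<close>

lemma X_norm_le:
  assumes "hoelder_le_line 2 \<beta> B (fst w)" "hoelder_le_strip 2 \<beta> B (snd w)"
  shows "snd (X_space \<kappa> \<beta>) w \<le> 22 * B"
  using hoelder_le_line_norm_le[OF assms(1)] hoelder_le_strip_norm_le[OF assms(2)] by (simp add: X_norm power2_eq_square)

lemma Y_norm_le:
  assumes "hoelder_le_line 1 \<beta> B (fst w)" "hoelder_le_strip 0 \<beta> B (snd w)"
  shows "snd (Y_space \<kappa> \<beta>) w \<le> 5 * B"
  using hoelder_le_line_norm_le[OF assms(1)] hoelder_le_strip_norm_le[OF assms(2)] by (simp add: Y_norm)

lemma Y_hoelder_le:
  assumes "w \<in> fst (Y_space \<kappa> \<beta>)"
  shows "hoelder_le_line 1 \<beta> (snd (Y_space \<kappa> \<beta>) w) (fst w)" "hoelder_le_strip 0 \<beta> (snd (Y_space \<kappa> \<beta>) w) (snd w)"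
proof -
  have 1: "hoelder_le_line 1 \<beta> (hoelder_line_norm 1 \<beta> (fst w)) (fst w)"
    using assms by (intro hoelder_le_line_norm) (auto simp: Y_carrier C_line_def)
  have 2: "hoelder_le_strip 0 \<beta> (hoelder_strip_norm 0 \<beta> (snd w)) (snd w)"
    using assms by (intro hoelder_le_strip_norm) (auto simp: Y_carrier C_strip_def)
  show "hoelder_le_line 1 \<beta> (snd (Y_space \<kappa> \<beta>) w) (fst w)" "hoelder_le_strip 0 \<beta> (snd (Y_space \<kappa> \<beta>) w) (snd w)"
    using hoelder_le_line_mono[OF 1] hoelder_le_strip_mono[OF 2] hoelder_le_line_nonneg[OF 1] hoelder_le_strip_nonneg[OF 2]
    by (simp_all only: Y_norm)
qed

lemma fun_plus_eta: "f + g = (\<lambda>x. f x + g x)" "c *\<^sub>R (h :: _ \<Rightarrow> real) = (\<lambda>x. c * h x)"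
  by (auto simp: plus_fun_def scaleR_fun_def)

lemma C_line_add: "f \<in> C_line k \<kappa> \<beta> \<Longrightarrow> g \<in> C_line k \<kappa> \<beta> \<Longrightarrow> f + g \<in> C_line k \<kappa> \<beta>"
  unfolding fun_plus_eta using hoelder_le_line_norm_le[OF hoelder_le_line_add[OF hoelder_le_line_norm hoelder_le_line_norm, of k \<beta> f g]]
  by (auto simp: C_line_def)

lemma C_line_scale: "f \<in> C_line k \<kappa> \<beta> \<Longrightarrow> c *\<^sub>R f \<in> C_line k \<kappa> \<beta>"
  unfolding fun_plus_eta using hoelder_le_line_norm_le[OF hoelder_le_line_scale[OF hoelder_le_line_norm, of k \<beta> f c]]
  by (auto simp: C_line_def)

lemma C_strip_add: "f \<in> C_strip k \<kappa> \<beta> \<Longrightarrow> g \<in> C_strip k \<kappa> \<beta> \<Longrightarrow> f + g \<in> C_strip k \<kappa> \<beta>"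
  unfolding fun_plus_eta using hoelder_le_strip_norm_le[OF hoelder_le_strip_add[OF hoelder_le_strip_norm hoelder_le_strip_norm, of k \<beta> f g]]
  by (auto simp: C_strip_def)

lemma C_strip_scale: "f \<in> C_strip k \<kappa> \<beta> \<Longrightarrow> c *\<^sub>R f \<in> C_strip k \<kappa> \<beta>"
  unfolding fun_plus_eta using hoelder_le_strip_norm_le[OF hoelder_le_strip_scale[OF hoelder_le_strip_norm, of k \<beta> f c]]
  by (auto simp: C_strip_def)

lemma hoelder_le_line_zero: "hoelder_le_line k \<beta> 0 (\<lambda>x. 0)"
  by (induction k) (auto simp: hoelder_le_def)

lemma hoelder_le_strip_zero: "hoelder_le_strip k \<beta> 0 (\<lambda>x. 0)"
proof (induction k)
  case (Suc k)
  have "dx (\<lambda>x. 0) = (\<lambda>x. 0)" "ds (\<lambda>x. 0) = (\<lambda>x. 0)"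
    using dx_eqI[of "\<lambda>x. 0" "\<lambda>x. 0"] ds_eqI[of "\<lambda>x. 0" "\<lambda>x. 0"] by (auto simp: on_strip_def)
  then show ?case using Suc by (simp add: pdiff_def)
qed (auto simp: hoelder_le_def)

lemma C_zero: "(\<lambda>x. 0) \<in> C_line k \<kappa> \<beta>" "(\<lambda>x. 0) \<in> C_strip k \<kappa> \<beta>"
  using hoelder_le_line_norm_le[OF hoelder_le_line_zero] hoelder_le_strip_norm_le[OF hoelder_le_strip_zero]
  by (auto simp: C_line_def C_strip_def)

lemma subspace_X: "subspace (fst (X_space \<kappa> \<beta>))"
  unfolding subspace_def
  by (auto simp: X_carrier C_line_add C_strip_add C_line_scale C_strip_scale C_zero zero_fun_def)
    (simp_all add: fun_plus_eta)

lemma subspace_Y: "subspace (fst (Y_space \<kappa> \<beta>))"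
  unfolding subspace_def
  by (auto simp: Y_carrier C_line_add C_strip_add C_line_scale C_strip_scale C_zero zero_fun_def)

lemma X_norm_add:
  assumes "u \<in> fst (X_space \<kappa> \<beta>)" "v \<in> fst (X_space \<kappa> \<beta>)"
  shows "snd (X_space \<kappa> \<beta>) (u + v) \<le> 22 * (snd (X_space \<kappa> \<beta>) u + snd (X_space \<kappa> \<beta>) v)"
  by (rule X_norm_le) (use X_hoelder_le[OF assms(1)] X_hoelder_le[OF assms(2)] in \<open>simp_all add: fun_plus_eta hoelder_le_line_add hoelder_le_strip_add\<close>)

lemma X_norm_scale:
  assumes "u \<in> fst (X_space \<kappa> \<beta>)"
  shows "snd (X_space \<kappa> \<beta>) (c *\<^sub>R u) \<le> 22 * (\<bar>c\<bar> * snd (X_space \<kappa> \<beta>) u)"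
  by (rule X_norm_le) (use X_hoelder_le[OF assms(1)] in \<open>simp_all add: fun_plus_eta hoelder_le_line_scale hoelder_le_strip_scale\<close>)

lemma Y_norm_add:
  assumes "u \<in> fst (Y_space \<kappa> \<beta>)" "v \<in> fst (Y_space \<kappa> \<beta>)"
  shows "snd (Y_space \<kappa> \<beta>) (u + v) \<le> 5 * (snd (Y_space \<kappa> \<beta>) u + snd (Y_space \<kappa> \<beta>) v)"
  by (rule Y_norm_le; unfold fst_add snd_add fun_plus_eta; intro hoelder_le_line_add hoelder_le_strip_add Y_hoelder_le assms)

lemma Y_norm_scale:
  assumes "u \<in> fst (Y_space \<kappa> \<beta>)"
  shows "snd (Y_space \<kappa> \<beta>) (c *\<^sub>R u) \<le> 5 * (\<bar>c\<bar> * snd (Y_space \<kappa> \<beta>) u)"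
proof (rule Y_norm_le)
  show "hoelder_le_line 1 \<beta> (\<bar>c\<bar> * snd (Y_space \<kappa> \<beta>) u) (fst (c *\<^sub>R u))"
    using hoelder_le_line_scale[OF Y_hoelder_le(1)[OF assms], of c] by (simp add: fun_plus_eta)
  show "hoelder_le_strip 0 \<beta> (\<bar>c\<bar> * snd (Y_space \<kappa> \<beta>) u) (snd (c *\<^sub>R u))"
    using hoelder_le_strip_scale[OF Y_hoelder_le(2)[OF assms], of c] by (simp add: fun_plus_eta)
qed

lemma Y_norm_zero_imp: 
  assumes "w \<in> fst (Y_space \<kappa> \<beta>)" "snd (Y_space \<kappa> \<beta>) w \<le> 0" shows "w = 0"
proof -
  have "fst w x = 0" for x
    using hoelder_le_line_bound[OF Y_hoelder_le(1)[OF assms(1)], of x] assms(2) by linarith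
  moreover have "snd w p = 0" for p
    using hoelder_le_strip_off[OF Y_hoelder_le(2)[OF assms(1)], of p] hoelder_le_strip_bound[OF Y_hoelder_le(2)[OF assms(1)], of p] assms(2)
    by (cases "p \<in> strip") auto
  ultimately show ?thesis by (auto simp: prod_eq_iff fun_eq_iff)
qed

section \<open>Derivatives of elements of X as bounded functionals\<close>

text \<open>A jet is a linear map from \<open>X\<close> to functions that is bounded in the Hoelder sense: typically, a partial
  derivative of order at most two of one of the two components, or its restriction to the surface. All
  terms of \<open>F\<close> are built from jets. The constant \<open>4\<close> absorbs the factors of \<open>hoelder_le_line_base\<close> and its
  analogue on the strip.\<close>

definition jet :: "real \<Rightarrow> real \<Rightarrow> 'q::metric_space set \<Rightarrow> (fpair \<Rightarrow> 'q \<Rightarrow> real) \<Rightarrow> bool" where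
  "jet \<kappa> \<beta> S j \<longleftrightarrow>
     (\<forall>u\<in>fst (X_space \<kappa> \<beta>). \<forall>v\<in>fst (X_space \<kappa> \<beta>). \<forall>p. j (u + v) p = j u p + j v p) \<and>
     (\<forall>c. \<forall>u\<in>fst (X_space \<kappa> \<beta>). \<forall>p. j (c *\<^sub>R u) p = c * j u p) \<and>
     (\<forall>u\<in>fst (X_space \<kappa> \<beta>). hoelder_le S \<beta> (4 * snd (X_space \<kappa> \<beta>) u) (j u))"

lemma jetI:
  assumes "\<And>u v p. u \<in> fst (X_space \<kappa> \<beta>) \<Longrightarrow> v \<in> fst (X_space \<kappa> \<beta>) \<Longrightarrow> j (u + v) p = j u p + j v p"
    "\<And>c u p. u \<in> fst (X_space \<kappa> \<beta>) \<Longrightarrow> j (c *\<^sub>R u) p = c * j u p"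
    "\<And>u. u \<in> fst (X_space \<kappa> \<beta>) \<Longrightarrow> hoelder_le S \<beta> (4 * snd (X_space \<kappa> \<beta>) u) (j u)"
  shows "jet \<kappa> \<beta> S j"
  using assms by (auto simp: jet_def)

lemma X_diff:
  assumes "w \<in> fst (X_space \<kappa> \<beta>)"
  shows "fst w differentiable (at x)" "deriv (fst w) differentiable (at x)"
    "pdiff (snd w)" "pdiff (dx (snd w))" "pdiff (ds (snd w))"
  using X_hoelder_le[OF assms] by (simp_all add: numeral_2_eq_2)

lemma jet_strip:
  assumes "0 < \<beta>" "\<beta> < 1"
  shows "jet \<kappa> \<beta> strip (\<lambda>w. snd w)"
    "jet \<kappa> \<beta> strip (\<lambda>w. dx (snd w))" "jet \<kappa> \<beta> strip (\<lambda>w. ds (snd w))"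
    "jet \<kappa> \<beta> strip (\<lambda>w. dx (dx (snd w)))" "jet \<kappa> \<beta> strip (\<lambda>w. dx (ds (snd w)))"
    "jet \<kappa> \<beta> strip (\<lambda>w. ds (dx (snd w)))" "jet \<kappa> \<beta> strip (\<lambda>w. ds (ds (snd w)))"
proof -
  have b: "hoelder_le_strip 2 \<beta> (snd (X_space \<kappa> \<beta>) w) (snd w)"
     "hoelder_le_strip 1 \<beta> (snd (X_space \<kappa> \<beta>) w) (dx (snd w))" "hoelder_le_strip 1 \<beta> (snd (X_space \<kappa> \<beta>) w) (ds (snd w))"
     "hoelder_le_strip 0 \<beta> (snd (X_space \<kappa> \<beta>) w) (dx (dx (snd w)))" "hoelder_le_strip 0 \<beta> (snd (X_space \<kappa> \<beta>) w) (dx (ds (snd w)))"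
     "hoelder_le_strip 0 \<beta> (snd (X_space \<kappa> \<beta>) w) (ds (dx (snd w)))" "hoelder_le_strip 0 \<beta> (snd (X_space \<kappa> \<beta>) w) (ds (ds (snd w)))"
    if w: "w \<in> fst (X_space \<kappa> \<beta>)" for w
    using X_hoelder_le(2)[OF w] by (simp_all add: numeral_2_eq_2)
  note d = X_diff(3-5) dx_ds_add dx_ds_scale
  show "jet \<kappa> \<beta> strip (\<lambda>w. snd w)"
    using hoelder_le_strip_base[OF assms b(1)] by (intro jetI) (simp_all add: fun_plus_eta d)
  show "jet \<kappa> \<beta> strip (\<lambda>w. dx (snd w))"
    using hoelder_le_strip_base[OF assms b(2)] by (intro jetI) (simp_all add: fun_plus_eta d)
  show "jet \<kappa> \<beta> strip (\<lambda>w. ds (snd w))"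
    using hoelder_le_strip_base[OF assms b(3)] by (intro jetI) (simp_all add: fun_plus_eta d)
  show "jet \<kappa> \<beta> strip (\<lambda>w. dx (dx (snd w)))"
    using hoelder_le_strip_base[OF assms b(4)] by (intro jetI) (simp_all add: fun_plus_eta d)
  show "jet \<kappa> \<beta> strip (\<lambda>w. dx (ds (snd w)))"
    using hoelder_le_strip_base[OF assms b(5)] by (intro jetI) (simp_all add: fun_plus_eta d)
  show "jet \<kappa> \<beta> strip (\<lambda>w. ds (dx (snd w)))"
    using hoelder_le_strip_base[OF assms b(6)] by (intro jetI) (simp_all add: fun_plus_eta d)
  show "jet \<kappa> \<beta> strip (\<lambda>w. ds (ds (snd w)))"
    using hoelder_le_strip_base[OF assms b(7)] by (intro jetI) (simp_all add: fun_plus_eta d)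
qed

lemma jet_line:
  assumes "0 < \<beta>" "\<beta> < 1"
  shows "jet \<kappa> \<beta> UNIV (\<lambda>w. fst w)" "jet \<kappa> \<beta> UNIV (\<lambda>w. deriv (fst w))"
    "jet \<kappa> \<beta> UNIV (\<lambda>w. deriv (deriv (fst w)))"
proof -
  have b: "hoelder_le UNIV \<beta> (4 * snd (X_space \<kappa> \<beta>) w) (fst w)" "hoelder_le UNIV \<beta> (4 * snd (X_space \<kappa> \<beta>) w) (deriv (fst w))"
    "hoelder_le UNIV \<beta> (4 * snd (X_space \<kappa> \<beta>) w) (deriv (deriv (fst w)))" if w: "w \<in> fst (X_space \<kappa> \<beta>)" for w
  proof -
    have h: "hoelder_le_line 2 \<beta> (snd (X_space \<kappa> \<beta>) w) (fst w)" by (rule X_hoelder_le(1)[OF w])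
    have "hoelder_le_line 1 \<beta> (snd (X_space \<kappa> \<beta>) w) (deriv (fst w))" "hoelder_le_line 0 \<beta> (snd (X_space \<kappa> \<beta>) w) (deriv (deriv (fst w)))"
      using h by (simp_all add: numeral_2_eq_2)
    then show "hoelder_le UNIV \<beta> (4 * snd (X_space \<kappa> \<beta>) w) (fst w)" "hoelder_le UNIV \<beta> (4 * snd (X_space \<kappa> \<beta>) w) (deriv (fst w))"
      "hoelder_le UNIV \<beta> (4 * snd (X_space \<kappa> \<beta>) w) (deriv (deriv (fst w)))"
      using hoelder_le_mono[OF hoelder_le_line_base[OF assms]] h X_norm_nonneg[OF w] by (simp_all del: hoelder_le_line.simps)
  qed
  show "jet \<kappa> \<beta> UNIV (\<lambda>w. fst w)" using b by (auto simp: jet_def fun_plus_eta)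
  show "jet \<kappa> \<beta> UNIV (\<lambda>w. deriv (fst w))"
    using b X_diff(1) by (auto simp: jet_def fun_plus_eta deriv_fun_add deriv_fun_scale)
  show "jet \<kappa> \<beta> UNIV (\<lambda>w. deriv (deriv (fst w)))"
    using b X_diff(1,2) by (auto simp: jet_def fun_plus_eta deriv_fun_add deriv_fun_scale)
qed

text \<open>Functions of \<open>x\<close> are viewed on the strip by composing with the first projection, and functions on the
  strip are restricted to the surface by composing with \<open>x \<mapsto> (x, 1)\<close>; neither map increases distances.\<close>

lemma jet_pullback:
  assumes "jet \<kappa> \<beta> S j" "\<And>p. p \<in> T \<Longrightarrow> r p \<in> S" "\<And>p q. dist (r p) (r q) \<le> dist p q" "0 < \<beta>"
  shows "jet \<kappa> \<beta> T (\<lambda>w p. j w (r p))"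
  unfolding jet_def
proof (intro conjI ballI allI)
  fix u assume u: "u \<in> fst (X_space \<kappa> \<beta>)"
  then have h: "hoelder_le S \<beta> (4 * snd (X_space \<kappa> \<beta>) u) (j u)" using assms(1) unfolding jet_def by auto
  show "hoelder_le T \<beta> (4 * snd (X_space \<kappa> \<beta>) u) (\<lambda>p. j u (r p))"
    unfolding hoelder_le_def
  proof (intro conjI ballI)
    fix p q assume pq: "p \<in> T" "q \<in> T"
    show "\<bar>j u (r p)\<bar> \<le> 4 * snd (X_space \<kappa> \<beta>) u" using h pq assms(2) by (auto intro: hoelder_le_bound)
    have "\<bar>j u (r p) - j u (r q)\<bar> \<le> 4 * snd (X_space \<kappa> \<beta>) u * dist (r p) (r q) powr \<beta>"
      using h assms(2)[OF pq(1)] assms(2)[OF pq(2)] unfolding hoelder_le_def by blast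
    also have "\<dots> \<le> 4 * snd (X_space \<kappa> \<beta>) u * dist p q powr \<beta>"
      using assms(3,4) X_norm_nonneg[OF u] by (intro mult_left_mono powr_mono2) auto
    finally show "\<bar>j u (r p) - j u (r q)\<bar> \<le> 4 * snd (X_space \<kappa> \<beta>) u * dist p q powr \<beta>" .
  qed
qed (use assms(1) in \<open>auto simp: jet_def\<close>)

lemma jet_eta:
  assumes "0 < \<beta>" "\<beta> < 1"
  shows "jet \<kappa> \<beta> strip (\<lambda>w p. fst w (fst p))" "jet \<kappa> \<beta> strip (\<lambda>w p. deriv (fst w) (fst p))"
    "jet \<kappa> \<beta> strip (\<lambda>w p. deriv (deriv (fst w)) (fst p))"
  using assms jet_pullback[where r = fst and T = strip, OF jet_line(1)[OF assms]]
    jet_pullback[where r = fst and T = strip, OF jet_line(2)[OF assms]]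
    jet_pullback[where r = fst and T = strip, OF jet_line(3)[OF assms]] by (simp_all add: dist_fst_le)

lemma jet_surface:
  assumes "0 < \<beta>" "\<beta> < 1"
  shows "jet \<kappa> \<beta> UNIV (\<lambda>w x. ds (snd w) (x, 1))" "jet \<kappa> \<beta> UNIV (\<lambda>w x. dx (ds (snd w)) (x, 1))"
  using assms jet_pullback[where r = "\<lambda>x. (x, 1)" and T = UNIV, OF jet_strip(3)[OF assms]]
    jet_pullback[where r = "\<lambda>x. (x, 1)" and T = UNIV, OF jet_strip(5)[OF assms]]
  by (simp_all add: dist_Pair_Pair)

section \<open>The water-wave operator as a rational expression in jets\<close>

definition psi0s :: "param \<Rightarrow> real \<Rightarrow> real" where
  "psi0s = (\<lambda>(\<mu>, \<alpha>, l) s. - \<mu> * sqrt \<bar>\<alpha>\<bar> * sin (sqrt \<bar>\<alpha>\<bar> * (s - 1) + l))"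

definition psi0ss :: "param \<Rightarrow> real \<Rightarrow> real" where
  "psi0ss = (\<lambda>(\<mu>, \<alpha>, l) s. - \<mu> * \<bar>\<alpha>\<bar> * cos (sqrt \<bar>\<alpha>\<bar> * (s - 1) + l))"

lemma psi0_deriv: "(psi0 \<Lambda> has_real_derivative psi0s \<Lambda> s) (at s within S)"
  by (cases \<Lambda>) (auto simp: psi0_def psi0s_def intro!: derivative_eq_intros)

lemma psi0s_deriv: "(psi0s \<Lambda> has_real_derivative psi0ss \<Lambda> s) (at s within S)"
  by (cases \<Lambda>) (auto simp: psi0ss_def psi0s_def intro!: derivative_eq_intros)

lemma deriv_psi0: "deriv (psi0 \<Lambda>) = psi0s \<Lambda>" "deriv (psi0s \<Lambda>) = psi0ss \<Lambda>"
  by (auto intro!: ext DERIV_imp_deriv psi0_deriv psi0s_deriv)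

text \<open>The two components of \<open>F\<close> as polynomials in the jets and in \<open>g = 1 / (1 + \<eta>) - 1\<close>. Using \<open>g\<close>, which
  vanishes with \<open>\<eta>\<close>, instead of the reciprocal keeps every monomial homogeneous in quantities that are small
  with \<open>w\<close>. The constant \<open>Q\<close> equals \<open>p\<^sup>2 / 2\<close> for \<open>p = \<psi>\<^sub>0\<^sub>s(1)\<close>.\<close>

definition bernoulli :: "real \<Rightarrow> real \<Rightarrow> real \<Rightarrow> real \<Rightarrow> real \<Rightarrow> real" where
  "bernoulli p \<eta> \<eta>x b g = (1 + \<eta>x\<^sup>2) * (p + b)\<^sup>2 * (1 + g)\<^sup>2 / 2 + \<eta> - p\<^sup>2 / 2"

definition vorticity :: "real \<Rightarrow> real \<Rightarrow> real \<Rightarrow> real \<Rightarrow> real \<Rightarrow> real \<Rightarrow> real \<Rightarrow> real \<Rightarrow> real \<Rightarrow> real \<Rightarrow> real \<Rightarrow> real \<Rightarrow> real \<Rightarrow> real" where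
  "vorticity \<alpha> s p q g \<eta>x \<eta>xx \<phi> \<phi>s \<phi>ss \<phi>xx \<phi>sx \<phi>xs =
     \<phi>xx - s * (\<eta>xx * (1 + g) - \<eta>x\<^sup>2 * (1 + g)\<^sup>2) * (p + \<phi>s) - s * \<eta>x * (1 + g) * \<phi>sx
     - s * \<eta>x * (1 + g) * (\<phi>xs - \<eta>x * (1 + g) * (p + \<phi>s) - s * \<eta>x * (1 + g) * (q + \<phi>ss))
     + q * (2 * g + g\<^sup>2) + \<phi>ss * (1 + g)\<^sup>2 - \<alpha> * \<phi>"

lemma F1_bernoulli:
  assumes "w \<in> O_set \<kappa> \<beta>" "\<Lambda> \<in> U_set"
  shows "F1 w \<Lambda> x = bernoulli (psi0s \<Lambda> 1) (fst w x) (deriv (fst w) x) (ds (snd w) (x, 1)) (1 / (1 + fst w x) - 1)"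
proof -
  obtain \<eta> \<phi> \<mu> \<alpha> l where w: "w = (\<eta>, \<phi>)" and L: "\<Lambda> = (\<mu>, \<alpha>, l)" by (cases w, cases \<Lambda>)
  have "(psi0s \<Lambda> 1)\<^sup>2 / 2 = Q_const \<Lambda>"
    by (simp add: L psi0s_def Q_const_def power_mult_distrib)
  moreover have "\<eta> x > -1" using assms(1) w by (auto simp: O_set_def)
  then have "1 + \<eta> x \<noteq> 0" by linarith
  ultimately show ?thesis
    by (simp add: w F1_def bernoulli_def deriv_psi0 power_divide)
qed

lemma dx_on_strip:
  assumes "\<And>x s. s \<in> {0..1} \<Longrightarrow> ((\<lambda>t. u (t, s)) has_real_derivative v (x, s)) (at x)"
  shows "dx (on_strip u) = on_strip v"
proof (rule dx_eqI)
  fix x s :: real assume s: "s \<in> {0..1}"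
  then show "((\<lambda>t. on_strip u (t, s)) has_real_derivative v (x, s)) (at x)" using assms[OF s] by simp
qed

lemma ds_on_strip:
  assumes "\<And>x s. s \<in> {0..1} \<Longrightarrow> ((\<lambda>t. u (x, t)) has_real_derivative v (x, s)) (at s within {0..1})"
  shows "ds (on_strip u) = on_strip v"
proof (rule ds_eqI)
  fix x s :: real assume s: "s \<in> {0..1}"
  show "((\<lambda>t. on_strip u (x, t)) has_real_derivative v (x, s)) (at s within {0..1})"
    by (rule has_field_derivative_transform_within[OF assms[OF s], of 1]) (use s in auto)
qed

lemma F2_off: "p \<notin> strip \<Longrightarrow> F2 w \<Lambda> p = 0"
  by (cases w) (simp add: F2_def)

text \<open>The zero-order term in \<open>\<psi>\<^sub>0\<close> cancels because \<open>\<psi>\<^sub>0\<close> solves \<open>\<psi>\<^sub>0'' = \<alpha> \<psi>\<^sub>0\<close>. The order of the mixed derivatives of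
  \<open>\<phi>\<close> is kept, as it results from applying the flattened derivative twice.\<close>

lemma F2_vorticity:
  assumes w: "w \<in> O_set \<kappa> \<beta>" and "\<Lambda> \<in> U_set" and s: "s \<in> {0..1}"
  shows "F2 w \<Lambda> (x, s) = vorticity (fst (snd \<Lambda>)) s (psi0s \<Lambda> s) (psi0ss \<Lambda> s) (1 / (1 + fst w x) - 1)
     (deriv (fst w) x) (deriv (deriv (fst w)) x) (snd w (x, s)) (ds (snd w) (x, s)) (ds (ds (snd w)) (x, s))
     (dx (dx (snd w)) (x, s)) (dx (ds (snd w)) (x, s)) (ds (dx (snd w)) (x, s))"
proof -
  obtain \<eta> \<phi> \<mu> \<alpha> l where weq: "w = (\<eta>, \<phi>)" and L: "\<Lambda> = (\<mu>, \<alpha>, l)" by (cases w, cases \<Lambda>)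
  have X: "(\<eta>, \<phi>) \<in> fst (X_space \<kappa> \<beta>)" using w unfolding weq O_set_def by auto
  have pos: "1 + \<eta> x > 0" for x
  proof -
    have "\<eta> x > -1" using w unfolding weq O_set_def by auto
    then show ?thesis by linarith
  qed
  note D = X_diff[OF X, simplified]
  have d\<eta>: "(\<eta> has_real_derivative deriv \<eta> x) (at x)" "(deriv \<eta> has_real_derivative deriv (deriv \<eta>) x) (at x)" for x
    using D(1,2) by (auto simp: DERIV_deriv_iff_real_differentiable)
  define u where "u = on_strip (\<lambda>(x, s). psi0 \<Lambda> s + \<phi> (x, s))"
  have dxu: "dx u = dx \<phi>"
  proof -
    have "dx u = on_strip (dx \<phi>)" unfolding u_def
      by (rule dx_on_strip) (auto intro!: derivative_eq_intros dx_deriv[OF D(3)])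
    then show ?thesis by (auto simp: fun_eq_iff on_strip_def on_strip_off)
  qed
  have dsu: "ds u = on_strip (\<lambda>(x, s). psi0s \<Lambda> s + ds \<phi> (x, s))" unfolding u_def
    by (rule ds_on_strip) (auto intro!: DERIV_add psi0_deriv ds_deriv[OF D(3)])
  define \<gamma> where "\<gamma> x = 1 / (1 + \<eta> x)" for x
  have d\<gamma>: "(\<gamma> has_real_derivative - deriv \<eta> x * (\<gamma> x)\<^sup>2) (at x)" for x
    unfolding \<gamma>_def using pos[of x] d\<eta>(1)[of x]
    by (auto intro!: derivative_eq_intros simp: power2_eq_square)
  have v: "flat_dx \<eta> u = on_strip (\<lambda>(x, s). dx \<phi> (x, s) - s * (deriv \<eta> x * \<gamma> x) * (psi0s \<Lambda> s + ds \<phi> (x, s)))"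
    unfolding flat_dx_def dxu dsu by (auto simp: fun_eq_iff on_strip_def \<gamma>_def)
  have dxv: "dx (flat_dx \<eta> u) = on_strip (\<lambda>(x, s). dx (dx \<phi>) (x, s)
     - s * (deriv (deriv \<eta>) x * \<gamma> x - (deriv \<eta> x)\<^sup>2 * (\<gamma> x)\<^sup>2) * (psi0s \<Lambda> s + ds \<phi> (x, s))
     - s * (deriv \<eta> x * \<gamma> x) * dx (ds \<phi>) (x, s))"
    unfolding v
    apply (rule dx_on_strip)
    apply clarsimp
    apply (rule derivative_eq_intros refl dx_deriv[OF D(4)] dx_deriv[OF D(5)] d\<eta> d\<gamma> | simp)+
    apply (simp add: algebra_simps power2_eq_square)
    done
  have dsv: "ds (flat_dx \<eta> u) = on_strip (\<lambda>(x, s). ds (dx \<phi>) (x, s)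
     - (deriv \<eta> x * \<gamma> x) * (psi0s \<Lambda> s + ds \<phi> (x, s))
     - s * (deriv \<eta> x * \<gamma> x) * (psi0ss \<Lambda> s + ds (ds \<phi>) (x, s)))"
    unfolding v
    apply (rule ds_on_strip)
    apply clarsimp
    apply (rule derivative_eq_intros refl ds_deriv[OF D(4)] ds_deriv[OF D(5)] psi0s_deriv | simp add: algebra_simps)+
    done
  have q: "psi0ss \<Lambda> s = \<alpha> * psi0 \<Lambda> s"
    using assms(2) by (simp add: L psi0ss_def psi0_def U_set_def)
  have g: "1 / (1 + \<eta> x) = \<gamma> x" by (simp add: \<gamma>_def)
  have "F2 w \<Lambda> (x, s) = dx (flat_dx \<eta> u) (x, s) - s * deriv \<eta> x * \<gamma> x * ds (flat_dx \<eta> u) (x, s)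
       + (psi0ss \<Lambda> s + ds (ds \<phi>) (x, s)) * (\<gamma> x)\<^sup>2 - \<alpha> * (psi0 \<Lambda> s + \<phi> (x, s))"
  proof -
    have "F2 w \<Lambda> (x, s) = flat_dx \<eta> (flat_dx \<eta> u) (x, s)
       + (psi0ss \<Lambda> s + ds (ds \<phi>) (x, s)) / (1 + \<eta> x)\<^sup>2 - \<alpha> * (psi0 \<Lambda> s + \<phi> (x, s))"
      using s by (simp add: F2_def weq u_def deriv_psi0 L)
    also have "flat_dx \<eta> (flat_dx \<eta> u) (x, s) = dx (flat_dx \<eta> u) (x, s) - s * deriv \<eta> x * \<gamma> x * ds (flat_dx \<eta> u) (x, s)"
      using s by (simp add: flat_dx_def[of \<eta> "flat_dx \<eta> u"] \<gamma>_def)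
    finally show ?thesis by (simp add: \<gamma>_def power_divide)
  qed
  then show ?thesis
    using s unfolding dxv dsv vorticity_def weq
    by (simp add: g L) (simp add: q[unfolded L] algebra_simps power2_eq_square)
qed

section \<open>Linearization at the trivial flow\<close>

text \<open>The candidate for \<open>D\<^sub>wF(0, \<Lambda>)\<close>, obtained from the terms of first order in \<open>bernoulli\<close> and \<open>vorticity\<close>.\<close>

definition L_op :: "param \<Rightarrow> fpair \<Rightarrow> fpair" where
  "L_op \<Lambda> w =
     (\<lambda>x. psi0s \<Lambda> 1 * ds (snd w) (x, 1) + (1 - (psi0s \<Lambda> 1)\<^sup>2) * fst w x,
      on_strip (\<lambda>(x, s). dx (dx (snd w)) (x, s) + ds (ds (snd w)) (x, s) - fst (snd \<Lambda>) * snd w (x, s)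
        - s * deriv (deriv (fst w)) x * psi0s \<Lambda> s - 2 * fst w x * psi0ss \<Lambda> s))"

lemma deriv_shift: "deriv f (x + T) = deriv (\<lambda>t. f (t + T)) (x::real)"
  by (simp add: deriv_def DERIV_shift)

lemma deriv_reflect: "(\<And>x. f differentiable (at x)) \<Longrightarrow> deriv (\<lambda>t. f (- t)) (x::real) = - deriv f (- x :: real)"
  by (rule DERIV_imp_deriv) (simp add: DERIV_mirror[symmetric] DERIV_deriv_iff_real_differentiable)

lemma X_line_symmetric:
  assumes w: "w \<in> fst (X_space \<kappa> \<beta>)"
  shows "fst w (x + 2 * pi / \<kappa>) = fst w x" "fst w (- x) = fst w x"
    "deriv (fst w) (x + 2 * pi / \<kappa>) = deriv (fst w) x" "deriv (fst w) (- x) = - deriv (fst w) x"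
    "deriv (deriv (fst w)) (x + 2 * pi / \<kappa>) = deriv (deriv (fst w)) x"
    "deriv (deriv (fst w)) (- x) = deriv (deriv (fst w)) x"
proof -
  have 0: "fst w (x + 2 * pi / \<kappa>) = fst w x" "fst w (- x) = fst w x" for x
    using w by (auto simp: X_carrier C_line_def)
  have 1: "deriv (fst w) (x + 2 * pi / \<kappa>) = deriv (fst w) x" "deriv (fst w) (- x) = - deriv (fst w) x" for x
    using deriv_shift[of "fst w" x] deriv_reflect[OF X_diff(1)[OF w], of x] by (simp_all add: 0)
  have 2: "deriv (deriv (fst w)) (x + 2 * pi / \<kappa>) = deriv (deriv (fst w)) x" for x
    using deriv_shift[of "deriv (fst w)" x] by (simp add: 1)
  have "deriv (\<lambda>t. - deriv (fst w) t) x = - deriv (deriv (fst w)) x" for x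
    using X_diff(2)[OF w] by (intro DERIV_imp_deriv DERIV_minus) (simp add: DERIV_deriv_iff_real_differentiable)
  then have 3: "deriv (deriv (fst w)) (- x) = deriv (deriv (fst w)) x" for x
    using deriv_reflect[OF X_diff(2)[OF w], of x] by (simp add: 1)
  show "fst w (x + 2 * pi / \<kappa>) = fst w x" "fst w (- x) = fst w x"
    "deriv (fst w) (x + 2 * pi / \<kappa>) = deriv (fst w) x" "deriv (fst w) (- x) = - deriv (fst w) x"
    "deriv (deriv (fst w)) (x + 2 * pi / \<kappa>) = deriv (deriv (fst w)) x"
    "deriv (deriv (fst w)) (- x) = deriv (deriv (fst w)) x"
    using 0 1 2 3 by auto
qed

lemma dx_shift:
  assumes "\<And>x s. u (x + T, s) = u (x, s)" shows "dx u (x + T, s) = dx u (x, s)"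
  using deriv_shift[of "\<lambda>t. u (t, s)" x T] assms by (simp add: dx_def on_strip_def)

lemma ds_shift:
  assumes "\<And>x s. u (x + T, s) = u (x, s)" shows "ds u (x + T, s) = ds u (x, s)"
  using assms by (simp add: ds_def on_strip_def)

lemma dx_reflect:
  assumes "\<And>x s. u (- x, s) = c * u (x, s)" "pdiff u" shows "dx u (- x, s) = - c * dx u (x, s)"
proof (cases "s \<in> {0..1}")
  case True
  have "((\<lambda>t. u (- t, s)) has_real_derivative - dx u (- x, s)) (at x)"
    using dx_deriv[OF assms(2) True, of "- x"] by (rule DERIV_mirror[THEN iffD1])
  then have "((\<lambda>t. c * u (t, s)) has_real_derivative - dx u (- x, s)) (at x)" by (simp add: assms(1))
  moreover have "((\<lambda>t. c * u (t, s)) has_real_derivative c * dx u (x, s)) (at x)"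
    by (intro DERIV_cmult dx_deriv assms True)
  ultimately have "- dx u (- x, s) = c * dx u (x, s)" by (rule DERIV_unique)
  then show ?thesis by simp
qed (auto simp: dx_def on_strip_def)

lemma ds_reflect:
  assumes "\<And>x s. u (- x, s) = u (x, s)" shows "ds u (- x, s) = ds u (x, s)"
  using assms by (simp add: ds_def on_strip_def)

lemma X_strip_symmetric:
  assumes w: "w \<in> fst (X_space \<kappa> \<beta>)"
  shows "snd w (x + 2 * pi / \<kappa>, s) = snd w (x, s)" "snd w (- x, s) = snd w (x, s)"
    "dx (snd w) (x + 2 * pi / \<kappa>, s) = dx (snd w) (x, s)"
    "ds (snd w) (x + 2 * pi / \<kappa>, s) = ds (snd w) (x, s)" "ds (snd w) (- x, s) = ds (snd w) (x, s)"
    "ds (ds (snd w)) (x + 2 * pi / \<kappa>, s) = ds (ds (snd w)) (x, s)" "ds (ds (snd w)) (- x, s) = ds (ds (snd w)) (x, s)"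
    "dx (dx (snd w)) (x + 2 * pi / \<kappa>, s) = dx (dx (snd w)) (x, s)" "dx (dx (snd w)) (- x, s) = dx (dx (snd w)) (x, s)"
proof -
  have 0: "snd w (x + 2 * pi / \<kappa>, s) = snd w (x, s)" "snd w (- x, s) = snd w (x, s)" for x s
    using w by (auto simp: X_carrier C_strip_def)
  note d = X_diff(3-5)[OF w]
  have "dx (snd w) (- x, s) = - 1 * dx (snd w) (x, s)" for x s
    using dx_reflect[of "snd w" 1, OF _ d(1)] by (simp add: 0)
  then have 1: "dx (dx (snd w)) (- x, s) = dx (dx (snd w)) (x, s)" for x s
    using dx_reflect[of "dx (snd w)" "-1", OF _ d(2)] by simp
  show "snd w (x + 2 * pi / \<kappa>, s) = snd w (x, s)" "snd w (- x, s) = snd w (x, s)"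
    "dx (snd w) (x + 2 * pi / \<kappa>, s) = dx (snd w) (x, s)"
    "ds (snd w) (x + 2 * pi / \<kappa>, s) = ds (snd w) (x, s)" "ds (snd w) (- x, s) = ds (snd w) (x, s)"
    "ds (ds (snd w)) (x + 2 * pi / \<kappa>, s) = ds (ds (snd w)) (x, s)" "ds (ds (snd w)) (- x, s) = ds (ds (snd w)) (x, s)"
    "dx (dx (snd w)) (x + 2 * pi / \<kappa>, s) = dx (dx (snd w)) (x, s)" "dx (dx (snd w)) (- x, s) = dx (dx (snd w)) (x, s)"
    by (intro dx_shift ds_shift ds_reflect 0 1)+
qed

text \<open>What the remainder estimate uses of a scale of bounds. It is applied to Hoelder bounds on the strip, where the
  second component of \<open>F\<close> lives, and to \<open>C\<^sup>1\<close>-Hoelder bounds on the line for the first component.\<close>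

definition bd_algebra :: "(real \<Rightarrow> ('q \<Rightarrow> real) \<Rightarrow> bool) \<Rightarrow> bool" where
  "bd_algebra bd \<longleftrightarrow>
     (\<forall>A B f g. bd A f \<longrightarrow> bd B g \<longrightarrow> bd (A + B) (\<lambda>p. f p + g p)) \<and>
     (\<forall>A B f. bd A f \<longrightarrow> A \<le> B \<longrightarrow> bd B f) \<and>
     (\<exists>M\<ge>0. \<forall>A B f g. 0 \<le> A \<longrightarrow> 0 \<le> B \<longrightarrow> bd A f \<longrightarrow> bd B g \<longrightarrow> bd (M * (A * B)) (\<lambda>p. f p * g p)) \<and>
     (\<forall>c. bd \<bar>c\<bar> (\<lambda>p. c))"

text \<open>The expression \<open>f w\<close> is \<open>O(n w ^ k)\<close> in the given scale of bounds, uniformly for \<open>w\<close> in \<open>D\<close>. The guard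
  \<open>0 \<le> n w\<close> makes the bounds nonnegative, as the product rule of \<open>bd_algebra\<close> demands.\<close>

definition of_order :: "fpair set \<Rightarrow> (fpair \<Rightarrow> real) \<Rightarrow> (real \<Rightarrow> ('q \<Rightarrow> real) \<Rightarrow> bool) \<Rightarrow> nat \<Rightarrow> (fpair \<Rightarrow> 'q \<Rightarrow> real) \<Rightarrow> bool" where
  "of_order D n bd k f \<longleftrightarrow> (\<exists>C\<ge>0. \<forall>w\<in>D. 0 \<le> n w \<longrightarrow> bd (C * n w ^ k) (f w))"

lemma of_order_add:
  assumes "bd_algebra bd" "of_order D n bd k f" "of_order D n bd k g"
  shows "of_order D n bd k (\<lambda>w p. f w p + g w p)"
proof -
  obtain C E where C: "0 \<le> C" "\<forall>w\<in>D. 0 \<le> n w \<longrightarrow> bd (C * n w ^ k) (f w)"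
    and E: "0 \<le> E" "\<forall>w\<in>D. 0 \<le> n w \<longrightarrow> bd (E * n w ^ k) (g w)" using assms unfolding of_order_def by auto
  have "bd ((C + E) * n w ^ k) (\<lambda>p. f w p + g w p)" if "w \<in> D" "0 \<le> n w" for w
    using C E that assms(1) unfolding bd_algebra_def by (simp add: distrib_right)
  then show ?thesis unfolding of_order_def using C(1) E(1) by (intro exI[of _ "C + E"]) auto
qed

lemma of_order_mult:
  assumes "bd_algebra bd" "of_order D n bd k f" "of_order D n bd l g"
  shows "of_order D n bd (k + l) (\<lambda>w p. f w p * g w p)"
proof -
  obtain C E where C: "0 \<le> C" "\<forall>w\<in>D. 0 \<le> n w \<longrightarrow> bd (C * n w ^ k) (f w)"
    and E: "0 \<le> E" "\<forall>w\<in>D. 0 \<le> n w \<longrightarrow> bd (E * n w ^ l) (g w)" using assms unfolding of_order_def by auto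
  obtain M where M: "0 \<le> M" "\<And>A B f g. 0 \<le> A \<Longrightarrow> 0 \<le> B \<Longrightarrow> bd A f \<Longrightarrow> bd B g \<Longrightarrow> bd (M * (A * B)) (\<lambda>p. f p * g p)"
    using assms(1) unfolding bd_algebra_def by blast
  have "bd ((M * (C * E)) * n w ^ (k + l)) (\<lambda>p. f w p * g w p)" if w: "w \<in> D" "0 \<le> n w" for w
  proof -
    have "bd (M * ((C * n w ^ k) * (E * n w ^ l))) (\<lambda>p. f w p * g w p)"
      using C E w by (intro M(2)) auto
    moreover have "M * ((C * n w ^ k) * (E * n w ^ l)) = (M * (C * E)) * n w ^ (k + l)"
      by (simp add: power_add mult_ac)
    ultimately show ?thesis by simp
  qed
  then show ?thesis unfolding of_order_def using C(1) E(1) M(1) by (intro exI[of _ "M * (C * E)"]) auto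
qed

lemma of_order_const:
  assumes "bd C f" "0 \<le> C" shows "of_order D n bd 0 (\<lambda>w. f)"
  unfolding of_order_def using assms by (intro exI[of _ C]) auto

lemma of_order_num: assumes "bd_algebra bd" shows "of_order D n bd 0 (\<lambda>w p. c)"
  using assms by (intro of_order_const[where C = "\<bar>c\<bar>"]) (auto simp: bd_algebra_def)

lemma of_order_bounded:
  assumes "bd_algebra bd" "of_order D n bd 1 f" "\<And>w. w \<in> D \<Longrightarrow> n w \<le> 1"
  shows "of_order D n bd 0 f"
proof -
  obtain C where C: "0 \<le> C" "\<forall>w\<in>D. 0 \<le> n w \<longrightarrow> bd (C * n w ^ 1) (f w)" using assms(2) unfolding of_order_def by auto
  have "bd C (f w)" if w: "w \<in> D" "0 \<le> n w" for w
  proof -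
    have "bd (C * n w) (f w)" "C * n w \<le> C" using C w assms(3)[OF w(1)] by (auto simp: mult_left_le)
    then show ?thesis using assms(1) unfolding bd_algebra_def by blast
  qed
  then show ?thesis using C(1) unfolding of_order_def by auto
qed

lemma of_order_quad:
  assumes "bd_algebra bd" "of_order D n bd 0 c" "of_order D n bd 1 f" "of_order D n bd 1 g"
  shows "of_order D n bd 2 (\<lambda>w p. c w p * (f w p * g w p))"
  using of_order_mult[OF assms(1,2) of_order_mult[OF assms(1,3,4)]] by (simp add: numeral_2_eq_2)

lemma of_order_lin:
  assumes "bd_algebra bd" "of_order D n bd 0 c" "of_order D n bd 1 f"
  shows "of_order D n bd 1 (\<lambda>w p. c w p * f w p)"
  using of_order_mult[OF assms] by simp

lemma of_order_prod0:
  assumes "bd_algebra bd" "of_order D n bd 0 c" "of_order D n bd 0 f"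
  shows "of_order D n bd 0 (\<lambda>w p. c w p * f w p)"
  using of_order_mult[OF assms] by simp

lemma hoelder_le_const: "hoelder_le S \<beta> \<bar>c\<bar> (\<lambda>p. c)" by (auto simp: hoelder_le_def)

lemma bd_algebra_hoelder_le: "bd_algebra (hoelder_le S \<beta>)"
  unfolding bd_algebra_def
proof (intro conjI allI impI)
  show "\<exists>M\<ge>0. \<forall>A B f g. 0 \<le> A \<longrightarrow> 0 \<le> B \<longrightarrow> hoelder_le S \<beta> A f \<longrightarrow> hoelder_le S \<beta> B g \<longrightarrow> hoelder_le S \<beta> (M * (A * B)) (\<lambda>p. f p * g p)"
    using hoelder_le_mult by (intro exI[of _ 2]) auto
qed (rule hoelder_le_add hoelder_le_mono hoelder_le_const; assumption)+

lemma hoelder_le_line_1I: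
  assumes "\<And>x. \<bar>f x\<bar> \<le> B" "\<And>x. (f has_real_derivative f' x) (at x)" "hoelder_le UNIV \<beta> B f'"
  shows "hoelder_le_line 1 \<beta> B f"
proof -
  have "deriv f = f'" using assms(2) by (auto intro!: ext DERIV_imp_deriv)
  then show ?thesis using assms by (auto simp: real_differentiable_def)
qed

lemma hoelder_le_line_1D:
  assumes "hoelder_le_line 1 \<beta> B f"
  shows "\<bar>f x\<bar> \<le> B" "(f has_real_derivative deriv f x) (at x)" "hoelder_le UNIV \<beta> B (deriv f)"
  using assms by (auto simp: DERIV_deriv_iff_real_differentiable)

lemma hoelder_le_line_1_mult:
  assumes "0 < \<beta>" "\<beta> < 1" "0 \<le> A" "0 \<le> B" and f: "hoelder_le_line 1 \<beta> A f" and g: "hoelder_le_line 1 \<beta> B g"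
  shows "hoelder_le_line 1 \<beta> (12 * (A * B)) (\<lambda>x. f x * g x)"
proof (rule hoelder_le_line_1I[where f' = "\<lambda>x. f x * deriv g x + deriv f x * g x"])
  fix x
  have "\<bar>f x * g x\<bar> \<le> A * B"
    unfolding abs_mult by (intro mult_mono hoelder_le_line_1D[OF f] hoelder_le_line_1D[OF g]) (use assms in auto)
  then show "\<bar>f x * g x\<bar> \<le> 12 * (A * B)" using assms(3,4) mult_nonneg_nonneg[of A B] by linarith
  show "((\<lambda>x. f x * g x) has_real_derivative f x * deriv g x + deriv f x * g x) (at x)"
    using hoelder_le_line_1D[OF f] hoelder_le_line_1D[OF g] by (auto intro!: derivative_eq_intros)
  have "hoelder_le UNIV \<beta> (2 * ((3 * A) * B) + 2 * (A * (3 * B))) (\<lambda>x. f x * deriv g x + deriv f x * g x)"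
    by (intro hoelder_le_add hoelder_le_mult hoelder_le_line_base[OF assms(1,2) f] hoelder_le_line_base[OF assms(1,2) g]
        hoelder_le_line_1D(3)[OF f] hoelder_le_line_1D(3)[OF g]) (use assms in auto)
  then show "hoelder_le UNIV \<beta> (12 * (A * B)) (\<lambda>x. f x * deriv g x + deriv f x * g x)" by (simp add: mult_ac)
qed

lemma bd_algebra_line: "0 < \<beta> \<Longrightarrow> \<beta> < 1 \<Longrightarrow> bd_algebra (hoelder_le_line 1 \<beta>)"
  unfolding bd_algebra_def
proof (intro conjI allI impI)
  show "hoelder_le_line 1 \<beta> \<bar>c\<bar> (\<lambda>p. c)" for c by (rule hoelder_le_line_1I[where f' = "\<lambda>x. 0"]) (auto simp: hoelder_le_def)
  show "\<exists>M\<ge>0. \<forall>A B f g. 0 \<le> A \<longrightarrow> 0 \<le> B \<longrightarrow> hoelder_le_line 1 \<beta> A f \<longrightarrow> hoelder_le_line 1 \<beta> B g \<longrightarrow> hoelder_le_line 1 \<beta> (M * (A * B)) (\<lambda>p. f p * g p)"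
    if "0 < \<beta>" "\<beta> < 1"
    using hoelder_le_line_1_mult[OF that] by (intro exI[of _ 12]) simp
qed (rule hoelder_le_line_add hoelder_le_line_mono; assumption)+

text \<open>For \<open>w\<close> in this set \<open>\<bar>\<eta>\<bar> \<le> 1/2\<close> even after the factor \<open>4\<close> lost in passing to jets, so \<open>1 / (1 + \<eta>)\<close> is under control.\<close>

definition near0 :: "real \<Rightarrow> real \<Rightarrow> fpair set" where
  "near0 \<kappa> \<beta> = {w \<in> fst (X_space \<kappa> \<beta>). snd (X_space \<kappa> \<beta>) w \<le> 1 / 8}"

lemma of_order_jet:
  assumes "jet \<kappa> \<beta> S j" "D \<subseteq> fst (X_space \<kappa> \<beta>)"
  shows "of_order D (snd (X_space \<kappa> \<beta>)) (hoelder_le S \<beta>) 1 j"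
  unfolding of_order_def using assms by (intro exI[of _ 4]) (auto simp: jet_def)

lemma hoelder_le_reciprocal:
  assumes f: "hoelder_le S \<beta> B f" and "B \<le> 1 / 2"
  shows "hoelder_le S \<beta> (4 * B) (\<lambda>p. 1 / (1 + f p) - 1)"
  unfolding hoelder_le_def
proof (intro conjI ballI)
  have pos: "1 / 2 \<le> 1 + f p" if "p \<in> S" for p using hoelder_le_bound[OF f that] assms(2) by linarith
  fix p assume p: "p \<in> S"
  have "\<bar>1 / (1 + f p) - 1\<bar> = \<bar>f p\<bar> / (1 + f p)"
    using pos[OF p] by (simp add: divide_simps abs_if)
  also have "\<dots> \<le> B / (1 / 2)" using pos[OF p] hoelder_le_bound[OF f p] by (intro frac_le) auto
  also have "\<dots> \<le> 4 * B" using hoelder_le_bound[OF f p] abs_ge_zero[of "f p"] by simp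
  finally show "\<bar>1 / (1 + f p) - 1\<bar> \<le> 4 * B" .
  fix q assume q: "q \<in> S"
  have "\<bar>1 / (1 + f p) - 1 - (1 / (1 + f q) - 1)\<bar> = \<bar>f p - f q\<bar> / ((1 + f p) * (1 + f q))"
  proof -
    have "1 / (1 + f p) - 1 - (1 / (1 + f q) - 1) = (f q - f p) / ((1 + f p) * (1 + f q))"
      using pos[OF p] pos[OF q] by (simp add: field_simps)
    then show ?thesis using pos[OF p] pos[OF q] by (simp add: abs_mult abs_minus_commute)
  qed
  also have "\<dots> \<le> (B * dist p q powr \<beta>) / (1 / 4)"
  proof (intro frac_le)
    show "1 / 4 \<le> (1 + f p) * (1 + f q)" using mult_mono[OF pos[OF p] pos[OF q]] pos[OF p] by auto
    show "\<bar>f p - f q\<bar> \<le> B * dist p q powr \<beta>" using f p q by (auto simp: hoelder_le_def)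
    then show "0 \<le> B * dist p q powr \<beta>" by linarith
  qed auto
  finally show "\<bar>1 / (1 + f p) - 1 - (1 / (1 + f q) - 1)\<bar> \<le> 4 * B * dist p q powr \<beta>" by simp
qed

lemma of_order_reciprocal_strip:
  assumes "0 < \<beta>" "\<beta> < 1"
  shows "of_order (near0 \<kappa> \<beta>) (snd (X_space \<kappa> \<beta>)) (hoelder_le strip \<beta>) 1 (\<lambda>w p. 1 / (1 + fst w (fst p)) - 1)"
  unfolding of_order_def
proof (intro exI[of _ 16] conjI ballI impI)
  fix w assume "w \<in> near0 \<kappa> \<beta>"
  then have "hoelder_le strip \<beta> (4 * snd (X_space \<kappa> \<beta>) w) (\<lambda>p. fst w (fst p))" "4 * snd (X_space \<kappa> \<beta>) w \<le> 1 / 2"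
    using jet_eta(1)[OF assms] by (auto simp: near0_def jet_def)
  then show "hoelder_le strip \<beta> (16 * snd (X_space \<kappa> \<beta>) w ^ 1) (\<lambda>p. 1 / (1 + fst w (fst p)) - 1)"
    using hoelder_le_reciprocal by fastforce
qed auto

lemma of_order_line:
  assumes b: "0 < \<beta>" "\<beta> < 1" and D: "D \<subseteq> fst (X_space \<kappa> \<beta>)"
  shows "of_order D (snd (X_space \<kappa> \<beta>)) (hoelder_le_line 1 \<beta>) 1 (\<lambda>w. fst w)"
    "of_order D (snd (X_space \<kappa> \<beta>)) (hoelder_le_line 1 \<beta>) 1 (\<lambda>w. deriv (fst w))"
    "of_order D (snd (X_space \<kappa> \<beta>)) (hoelder_le_line 1 \<beta>) 1 (\<lambda>w x. ds (snd w) (x, 1))"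
proof -
  have d: "(fst w has_real_derivative deriv (fst w) x) (at x)"
    "(deriv (fst w) has_real_derivative deriv (deriv (fst w)) x) (at x)"
    "((\<lambda>x. ds (snd w) (x, 1)) has_real_derivative dx (ds (snd w)) (x, 1)) (at x)"
    "\<bar>fst w x\<bar> \<le> 4 * snd (X_space \<kappa> \<beta>) w" "\<bar>deriv (fst w) x\<bar> \<le> 4 * snd (X_space \<kappa> \<beta>) w"
    "\<bar>ds (snd w) (x, 1)\<bar> \<le> 4 * snd (X_space \<kappa> \<beta>) w"
    if "w \<in> D" for w x
  proof -
    have w: "w \<in> fst (X_space \<kappa> \<beta>)" using that D by auto
    show "(fst w has_real_derivative deriv (fst w) x) (at x)"
      "(deriv (fst w) has_real_derivative deriv (deriv (fst w)) x) (at x)"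
      using X_diff(1,2)[OF w] by (simp_all add: DERIV_deriv_iff_real_differentiable)
    show "((\<lambda>x. ds (snd w) (x, 1)) has_real_derivative dx (ds (snd w)) (x, 1)) (at x)"
      using dx_deriv[OF X_diff(5)[OF w]] by simp
    show "\<bar>fst w x\<bar> \<le> 4 * snd (X_space \<kappa> \<beta>) w" "\<bar>deriv (fst w) x\<bar> \<le> 4 * snd (X_space \<kappa> \<beta>) w"
      "\<bar>ds (snd w) (x, 1)\<bar> \<le> 4 * snd (X_space \<kappa> \<beta>) w"
      using jet_line[OF b] jet_surface[OF b] w by (auto simp: jet_def hoelder_le_def)
  qed
  show "of_order D (snd (X_space \<kappa> \<beta>)) (hoelder_le_line 1 \<beta>) 1 (\<lambda>w. fst w)" unfolding of_order_def
  proof (intro exI[of _ 4] conjI ballI impI)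
    fix w assume w: "w \<in> D"
    have "hoelder_le UNIV \<beta> (4 * snd (X_space \<kappa> \<beta>) w) (deriv (fst w))"
      using jet_line(2)[OF b, of \<kappa>] w D unfolding jet_def by blast
    then show "hoelder_le_line 1 \<beta> (4 * snd (X_space \<kappa> \<beta>) w ^ 1) (fst w)"
      using d(1,4)[OF w] by (intro hoelder_le_line_1I) auto
  qed simp
  show "of_order D (snd (X_space \<kappa> \<beta>)) (hoelder_le_line 1 \<beta>) 1 (\<lambda>w. deriv (fst w))" unfolding of_order_def
  proof (intro exI[of _ 4] conjI ballI impI)
    fix w assume w: "w \<in> D"
    have "hoelder_le UNIV \<beta> (4 * snd (X_space \<kappa> \<beta>) w) (deriv (deriv (fst w)))"
      using jet_line(3)[OF b, of \<kappa>] w D unfolding jet_def by blast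
    then show "hoelder_le_line 1 \<beta> (4 * snd (X_space \<kappa> \<beta>) w ^ 1) (deriv (fst w))"
      using d(2,5)[OF w] by (intro hoelder_le_line_1I) auto
  qed simp
  show "of_order D (snd (X_space \<kappa> \<beta>)) (hoelder_le_line 1 \<beta>) 1 (\<lambda>w x. ds (snd w) (x, 1))" unfolding of_order_def
  proof (intro exI[of _ 4] conjI ballI impI)
    fix w assume w: "w \<in> D"
    have "hoelder_le UNIV \<beta> (4 * snd (X_space \<kappa> \<beta>) w) (\<lambda>x. dx (ds (snd w)) (x, 1))"
      using jet_surface(2)[OF b, of \<kappa>] w D unfolding jet_def by blast
    then show "hoelder_le_line 1 \<beta> (4 * snd (X_space \<kappa> \<beta>) w ^ 1) (\<lambda>x. ds (snd w) (x, 1))"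
      using d(3,6)[OF w] by (intro hoelder_le_line_1I) auto
  qed simp
qed

lemma of_order_reciprocal_line:
  assumes b: "0 < \<beta>" "\<beta> < 1"
  shows "of_order (near0 \<kappa> \<beta>) (snd (X_space \<kappa> \<beta>)) (hoelder_le_line 1 \<beta>) 1 (\<lambda>w x. 1 / (1 + fst w x) - 1)"
  unfolding of_order_def
proof (intro exI[of _ 144] conjI ballI impI)
  fix w assume w: "w \<in> near0 \<kappa> \<beta>"
  let ?N = "snd (X_space \<kappa> \<beta>) w" and ?g = "\<lambda>x. 1 / (1 + fst w x) - 1"
  have wX: "w \<in> fst (X_space \<kappa> \<beta>)" using w by (auto simp: near0_def)
  have \<eta>: "hoelder_le UNIV \<beta> (4 * ?N) (fst w)" "hoelder_le UNIV \<beta> (4 * ?N) (deriv (fst w))" "4 * ?N \<le> 1 / 2"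
    using w jet_line[OF b] by (auto simp: near0_def jet_def)
  have N0: "0 \<le> ?N" using X_norm_nonneg[OF wX] .
  have g: "hoelder_le UNIV \<beta> (4 * (4 * ?N)) ?g" using \<eta> by (intro hoelder_le_reciprocal)
  have "hoelder_le UNIV \<beta> (\<bar>1\<bar> + 4 * (4 * ?N)) (\<lambda>x. 1 + ?g x)" by (intro hoelder_le_add hoelder_le_const g)
  then have g1: "hoelder_le UNIV \<beta> 3 (\<lambda>x. 1 + ?g x)" by (rule hoelder_le_mono) (use \<eta> in simp)
  have pos: "1 + fst w x > 0" for x using hoelder_le_bound[OF \<eta>(1), of x] \<eta>(3) by auto
  show "hoelder_le_line 1 \<beta> (144 * ?N ^ 1) ?g"
  proof (rule hoelder_le_line_1I[where f' = "\<lambda>x. (-1) * (deriv (fst w) x * ((1 + ?g x) * (1 + ?g x)))"])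
    show "\<bar>?g x\<bar> \<le> 144 * ?N ^ 1" for x using hoelder_le_bound[OF g, of x] N0 by simp
    show "(?g has_real_derivative (-1) * (deriv (fst w) x * ((1 + ?g x) * (1 + ?g x)))) (at x)" for x
      using pos[of x] X_diff(1)[OF wX, of x, folded DERIV_deriv_iff_real_differentiable]
      by (auto intro!: derivative_eq_intros)
    have "hoelder_le UNIV \<beta> (\<bar>-1\<bar> * (2 * ((4 * ?N) * (2 * (3 * 3))))) (\<lambda>x. (-1) * (deriv (fst w) x * ((1 + ?g x) * (1 + ?g x))))"
      using N0 by (intro hoelder_le_scale hoelder_le_mult \<eta> g1) auto
    then show "hoelder_le UNIV \<beta> (144 * ?N ^ 1) (\<lambda>x. (-1) * (deriv (fst w) x * ((1 + ?g x) * (1 + ?g x))))"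
      by (simp only: abs_minus_cancel abs_one mult_1 power_one_right) (simp add: mult.commute)
  qed
qed auto

text \<open>Every product on the right has two factors that vanish with \<open>w\<close>. Replacing \<open>g\<close> by \<open>- \<eta>\<close> in the linear part
  costs \<open>\<eta> g\<close>, since \<open>g + \<eta> + \<eta> g = 0\<close>.\<close>

lemma bernoulli_remainder:
  assumes "(1 + g) * (1 + \<eta>) = (1::real)"
  shows "bernoulli p \<eta> \<eta>x b g - (p * b + (1 - p\<^sup>2) * \<eta>) =
    1/2 * (p + b)\<^sup>2 * (1 + g)\<^sup>2 * (\<eta>x * \<eta>x) + (1/2 * (1 + g) * (1 + g)) * (b * b) + 1/2 * p\<^sup>2 * (g * g)
     + p * (2 + g) * (b * g) + (- p\<^sup>2) * (\<eta> * g)"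
proof -
  have e: "g + \<eta> + \<eta> * g = 0" using assms by (simp add: algebra_simps)
  have "bernoulli p \<eta> \<eta>x b g - (p * b + (1 - p\<^sup>2) * \<eta>) -
    (1/2 * (p + b)\<^sup>2 * (1 + g)\<^sup>2 * (\<eta>x * \<eta>x) + (1/2 * (1 + g) * (1 + g)) * (b * b) + 1/2 * p\<^sup>2 * (g * g)
     + p * (2 + g) * (b * g) + (- p\<^sup>2) * (\<eta> * g)) = p\<^sup>2 * (g + \<eta> + \<eta> * g)"
    unfolding bernoulli_def by (simp add: field_simps power2_eq_square)
  also have "\<dots> = 0" using e by simp
  finally show ?thesis by simp
qed

text \<open>As in \<open>bernoulli_remainder\<close>, the linear part is removed and only products of two small factors remain.\<close>

lemma vorticity_remainder:
  assumes "(1 + g) * (1 + \<eta>) = (1::real)"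
  shows "vorticity \<alpha> s p q g \<eta>x \<eta>xx \<phi> \<phi>s \<phi>ss \<phi>xx \<phi>sx \<phi>xs - (\<phi>xx + \<phi>ss - \<alpha> * \<phi> - s * \<eta>xx * p - 2 * \<eta> * q) =
    (- (s * p)) * (\<eta>xx * g) + (- s * (1 + g)) * (\<eta>xx * \<phi>s) + (s * (1 + g) * (1 + g) * (p + \<phi>s)) * (\<eta>x * \<eta>x)
    + (- s * (1 + g)) * (\<eta>x * \<phi>sx) + (- s * (1 + g)) * (\<eta>x * \<phi>xs)
    + (s * (1 + g) * (1 + g) * (p + \<phi>s)) * (\<eta>x * \<eta>x) + (s * s * (1 + g) * (1 + g) * (q + \<phi>ss)) * (\<eta>x * \<eta>x)
    + (- 2 * q) * (\<eta> * g) + q * (g * g) + (2 + g) * (g * \<phi>ss)"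
proof -
  have e: "g + \<eta> + \<eta> * g = 0" using assms by (simp add: algebra_simps)
  have "vorticity \<alpha> s p q g \<eta>x \<eta>xx \<phi> \<phi>s \<phi>ss \<phi>xx \<phi>sx \<phi>xs - (\<phi>xx + \<phi>ss - \<alpha> * \<phi> - s * \<eta>xx * p - 2 * \<eta> * q) -
    ((- (s * p)) * (\<eta>xx * g) + (- s * (1 + g)) * (\<eta>xx * \<phi>s) + (s * (1 + g) * (1 + g) * (p + \<phi>s)) * (\<eta>x * \<eta>x)
    + (- s * (1 + g)) * (\<eta>x * \<phi>sx) + (- s * (1 + g)) * (\<eta>x * \<phi>xs)
    + (s * (1 + g) * (1 + g) * (p + \<phi>s)) * (\<eta>x * \<eta>x) + (s * s * (1 + g) * (1 + g) * (q + \<phi>ss)) * (\<eta>x * \<eta>x)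
    + (- 2 * q) * (\<eta> * g) + q * (g * g) + (2 + g) * (g * \<phi>ss)) = 2 * q * (g + \<eta> + \<eta> * g)"
    unfolding vorticity_def by (simp add: algebra_simps power2_eq_square)
  also have "\<dots> = 0" using e by simp
  finally show ?thesis by simp
qed

lemma of_order_const': "\<exists>C\<ge>0. bd C f \<Longrightarrow> of_order D n bd 0 (\<lambda>w. f)"
  by (auto intro: of_order_const)

lemma of_orderE:
  assumes "of_order D n bd k f"
  obtains C where "0 \<le> C" "\<And>w. w \<in> D \<Longrightarrow> 0 \<le> n w \<Longrightarrow> bd (C * n w ^ k) (f w)"
  using assms by (auto simp: of_order_def)

lemma hoelder_le_coefficient:
  fixes g :: "real \<Rightarrow> real"
  assumes "0 < \<beta>" "\<beta> < 1" and d: "\<And>s. s \<in> {0..1} \<Longrightarrow> (g has_real_derivative g' s) (at s)" and c: "continuous_on {0..1} g'"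
  shows "\<exists>C\<ge>0. hoelder_le strip \<beta> C (\<lambda>p. g (snd p))"
proof -
  have "continuous_on {0..1} g" using d by (meson DERIV_continuous continuous_at_imp_continuous_on)
  then have "bounded (g ` {0..1})" by (intro compact_imp_bounded compact_continuous_image) auto
  then obtain B where B: "\<And>s. s \<in> {0..1} \<Longrightarrow> \<bar>g s\<bar> \<le> B" 
    unfolding bounded_iff by (metis imageI real_norm_def)
  have "bounded (g' ` {0..1})" using c by (intro compact_imp_bounded compact_continuous_image) auto
  then obtain L where L: "\<And>s. s \<in> {0..1} \<Longrightarrow> \<bar>g' s\<bar> \<le> L"
    unfolding bounded_iff by (metis imageI real_norm_def)
  have B0: "0 \<le> B" and L0: "0 \<le> L" using B[of 0] L[of 0] by auto
  have l: "\<bar>g (snd p) - g (snd q)\<bar> \<le> L * dist p q" if "p \<in> strip" "q \<in> strip" for p q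
  proof -
    have "norm (g (snd p) - g (snd q)) \<le> L * norm (snd p - snd q)"
      by (rule field_differentiable_bound[of "{0..1}" g g'])
        (use that d L in \<open>auto simp: strip_def intro: has_field_derivative_at_within\<close>)
    also have "\<dots> \<le> L * dist p q" using L0 dist_snd_le[of p q] by (intro mult_left_mono) (auto simp: dist_norm)
    finally show ?thesis by simp
  qed
  have "hoelder_le strip \<beta> (2 * B + L) (\<lambda>p. g (snd p))"
    by (intro hoelder_le_lipschitz assms(1,2) B0 L0 l) (auto simp: strip_def intro!: B)
  then show ?thesis using B0 L0 by (intro exI[of _ "2 * B + L"]) auto
qed

lemma psi0ss_deriv: "(psi0ss \<Lambda> has_real_derivative - \<bar>fst (snd \<Lambda>)\<bar> * psi0s \<Lambda> s) (at s within S)"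
  by (cases \<Lambda>) (auto simp: psi0ss_def psi0s_def intro!: derivative_eq_intros)

lemma psi0_continuous: "continuous_on S (psi0s \<Lambda>)" "continuous_on S (psi0ss \<Lambda>)"
  using psi0s_deriv psi0ss_deriv by (meson DERIV_continuous_on)+

lemma of_order_coefficients:
  assumes b: "0 < \<beta>" "\<beta> < 1"
  shows "of_order D n (hoelder_le strip \<beta>) 0 (\<lambda>w p. snd p)"
    "of_order D n (hoelder_le strip \<beta>) 0 (\<lambda>w p. psi0s \<Lambda> (snd p))" "of_order D n (hoelder_le strip \<beta>) 0 (\<lambda>w p. psi0ss \<Lambda> (snd p))"
proof -
  have "\<exists>C\<ge>0. hoelder_le strip \<beta> C (\<lambda>p. snd p)"
    by (rule hoelder_le_coefficient[OF b, where g' = "\<lambda>s. 1"]) auto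
  moreover have "\<exists>C\<ge>0. hoelder_le strip \<beta> C (\<lambda>p. psi0s \<Lambda> (snd p))"
    by (rule hoelder_le_coefficient[OF b psi0s_deriv psi0_continuous(2)])
  moreover have "\<exists>C\<ge>0. hoelder_le strip \<beta> C (\<lambda>p. psi0ss \<Lambda> (snd p))"
    by (rule hoelder_le_coefficient[OF b psi0ss_deriv]) (intro continuous_intros psi0_continuous)
  ultimately show "of_order D n (hoelder_le strip \<beta>) 0 (\<lambda>w p. snd p)"
    "of_order D n (hoelder_le strip \<beta>) 0 (\<lambda>w p. psi0s \<Lambda> (snd p))" "of_order D n (hoelder_le strip \<beta>) 0 (\<lambda>w p. psi0ss \<Lambda> (snd p))"
    by (simp_all add: of_order_const')
qed

lemma of_order_cong_hoelder_le:
  assumes "of_order D n (hoelder_le S \<beta>) k f" "\<And>w p. w \<in> D \<Longrightarrow> p \<in> S \<Longrightarrow> f w p = g w p"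
  shows "of_order D n (hoelder_le S \<beta>) k g"
  using assms unfolding of_order_def by (meson hoelder_le_cong)

lemma of_order_cong_line:
  assumes "of_order D n bd k f" "\<And>w. w \<in> D \<Longrightarrow> f w = g w"
  shows "of_order D n bd k g"
  using assms unfolding of_order_def by auto

lemma L_op_of_order:
  assumes b: "0 < \<beta>" "\<beta> < 1"
  shows "of_order (fst (X_space \<kappa> \<beta>)) (snd (X_space \<kappa> \<beta>)) (hoelder_le_line 1 \<beta>) 1 (\<lambda>w. fst (L_op \<Lambda> w))"
    "of_order (fst (X_space \<kappa> \<beta>)) (snd (X_space \<kappa> \<beta>)) (hoelder_le strip \<beta>) 1 (\<lambda>w. snd (L_op \<Lambda> w))"
proof -
  let ?X = "fst (X_space \<kappa> \<beta>)" and ?n = "snd (X_space \<kappa> \<beta>)"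
  note al = bd_algebra_line[OF b] and ah = bd_algebra_hoelder_le[of strip \<beta>]
  have "of_order ?X ?n (hoelder_le_line 1 \<beta>) 1 (\<lambda>w x. psi0s \<Lambda> 1 * ds (snd w) (x, 1) + (1 - (psi0s \<Lambda> 1)\<^sup>2) * fst w x)"
    by (intro of_order_add of_order_lin al of_order_num of_order_line b subset_refl)
  then show "of_order ?X ?n (hoelder_le_line 1 \<beta>) 1 (\<lambda>w. fst (L_op \<Lambda> w))" by (simp add: L_op_def)
  have "of_order ?X ?n (hoelder_le strip \<beta>) 1 (\<lambda>w p. dx (dx (snd w)) p + ds (ds (snd w)) p + (- fst (snd \<Lambda>)) * snd w p
        + ((-1) * (snd p * psi0s \<Lambda> (snd p))) * deriv (deriv (fst w)) (fst p)
        + ((-2) * psi0ss \<Lambda> (snd p)) * fst w (fst p))"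
    by (intro of_order_add of_order_lin ah of_order_num of_order_prod0 of_order_coefficients b of_order_jet jet_strip jet_eta subset_refl)
  then show "of_order ?X ?n (hoelder_le strip \<beta>) 1 (\<lambda>w. snd (L_op \<Lambda> w))"
    by (rule of_order_cong_hoelder_le) (auto simp: L_op_def split: prod.splits)
qed

lemma L_op_in_Y:
  assumes b: "0 < \<beta>" "\<beta> < 1" and w: "w \<in> fst (X_space \<kappa> \<beta>)"
  shows "L_op \<Lambda> w \<in> fst (Y_space \<kappa> \<beta>)"
proof -
  obtain B where B: "hoelder_le_line 1 \<beta> B (fst (L_op \<Lambda> w))"
    by (rule of_orderE[OF L_op_of_order(1)[OF b, of \<kappa> \<Lambda>]]) (use w X_norm_nonneg[OF w] in blast)
  obtain C where "hoelder_le strip \<beta> C (snd (L_op \<Lambda> w))"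
    by (rule of_orderE[OF L_op_of_order(2)[OF b, of \<kappa> \<Lambda>]]) (use w X_norm_nonneg[OF w] in blast)
  then have C: "hoelder_le_strip 0 \<beta> C (snd (L_op \<Lambda> w))" by (auto simp: L_op_def on_strip_def)
  show ?thesis
    using hoelder_le_line_norm_le[OF B] hoelder_le_strip_norm_le[OF C] X_line_symmetric[OF w] X_strip_symmetric[OF w]
    by (auto simp: Y_carrier C_line_def C_strip_def simp del: hoelder_line.simps hoelder_strip.simps)
      (auto simp: L_op_def on_strip_def)
qed

lemma L_op_add:
  assumes u: "u \<in> fst (X_space \<kappa> \<beta>)" and v: "v \<in> fst (X_space \<kappa> \<beta>)"
  shows "L_op \<Lambda> (u + v) = L_op \<Lambda> u + L_op \<Lambda> v"
  using X_diff[OF u] X_diff[OF v]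
  by (auto simp: L_op_def fun_plus_eta dx_ds_add deriv_fun_add prod_eq_iff fun_eq_iff on_strip_def algebra_simps
      split: prod.splits)

lemma L_op_scale:
  assumes u: "u \<in> fst (X_space \<kappa> \<beta>)"
  shows "L_op \<Lambda> (c *\<^sub>R u) = c *\<^sub>R L_op \<Lambda> u"
  using X_diff[OF u]
  by (auto simp: L_op_def fun_plus_eta dx_ds_scale deriv_fun_scale prod_eq_iff fun_eq_iff on_strip_def algebra_simps
      split: prod.splits)

lemma L_op_bounded:
  assumes b: "0 < \<beta>" "\<beta> < 1"
  shows "bounded_linear_between (X_space \<kappa> \<beta>) (Y_space \<kappa> \<beta>) (L_op \<Lambda>)"
proof -
  obtain B where B: "0 \<le> B" "\<And>w. w \<in> fst (X_space \<kappa> \<beta>) \<Longrightarrow> hoelder_le_line 1 \<beta> (B * snd (X_space \<kappa> \<beta>) w ^ 1) (fst (L_op \<Lambda> w))"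
    by (rule of_orderE[OF L_op_of_order(1)[OF b, of \<kappa> \<Lambda>]]) (use X_norm_nonneg in blast)
  obtain C where C: "0 \<le> C" "\<And>w. w \<in> fst (X_space \<kappa> \<beta>) \<Longrightarrow> hoelder_le strip \<beta> (C * snd (X_space \<kappa> \<beta>) w ^ 1) (snd (L_op \<Lambda> w))"
    by (rule of_orderE[OF L_op_of_order(2)[OF b, of \<kappa> \<Lambda>]]) (use X_norm_nonneg in blast)
  have "snd (Y_space \<kappa> \<beta>) (L_op \<Lambda> w) \<le> 5 * (B + C) * snd (X_space \<kappa> \<beta>) w" if w: "w \<in> fst (X_space \<kappa> \<beta>)" for w
  proof -
    have "B * snd (X_space \<kappa> \<beta>) w ^ 1 \<le> (B + C) * snd (X_space \<kappa> \<beta>) w"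
      "C * snd (X_space \<kappa> \<beta>) w ^ 1 \<le> (B + C) * snd (X_space \<kappa> \<beta>) w"
      using B(1) C(1) X_norm_nonneg[OF w] by (auto intro!: mult_right_mono)
    then have "hoelder_le_line 1 \<beta> ((B + C) * snd (X_space \<kappa> \<beta>) w) (fst (L_op \<Lambda> w))"
      "hoelder_le strip \<beta> ((B + C) * snd (X_space \<kappa> \<beta>) w) (snd (L_op \<Lambda> w))"
      using B(2)[OF w] C(2)[OF w] hoelder_le_line_mono hoelder_le_mono by blast+
    moreover from this(2) have "hoelder_le_strip 0 \<beta> ((B + C) * snd (X_space \<kappa> \<beta>) w) (snd (L_op \<Lambda> w))"
      by (auto simp: L_op_def on_strip_def)
    ultimately have "snd (Y_space \<kappa> \<beta>) (L_op \<Lambda> w) \<le> 5 * ((B + C) * snd (X_space \<kappa> \<beta>) w)" by (intro Y_norm_le)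
    then show ?thesis by (simp only: mult.assoc)
  qed
  then show ?thesis unfolding bounded_linear_between_def
    using L_op_in_Y[OF b] L_op_add L_op_scale by blast
qed

lemma zero_in_O: "0 \<in> O_set \<kappa> \<beta>"
  using subspace_0[OF subspace_X[of \<kappa> \<beta>]] by (auto simp: O_set_def zero_prod_def)

lemma L_op_zero: "L_op \<Lambda> 0 = 0"
  using L_op_scale[OF subspace_0[OF subspace_X], of \<Lambda> 0] by simp

lemma jets_zero: "deriv 0 = (0 :: real \<Rightarrow> real)" "dx 0 = 0" "ds 0 = 0"
proof -
  show "deriv 0 = (0 :: real \<Rightarrow> real)" by (simp add: zero_fun_def)
  show "dx 0 = 0" "ds 0 = 0"
    using dx_eqI[of "0" "\<lambda>x. 0"] ds_eqI[of "0" "\<lambda>x. 0"] by (auto simp: on_strip_def zero_fun_def)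
qed

lemma F_map_0: assumes "\<Lambda> \<in> U_set" shows "F_map 0 \<Lambda> = 0"
proof -
  have "F1 0 \<Lambda> x = 0" for x
    unfolding F1_bernoulli[OF zero_in_O assms] by (simp add: jets_zero bernoulli_def)
  moreover have "F2 0 \<Lambda> p = 0" for p
  proof (cases "p \<in> strip")
    case True
    then obtain x s where p: "p = (x, s)" "s \<in> {0..1}" by (cases p) auto
    show ?thesis unfolding p(1) F2_vorticity[OF zero_in_O assms p(2)] by (simp add: jets_zero vorticity_def)
  qed (rule F2_off)
  ultimately show ?thesis by (simp add: F_map_def zero_prod_def fun_eq_iff)
qed

lemma F_remainder_of_order:
  assumes b: "0 < \<beta>" "\<beta> < 1" and U: "\<Lambda> \<in> U_set"
  shows "of_order (near0 \<kappa> \<beta> \<inter> O_set \<kappa> \<beta>) (snd (X_space \<kappa> \<beta>)) (hoelder_le_line 1 \<beta>) 2 (\<lambda>w. fst (F_map w \<Lambda> - L_op \<Lambda> w))"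
    "of_order (near0 \<kappa> \<beta> \<inter> O_set \<kappa> \<beta>) (snd (X_space \<kappa> \<beta>)) (hoelder_le strip \<beta>) 2 (\<lambda>w. snd (F_map w \<Lambda> - L_op \<Lambda> w))"
proof -
  let ?D = "near0 \<kappa> \<beta> \<inter> O_set \<kappa> \<beta>" and ?n = "snd (X_space \<kappa> \<beta>)"
  let ?p = "psi0s \<Lambda> 1"
  have D: "?D \<subseteq> fst (X_space \<kappa> \<beta>)" and n1: "w \<in> ?D \<Longrightarrow> ?n w \<le> 1" for w by (auto simp: near0_def)
  note al = bd_algebra_line[OF b] and ah = bd_algebra_hoelder_le[of strip \<beta>]
  have sub: "of_order ?D ?n bd k f" if "of_order (near0 \<kappa> \<beta>) ?n bd k f" for bd :: "real \<Rightarrow> ('q \<Rightarrow> real) \<Rightarrow> bool" and k f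
    using that unfolding of_order_def by blast
  have inv: "(1 + (1 / (1 + fst w x) - 1)) * (1 + fst w x) = 1" if "w \<in> ?D" for w x
  proof -
    have "fst w x > -1" using that by (auto simp: O_set_def)
    then show ?thesis by (simp add: field_simps)
  qed
  define g where "g w x = 1 / (1 + fst w x) - 1" for w :: fpair and x
  have gl: "of_order ?D ?n (hoelder_le_line 1 \<beta>) 1 g" and gh: "of_order ?D ?n (hoelder_le strip \<beta>) 1 (\<lambda>w p. g w (fst p))"
    unfolding g_def by (intro sub of_order_reciprocal_line of_order_reciprocal_strip b)+
  note l = of_order_line[OF b D]
  note l0 = l[THEN of_order_bounded[OF al _ n1]] gl[THEN of_order_bounded[OF al _ n1]]
  have "of_order ?D ?n (hoelder_le_line 1 \<beta>) 2 (\<lambda>w x.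
      1/2 * ((?p + ds (snd w) (x, 1)) * (?p + ds (snd w) (x, 1))) * ((1 + g w x) * (1 + g w x)) * (deriv (fst w) x * deriv (fst w) x)
      + (1/2 * (1 + g w x) * (1 + g w x)) * (ds (snd w) (x, 1) * ds (snd w) (x, 1)) + 1/2 * (?p * ?p) * (g w x * g w x)
      + ?p * (2 + g w x) * (ds (snd w) (x, 1) * g w x) + (- (?p * ?p)) * (fst w x * g w x))"
    by (intro of_order_add[OF al] of_order_quad[OF al] of_order_prod0[OF al] of_order_num[OF al] l l0 gl)
  then show "of_order ?D ?n (hoelder_le_line 1 \<beta>) 2 (\<lambda>w. fst (F_map w \<Lambda> - L_op \<Lambda> w))"
  proof (rule of_order_cong_line)
    fix w assume w: "w \<in> ?D"
    then have wO: "w \<in> O_set \<kappa> \<beta>" by simp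
    show "(\<lambda>x. 1/2 * ((?p + ds (snd w) (x, 1)) * (?p + ds (snd w) (x, 1))) * ((1 + g w x) * (1 + g w x)) * (deriv (fst w) x * deriv (fst w) x)
      + (1/2 * (1 + g w x) * (1 + g w x)) * (ds (snd w) (x, 1) * ds (snd w) (x, 1)) + 1/2 * (?p * ?p) * (g w x * g w x)
      + ?p * (2 + g w x) * (ds (snd w) (x, 1) * g w x) + (- (?p * ?p)) * (fst w x * g w x)) = fst (F_map w \<Lambda> - L_op \<Lambda> w)"
      using bernoulli_remainder[OF inv[OF w]]
      by (simp add: fun_eq_iff F_map_def L_op_def F1_bernoulli[OF wO U] g_def[symmetric] power2_eq_square)
  qed
  note j = jet_strip[OF b, THEN of_order_jet, OF D] jet_eta[OF b, THEN of_order_jet, OF D]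
  note j0 = j[THEN of_order_bounded[OF ah _ n1]] gh[THEN of_order_bounded[OF ah _ n1]]
  note c = of_order_coefficients[OF b]
  let ?P = "\<lambda>p. psi0s \<Lambda> (snd p)" and ?Q = "\<lambda>p. psi0ss \<Lambda> (snd p)"
  have "of_order ?D ?n (hoelder_le strip \<beta>) 2 (\<lambda>w p.
     (-1 * (snd p * ?P p)) * (deriv (deriv (fst w)) (fst p) * g w (fst p))
     + (-1 * snd p * (1 + g w (fst p))) * (deriv (deriv (fst w)) (fst p) * ds (snd w) p)
     + (snd p * (1 + g w (fst p)) * (1 + g w (fst p)) * (?P p + ds (snd w) p)) * (deriv (fst w) (fst p) * deriv (fst w) (fst p))
     + (-1 * snd p * (1 + g w (fst p))) * (deriv (fst w) (fst p) * dx (ds (snd w)) p)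
     + (-1 * snd p * (1 + g w (fst p))) * (deriv (fst w) (fst p) * ds (dx (snd w)) p)
     + (snd p * (1 + g w (fst p)) * (1 + g w (fst p)) * (?P p + ds (snd w) p)) * (deriv (fst w) (fst p) * deriv (fst w) (fst p))
     + (snd p * snd p * (1 + g w (fst p)) * (1 + g w (fst p)) * (?Q p + ds (ds (snd w)) p)) * (deriv (fst w) (fst p) * deriv (fst w) (fst p))
     + (-2 * ?Q p) * (fst w (fst p) * g w (fst p)) + ?Q p * (g w (fst p) * g w (fst p))
     + (2 + g w (fst p)) * (g w (fst p) * ds (ds (snd w)) p))"
    by (intro of_order_add[OF ah] of_order_quad[OF ah] of_order_prod0[OF ah] of_order_num[OF ah] j j0 gh c)
  then show "of_order ?D ?n (hoelder_le strip \<beta>) 2 (\<lambda>w. snd (F_map w \<Lambda> - L_op \<Lambda> w))"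
  proof (rule of_order_cong_hoelder_le)
    fix w p assume w: "w \<in> ?D" and "p \<in> strip"
    then obtain x s where p: "p = (x, s)" "s \<in> {0..1}" by (cases p) auto
    have wO: "w \<in> O_set \<kappa> \<beta>" using w by simp
    show "(-1 * (snd p * ?P p)) * (deriv (deriv (fst w)) (fst p) * g w (fst p))
     + (-1 * snd p * (1 + g w (fst p))) * (deriv (deriv (fst w)) (fst p) * ds (snd w) p)
     + (snd p * (1 + g w (fst p)) * (1 + g w (fst p)) * (?P p + ds (snd w) p)) * (deriv (fst w) (fst p) * deriv (fst w) (fst p))
     + (-1 * snd p * (1 + g w (fst p))) * (deriv (fst w) (fst p) * dx (ds (snd w)) p)
     + (-1 * snd p * (1 + g w (fst p))) * (deriv (fst w) (fst p) * ds (dx (snd w)) p)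
     + (snd p * (1 + g w (fst p)) * (1 + g w (fst p)) * (?P p + ds (snd w) p)) * (deriv (fst w) (fst p) * deriv (fst w) (fst p))
     + (snd p * snd p * (1 + g w (fst p)) * (1 + g w (fst p)) * (?Q p + ds (ds (snd w)) p)) * (deriv (fst w) (fst p) * deriv (fst w) (fst p))
     + (-2 * ?Q p) * (fst w (fst p) * g w (fst p)) + ?Q p * (g w (fst p) * g w (fst p))
     + (2 + g w (fst p)) * (g w (fst p) * ds (ds (snd w)) p) = snd (F_map w \<Lambda> - L_op \<Lambda> w) p"
      using vorticity_remainder[OF inv[OF w]] p(2)
      by (simp add: p(1) F_map_def L_op_def F2_vorticity[OF wO U p(2)] g_def[symmetric])
  qed
qed

text \<open>\<open>L_op\<close> is a Frechet derivative because the remainder is of second order by \<open>F_remainder_of_order\<close>.\<close>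

lemma has_fderiv_F:
  assumes b: "0 < \<beta>" "\<beta> < 1" and U: "\<Lambda> \<in> U_set"
  shows "has_fderiv (X_space \<kappa> \<beta>) (Y_space \<kappa> \<beta>) (O_set \<kappa> \<beta>) (\<lambda>w. F_map w \<Lambda>) (L_op \<Lambda>) 0"
  unfolding has_fderiv_def
proof (intro conjI L_op_bounded[OF b] allI impI)
  let ?D = "near0 \<kappa> \<beta> \<inter> O_set \<kappa> \<beta>" and ?n = "snd (X_space \<kappa> \<beta>)"
  obtain A where A: "0 \<le> A" "\<And>w. w \<in> ?D \<Longrightarrow> 0 \<le> ?n w \<Longrightarrow> hoelder_le_line 1 \<beta> (A * ?n w ^ 2) (fst (F_map w \<Lambda> - L_op \<Lambda> w))"
    using of_orderE[OF F_remainder_of_order(1)[OF b U, of \<kappa>]] by blast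
  obtain C where C: "0 \<le> C" "\<And>w. w \<in> ?D \<Longrightarrow> 0 \<le> ?n w \<Longrightarrow> hoelder_le strip \<beta> (C * ?n w ^ 2) (snd (F_map w \<Lambda> - L_op \<Lambda> w))"
    using of_orderE[OF F_remainder_of_order(2)[OF b U, of \<kappa>]] by blast
  fix e :: real assume e: "e > 0"
  define K where "K = 5 * (A + C) + 1"
  have K: "K > 0" using A(1) C(1) by (simp add: K_def)
  show "\<exists>d>0. \<forall>h\<in>fst (X_space \<kappa> \<beta>). ?n h < d \<and> 0 + h \<in> O_set \<kappa> \<beta> \<longrightarrow>
      snd (Y_space \<kappa> \<beta>) (F_map (0 + h) \<Lambda> - F_map 0 \<Lambda> - L_op \<Lambda> h) \<le> e * ?n h"
  proof (intro exI[of _ "min (1 / 8) (e / K)"] conjI ballI impI)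
    fix h assume h: "h \<in> fst (X_space \<kappa> \<beta>)" and "?n h < min (1 / 8) (e / K) \<and> 0 + h \<in> O_set \<kappa> \<beta>"
    then have hD: "h \<in> ?D" and nK: "?n h \<le> e / K" by (auto simp: near0_def)
    note n0 = X_norm_nonneg[OF h]
    have "A * ?n h ^ 2 \<le> (A + C) * ?n h ^ 2" "C * ?n h ^ 2 \<le> (A + C) * ?n h ^ 2"
      using A(1) C(1) by (auto intro!: mult_right_mono)
    then have "hoelder_le_line 1 \<beta> ((A + C) * ?n h ^ 2) (fst (F_map h \<Lambda> - L_op \<Lambda> h))"
      and "hoelder_le strip \<beta> ((A + C) * ?n h ^ 2) (snd (F_map h \<Lambda> - L_op \<Lambda> h))"
      using A(2)[OF hD n0] C(2)[OF hD n0] hoelder_le_line_mono hoelder_le_mono by blast+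
    moreover from this(2) have "hoelder_le_strip 0 \<beta> ((A + C) * ?n h ^ 2) (snd (F_map h \<Lambda> - L_op \<Lambda> h))"
      by (auto simp: L_op_def on_strip_def F_map_def F2_off)
    ultimately have "snd (Y_space \<kappa> \<beta>) (F_map h \<Lambda> - L_op \<Lambda> h) \<le> 5 * ((A + C) * ?n h ^ 2)"
      by (intro Y_norm_le)
    also have "\<dots> \<le> K * ?n h ^ 2" using n0 by (simp add: K_def distrib_right)
    also have "\<dots> = (K * ?n h) * ?n h" by (simp add: power2_eq_square)
    also have "\<dots> \<le> e * ?n h" using nK K n0 by (intro mult_right_mono) (auto simp: field_simps)
    finally show "snd (Y_space \<kappa> \<beta>) (F_map (0 + h) \<Lambda> - F_map 0 \<Lambda> - L_op \<Lambda> h) \<le> e * ?n h"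
      by (simp add: F_map_0[OF U])
  qed (use e K in simp)
qed

section \<open>Families of functions depending differentiably on a parameter\<close>

text \<open>\<open>f P q\<close> is \<open>k\<close> times continuously differentiable in the parameter \<open>P\<close>, jointly continuously in the point \<open>q\<close>.
  This is what differentiation under the integral sign over \<open>q\<close> requires. Directional derivatives are used
  in the recursion so that every level concerns real-valued families.\<close>

primrec Ck_fam :: "nat \<Rightarrow> 'p::euclidean_space set \<Rightarrow> 'q::topological_space set \<Rightarrow> ('p \<Rightarrow> 'q \<Rightarrow> real) \<Rightarrow> bool" where
  "Ck_fam 0 U Q f \<longleftrightarrow> continuous_on (U \<times> Q) (\<lambda>(P, q). f P q)"
| "Ck_fam (Suc k) U Q f \<longleftrightarrow> continuous_on (U \<times> Q) (\<lambda>(P, q). f P q) \<and>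
     (\<exists>D. (\<forall>P\<in>U. \<forall>q\<in>Q. ((\<lambda>P. f P q) has_derivative D P q) (at P)) \<and> (\<forall>h. Ck_fam k U Q (\<lambda>P q. D P q h)))"

lemma Ck_fam_continuous: "Ck_fam k U Q f \<Longrightarrow> continuous_on (U \<times> Q) (\<lambda>(P, q). f P q)"
  by (cases k) auto

lemma Ck_fam_down: "Ck_fam (Suc k) U Q f \<Longrightarrow> Ck_fam k U Q f"
proof (induction k arbitrary: f)
  case (Suc k)
  then show ?case by (simp only: Ck_fam.simps(2)) blast
qed simp

lemma Ck_fam_cong:
  assumes f: "Ck_fam k U Q f" and U: "open U" and eq: "\<And>P q. P \<in> U \<Longrightarrow> q \<in> Q \<Longrightarrow> f P q = g P q"
  shows "Ck_fam k U Q g"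
proof -
  have c: "continuous_on (U \<times> Q) (\<lambda>(P, q). g P q)"
    using Ck_fam_continuous[OF f] by (rule continuous_on_eq) (auto simp: eq)
  show ?thesis
  proof (cases k)
    case (Suc m)
    then obtain D where D: "\<And>P q. P \<in> U \<Longrightarrow> q \<in> Q \<Longrightarrow> ((\<lambda>P. f P q) has_derivative D P q) (at P)"
      "\<And>h. Ck_fam m U Q (\<lambda>P q. D P q h)" using f by auto
    have "((\<lambda>P. g P q) has_derivative D P q) (at P)" if "P \<in> U" "q \<in> Q" for P q
      using has_derivative_transform_within_open[OF D(1)[OF that] U that(1)] eq that by auto
    then show ?thesis using c D(2) Suc by (simp only: Ck_fam.simps(2)) blast
  qed (use c in simp)
qed

lemma Ck_fam_add: "Ck_fam k U Q f \<Longrightarrow> Ck_fam k U Q g \<Longrightarrow> Ck_fam k U Q (\<lambda>P q. f P q + g P q)"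
proof (induction k arbitrary: f g)
  case 0
  then show ?case using continuous_on_add by (fastforce simp: case_prod_unfold)
next
  case (Suc k)
  obtain D where D: "\<And>P q. P \<in> U \<Longrightarrow> q \<in> Q \<Longrightarrow> ((\<lambda>P. f P q) has_derivative D P q) (at P)"
      "\<And>h. Ck_fam k U Q (\<lambda>P q. D P q h)" using Suc.prems(1) by auto
  obtain E where E: "\<And>P q. P \<in> U \<Longrightarrow> q \<in> Q \<Longrightarrow> ((\<lambda>P. g P q) has_derivative E P q) (at P)"
      "\<And>h. Ck_fam k U Q (\<lambda>P q. E P q h)" using Suc.prems(2) by auto
  have "continuous_on (U \<times> Q) (\<lambda>(P, q). f P q + g P q)"
    using continuous_on_add[OF Ck_fam_continuous[OF Suc.prems(1)] Ck_fam_continuous[OF Suc.prems(2)]]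
    by (simp add: case_prod_unfold)
  then show ?case unfolding Ck_fam.simps(2) using D E Suc.IH
    by (intro conjI exI[of _ "\<lambda>P q h. D P q h + E P q h"]) (auto intro: has_derivative_add)
qed

lemma Ck_fam_mult: "Ck_fam k U Q f \<Longrightarrow> Ck_fam k U Q g \<Longrightarrow> Ck_fam k U Q (\<lambda>P q. f P q * g P q)"
proof (induction k arbitrary: f g)
  case 0
  then show ?case using continuous_on_mult by (fastforce simp: case_prod_unfold)
next
  case (Suc k)
  obtain D where D: "\<And>P q. P \<in> U \<Longrightarrow> q \<in> Q \<Longrightarrow> ((\<lambda>P. f P q) has_derivative D P q) (at P)"
      "\<And>h. Ck_fam k U Q (\<lambda>P q. D P q h)" using Suc.prems(1) by auto
  obtain E where E: "\<And>P q. P \<in> U \<Longrightarrow> q \<in> Q \<Longrightarrow> ((\<lambda>P. g P q) has_derivative E P q) (at P)"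
      "\<And>h. Ck_fam k U Q (\<lambda>P q. E P q h)" using Suc.prems(2) by auto
  have c: "continuous_on (U \<times> Q) (\<lambda>(P, q). f P q * g P q)"
    using continuous_on_mult[OF Ck_fam_continuous[OF Suc.prems(1)] Ck_fam_continuous[OF Suc.prems(2)]]
    by (simp add: case_prod_unfold)
  have d: "Ck_fam k U Q (\<lambda>P q. f P q * E P q h + D P q h * g P q)" for h
    by (rule Ck_fam_add[OF Suc.IH[OF Ck_fam_down[OF Suc.prems(1)] E(2)] Suc.IH[OF D(2) Ck_fam_down[OF Suc.prems(2)]]])
  show ?case unfolding Ck_fam.simps(2) using D(1) E(1) d c
    by (intro conjI exI[of _ "\<lambda>P q h. f P q * E P q h + D P q h * g P q"]) (auto intro: has_derivative_mult)
qed

lemma Ck_fam_fixed: "continuous_on Q g \<Longrightarrow> Ck_fam k U Q (\<lambda>P q. g q)"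
proof (induction k arbitrary: g)
  case 0
  have "continuous_on (U \<times> Q) (\<lambda>x. g (snd x))"
    by (rule continuous_on_compose2[OF 0]) (auto intro: continuous_intros)
  then show ?case by (simp add: case_prod_unfold)
next
  case (Suc k)
  have "Ck_fam k U Q (\<lambda>P q. 0)" using Suc.IH[of "\<lambda>q. 0"] by simp
  moreover have "continuous_on (U \<times> Q) (\<lambda>x. g (snd x))"
    by (rule continuous_on_compose2[OF Suc.prems]) (auto intro: continuous_intros)
  ultimately show ?case
    by (auto simp: case_prod_unfold intro!: exI[of _ "\<lambda>P q h. 0"])
qed

lemma Ck_fam_const: "Ck_fam k U Q (\<lambda>P q. c)"
  by (rule Ck_fam_fixed) simp

lemma Ck_fam_linear: assumes "bounded_linear f" shows "Ck_fam k U Q (\<lambda>P q. f P)"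
proof -
  have "continuous_on (U \<times> Q) (\<lambda>x. f (fst x))"
    by (intro bounded_linear.continuous_on[OF assms] continuous_intros)
  then show ?thesis
    by (cases k) (auto simp: case_prod_unfold Ck_fam_const intro!: exI[of _ "\<lambda>P q. f"] bounded_linear_imp_has_derivative assms)
qed

text \<open>The outer function comes with all its derivatives \<open>F n\<close>, so that the induction on \<open>k\<close> can pass from \<open>F n\<close> to
  \<open>F (Suc n)\<close>. It is used for cosine and for real powers, whose derivatives have closed forms.\<close>

lemma Ck_fam_compose:
  assumes F: "\<And>n x. x \<in> T \<Longrightarrow> (F n has_real_derivative F (Suc n) x) (at x)"
    and "\<And>P q. P \<in> U \<Longrightarrow> q \<in> Q \<Longrightarrow> f P q \<in> T" and "Ck_fam k U Q f"
  shows "Ck_fam k U Q (\<lambda>P q. F n (f P q))"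
  using assms(2,3)
proof (induction k arbitrary: n)
  case 0
  have "continuous_on T (F n)" using F by (meson DERIV_continuous continuous_at_imp_continuous_on)
  then have "continuous_on (U \<times> Q) (\<lambda>x. F n (case x of (P, q) \<Rightarrow> f P q))"
    by (rule continuous_on_compose2) (use 0 in auto)
  then show ?case by (simp add: case_prod_unfold)
next
  case (Suc k)
  obtain D where D: "\<And>P q. P \<in> U \<Longrightarrow> q \<in> Q \<Longrightarrow> ((\<lambda>P. f P q) has_derivative D P q) (at P)"
      "\<And>h. Ck_fam k U Q (\<lambda>P q. D P q h)" using Suc.prems(2) by auto
  have "continuous_on T (F n)" using F by (meson DERIV_continuous continuous_at_imp_continuous_on)
  then have "continuous_on (U \<times> Q) (\<lambda>x. F n (case x of (P, q) \<Rightarrow> f P q))"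
    by (rule continuous_on_compose2) (use Suc.prems(1) Ck_fam_continuous[OF Suc.prems(2)] in auto)
  moreover have "Ck_fam k U Q (\<lambda>P q. F (Suc n) (f P q) * D P q h)" for h
    by (rule Ck_fam_mult[OF Suc.IH[OF Suc.prems(1) Ck_fam_down[OF Suc.prems(2)]] D(2)])
  moreover have "((\<lambda>P. F n (f P q)) has_derivative (\<lambda>h. F (Suc n) (f P q) * D P q h)) (at P)"
    if "P \<in> U" "q \<in> Q" for P q
  proof -
    have "(F n has_derivative (\<lambda>y. F (Suc n) (f P q) * y)) (at (f P q))"
      using F[OF Suc.prems(1)[OF that]] by (simp add: has_field_derivative_def)
    from has_derivative_compose[OF D(1)[OF that] this] show ?thesis .
  qed
  ultimately show ?case unfolding Ck_fam.simps(2)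
    by (intro conjI exI[of _ "\<lambda>P q h. F (Suc n) (f P q) * D P q h"]) (auto simp: case_prod_unfold)
qed

lemma Ck_fam_cos_shift:
  assumes "Ck_fam k U Q f" shows "Ck_fam k U Q (\<lambda>P q. cos (f P q + real n * (pi / 2)))"
proof (rule Ck_fam_compose[where T = UNIV and F = "\<lambda>n x. cos (x + real n * (pi / 2))", OF _ _ assms])
  fix n and x :: real
  have "cos (x + real (Suc n) * (pi / 2)) = - sin (x + real n * (pi / 2))"
  proof -
    have "x + real (Suc n) * (pi / 2) = (x + real n * (pi / 2)) + pi / 2" by (simp add: distrib_right)
    then show ?thesis by (simp only: cos_add) simp
  qed
  moreover have "((\<lambda>x. cos (x + c)) has_real_derivative - sin (x + c)) (at x)" for c
    by (auto intro!: derivative_eq_intros)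
  ultimately show "((\<lambda>x. cos (x + real n * (pi / 2))) has_real_derivative cos (x + real (Suc n) * (pi / 2))) (at x)"
    by (simp only:)
qed simp

lemma Ck_fam_cos: "Ck_fam k U Q f \<Longrightarrow> Ck_fam k U Q (\<lambda>P q. cos (f P q))"
  using Ck_fam_cos_shift[of k U Q f 0] by simp

lemma Ck_fam_sin: assumes "Ck_fam k U Q f" shows "Ck_fam k U Q (\<lambda>P q. sin (f P q))"
proof -
  have "sin x = (-1) * cos (x + real 1 * (pi / 2))" for x by (simp add: cos_add)
  moreover have "Ck_fam k U Q (\<lambda>P q. (-1) * cos (f P q + real 1 * (pi / 2)))"
    by (rule Ck_fam_mult[OF Ck_fam_const Ck_fam_cos_shift[OF assms]])
  ultimately show ?thesis by simp
qed

lemma Ck_fam_powr: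
  assumes "Ck_fam k U Q f" "\<And>P q. P \<in> U \<Longrightarrow> q \<in> Q \<Longrightarrow> 0 < f P q"
  shows "Ck_fam k U Q (\<lambda>P q. f P q powr a)"
proof -
  have "Ck_fam k U Q (\<lambda>P q. (\<Prod>i<0. a - real i) * f P q powr (a - real 0))"
  proof (rule Ck_fam_compose[where T = "{0<..}" and F = "\<lambda>n x. (\<Prod>i<n. a - real i) * x powr (a - real n)", OF _ _ assms(1)])
    fix n and x :: real assume x: "x \<in> {0<..}"
    have "((\<lambda>x. x powr r) has_real_derivative r * x powr (r - 1)) (at x)" for r
      using x by (intro has_real_derivative_powr) simp
    from DERIV_cmult[OF this, of "\<Prod>i<n. a - real i" "a - real n"]
    show "((\<lambda>x. (\<Prod>i<n. a - real i) * x powr (a - real n)) has_real_derivative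
        (\<Prod>i<Suc n. a - real i) * x powr (a - real (Suc n))) (at x)"
      by (simp add: diff_diff_eq add.commute mult.assoc)
  qed (use assms in auto)
  then show ?thesis by simp
qed

lemma Ck_fam_reciprocal:
  assumes "Ck_fam k U Q f" "\<And>P q. P \<in> U \<Longrightarrow> q \<in> Q \<Longrightarrow> 0 < f P q" "open U"
  shows "Ck_fam k U Q (\<lambda>P q. 1 / f P q)"
proof (rule Ck_fam_cong[OF Ck_fam_powr[OF assms(1,2), where a = "-1"] assms(3)])
  fix P q assume "P \<in> U" "q \<in> Q"
  then have "0 < f P q" by (rule assms(2))
  then show "f P q powr (-1) = 1 / f P q" by (simp add: powr_minus divide_inverse)
qed auto

lemma Ck_fam_sqrt:
  assumes "Ck_fam k U Q f" "\<And>P q. P \<in> U \<Longrightarrow> q \<in> Q \<Longrightarrow> 0 < f P q" "open U"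
  shows "Ck_fam k U Q (\<lambda>P q. sqrt (f P q))"
proof (rule Ck_fam_cong[OF Ck_fam_powr[OF assms(1,2), where a = "1/2"] assms(3)])
  fix P q assume "P \<in> U" "q \<in> Q"
  then have "0 < f P q" by (rule assms(2))
  then show "f P q powr (1/2) = sqrt (f P q)" by (simp add: powr_half_sqrt)
qed auto

text \<open>The classical Leibniz rule is stated for operator-valued derivatives that are continuous in norm. In finite
  dimension this follows from continuity of the derivative in each direction.\<close>

lemma integral_has_derivative_parameter:
  fixes f :: "'p::euclidean_space \<Rightarrow> 'q::euclidean_space \<Rightarrow> real"
  assumes D: "\<And>P q. P \<in> U \<Longrightarrow> q \<in> cbox a b \<Longrightarrow> ((\<lambda>P. f P q) has_derivative D P q) (at P)"
    and cD: "\<And>h. continuous_on (U \<times> cbox a b) (\<lambda>(P, q). D P q h)"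
    and cf: "continuous_on (U \<times> cbox a b) (\<lambda>(P, q). f P q)"
    and U: "open U" "convex U" "P \<in> U"
  shows "((\<lambda>P. integral (cbox a b) (f P)) has_derivative (\<lambda>h. integral (cbox a b) (\<lambda>q. D P q h))) (at P)"
proof -
  let ?B = "\<lambda>P q. Blinfun (D P q)"
  have app: "blinfun_apply (?B P q) = D P q" if "P \<in> U" "q \<in> cbox a b" for P q
    using D[OF that] by (intro bounded_linear_Blinfun_apply has_derivative_bounded_linear)
  have cB: "continuous_on (U \<times> cbox a b) (\<lambda>(P, q). ?B P q)"
  proof (rule continuous_on_blinfun_componentwise)
    fix i :: 'p
    show "continuous_on (U \<times> cbox a b) (\<lambda>x. blinfun_apply (case x of (P, q) \<Rightarrow> ?B P q) i)"
      using cD[of i] by (rule continuous_on_eq) (auto simp: app)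
  qed
  have slice: "continuous_on (cbox a b) (\<lambda>q. g P q)"
    if "continuous_on (U \<times> cbox a b) (\<lambda>(P, q). g P q)" "P \<in> U" for g :: "'p \<Rightarrow> 'q \<Rightarrow> 'z::topological_space" and P
  proof -
    have "continuous_on (cbox a b) (\<lambda>q. (\<lambda>(P, q). g P q) (P, q))"
      by (rule continuous_on_compose2[OF that(1)]) (use that(2) in \<open>auto intro!: continuous_intros\<close>)
    then show ?thesis by simp
  qed
  have "((\<lambda>P. integral (cbox a b) (f P)) has_derivative integral (cbox a b) (?B P)) (at P within U)"
  proof (rule leibniz_rule[OF _ _ cB U(3,2)])
    fix P q assume "P \<in> U" "q \<in> cbox a b"
    then show "((\<lambda>P. f P q) has_derivative blinfun_apply (?B P q)) (at P within U)"
      using D app by (simp add: has_derivative_at_withinI)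
  next
    fix P assume "P \<in> U"
    then show "f P integrable_on cbox a b" by (intro integrable_continuous slice[OF cf])
  qed
  moreover have "blinfun_apply (integral (cbox a b) (?B P)) = (\<lambda>h. integral (cbox a b) (\<lambda>q. D P q h))"
  proof
    fix h
    have "blinfun_apply (integral (cbox a b) (?B P)) h = integral (cbox a b) (\<lambda>q. blinfun_apply (?B P q) h)"
      by (intro blinfun_apply_integral integrable_continuous slice[OF cB] U)
    also have "\<dots> = integral (cbox a b) (\<lambda>q. D P q h)"
      by (intro integral_cong) (simp add: app[OF U(3)])
    finally show "blinfun_apply (integral (cbox a b) (?B P)) h = integral (cbox a b) (\<lambda>q. D P q h)" .
  qed
  ultimately show ?thesis using at_within_open[OF U(3,1)] by simp
qed

section \<open>Second-order expansions along two directions\<close>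

text \<open>The value \<open>a\<close>, the derivatives \<open>b\<close>, \<open>c\<close> in the directions \<open>h\<close>, \<open>k\<close> and the mixed second derivative \<open>d\<close>
  of \<open>f\<close> at \<open>P0\<close>. The first derivative in the direction \<open>h\<close> exists on all of \<open>U\<close>, so that it can be
  differentiated again. Such quadruples are multiplied and inverted like truncated power series, which makes the second
  variation of \<open>bernoulli\<close> and \<open>vorticity\<close> a computation by rules.\<close>

definition jet2 :: "'p::real_normed_vector set \<Rightarrow> 'p \<Rightarrow> 'p \<Rightarrow> 'p \<Rightarrow> ('p \<Rightarrow> real) \<Rightarrow> real \<Rightarrow> real \<Rightarrow> real \<Rightarrow> real \<Rightarrow> bool" where
  "jet2 U P0 h k f a b c d \<longleftrightarrow> f P0 = a \<and> ((\<lambda>\<tau>. f (P0 + \<tau> *\<^sub>R k)) has_real_derivative c) (at 0) \<and>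
     (\<exists>fh. (\<forall>P\<in>U. ((\<lambda>\<tau>. f (P + \<tau> *\<^sub>R h)) has_real_derivative fh P) (at 0)) \<and> fh P0 = b \<and>
       ((\<lambda>\<tau>. fh (P0 + \<tau> *\<^sub>R k)) has_real_derivative d) (at 0))"

lemma jet2_const: "jet2 U P0 h k (\<lambda>P. a) a 0 0 0"
  by (auto simp: jet2_def intro!: exI[of _ "\<lambda>P. 0"])

lemma jet2_add:
  assumes "jet2 U P0 h k f a b c d" "jet2 U P0 h k g a' b' c' d'"
  shows "jet2 U P0 h k (\<lambda>P. f P + g P) (a + a') (b + b') (c + c') (d + d')"
proof -
  obtain fh gh where "\<forall>P\<in>U. ((\<lambda>\<tau>. f (P + \<tau> *\<^sub>R h)) has_real_derivative fh P) (at 0)" "fh P0 = b"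
       "((\<lambda>\<tau>. fh (P0 + \<tau> *\<^sub>R k)) has_real_derivative d) (at 0)"
     "\<forall>P\<in>U. ((\<lambda>\<tau>. g (P + \<tau> *\<^sub>R h)) has_real_derivative gh P) (at 0)" "gh P0 = b'"
       "((\<lambda>\<tau>. gh (P0 + \<tau> *\<^sub>R k)) has_real_derivative d') (at 0)"
    using assms unfolding jet2_def by blast
  then show ?thesis using assms unfolding jet2_def
    by (auto intro!: exI[of _ "\<lambda>P. fh P + gh P"] DERIV_add)
qed

lemma jet2_mult:
  assumes "jet2 U P0 h k f a b c d" "jet2 U P0 h k g a' b' c' d'"
  shows "jet2 U P0 h k (\<lambda>P. f P * g P) (a * a') (b * a' + a * b') (c * a' + a * c') (d * a' + b * c' + c * b' + a * d')"
proof -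
  obtain fh gh where f: "\<forall>P\<in>U. ((\<lambda>\<tau>. f (P + \<tau> *\<^sub>R h)) has_real_derivative fh P) (at 0)" "fh P0 = b"
       "((\<lambda>\<tau>. fh (P0 + \<tau> *\<^sub>R k)) has_real_derivative d) (at 0)"
     and g: "\<forall>P\<in>U. ((\<lambda>\<tau>. g (P + \<tau> *\<^sub>R h)) has_real_derivative gh P) (at 0)" "gh P0 = b'"
       "((\<lambda>\<tau>. gh (P0 + \<tau> *\<^sub>R k)) has_real_derivative d') (at 0)"
    using assms unfolding jet2_def by blast
  have a: "f P0 = a" "g P0 = a'" "((\<lambda>\<tau>. f (P0 + \<tau> *\<^sub>R k)) has_real_derivative c) (at 0)"
    "((\<lambda>\<tau>. g (P0 + \<tau> *\<^sub>R k)) has_real_derivative c') (at 0)" using assms unfolding jet2_def by auto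
  have "((\<lambda>\<tau>. f (P + \<tau> *\<^sub>R h) * g (P + \<tau> *\<^sub>R h)) has_real_derivative fh P * g P + f P * gh P) (at 0)"
    if "P \<in> U" for P
    using that f g by (auto intro!: derivative_eq_intros)
  moreover have "((\<lambda>\<tau>. fh (P0 + \<tau> *\<^sub>R k) * g (P0 + \<tau> *\<^sub>R k) + f (P0 + \<tau> *\<^sub>R k) * gh (P0 + \<tau> *\<^sub>R k))
      has_real_derivative d * a' + b * c' + c * b' + a * d') (at 0)"
    by (rule derivative_eq_intros f(3) g(3) a(3,4) refl)+ (simp add: a f g)
  moreover have "((\<lambda>\<tau>. f (P0 + \<tau> *\<^sub>R k) * g (P0 + \<tau> *\<^sub>R k)) has_real_derivative c * a' + a * c') (at 0)"
    by (rule derivative_eq_intros a(3,4) refl)+ (simp add: a)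
  ultimately show ?thesis unfolding jet2_def using a f g
    by (auto intro!: exI[of _ "\<lambda>P. fh P * g P + f P * gh P"])
qed

lemma jet2_reciprocal:
  assumes f: "jet2 U P0 h k f 0 b c d" and pos: "\<And>P. P \<in> U \<Longrightarrow> 1 + f P > 0"
  shows "jet2 U P0 h k (\<lambda>P. 1 / (1 + f P) - 1) 0 (- b) (- c) (2 * b * c - d)"
proof -
  obtain fh where f: "\<forall>P\<in>U. ((\<lambda>\<tau>. f (P + \<tau> *\<^sub>R h)) has_real_derivative fh P) (at 0)" "fh P0 = b"
       "((\<lambda>\<tau>. fh (P0 + \<tau> *\<^sub>R k)) has_real_derivative d) (at 0)"
    and a: "f P0 = 0" "((\<lambda>\<tau>. f (P0 + \<tau> *\<^sub>R k)) has_real_derivative c) (at 0)"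
    using f unfolding jet2_def by blast
  have "((\<lambda>\<tau>. 1 / (1 + f (P + \<tau> *\<^sub>R h)) - 1) has_real_derivative - fh P / (1 + f P)\<^sup>2) (at 0)"
    if "P \<in> U" for P
    using that f pos[OF that] by (auto intro!: derivative_eq_intros simp: power2_eq_square)
  moreover have "((\<lambda>\<tau>. - fh (P0 + \<tau> *\<^sub>R k) / (1 + f (P0 + \<tau> *\<^sub>R k))\<^sup>2) has_real_derivative 2 * b * c - d) (at 0)"
    by (rule derivative_eq_intros f(3) a(2) refl | simp add: a f)+
  moreover have "((\<lambda>\<tau>. 1 / (1 + f (P0 + \<tau> *\<^sub>R k)) - 1) has_real_derivative - c) (at 0)"
    by (rule derivative_eq_intros a(2) refl | simp add: a)+
  ultimately show ?thesis unfolding jet2_def using a f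
    by (auto intro!: exI[of _ "\<lambda>P. - fh P / (1 + f P)\<^sup>2"])
qed

lemma jet2_invariant:
  assumes "\<And>P \<tau>. f (P + \<tau> *\<^sub>R h) = f P" "f P0 = a" "((\<lambda>\<tau>. f (P0 + \<tau> *\<^sub>R k)) has_real_derivative c) (at 0)"
  shows "jet2 U P0 h k f a 0 c 0"
  unfolding jet2_def using assms by (auto intro!: exI[of _ "\<lambda>P. 0"])

lemma has_derivative_direction:
  assumes "(f has_derivative f') (at P)"
  shows "((\<lambda>\<tau>. f (P + \<tau> *\<^sub>R h)) has_real_derivative f' h) (at (0::real))"
proof -
  have "((\<lambda>\<tau>::real. P + \<tau> *\<^sub>R h) has_derivative (\<lambda>\<tau>. \<tau> *\<^sub>R h)) (at 0)"
    by (auto intro!: derivative_eq_intros)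
  from has_derivative_compose[OF this, of f f'] assms
  have "((\<lambda>\<tau>. f (P + \<tau> *\<^sub>R h)) has_derivative (\<lambda>\<tau>. f' (\<tau> *\<^sub>R h))) (at 0)" by simp
  moreover have "f' (\<tau> *\<^sub>R h) = f' h * \<tau>" for \<tau>
    using linear_scale[OF has_derivative_linear[OF assms]] by simp
  ultimately show ?thesis by (simp add: has_field_derivative_def)
qed

text \<open>First and second derivatives of an integral depending on a parameter can be read off from second-order expansions
  of the integrand, one point at a time.\<close>

lemma Ck_fam2_integral:
  fixes I :: "'p::euclidean_space \<Rightarrow> 'q::euclidean_space \<Rightarrow> real"
  assumes I: "Ck_fam 2 U (cbox u v) I" and U: "open U" "convex U" "P0 \<in> U"
  obtains G G2 where "\<And>P. P \<in> U \<Longrightarrow> ((\<lambda>P. integral (cbox u v) (I P)) has_derivative G P) (at P)"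
    "\<And>h. continuous_on U (\<lambda>P. G P h)" "\<And>h. ((\<lambda>P. G P h) has_derivative G2 h) (at P0)"
    "\<And>h k a b c d. (\<And>q. q \<in> cbox u v \<Longrightarrow> jet2 U P0 h k (\<lambda>P. I P q) (a q) (b q) (c q) (d q)) \<Longrightarrow>
       G P0 h = integral (cbox u v) b \<and> G2 h k = integral (cbox u v) d"
proof -
  let ?Q = "cbox u v"
  have I': "Ck_fam (Suc (Suc 0)) U ?Q I" using I by (simp add: numeral_2_eq_2)
  obtain D where D: "\<And>P q. P \<in> U \<Longrightarrow> q \<in> ?Q \<Longrightarrow> ((\<lambda>P. I P q) has_derivative D P q) (at P)"
      "\<And>h. Ck_fam (Suc 0) U ?Q (\<lambda>P q. D P q h)" using I' by (simp only: Ck_fam.simps(2)) blast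
  have "\<forall>h. \<exists>E. (\<forall>P\<in>U. \<forall>q\<in>?Q. ((\<lambda>P. D P q h) has_derivative E P q) (at P)) \<and> (\<forall>k. Ck_fam 0 U ?Q (\<lambda>P q. E P q k))"
    using D(2) by (simp only: Ck_fam.simps(2)) blast
  then obtain E where E: "\<And>h P q. P \<in> U \<Longrightarrow> q \<in> ?Q \<Longrightarrow> ((\<lambda>P. D P q h) has_derivative E h P q) (at P)"
      "\<And>h k. Ck_fam 0 U ?Q (\<lambda>P q. E h P q k)" by metis
  show ?thesis
  proof (rule that[of "\<lambda>P h. integral ?Q (\<lambda>q. D P q h)" "\<lambda>h k. integral ?Q (\<lambda>q. E h P0 q k)"])
    show "((\<lambda>P. integral ?Q (I P)) has_derivative (\<lambda>h. integral ?Q (\<lambda>q. D P q h))) (at P)" if "P \<in> U" for P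
      by (intro integral_has_derivative_parameter[OF D(1) _ _ U(1,2) that] Ck_fam_continuous[OF D(2)] Ck_fam_continuous[OF I])
    show "continuous_on U (\<lambda>P. integral ?Q (\<lambda>q. D P q h))" for h
      by (rule integral_continuous_on_param[OF Ck_fam_continuous[OF D(2)]])
    show "((\<lambda>P. integral ?Q (\<lambda>q. D P q h)) has_derivative (\<lambda>k. integral ?Q (\<lambda>q. E h P0 q k))) (at P0)" for h
      by (intro integral_has_derivative_parameter[OF E(1) _ _ U] Ck_fam_continuous[OF D(2)] Ck_fam_continuous[OF E(2)])
    show "integral ?Q (\<lambda>q. D P0 q h) = integral ?Q b \<and> integral ?Q (\<lambda>q. E h P0 q k) = integral ?Q d"
      if t: "\<And>q. q \<in> ?Q \<Longrightarrow> jet2 U P0 h k (\<lambda>P. I P q) (a q) (b q) (c q) (d q)" for h k a b c d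
    proof -
      have "D P0 q h = b q \<and> E h P0 q k = d q" if q: "q \<in> ?Q" for q
      proof -
        obtain fh where f: "\<And>P. P \<in> U \<Longrightarrow> ((\<lambda>\<tau>. I (P + \<tau> *\<^sub>R h) q) has_real_derivative fh P) (at 0)" "fh P0 = b q"
          "((\<lambda>\<tau>. fh (P0 + \<tau> *\<^sub>R k)) has_real_derivative d q) (at 0)"
          using t[OF q] unfolding jet2_def by blast
        have fh: "fh P = D P q h" if "P \<in> U" for P
          using DERIV_unique[OF f(1)[OF that] has_derivative_direction[OF D(1)[OF that q]]] .
        have "((\<lambda>\<tau>. D (P0 + \<tau> *\<^sub>R k) q h) has_real_derivative E h P0 q k) (at 0)"
          by (rule has_derivative_direction[OF E(1)[OF U(3) q]])
        moreover have "\<forall>\<^sub>F \<tau> in nhds 0. fh (P0 + \<tau> *\<^sub>R k) = D (P0 + \<tau> *\<^sub>R k) q h"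
        proof -
          have "open ((\<lambda>\<tau>::real. P0 + \<tau> *\<^sub>R k) -` U)" using U(1) by (intro open_vimage continuous_intros) auto
          then have "\<forall>\<^sub>F \<tau> in nhds 0. \<tau> \<in> (\<lambda>\<tau>::real. P0 + \<tau> *\<^sub>R k) -` U"
            using U(3) by (intro eventually_nhds_in_open) auto
          then show ?thesis by eventually_elim (simp add: fh)
        qed
        ultimately have "((\<lambda>\<tau>. fh (P0 + \<tau> *\<^sub>R k)) has_real_derivative E h P0 q k) (at 0)"
          using DERIV_cong_ev[OF refl _ refl, of "\<lambda>\<tau>. fh (P0 + \<tau> *\<^sub>R k)" "\<lambda>\<tau>. D (P0 + \<tau> *\<^sub>R k) q h" 0 "E h P0 q k"]
          by simp
        then show ?thesis using DERIV_unique[OF f(3)] fh[OF U(3)] f(2) by auto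
      qed
      then show ?thesis by (auto intro!: integral_cong)
    qed
  qed
qed

text \<open>By differentiability at the base point,
  \<open>g (A r + z B r) = g P0 + r (g' A' + z g' B') + o(r)\<close> uniformly in \<open>z\<close>, and the mean of \<open>z\<close> over \<open>[0, 1]\<close> is \<open>1/2\<close>.
  Continuity on \<open>U\<close> makes the integrals exist.\<close>

lemma average_along_segment:
  fixes g :: "'p::euclidean_space \<Rightarrow> real"
  assumes g: "(g has_derivative g') (at P0)" "continuous_on U g" and U: "open U" "P0 \<in> U"
    and A: "(A has_vector_derivative A') (at 0)" "A 0 = P0" and B: "(B has_vector_derivative B') (at 0)" "B 0 = 0"
  shows "((\<lambda>r. integral {0..1} (\<lambda>z. g (A r + z *\<^sub>R B r))) has_real_derivative g' A' + g' B' / 2) (at 0)"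
proof -
  have lin: "bounded_linear g'" using g(1) by (rule has_derivative_bounded_linear)
  define l where "l r = g' (A r - P0) + g' (B r) / 2" for r
  define m where "m r = integral {0..1} (\<lambda>z. g (A r + z *\<^sub>R B r)) - l r" for r
  have "(l has_real_derivative g' A' + g' B' / 2) (at 0)"
  proof -
    have 1: "((\<lambda>r. g' (A r - P0)) has_vector_derivative g' A') (at 0)"
      by (rule bounded_linear.has_vector_derivative[OF lin]) (auto intro!: derivative_eq_intros A)
    have 2: "((\<lambda>r. g' (B r)) has_vector_derivative g' B') (at 0)"
      by (rule bounded_linear.has_vector_derivative[OF lin B(1)])
    show ?thesis unfolding l_def using 1 2
      by (auto intro!: derivative_eq_intros simp: has_real_derivative_iff_has_vector_derivative[symmetric])
  qed
  moreover have "(m has_real_derivative 0) (at 0)"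
    unfolding has_field_derivative_def has_derivative_at_alt
  proof (intro conjI allI impI)
    show "bounded_linear ((*) (0::real))" by (rule bounded_linear_mult_right)
    fix e :: real assume e: "e > 0"
    obtain \<rho> where \<rho>: "\<rho> > 0" "ball P0 \<rho> \<subseteq> U" using U by (meson openE)
    define C where "C = norm A' + norm B' + 2"
    have C: "C > 0" unfolding C_def using norm_ge_zero[of A'] norm_ge_zero[of B'] by linarith
    obtain d where d: "d > 0" "\<And>P. norm (P - P0) < d \<Longrightarrow> norm (g P - g P0 - g' (P - P0)) \<le> e / C * norm (P - P0)"
      using g(1) e C unfolding has_derivative_at_alt by (meson divide_pos_pos)
    obtain dA where dA: "dA > 0" "\<And>r. norm (r - 0) < dA \<Longrightarrow> norm (A r - A 0 - (r - 0) *\<^sub>R A') \<le> 1 * norm (r - 0)"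
      using A(1) unfolding has_vector_derivative_def has_derivative_at_alt by (meson zero_less_one)
    obtain dB where dB: "dB > 0" "\<And>r. norm (r - 0) < dB \<Longrightarrow> norm (B r - B 0 - (r - 0) *\<^sub>R B') \<le> 1 * norm (r - 0)"
      using B(1) unfolding has_vector_derivative_def has_derivative_at_alt by (meson zero_less_one)
    define \<delta> where "\<delta> = min (min dA dB) (min d \<rho> / C)"
    have "\<delta> > 0" using d(1) dA(1) dB(1) \<rho>(1) C by (simp add: \<delta>_def)
    moreover have "norm (m r - m 0 - 0 * (r - 0)) \<le> e * norm (r - 0)" if r: "norm (r - 0) < \<delta>" for r
    proof -
      have "norm (A r - P0) \<le> \<bar>r\<bar> * (norm A' + 1)"
        using dA(2)[of r] r norm_triangle_sub[of "A r - P0" "r *\<^sub>R A'"] by (simp add: \<delta>_def A(2) algebra_simps)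
      moreover have "norm (B r) \<le> \<bar>r\<bar> * (norm B' + 1)"
        using dB(2)[of r] r norm_triangle_sub[of "B r" "r *\<^sub>R B'"] by (simp add: \<delta>_def B(2) algebra_simps)
      ultimately have AB: "norm (A r - P0) + norm (B r) \<le> C * \<bar>r\<bar>" by (simp add: C_def algebra_simps)
      have near: "norm (A r + z *\<^sub>R B r - P0) \<le> C * \<bar>r\<bar>" if "z \<in> {0..1}" for z
      proof -
        have "norm (A r + z *\<^sub>R B r - P0) \<le> norm (A r - P0) + norm (z *\<^sub>R B r)"
          using norm_triangle_ineq[of "A r - P0" "z *\<^sub>R B r"] by (simp add: algebra_simps)
        also have "norm (z *\<^sub>R B r) \<le> norm (B r)" using that by (simp add: mult_left_le_one_le)
        finally show ?thesis using AB by linarith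
      qed
      have small: "C * \<bar>r\<bar> < d" "C * \<bar>r\<bar> < \<rho>" using r C by (auto simp: \<delta>_def field_simps)
      let ?h = "\<lambda>z. g (A r + z *\<^sub>R B r)"
      have inU: "A r + z *\<^sub>R B r \<in> U" if "z \<in> {0..1}" for z
        using near[OF that] small(2) \<rho>(2) by (auto simp: dist_norm norm_minus_commute subset_iff)
      have cont: "continuous_on {0..1} ?h"
        by (rule continuous_on_compose2[OF g(2)]) (use inU in \<open>auto intro!: continuous_intros\<close>)
      have m0: "m 0 = g P0" using A(2) B(2) by (simp add: m_def l_def linear_0 bounded_linear.linear[OF lin])
      have lin2: "g' (A r + z *\<^sub>R B r - P0) = g' (A r - P0) + z * g' (B r)" for z
      proof -
        have "A r + z *\<^sub>R B r - P0 = (A r - P0) + z *\<^sub>R B r" by simp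
        then show ?thesis
          using linear_add[OF bounded_linear.linear[OF lin], of "A r - P0" "z *\<^sub>R B r"]
            linear_scale[OF bounded_linear.linear[OF lin], of z "B r"] by (simp only: real_scaleR_def)
      qed
      have "((\<lambda>z::real. z) has_integral (1\<^sup>2 / 2 - 0\<^sup>2 / 2)) {0..1}"
        by (rule fundamental_theorem_of_calculus) (auto intro!: derivative_eq_intros simp: has_real_derivative_iff_has_vector_derivative[symmetric])
      then have iz: "((\<lambda>z::real. z) has_integral 1 / 2) {0..1}" by simp
      have "((\<lambda>z. g P0 + g' (A r - P0) + z * g' (B r)) has_integral (g P0 + g' (A r - P0) + 1 / 2 * g' (B r))) {0..1}"
        using has_integral_add[OF has_integral_const_real[of "g P0 + g' (A r - P0)" 0 1] has_integral_mult_left[OF iz, of "g' (B r)"]]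
        by simp
      then have *: "((\<lambda>z. ?h z - (g P0 + g' (A r - P0) + z * g' (B r))) has_integral
          (integral {0..1} ?h - (g P0 + g' (A r - P0) + 1 / 2 * g' (B r)))) {0..1}"
        by (intro has_integral_diff integrable_integral integrable_continuous_real cont)
      have hi: "((\<lambda>z. ?h z - (g P0 + g' (A r - P0) + z * g' (B r))) has_integral (m r - m 0)) (cbox 0 1)"
      proof -
        have "m r - m 0 = integral {0..1} ?h - (g P0 + g' (A r - P0) + 1 / 2 * g' (B r))"
          unfolding m0 by (simp add: m_def l_def)
        then show ?thesis using * by (simp only: box_real)
      qed
      have "norm (m r - m 0) \<le> (e * \<bar>r\<bar>) * measure lborel (cbox 0 (1::real))"
      proof (rule has_integral_bound[OF _ hi])
        show "0 \<le> e * \<bar>r\<bar>" using e by simp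
        fix z :: real assume "z \<in> cbox 0 1"
        then have z: "z \<in> {0..1}" by simp
        have "norm (g (A r + z *\<^sub>R B r) - g P0 - g' (A r + z *\<^sub>R B r - P0)) \<le> e / C * norm (A r + z *\<^sub>R B r - P0)"
          using near[OF z] small(1) by (intro d(2)) linarith
        also have "\<dots> \<le> e / C * (C * \<bar>r\<bar>)" using near[OF z] e C by (intro mult_left_mono) auto
        also have "\<dots> = e * \<bar>r\<bar>" using C by simp
        finally show "norm (?h z - (g P0 + g' (A r - P0) + z * g' (B r))) \<le> e * \<bar>r\<bar>"
          unfolding lin2 by (simp add: algebra_simps)
      qed
      then show ?thesis by simp
    qed
    ultimately show "\<exists>d>0. \<forall>y. norm (y - 0) < d \<longrightarrow> norm (m y - m 0 - 0 * (y - 0)) \<le> e * norm (y - 0)" by blast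
  qed
  ultimately have "((\<lambda>r. m r + l r) has_real_derivative 0 + (g' A' + g' B' / 2)) (at 0)"
    by (intro DERIV_add)
  then show ?thesis by (simp add: m_def)
qed

section \<open>Separated functions\<close>

definition sep :: "(real \<Rightarrow> real) \<Rightarrow> (real \<Rightarrow> real) \<Rightarrow> real \<times> real \<Rightarrow> real" where
  "sep A G = on_strip (\<lambda>(x, s). A x * G s)"

lemma sep_apply: "s \<in> {0..1} \<Longrightarrow> sep A G (x, s) = A x * G s"
  by (simp add: sep_def)

lemma sep_derivatives:
  assumes A: "\<And>x. (A has_real_derivative A' x) (at x)" and G: "\<And>s. (G has_real_derivative G' s) (at s)"
  shows "dx (sep A G) = sep A' G" "ds (sep A G) = sep A G'" "pdiff (sep A G)"
proof -
  have 1: "((\<lambda>t. sep A G (t, s)) has_real_derivative A' x * G s) (at x)" if "s \<in> {0..1}" for x s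
    using that A by (auto simp: sep_apply intro!: derivative_eq_intros)
  have 2: "((\<lambda>t. sep A G (x, t)) has_real_derivative A x * G' s) (at s within {0..1})" if "s \<in> {0..1}" for x s
  proof (rule has_field_derivative_transform_within[OF _ zero_less_one that])
    show "((\<lambda>t. A x * G t) has_real_derivative A x * G' s) (at s within {0..1})"
      by (intro DERIV_cmult has_field_derivative_at_within[OF G])
  qed (simp add: sep_apply)
  show "dx (sep A G) = sep A' G" unfolding sep_def[of A' G] using 1 by (intro dx_eqI) auto
  show "ds (sep A G) = sep A G'" unfolding sep_def[of A G'] using 2 by (intro ds_eqI) auto
  show "pdiff (sep A G)" using pdiffI[of "sep A G" "\<lambda>(x, s). A' x * G s" "\<lambda>(x, s). A x * G' s"] 1 2 by auto
qed

lemma sep_hoelder_le: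
  assumes b: "0 < \<beta>" "\<beta> < 1" and A: "\<And>x. (A has_real_derivative A' x) (at x)" "\<And>x. \<bar>A x\<bar> \<le> a" "\<And>x. \<bar>A' x\<bar> \<le> a"
    and G: "\<And>s. (G has_real_derivative G' s) (at s)" "continuous_on {0..1} G'"
  shows "\<exists>B. hoelder_le_strip 0 \<beta> B (sep A G)"
proof -
  have a0: "0 \<le> a" using A(2)[of 0] by linarith
  have l: "\<bar>A (fst p) - A (fst q)\<bar> \<le> a * dist p q" for p q :: "real \<times> real"
  proof -
    have "norm (A (fst p) - A (fst q)) \<le> a * norm (fst p - fst q)"
      by (rule field_differentiable_bound[of UNIV A A']) (use A in auto)
    also have "\<dots> \<le> a * dist p q" using a0 dist_fst_le[of p q] by (intro mult_left_mono) (auto simp: dist_norm)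
    finally show ?thesis by simp
  qed
  have 1: "hoelder_le strip \<beta> (2 * a + a) (\<lambda>p. A (fst p))" by (intro hoelder_le_lipschitz b a0 l A)
  obtain C where 2: "hoelder_le strip \<beta> C (\<lambda>p. G (snd p))"
    using hoelder_le_coefficient[OF b G] by auto
  have "hoelder_le strip \<beta> (2 * ((2 * a + a) * C)) (\<lambda>p. A (fst p) * G (snd p))"
    using a0 by (intro hoelder_le_mult[OF 1 2]) auto
  then have "hoelder_le strip \<beta> (2 * ((2 * a + a) * C)) (sep A G)"
    by (rule hoelder_le_cong) (auto simp: sep_def split: prod.splits)
  then show ?thesis by (auto simp: sep_def on_strip_def simp del: split_paired_All)
qed

lemma hoelder_le_strip_SucI:
  assumes "\<exists>B. hoelder_le_strip k \<beta> B (dx u)" "\<exists>B. hoelder_le_strip k \<beta> B (ds u)" "\<exists>B. hoelder_le_strip 0 \<beta> B u" "pdiff u"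
  shows "\<exists>B. hoelder_le_strip (Suc k) \<beta> B u"
proof -
  obtain A B C where h: "hoelder_le_strip k \<beta> A (dx u)" "hoelder_le_strip k \<beta> B (ds u)" "hoelder_le_strip 0 \<beta> C u" using assms by blast
  let ?M = "max A (max B C)"
  have m: "A \<le> ?M" "B \<le> ?M" "C \<le> ?M" by linarith+
  then have h': "hoelder_le_strip k \<beta> ?M (dx u)" "hoelder_le_strip k \<beta> ?M (ds u)" "hoelder_le_strip 0 \<beta> ?M u"
    using h hoelder_le_strip_mono by blast+
  have "hoelder_le_strip (Suc k) \<beta> ?M u" unfolding hoelder_le_strip.simps(2)
    using h' hoelder_le_strip_off[OF h'(3)] hoelder_le_strip_bound[OF h'(3)] assms(4) by blast
  then show ?thesis ..
qed

lemma sep_hoelder_le2: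
  assumes b: "0 < \<beta>" "\<beta> < 1"
    and A: "\<And>n x. n < 3 \<Longrightarrow> (A n has_real_derivative A (Suc n) x) (at x)" "\<And>n x. n \<le> 3 \<Longrightarrow> \<bar>A n x\<bar> \<le> a"
    and G: "\<And>n s. n < 3 \<Longrightarrow> (G n has_real_derivative G (Suc n) s) (at s)" "continuous_on {0..1} (G 3)"
  shows "\<exists>B. hoelder_le_strip 2 \<beta> B (sep (A 0) (G 0))"
proof -
  have c: "continuous_on {0..1} (G (Suc j))" if "j < 3" for j
  proof (cases "j = 2")
    case False
    then have "Suc j < 3" using that by simp
    then show ?thesis using G(1) by (meson DERIV_continuous continuous_at_imp_continuous_on)
  qed (use G(2) in \<open>simp add: numeral_3_eq_3\<close>)
  have h0: "\<exists>B. hoelder_le_strip 0 \<beta> B (sep (A i) (G j))" if "i < 3" "j < 3" for i j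
    using that by (intro sep_hoelder_le[OF b A(1) A(2) A(2) G(1) c]) auto
  note d = sep_derivatives[OF A(1) G(1)]
  have h1: "\<exists>B. hoelder_le_strip 1 \<beta> B (sep (A i) (G j))" if "i < 2" "j < 2" for i j
  proof -
    have ij: "i < 3" "j < 3" "Suc i < 3" "Suc j < 3" using that by auto
    show ?thesis unfolding One_nat_def
      using ij by (intro hoelder_le_strip_SucI) (simp_all only: d h0)
  qed
  have "\<exists>B. hoelder_le_strip (Suc 1) \<beta> B (sep (A 0) (G 0))"
  proof (rule hoelder_le_strip_SucI)
    have z: "dx (sep (A 0) (G 0)) = sep (A 1) (G 0)" "ds (sep (A 0) (G 0)) = sep (A 0) (G 1)" "pdiff (sep (A 0) (G 0))"
      using sep_derivatives[of "A 0" "A 1" "G 0" "G 1"] A(1)[of 0] G(1)[of 0] by auto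
    show "\<exists>B. hoelder_le_strip 1 \<beta> B (dx (sep (A 0) (G 0)))" "\<exists>B. hoelder_le_strip 1 \<beta> B (ds (sep (A 0) (G 0)))"
      unfolding z by (intro h1; simp)+
    show "\<exists>B. hoelder_le_strip 0 \<beta> B (sep (A 0) (G 0))" by (intro h0) auto
    show "pdiff (sep (A 0) (G 0))" by (rule z)
  qed
  then show ?thesis by (simp add: numeral_2_eq_2)
qed

section \<open>Green's identity and Fourier integrals\<close>

lemma has_derivative_subinterval:
  assumes "(f has_real_derivative f') (at x within S)" shows "(f has_vector_derivative f') (at x within S)"
  using assms by (simp add: has_real_derivative_iff_has_vector_derivative)

text \<open>The test function \<open>cos (m x) S s\<close> solves the adjoint equation, which is the equation itself. Periodicity removes the lateral
  boundary terms, and both functions vanish at the bottom, so only the surface contributes. The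
  two variables are treated separately: the \<open>x\<close>-part integrates to zero for each \<open>s\<close>.\<close>

lemma green_identity:
  fixes Z Zx Zxx Zs Zss :: "real \<Rightarrow> real \<Rightarrow> real"
  assumes dx: "\<And>x s. s \<in> {0..1} \<Longrightarrow> ((\<lambda>t. Z t s) has_real_derivative Zx x s) (at x)"
    and dxx: "\<And>x s. s \<in> {0..1} \<Longrightarrow> ((\<lambda>t. Zx t s) has_real_derivative Zxx x s) (at x)"
    and ds: "\<And>x s. s \<in> {0..1} \<Longrightarrow> ((\<lambda>t. Z x t) has_real_derivative Zs x s) (at s within {0..1})"
    and dss: "\<And>x s. s \<in> {0..1} \<Longrightarrow> ((\<lambda>t. Zs x t) has_real_derivative Zss x s) (at s within {0..1})"
    and cont: "continuous_on (UNIV \<times> {0..1}) (\<lambda>(x, s). Z x s)" "continuous_on (UNIV \<times> {0..1}) (\<lambda>(x, s). Zxx x s)"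
      "continuous_on (UNIV \<times> {0..1}) (\<lambda>(x, s). Zss x s)"
    and T: "0 \<le> T" "sin (m * T) = 0" "cos (m * T) = 1" and per: "\<And>x s. Z (x + T) s = Z x s" "\<And>x s. Zx (x + T) s = Zx x s"
    and bot: "\<And>x. Z x 0 = 0"
    and S: "\<And>s. (S has_real_derivative S' s) (at s)" "\<And>s. (S' has_real_derivative (m\<^sup>2 + \<alpha>) * S s) (at s)" "S 0 = 0"
  shows "integral (cbox (0, 0) (T, 1)) (\<lambda>(x, s). (Zxx x s + Zss x s - \<alpha> * Z x s) * (cos (m * x) * S s)) =
    integral {0..T} (\<lambda>x. (Zs x 1 * S 1 - Z x 1 * S' 1) * cos (m * x))"
proof -
  have cS: "continuous_on X S" for X using S(1) by (meson DERIV_continuous continuous_at_imp_continuous_on)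
  have sub: "cbox (0, 0) (T, 1) \<subseteq> UNIV \<times> {0..1::real}" by auto
  have c: "continuous_on (cbox (0, 0) (T, 1)) (\<lambda>(x, s). Z x s)" "continuous_on (cbox (0, 0) (T, 1)) (\<lambda>(x, s). Zxx x s)"
    "continuous_on (cbox (0, 0) (T, 1)) (\<lambda>(x, s). Zss x s)"
    using cont continuous_on_subset[OF _ sub] by blast+
  have cw: "continuous_on (cbox (0, 0) (T, 1)) (\<lambda>p. cos (m * fst p) * S (snd p))"
    by (intro continuous_intros continuous_on_compose2[OF cS[of UNIV]]) auto
  have c1: "continuous_on (cbox (0, 0) (T, 1)) (\<lambda>(x, s). (Zxx x s + m\<^sup>2 * Z x s) * (cos (m * x) * S s))"
    using continuous_on_mult[OF continuous_on_add[OF c(2) continuous_on_mult[OF continuous_on_const c(1), of "m\<^sup>2"]] cw]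
    by (simp add: case_prod_unfold)
  have c2: "continuous_on (cbox (0, 0) (T, 1)) (\<lambda>(x, s). (Zss x s - (m\<^sup>2 + \<alpha>) * Z x s) * (cos (m * x) * S s))"
    using continuous_on_mult[OF continuous_on_diff[OF c(3) continuous_on_mult[OF continuous_on_const c(1), of "m\<^sup>2 + \<alpha>"]] cw]
    by (simp add: case_prod_unfold)
  have "integral (cbox (0, 0) (T, 1)) (\<lambda>(x, s). (Zxx x s + m\<^sup>2 * Z x s) * (cos (m * x) * S s)) =
      integral (cbox 0 1) (\<lambda>s. integral (cbox 0 T) (\<lambda>x. (Zxx x s + m\<^sup>2 * Z x s) * (cos (m * x) * S s)))"
    using integral_prod_continuous[OF c1] integral_swap_continuous[OF c1] by simp
  also have "\<dots> = integral (cbox 0 1) (\<lambda>s::real. 0)"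
  proof (rule integral_cong)
    fix s :: real assume "s \<in> cbox 0 1"
    then have s: "s \<in> {0..1}" by simp
    have "((\<lambda>x. (Zxx x s + m\<^sup>2 * Z x s) * cos (m * x)) has_integral
        (Zx T s * cos (m * T) + m * Z T s * sin (m * T)) - (Zx 0 s * cos (m * 0) + m * Z 0 s * sin (m * 0))) {0..T}"
      by (rule fundamental_theorem_of_calculus[OF T(1)])
        (auto intro!: derivative_eq_intros has_derivative_subinterval has_field_derivative_at_within[OF dx[OF s]] has_field_derivative_at_within[OF dxx[OF s]] simp: algebra_simps power2_eq_square)
    moreover have "Zx T s = Zx 0 s" using per(2)[of 0 s] by simp
    ultimately have "((\<lambda>x. (Zxx x s + m\<^sup>2 * Z x s) * cos (m * x)) has_integral 0) {0..T}"
      using T by simp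
    from has_integral_mult_left[OF this, of "S s"]
    show "integral (cbox 0 T) (\<lambda>x. (Zxx x s + m\<^sup>2 * Z x s) * (cos (m * x) * S s)) = 0"
      by (intro integral_unique) (simp add: mult.assoc)
  qed
  finally have I1: "integral (cbox (0, 0) (T, 1)) (\<lambda>(x, s). (Zxx x s + m\<^sup>2 * Z x s) * (cos (m * x) * S s)) = 0" by simp
  have "integral (cbox (0, 0) (T, 1)) (\<lambda>(x, s). (Zss x s - (m\<^sup>2 + \<alpha>) * Z x s) * (cos (m * x) * S s)) =
      integral (cbox 0 T) (\<lambda>x. integral (cbox 0 1) (\<lambda>s. (Zss x s - (m\<^sup>2 + \<alpha>) * Z x s) * (cos (m * x) * S s)))"
    using integral_prod_continuous[OF c2] by simp
  also have "\<dots> = integral (cbox 0 T) (\<lambda>x. (Zs x 1 * S 1 - Z x 1 * S' 1) * cos (m * x))"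
  proof (rule integral_cong)
    fix x :: real
    have "((\<lambda>s. (Zss x s - (m\<^sup>2 + \<alpha>) * Z x s) * S s) has_integral
        (Zs x 1 * S 1 - Z x 1 * S' 1) - (Zs x 0 * S 0 - Z x 0 * S' 0)) {0..1}"
      by (rule fundamental_theorem_of_calculus)
        (auto intro!: derivative_eq_intros has_derivative_subinterval ds dss has_field_derivative_at_within[OF S(1)] has_field_derivative_at_within[OF S(2)] simp: algebra_simps)
    from has_integral_mult_left[OF this, of "cos (m * x)"]
    show "integral (cbox 0 1) (\<lambda>s. (Zss x s - (m\<^sup>2 + \<alpha>) * Z x s) * (cos (m * x) * S s)) =
        (Zs x 1 * S 1 - Z x 1 * S' 1) * cos (m * x)"
      by (intro integral_unique) (simp add: bot S(3) mult_ac)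
  qed
  finally have I2: "integral (cbox (0, 0) (T, 1)) (\<lambda>(x, s). (Zss x s - (m\<^sup>2 + \<alpha>) * Z x s) * (cos (m * x) * S s)) =
    integral (cbox 0 T) (\<lambda>x. (Zs x 1 * S 1 - Z x 1 * S' 1) * cos (m * x))" .
  have "integral (cbox (0, 0) (T, 1)) (\<lambda>(x, s). (Zxx x s + Zss x s - \<alpha> * Z x s) * (cos (m * x) * S s)) =
    integral (cbox (0, 0) (T, 1)) (\<lambda>p. (\<lambda>(x, s). (Zxx x s + m\<^sup>2 * Z x s) * (cos (m * x) * S s)) p +
      (\<lambda>(x, s). (Zss x s - (m\<^sup>2 + \<alpha>) * Z x s) * (cos (m * x) * S s)) p)"
    by (intro integral_cong) (auto simp: algebra_simps)
  also have "\<dots> = integral (cbox 0 T) (\<lambda>x. (Zs x 1 * S 1 - Z x 1 * S' 1) * cos (m * x))"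
    using integral_add[OF integrable_continuous[OF c1] integrable_continuous[OF c2]] I1 I2 by simp
  finally show ?thesis by simp
qed

lemma integral_cos_harmonic:
  assumes "\<kappa> > 0"
  shows "((\<lambda>x. cos (real j * \<kappa> * x)) has_integral (if j = 0 then 2 * pi / \<kappa> else 0)) {0..2 * pi / \<kappa>}"
proof (cases "j = 0")
  case True
  then show ?thesis using assms has_integral_const_real[of "1::real" 0 "2 * pi / \<kappa>"] by simp
next
  case False
  let ?m = "real j * \<kappa>"
  have m: "?m \<noteq> 0" using False assms by simp
  have "((\<lambda>x. cos (?m * x)) has_integral sin (?m * (2 * pi / \<kappa>)) / ?m - sin (?m * 0) / ?m) {0..2 * pi / \<kappa>}"
    by (rule fundamental_theorem_of_calculus)
      (use assms m in \<open>auto intro!: derivative_eq_intros has_derivative_subinterval\<close>)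
  moreover have "?m * (2 * pi / \<kappa>) = 2 * pi * real j" using assms by simp
  then have "sin (?m * (2 * pi / \<kappa>)) = 0" by (simp add: sin_integer_2pi)
  ultimately show ?thesis using False by simp
qed

lemma integral_box_product:
  fixes A G :: "real \<Rightarrow> real"
  assumes "continuous_on {0..T} A" "continuous_on {0..1} G"
  shows "integral (cbox (0, 0) (T, 1)) (\<lambda>(x, s). A x * G s) = integral {0..T} A * integral {0..1} G"
proof -
  have "continuous_on (cbox (0, 0) (T, 1)) (\<lambda>p. A (fst p) * G (snd p))"
    by (intro continuous_intros continuous_on_compose2[OF assms(1)] continuous_on_compose2[OF assms(2)]) auto
  then have "integral (cbox (0, 0) (T, 1)) (\<lambda>(x, s). A x * G s) = integral (cbox 0 T) (\<lambda>x. integral (cbox 0 1) (\<lambda>s. A x * G s))"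
    using integral_prod_continuous[of 0 0 T 1 "\<lambda>p. A (fst p) * G (snd p)"] by (simp add: case_prod_unfold)
  then show ?thesis by simp
qed

section \<open>The bifurcation point\<close>

locale double_point =
  fixes \<sigma> \<kappa> \<beta> :: real and \<Lambda>s :: param
  assumes beta: "0 < \<beta>" "\<beta> < 1"
    and sigma: "0 < \<sigma>" "\<sigma> * cot \<sigma> = 1" "\<And>x::real. 0 < x \<Longrightarrow> x * cot x = 1 \<Longrightarrow> \<sigma> \<le> x"
    and kappa: "\<kappa> = \<sigma> / sqrt 3"
    and Lambda: "\<Lambda>s = (1 / (2 * \<kappa>), - 4 * \<kappa>\<^sup>2, pi / 2)"
begin

lemma kappa_pos: "\<kappa> > 0" using sigma(1) kappa by simp

lemma kappa_sq: "3 * \<kappa>\<^sup>2 = \<sigma>\<^sup>2" unfolding kappa by (simp add: power_divide)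

lemma sin_sigma_nz: "sin \<sigma> \<noteq> 0" using sigma(2) by (auto simp: cot_def)

lemma sin_sigma: "sin \<sigma> = \<sigma> * cos \<sigma>"
  using sigma(2) sin_sigma_nz by (simp add: cot_def field_simps)

lemma cos_sigma_nz: "cos \<sigma> \<noteq> 0" using sin_sigma sin_sigma_nz by auto

lemma cos_sigma_sq: "(1 + \<sigma>\<^sup>2) * (cos \<sigma>)\<^sup>2 = 1"
  using sin_cos_squared_add[of \<sigma>] unfolding sin_sigma by (simp add: algebra_simps power_mult_distrib)

lemma U_Lambda: "\<Lambda>s \<in> U_set"
  using kappa_pos by (auto simp: Lambda U_set_def)

lemma root_derivative: "((\<lambda>x. x * cos x - sin x) has_real_derivative - x * sin x) (at (x::real))"
  by (auto intro!: derivative_eq_intros)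

text \<open>The function \<open>x cos x - sin x\<close> is strictly decreasing on \<open>[0, \<pi>]\<close> and vanishes at \<open>0\<close>, and it changes sign
  between \<open>\<pi>\<close> and \<open>3\<pi>/2\<close>.\<close>

lemma sigma_bounds: "pi < \<sigma>" "\<sigma> < 3 * pi / 2"
proof -
  show "pi < \<sigma>"
  proof (rule ccontr)
    assume "\<not> pi < \<sigma>"
    then have s: "\<sigma> \<le> pi" by simp
    have "(\<lambda>x. x * cos x - sin x) \<sigma> < (\<lambda>x. x * cos x - sin x) 0"
    proof (rule DERIV_neg_imp_decreasing_open[OF sigma(1)])
      fix x assume "0 < x" "x < \<sigma>"
      then have "sin x > 0" "x > 0" using s by (auto intro: sin_gt_zero)
      then show "\<exists>y. ((\<lambda>x. x * cos x - sin x) has_real_derivative y) (at x) \<and> y < 0"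
        using root_derivative[of x] by (intro exI[of _ "- x * sin x"]) simp
    qed (intro continuous_intros)
    then show False using sin_sigma by simp
  qed
  have "\<exists>x\<ge>pi. x \<le> 3 * pi / 2 \<and> x * cos x - sin x = (0::real)"
  proof (rule IVT')
    show "pi * cos pi - sin pi \<le> 0" by simp
    have "cos (3 * pi / 2) = (0::real)" "sin (3 * pi / 2) = (-1::real)"
      using cos_periodic_pi2[of "pi/2"] sin_periodic_pi2[of "pi/2"] by (simp_all add: field_simps)
    then show "0 \<le> (3 * pi / 2) * cos (3 * pi / 2) - sin (3 * pi / 2)" by simp
  qed (use pi_gt_zero in \<open>auto intro!: continuous_intros\<close>)
  then obtain x where x: "pi \<le> x" "x \<le> 3 * pi / 2" "x * cos x = sin x" by auto
  have x0: "x > 0" using x(1) pi_gt_zero by linarith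
  have nz: "sin x \<noteq> 0"
  proof
    assume "sin x = 0"
    then have "cos x = 0" using x(3) x0 by simp
    then show False using \<open>sin x = 0\<close> sin_cos_squared_add[of x] by simp
  qed
  then have "x * cot x = 1" using x(3) by (simp add: cot_def)
  then have "\<sigma> \<le> x" by (rule sigma(3)[OF x0])
  moreover have "x \<noteq> 3 * pi / 2"
  proof
    assume "x = 3 * pi / 2"
    moreover have "cos (3 * pi / 2) = (0::real)"
      using cos_periodic_pi2[of "pi/2"] by (simp add: field_simps)
    ultimately have "cos x = 0" by (simp only:)
    then show False using x(3) nz by simp
  qed
  ultimately show "\<sigma> < 3 * pi / 2" using x(2) by linarith
qed

text \<open>This keeps \<open>0\<close> out of \<open>M\<close>. With \<open>2\<kappa> = 2\<sigma> / \<surd>3\<close> and the bounds on \<open>\<sigma>\<close>, both \<open>\<sigma>\<close> and \<open>2\<kappa>\<close> lie in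
  \<open>(\<pi>, 2\<pi>)\<close>, where \<open>x cos x - sin x\<close> is strictly increasing; it vanishes at \<open>\<sigma>\<close>.\<close>

lemma zero_mode_excluded: "2 * \<kappa> * cos (2 * \<kappa>) \<noteq> sin (2 * \<kappa>)"
proof -
  have k: "2 * \<kappa> = \<sigma> * (2 / sqrt 3)" by (simp add: kappa)
  have "sqrt 3 < sqrt (2\<^sup>2)" "sqrt ((3/2)\<^sup>2) < sqrt (3::real)"
    by (subst real_sqrt_less_iff, simp add: power_divide)+
  then have s3: "sqrt 3 < 2" "3 / 2 < sqrt (3::real)" by simp_all
  have "1 < 2 / sqrt (3::real)" using s3 by (simp add: less_divide_eq)
  then have "\<sigma> * 1 < 2 * \<kappa>" unfolding k using sigma(1) by (intro mult_strict_left_mono)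
  then have lt: "\<sigma> < 2 * \<kappa>" by simp
  have "2 / sqrt (3::real) < 4 / 3" using s3 by (simp add: divide_less_eq)
  then have "\<sigma> * (2 / sqrt 3) < \<sigma> * (4 / 3)" using sigma(1) by (intro mult_strict_left_mono)
  then have lt2: "2 * \<kappa> < 2 * pi" unfolding k using sigma_bounds(2) by linarith
  have "(\<lambda>x. x * cos x - sin x) \<sigma> < (\<lambda>x. x * cos x - sin x) (2 * \<kappa>)"
  proof (rule DERIV_pos_imp_increasing[OF lt])
    fix x assume "\<sigma> \<le> x" "x \<le> 2 * \<kappa>"
    then have x: "pi < x" "x < 2 * pi" using sigma_bounds(1) lt2 by linarith+
    then have "sin (x - pi) > 0" by (intro sin_gt_zero) auto
    then have "sin x < 0" by (simp add: sin_diff)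
    moreover have "0 < x" using x(1) pi_gt_zero by linarith
    ultimately have "- x * sin x > 0" by (simp add: mult_pos_neg)
    then show "\<exists>y. ((\<lambda>x. x * cos x - sin x) has_real_derivative y) (at x) \<and> y > 0"
      using root_derivative[of x] by blast
  qed
  then show ?thesis using sin_sigma by simp
qed

lemma sinh_imaginary: "sinh (\<i> * complex_of_real a) = \<i> * complex_of_real (sin a)"
  "cosh (\<i> * complex_of_real a) = complex_of_real (cos a)"
  by (simp_all add: sinh_conv_sin cosh_conv_cos mult.assoc[symmetric] sin_of_real cos_of_real)

lemma sinh_real: "sinh (complex_of_real a) = complex_of_real (sinh a)" "cosh (complex_of_real a) = complex_of_real (cosh a)"
  unfolding sinh_def cosh_def of_real_minus[symmetric] exp_of_real by (simp_all add: scaleR_conv_of_real)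

lemma theta_values:
  "theta \<kappa> 0 (- 4 * \<kappa>\<^sup>2) = \<i> * complex_of_real (2 * \<kappa>)" "theta \<kappa> 1 (- 4 * \<kappa>\<^sup>2) = \<i> * complex_of_real \<sigma>"
  "theta \<kappa> 2 (- 4 * \<kappa>\<^sup>2) = 0"
  "n \<ge> 3 \<Longrightarrow> theta \<kappa> n (- 4 * \<kappa>\<^sup>2) = complex_of_real (sqrt ((real n)\<^sup>2 - 4) * \<kappa>)"
proof -
  show "theta \<kappa> 0 (- 4 * \<kappa>\<^sup>2) = \<i> * complex_of_real (2 * \<kappa>)"
    using kappa_pos by (simp add: theta_def real_sqrt_mult)
  have "\<bar>- 4 * \<kappa>\<^sup>2 + \<kappa>\<^sup>2\<bar> = \<sigma>\<^sup>2" using kappa_sq by simp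
  then show "theta \<kappa> 1 (- 4 * \<kappa>\<^sup>2) = \<i> * complex_of_real \<sigma>"
    using sigma(1) by (simp add: theta_def)
  show "theta \<kappa> 2 (- 4 * \<kappa>\<^sup>2) = 0" by (simp add: theta_def)
  assume n: "n \<ge> 3"
  then have "3\<^sup>2 \<le> (real n)\<^sup>2" by (intro power_mono) auto
  then have n4: "(real n)\<^sup>2 - 4 \<ge> 0" by simp
  have "- 4 * \<kappa>\<^sup>2 + (real n)\<^sup>2 * \<kappa>\<^sup>2 = ((real n)\<^sup>2 - 4) * \<kappa>\<^sup>2" by (simp add: algebra_simps)
  then show "theta \<kappa> n (- 4 * \<kappa>\<^sup>2) = complex_of_real (sqrt ((real n)\<^sup>2 - 4) * \<kappa>)"
    using n4 kappa_pos unfolding theta_def by (simp only:) (simp add: real_sqrt_mult)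
qed

lemma disp_r_value: "disp_r \<Lambda>s = 1"
  using kappa_pos by (simp add: Lambda disp_r_def power_divide cot_def)

lemma sinh_less_cosh: assumes "0 < (t::real)" shows "sinh t < t * cosh t"
proof -
  have "(\<lambda>t. t * cosh t - sinh t) 0 < (\<lambda>t. t * cosh t - sinh t) t"
  proof (rule DERIV_pos_imp_increasing_open[OF assms])
    fix x :: real assume "0 < x" "x < t"
    then show "\<exists>y. ((\<lambda>t. t * cosh t - sinh t) has_real_derivative y) (at x) \<and> y > 0"
      by (intro exI[of _ "x * sinh x"] conjI) (auto intro!: derivative_eq_intros)
  qed (intro continuous_intros)
  then show ?thesis by simp
qed

text \<open>Here \<open>r(\<Lambda>\<^sup>*) = 1\<close>. For \<open>n = 1\<close> one has \<open>\<theta> = i\<sigma>\<close> and \<open>l = \<sigma> cot \<sigma> = 1\<close>; for \<open>n = 2\<close> one has \<open>\<theta> = 0\<close>. The value \<open>l = 1\<close>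
  is not attained for \<open>n = 0\<close> by \<open>zero_mode_excluded\<close>, nor for \<open>n \<ge> 3\<close>, where \<open>\<theta>\<close> is positive and \<open>\<theta> coth \<theta> > 1\<close>.\<close>

lemma M_set_value: "M_set \<kappa> \<Lambda>s = {1, 2}"
proof -
  have al: "fst (snd \<Lambda>s) = - 4 * \<kappa>\<^sup>2" by (simp add: Lambda)
  have "0 \<notin> M_set \<kappa> \<Lambda>s"
  proof
    assume "0 \<in> M_set \<kappa> \<Lambda>s"
    then have th: "theta \<kappa> 0 (- 4 * \<kappa>\<^sup>2) = 0 \<or> sinh (theta \<kappa> 0 (- 4 * \<kappa>\<^sup>2)) \<noteq> 0" and e: "disp_l \<kappa> 0 (- 4 * \<kappa>\<^sup>2) = 1"
      unfolding M_set_def Let_def al mem_Collect_eq disp_r_value of_real_1 by auto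
    then have "sin (2 * \<kappa>) \<noteq> 0"
      using kappa_pos unfolding theta_values(1) sinh_imaginary by auto
    have "disp_l \<kappa> 0 (- 4 * \<kappa>\<^sup>2) = complex_of_real (2 * \<kappa> * cos (2 * \<kappa>) / sin (2 * \<kappa>))"
      unfolding disp_l_def theta_values(1) Let_def sinh_imaginary using kappa_pos \<open>sin (2 * \<kappa>) \<noteq> 0\<close>
      by (simp add: field_simps)
    then have "2 * \<kappa> * cos (2 * \<kappa>) / sin (2 * \<kappa>) = 1" using e by (metis of_real_1 of_real_eq_iff)
    then show False using zero_mode_excluded \<open>sin (2 * \<kappa>) \<noteq> 0\<close> by simp
  qed
  moreover have "1 \<in> M_set \<kappa> \<Lambda>s"
  proof -
    have "disp_l \<kappa> 1 (- 4 * \<kappa>\<^sup>2) = complex_of_real (\<sigma> * cos \<sigma> / sin \<sigma>)"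
      unfolding disp_l_def theta_values(2) Let_def sinh_imaginary using sigma(1) sin_sigma_nz
      by (simp add: field_simps)
    also have "\<sigma> * cos \<sigma> / sin \<sigma> = 1" using sin_sigma sin_sigma_nz by simp
    finally have d: "disp_l \<kappa> 1 (- 4 * \<kappa>\<^sup>2) = 1" by simp
    show ?thesis unfolding M_set_def Let_def al mem_Collect_eq disp_r_value d theta_values(2) sinh_imaginary
      using sin_sigma_nz by simp
  qed
  moreover have "2 \<in> M_set \<kappa> \<Lambda>s"
    unfolding M_set_def Let_def al mem_Collect_eq disp_r_value disp_l_def theta_values(3) by simp
  moreover have "n \<notin> M_set \<kappa> \<Lambda>s" if n: "n \<ge> 3" for n
  proof
    assume a: "n \<in> M_set \<kappa> \<Lambda>s"
    define t where "t = sqrt ((real n)\<^sup>2 - 4) * \<kappa>"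
    have "3\<^sup>2 \<le> (real n)\<^sup>2" using n by (intro power_mono) auto
    then have t: "t > 0" using kappa_pos by (simp add: t_def)
    have th: "theta \<kappa> n (- 4 * \<kappa>\<^sup>2) = complex_of_real t" using theta_values(4)[OF n] by (simp add: t_def)
    have "disp_l \<kappa> n (- 4 * \<kappa>\<^sup>2) = complex_of_real (t * cosh t / sinh t)"
      unfolding disp_l_def th Let_def sinh_real using t by simp
    moreover have "disp_l \<kappa> n (- 4 * \<kappa>\<^sup>2) = 1"
      using a unfolding M_set_def Let_def al mem_Collect_eq disp_r_value of_real_1 by simp
    ultimately have "t * cosh t / sinh t = 1" by (metis of_real_1 of_real_eq_iff)
    moreover have "sinh t > 0" using t by simp
    ultimately show False using sinh_less_cosh[OF t] by simp
  qed
  ultimately have "n \<in> M_set \<kappa> \<Lambda>s \<longleftrightarrow> n = 1 \<or> n = 2" for n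
  proof -
    have "n = 0 \<or> n = 1 \<or> n = 2 \<or> 3 \<le> n" by arith
    then show ?thesis
      using \<open>0 \<notin> M_set \<kappa> \<Lambda>s\<close> \<open>1 \<in> M_set \<kappa> \<Lambda>s\<close> \<open>2 \<in> M_set \<kappa> \<Lambda>s\<close> \<open>\<And>n. 3 \<le> n \<Longrightarrow> n \<notin> M_set \<kappa> \<Lambda>s\<close> by (elim disjE) auto
  qed
  then show ?thesis by blast
qed

text \<open>Abbreviations used throughout: \<open>S n\<close> is the vertical profile of \<open>\<phi>\<^sub>n\<close>, \<open>Sd n\<close> its derivative, \<open>amp n\<close> its surface value,
  which is also the surface amplitude of the mode because \<open>\<psi>\<^sub>0\<^sub>s(1) = -1\<close>, and \<open>theta_sq n\<close> is the square of \<open>\<theta>\<^sub>n\<close>.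
  At the bifurcation point \<open>\<psi>\<^sub>0\<^sub>s = - Co\<close> and \<open>\<psi>\<^sub>0\<^sub>s\<^sub>s = 2\<kappa> Si\<close>.\<close>

definition S :: "nat \<Rightarrow> real \<Rightarrow> real" where "S n s = (if n = 1 then sin (\<sigma> * s) / \<sigma> else s)"
definition Sd :: "nat \<Rightarrow> real \<Rightarrow> real" where "Sd n s = (if n = 1 then cos (\<sigma> * s) else 1)"
definition amp :: "nat \<Rightarrow> real" where "amp n = S n 1"
definition Co :: "real \<Rightarrow> real" where "Co s = cos (2 * \<kappa> * (s - 1))"
definition Si :: "real \<Rightarrow> real" where "Si s = sin (2 * \<kappa> * (s - 1))"
definition theta_sq :: "nat \<Rightarrow> real" where "theta_sq n = (real n)\<^sup>2 * \<kappa>\<^sup>2 - 4 * \<kappa>\<^sup>2"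

lemma S_deriv: "n \<in> {1, 2} \<Longrightarrow> (S n has_real_derivative Sd n s) (at s)"
  "n \<in> {1, 2} \<Longrightarrow> (Sd n has_real_derivative theta_sq n * S n s) (at s)"
proof -
  assume n: "n \<in> {1, 2}"
  show "(S n has_real_derivative Sd n s) (at s)"
    using n sigma(1) by (auto simp: S_def[abs_def] Sd_def intro!: derivative_eq_intros)
  have "\<kappa>\<^sup>2 - 4 * \<kappa>\<^sup>2 = - (\<sigma> * \<sigma>)" using kappa_sq by (simp add: power2_eq_square)
  then show "(Sd n has_real_derivative theta_sq n * S n s) (at s)"
    using n sigma(1) by (auto simp: S_def Sd_def[abs_def] theta_sq_def intro!: derivative_eq_intros)
qed

lemma S_values: "S n 0 = 0" "amp 1 = cos \<sigma>" "amp 2 = 1" "n \<in> {1, 2} \<Longrightarrow> Sd n 1 = amp n" "S n 1 = amp n"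
  using sin_sigma sigma(1) by (auto simp: S_def Sd_def amp_def)

lemma Co_deriv: "(Co has_real_derivative - (2 * \<kappa>) * Si s) (at s)" "(Si has_real_derivative 2 * \<kappa> * Co s) (at s)"
  unfolding Co_def[abs_def] Si_def[abs_def] by (auto intro!: derivative_eq_intros)

lemma Co_values: "Co 1 = 1" "Si 1 = 0" by (auto simp: Co_def Si_def)

lemma psi0s_value: "psi0s \<Lambda>s s = - Co s"
  using kappa_pos by (simp add: psi0s_def Lambda Co_def sin_add real_sqrt_mult)

lemma psi0ss_value: "psi0ss \<Lambda>s s = 2 * \<kappa> * Si s"
  using kappa_pos by (simp add: psi0ss_def Lambda Si_def cos_add real_sqrt_mult power2_eq_square)

lemma alpha_value: "fst (snd \<Lambda>s) = - 4 * \<kappa>\<^sup>2" by (simp add: Lambda)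

lemma phi_mode_value: assumes "n \<in> {1, 2}" shows "phi_mode \<kappa> n (- 4 * \<kappa>\<^sup>2) = sep (\<lambda>x. cos (real n * \<kappa> * x)) (S n)"
proof -
  have "(if theta \<kappa> n (- 4 * \<kappa>\<^sup>2) = 0 then s else Re (sinh (theta \<kappa> n (- 4 * \<kappa>\<^sup>2) * complex_of_real s) / theta \<kappa> n (- 4 * \<kappa>\<^sup>2))) = S n s" for s
  proof (cases "n = 1")
    case True
    have "\<i> * complex_of_real \<sigma> * complex_of_real s = \<i> * complex_of_real (\<sigma> * s)" by simp
    then have "sinh (\<i> * complex_of_real \<sigma> * complex_of_real s) / (\<i> * complex_of_real \<sigma>) = complex_of_real (sin (\<sigma> * s) / \<sigma>)"
      using sigma(1) by (simp only: sinh_imaginary) simp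
    then have "Re (sinh (\<i> * complex_of_real \<sigma> * complex_of_real s) / (\<i> * complex_of_real \<sigma>)) = sin (\<sigma> * s) / \<sigma>"
      by (simp only: Re_complex_of_real)
    then show ?thesis using True sigma(1) unfolding True theta_values(2) by (simp add: S_def)
  next
    case False
    then have "n = 2" using assms by auto
    then show ?thesis using theta_values(3) by (simp add: S_def)
  qed
  then show ?thesis unfolding phi_mode_def sep_def Let_def by simp
qed

text \<open>The vertical profile of the second component of \<open>w\<^sub>n\<close>, where \<open>\<T>\<close> subtracts the displacement term
  \<open>s \<psi>\<^sub>0\<^sub>s / \<psi>\<^sub>0\<^sub>s(1)\<close>, followed by its derivatives up to order three.\<close>

definition Gn :: "nat \<Rightarrow> real \<Rightarrow> real" where "Gn n s = S n s - amp n * (s * Co s)"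
definition Gd :: "nat \<Rightarrow> real \<Rightarrow> real" where "Gd n s = Sd n s - amp n * (Co s - 2 * \<kappa> * (s * Si s))"
definition Gdd :: "nat \<Rightarrow> real \<Rightarrow> real" where "Gdd n s = theta_sq n * S n s + amp n * (4 * \<kappa> * Si s + 4 * \<kappa>\<^sup>2 * (s * Co s))"
definition Gddd :: "nat \<Rightarrow> real \<Rightarrow> real" where "Gddd n s = theta_sq n * Sd n s + amp n * (12 * \<kappa>\<^sup>2 * Co s - 8 * \<kappa> ^ 3 * (s * Si s))"

lemma Gn_deriv:
  assumes n: "n \<in> {1, 2}"
  shows "(Gn n has_real_derivative Gd n s) (at s)" "(Gd n has_real_derivative Gdd n s) (at s)"
    "(Gdd n has_real_derivative Gddd n s) (at s)"
proof -
  show "(Gn n has_real_derivative Gd n s) (at s)" unfolding Gn_def[abs_def]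
    by (auto intro!: derivative_eq_intros S_deriv[OF n] Co_deriv simp: Gd_def algebra_simps)
  show "(Gd n has_real_derivative Gdd n s) (at s)" unfolding Gd_def[abs_def]
    by (auto intro!: derivative_eq_intros S_deriv[OF n] Co_deriv simp: Gdd_def algebra_simps power2_eq_square)
  show "(Gdd n has_real_derivative Gddd n s) (at s)" unfolding Gdd_def[abs_def]
    by (auto intro!: derivative_eq_intros S_deriv[OF n] Co_deriv simp: Gddd_def algebra_simps power2_eq_square power3_eq_cube)
qed

lemma w_star_value:
  assumes n: "n \<in> {1, 2}"
  shows "w_star \<kappa> \<Lambda>s n = (\<lambda>x. amp n * cos (real n * \<kappa> * x), sep (\<lambda>x. cos (real n * \<kappa> * x)) (Gn n))"
    "wt_star \<kappa> \<Lambda>s n = (\<lambda>x. amp n * cos (real n * \<kappa> * x), sep (\<lambda>x. cos (real n * \<kappa> * x)) (S n))"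
  unfolding w_star_def wt_star_def T_map_def alpha_value phi_mode_value[OF n] Let_def deriv_psi0 psi0s_value
  by (auto simp: Co_values fun_eq_iff sep_def on_strip_def Gn_def amp_def algebra_simps)

end

text \<open>The \<open>n\<close>-th derivative of \<open>cos (m x)\<close>.\<close>

definition cosd :: "real \<Rightarrow> nat \<Rightarrow> real \<Rightarrow> real" where
  "cosd m n x = m ^ n * cos (m * x + real n * (pi / 2))"

lemma cosd_deriv: "(cosd m n has_real_derivative cosd m (Suc n) x) (at x)"
proof -
  have "cos (m * x + real (Suc n) * (pi / 2)) = - sin (m * x + real n * (pi / 2))"
  proof -
    have "m * x + real (Suc n) * (pi / 2) = (m * x + real n * (pi / 2)) + pi / 2" by (simp add: distrib_right)
    then show ?thesis by (simp only: cos_add) simp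
  qed
  moreover have "((\<lambda>x. m ^ n * cos (m * x + c)) has_real_derivative m ^ Suc n * - sin (m * x + c)) (at x)" for c
    by (auto intro!: derivative_eq_intros)
  ultimately show ?thesis unfolding cosd_def[abs_def] by (simp only:)
qed

lemma cosd_bound: "n \<le> 3 \<Longrightarrow> \<bar>cosd m n x\<bar> \<le> (1 + \<bar>m\<bar>) ^ 3"
proof -
  assume n: "n \<le> 3"
  have "\<bar>cosd m n x\<bar> \<le> \<bar>m\<bar> ^ n * 1" unfolding cosd_def abs_mult power_abs by (intro mult_left_mono) auto
  also have "\<dots> \<le> (1 + \<bar>m\<bar>) ^ n" by (simp add: power_mono)
  also have "\<dots> \<le> (1 + \<bar>m\<bar>) ^ 3" using n by (intro power_increasing) auto
  finally show ?thesis .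
qed

lemma cosd_values: "cosd m 0 x = cos (m * x)" "cosd m 1 x = - m * sin (m * x)" "cosd m 2 x = - m\<^sup>2 * cos (m * x)"
proof -
  have "cos (m * x + pi) = - cos (m * x)" by simp
  then show "cosd m 2 x = - m\<^sup>2 * cos (m * x)" by (simp add: cosd_def)
qed (simp_all add: cosd_def cos_add)

lemma line_cos:
  assumes b: "0 < \<beta>" "\<beta> < 1" shows "\<exists>B. hoelder_le_line 2 \<beta> B (\<lambda>x. c * cosd m 0 x)"
proof -
  have l: "\<bar>cosd m 2 x - cosd m 2 y\<bar> \<le> (1 + \<bar>m\<bar>) ^ 3 * dist x y" for x y
    using field_differentiable_bound[of UNIV "cosd m 2" "cosd m 3" "(1 + \<bar>m\<bar>) ^ 3" x y]
      cosd_deriv[of m 2] cosd_bound[of 3 m] by (simp add: numeral_3_eq_3 numeral_2_eq_2 dist_real_def)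
  have d: "deriv (cosd m n) = cosd m (Suc n)" "cosd m n differentiable (at x)" for n x
    using cosd_deriv[of m n] by (auto intro!: ext DERIV_imp_deriv simp: real_differentiable_def)
  define M where "M = 2 * (1 + \<bar>m\<bar>) ^ 3 + (1 + \<bar>m\<bar>) ^ 3"
  have M: "(1 + \<bar>m\<bar>) ^ 3 \<le> M" by (simp add: M_def)
  have "hoelder_le UNIV \<beta> M (cosd m 2)" unfolding M_def by (intro hoelder_le_lipschitz b l cosd_bound) auto
  then have "hoelder_le_line 2 \<beta> M (cosd m 0)"
    using cosd_bound[of 0 m] cosd_bound[of 1 m] M by (auto simp: numeral_2_eq_2 d intro: order_trans)
  then show ?thesis using hoelder_le_line_scale by blast
qed

section \<open>The kernel of the linearization and the orthogonality relations\<close>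

context double_point
begin

abbreviation "X \<equiv> fst (X_space \<kappa> \<beta>)"
abbreviation "nX \<equiv> snd (X_space \<kappa> \<beta>)"
abbreviation "T \<equiv> 2 * pi / \<kappa>"
abbreviation "freq n \<equiv> real n * \<kappa>"

lemma freq_period: "freq n * T = 2 * pi * real n"
  using kappa_pos by simp

lemma trig_period: "sin (freq n * T) = 0" "cos (freq n * T) = 1"
proof -
  show "sin (freq n * T) = 0" unfolding freq_period by (simp add: sin_integer_2pi)
  show "cos (freq n * T) = 1" unfolding freq_period by (simp add: cos_integer_2pi)
qed

lemma cos_periodic_freq: "cos (freq n * (x + T)) = cos (freq n * x)"
proof -
  have "freq n * (x + T) = freq n * x + freq n * T" by (simp add: distrib_left)
  then show ?thesis by (simp add: cos_add trig_period del: times_divide_eq_right)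
qed

lemma cosd_0: "cosd m 0 = (\<lambda>x. cos (m * x))" by (simp add: cosd_def fun_eq_iff)

lemma mode_line: "(\<lambda>x. amp n * cos (freq n * x)) \<in> C_line 2 \<kappa> \<beta>"
proof -
  obtain B where "hoelder_le_line 2 \<beta> B (\<lambda>x. amp n * cosd (freq n) 0 x)" using line_cos[OF beta] by blast
  then show ?thesis
    using hoelder_le_line_norm_le[of 2 \<beta> B] by (simp add: C_line_def cosd_0 cos_periodic_freq del: hoelder_line.simps)
qed

lemma C_line_Suc: "\<eta> \<in> C_line 2 \<kappa> \<beta> \<Longrightarrow> \<eta> \<in> C_line 1 \<kappa> \<beta>"
proof -
  assume a: "\<eta> \<in> C_line 2 \<kappa> \<beta>"
  then obtain B where B: "hoelder_le_line 2 \<beta> B \<eta>" using hoelder_le_line_norm by (auto simp: C_line_def)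
  have d: "\<And>x. \<bar>\<eta> x\<bar> \<le> B" "\<And>x. \<eta> differentiable (at x)" "hoelder_le_line 1 \<beta> B (deriv \<eta>)"
    using B by (auto simp: numeral_2_eq_2)
  have "0 \<le> B" using hoelder_le_line_nonneg[OF B] .
  then have "\<bar>\<eta> x\<bar> \<le> 3 * B" for x using d(1)[of x] by linarith
  then have "hoelder_le_line 1 \<beta> (3 * B) \<eta>"
    using d(2) hoelder_le_line_base[OF beta d(3)] by simp
  then show ?thesis using a hoelder_le_line_norm_le by (auto simp: C_line_def simp del: hoelder_line.simps)
qed

lemma Co_cont: "continuous_on A Co" "continuous_on A Si"
  using Co_deriv by (meson DERIV_continuous continuous_at_imp_continuous_on)+

lemma S_cont: "n \<in> {1,2} \<Longrightarrow> continuous_on A (S n)" "n \<in> {1,2} \<Longrightarrow> continuous_on A (Sd n)"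
  using S_deriv by (meson DERIV_continuous continuous_at_imp_continuous_on)+

lemma mode_strip:
  assumes n: "n \<in> {1, 2}"
  shows "sep (\<lambda>x. cos (freq n * x)) (Gn n) \<in> C_strip 2 \<kappa> \<beta>"
    "sep (\<lambda>x. cos (freq n * x)) (S n) \<in> C_strip 0 \<kappa> \<beta>"
proof -
  define G where "G = (!) [Gn n, Gd n, Gdd n, Gddd n]"
  have "\<exists>B. hoelder_le_strip 2 \<beta> B (sep (cosd (freq n) 0) (G 0))"
  proof (rule sep_hoelder_le2[OF beta, where A = "cosd (freq n)" and G = G, OF cosd_deriv cosd_bound])
    fix j s assume "j < (3::nat)"
    then consider "j = 0" | "j = 1" | "j = 2" by linarith
    then show "(G j has_real_derivative G (Suc j) s) (at s)"
      by cases (use Gn_deriv[OF n, of s] in \<open>auto simp: G_def numeral_2_eq_2 numeral_3_eq_3\<close>)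
  next
    have "continuous_on {0..1} (Gddd n)" unfolding Gddd_def[abs_def]
      by (intro continuous_intros Co_cont S_cont n)
    then show "continuous_on {0..1} (G 3)" by (simp add: G_def numeral_3_eq_3)
  qed
  then obtain B where B: "hoelder_le_strip 2 \<beta> B (sep (cosd (freq n) 0) (G 0))" ..
  have "hoelder_strip 2 \<beta> (sep (\<lambda>x. cos (freq n * x)) (Gn n))"
    using hoelder_le_strip_norm_le[OF B] by (simp add: G_def cosd_0)
  then show "sep (\<lambda>x. cos (freq n * x)) (Gn n) \<in> C_strip 2 \<kappa> \<beta>"
    by (simp add: C_strip_def sep_def on_strip_def cos_periodic_freq del: hoelder_strip.simps)
  have "\<exists>B. hoelder_le_strip 0 \<beta> B (sep (cosd (freq n) 0) (S n))"
    by (rule sep_hoelder_le[OF beta, where A = "cosd (freq n) 0", OF cosd_deriv cosd_bound cosd_bound S_deriv(1)[OF n] S_cont(2)[OF n]]) auto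
  then obtain C where C: "hoelder_le_strip 0 \<beta> C (sep (cosd (freq n) 0) (S n))" ..
  have "hoelder_strip 0 \<beta> (sep (\<lambda>x. cos (freq n * x)) (S n))"
    using hoelder_le_strip_norm_le[OF C] by (simp add: cosd_0)
  then show "sep (\<lambda>x. cos (freq n * x)) (S n) \<in> C_strip 0 \<kappa> \<beta>"
    by (simp add: C_strip_def sep_def on_strip_def cos_periodic_freq del: hoelder_strip.simps)
qed

abbreviation "w n \<equiv> w_star \<kappa> \<Lambda>s n"
abbreviation "wt n \<equiv> wt_star \<kappa> \<Lambda>s n"

lemma w_in_X: "n \<in> {1, 2} \<Longrightarrow> w n \<in> X"
  using mode_line mode_strip
  by (auto simp: X_carrier w_star_value sep_apply Gn_def S_values Co_values)

lemma wt_in_Y: "n \<in> {1, 2} \<Longrightarrow> wt n \<in> fst (Y_space \<kappa> \<beta>)"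
  using C_line_Suc[OF mode_line] mode_strip by (auto simp: Y_carrier w_star_value)

lemma w_jets:
  assumes n: "n \<in> {1, 2}"
  shows "fst (w n) x = amp n * cos (freq n * x)"
    "deriv (fst (w n)) x = amp n * (- freq n * sin (freq n * x))"
    "deriv (deriv (fst (w n))) x = amp n * (- (freq n)\<^sup>2 * cos (freq n * x))"
    "s \<in> {0..1} \<Longrightarrow> snd (w n) (x, s) = cos (freq n * x) * Gn n s"
    "s \<in> {0..1} \<Longrightarrow> dx (snd (w n)) (x, s) = - freq n * sin (freq n * x) * Gn n s"
    "s \<in> {0..1} \<Longrightarrow> ds (snd (w n)) (x, s) = cos (freq n * x) * Gd n s"
    "s \<in> {0..1} \<Longrightarrow> dx (dx (snd (w n))) (x, s) = - (freq n)\<^sup>2 * cos (freq n * x) * Gn n s"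
    "s \<in> {0..1} \<Longrightarrow> dx (ds (snd (w n))) (x, s) = - freq n * sin (freq n * x) * Gd n s"
    "s \<in> {0..1} \<Longrightarrow> ds (dx (snd (w n))) (x, s) = - freq n * sin (freq n * x) * Gd n s"
    "s \<in> {0..1} \<Longrightarrow> ds (ds (snd (w n))) (x, s) = cos (freq n * x) * Gdd n s"
proof -
  let ?m = "freq n"
  have f: "fst (w n) = (\<lambda>x. amp n * cosd ?m 0 x)" and g: "snd (w n) = sep (cosd ?m 0) (Gn n)"
    using w_star_value(1)[OF n] by (simp_all add: cosd_0)
  have df: "deriv (\<lambda>x. amp n * cosd ?m j x) = (\<lambda>x. amp n * cosd ?m (Suc j) x)" for j
    by (intro ext DERIV_imp_deriv DERIV_cmult cosd_deriv)
  show "fst (w n) x = amp n * cos (?m * x)" by (simp add: f cosd_values)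
  show "deriv (fst (w n)) x = amp n * (- ?m * sin (?m * x))"
    using cosd_values(2)[of ?m x] by (simp add: f df)
  show "deriv (deriv (fst (w n))) x = amp n * (- ?m\<^sup>2 * cos (?m * x))"
    using cosd_values(3)[of ?m x] by (simp add: f df numeral_2_eq_2)
  note d = sep_derivatives[OF cosd_deriv Gn_deriv(1)[OF n]] sep_derivatives[OF cosd_deriv Gn_deriv(2)[OF n]]
  assume s: "s \<in> {0..1}"
  show "snd (w n) (x, s) = cos (?m * x) * Gn n s"
    "dx (snd (w n)) (x, s) = - ?m * sin (?m * x) * Gn n s"
    "ds (snd (w n)) (x, s) = cos (?m * x) * Gd n s"
    "dx (dx (snd (w n))) (x, s) = - ?m\<^sup>2 * cos (?m * x) * Gn n s"
    "dx (ds (snd (w n))) (x, s) = - ?m * sin (?m * x) * Gd n s"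
    "ds (dx (snd (w n))) (x, s) = - ?m * sin (?m * x) * Gd n s"
    "ds (ds (snd (w n))) (x, s) = cos (?m * x) * Gdd n s"
    using cosd_values[of ?m x] sep_apply[OF s] by (simp_all add: g d numeral_2_eq_2)
qed

lemma L_op_w: assumes n: "n \<in> {1, 2}" shows "L_op \<Lambda>s (w n) = 0"
proof -
  have "fst (L_op \<Lambda>s (w n)) x = 0" for x
    using n by (simp add: L_op_def psi0s_value Co_values w_jets Gd_def S_values)
  moreover have "snd (L_op \<Lambda>s (w n)) p = 0" for p
  proof (cases "p \<in> strip")
    case True
    then obtain x s where p: "p = (x, s)" "s \<in> {0..1}" by (cases p) auto
    have "- (freq n)\<^sup>2 * cos (freq n * x) * Gn n s + cos (freq n * x) * Gdd n s + 4 * \<kappa>\<^sup>2 * (cos (freq n * x) * Gn n s)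
        - s * (amp n * (- (freq n)\<^sup>2 * cos (freq n * x))) * (- Co s) - 2 * (amp n * cos (freq n * x)) * (2 * \<kappa> * Si s) = 0"
      unfolding Gn_def Gdd_def theta_sq_def by (simp add: algebra_simps power2_eq_square)
    then show ?thesis using p(2)
      by (simp add: p(1) L_op_def w_jets[OF n] psi0s_value psi0ss_value alpha_value)
  qed (simp add: L_op_def)
  ultimately show ?thesis by (simp add: prod_eq_iff fun_eq_iff)
qed

lemma Y_pointwise_bound:
  assumes "hoelder_line 1 \<beta> (fst u)" "hoelder_strip 0 \<beta> (snd u)"
  shows "\<bar>fst u x\<bar> \<le> snd (Y_space \<kappa> \<beta>) u" "\<bar>snd u p\<bar> \<le> snd (Y_space \<kappa> \<beta>) u"
proof -
  note h = hoelder_le_line_norm[OF assms(1)] hoelder_le_strip_norm[OF assms(2)]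
  have "\<bar>snd u p\<bar> \<le> hoelder_strip_norm 0 \<beta> (snd u)"
    using hoelder_le_strip_bound[OF h(2), of p] hoelder_le_strip_off[OF h(2), of p] hoelder_le_strip_nonneg[OF h(2)]
    by (cases "p \<in> strip") auto
  then show "\<bar>fst u x\<bar> \<le> snd (Y_space \<kappa> \<beta>) u" "\<bar>snd u p\<bar> \<le> snd (Y_space \<kappa> \<beta>) u"
    using hoelder_le_line_bound[OF h(1), of x] hoelder_le_line_nonneg[OF h(1)] hoelder_le_strip_nonneg[OF h(2)] unfolding Y_norm
    by linarith+
qed

text \<open>\<open>DwF\<close> is some Frechet derivative of \<open>F\<close> at \<open>0\<close> and \<open>L_op\<close> is one, so the claim is uniqueness. On the ray \<open>t h\<close>
  the two differ by \<open>t d\<close> with a fixed \<open>d\<close>, while both remainders are \<open>o(t)\<close>; hence \<open>d = 0\<close>, pointwise.\<close>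

lemma DwF_eq: assumes h: "h \<in> X" shows "DwF \<kappa> \<beta> \<Lambda>s h = L_op \<Lambda>s h"
proof -
  let ?Y = "fst (Y_space \<kappa> \<beta>)" and ?n = "snd (Y_space \<kappa> \<beta>)"
  let ?L = "DwF \<kappa> \<beta> \<Lambda>s"
  have L: "has_fderiv (X_space \<kappa> \<beta>) (Y_space \<kappa> \<beta>) (O_set \<kappa> \<beta>) (\<lambda>w. F_map w \<Lambda>s) (L_op \<Lambda>s) 0"
    by (rule has_fderiv_F[OF beta U_Lambda])
  have D: "has_fderiv (X_space \<kappa> \<beta>) (Y_space \<kappa> \<beta>) (O_set \<kappa> \<beta>) (\<lambda>w. F_map w \<Lambda>s) ?L 0"
    unfolding DwF_def
    by (rule someI[where P = "\<lambda>L. has_fderiv (X_space \<kappa> \<beta>) (Y_space \<kappa> \<beta>) (O_set \<kappa> \<beta>) (\<lambda>w. F_map w \<Lambda>s) L 0", OF L])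
  have inY: "?L v \<in> ?Y" "L_op \<Lambda>s v \<in> ?Y" "?L (c *\<^sub>R v) = c *\<^sub>R ?L v" if "v \<in> X" for v c
    using D L that unfolding has_fderiv_def bounded_linear_between_def by blast+
  define d where "d = ?L h - L_op \<Lambda>s h"
  have n0: "0 \<le> nX h" by (rule X_norm_nonneg[OF h])
  have bound: "\<bar>fst d x\<bar> \<le> e \<and> \<bar>snd d p\<bar> \<le> e" if e: "e > 0" for e x p
  proof -
    define e' where "e' = e / (44 * (nX h + 1))"
    have e': "e' > 0" using e n0 by (simp add: e'_def)
    obtain d1 where d1: "d1 > 0" "\<And>v. v \<in> X \<Longrightarrow> nX v < d1 \<Longrightarrow> 0 + v \<in> O_set \<kappa> \<beta> \<Longrightarrow>
        ?n (F_map (0 + v) \<Lambda>s - F_map 0 \<Lambda>s - ?L v) \<le> e' * nX v"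
      using D e' unfolding has_fderiv_def by blast
    obtain d2 where d2: "d2 > 0" "\<And>v. v \<in> X \<Longrightarrow> nX v < d2 \<Longrightarrow> 0 + v \<in> O_set \<kappa> \<beta> \<Longrightarrow>
        ?n (F_map (0 + v) \<Lambda>s - F_map 0 \<Lambda>s - L_op \<Lambda>s v) \<le> e' * nX v"
      using L e' unfolding has_fderiv_def by blast
    define t where "t = min (min d1 d2) (1/8) / (44 * (nX h + 1))"
    have t: "t > 0" using d1(1) d2(1) n0 by (simp add: t_def)
    have tb: "t * (44 * (nX h + 1)) = min (min d1 d2) (1/8)" using n0 by (simp add: t_def)
    let ?v = "t *\<^sub>R h"
    have vX: "?v \<in> X" using h subspace_scale[OF subspace_X] by blast
    have nv: "nX ?v \<le> 22 * (t * nX h)" using X_norm_scale[OF h, of t] t by simp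
    have "0 \<le> t * nX h" using t n0 by simp
    then have "22 * (t * nX h) < 44 * (t * nX h) + 44 * t" using t by linarith
    then have "22 * (t * nX h) < t * (44 * (nX h + 1))" by (simp add: algebra_simps)
    then have small: "nX ?v < d1" "nX ?v < d2" "nX ?v < 1/8" using nv tb by auto
    have O: "?v \<in> O_set \<kappa> \<beta>"
    proof -
      have "fst ?v x > - 1" for x using hoelder_le_line_bound[OF X_hoelder_le(1)[OF vX], of x] small(3) by linarith
      then show ?thesis using vX by (cases "t *\<^sub>R h") (auto simp: O_set_def)
    qed
    have vN: "?v \<in> near0 \<kappa> \<beta> \<inter> O_set \<kappa> \<beta>" using O small(3) vX by (simp add: near0_def)
    let ?a = "F_map ?v \<Lambda>s - L_op \<Lambda>s ?v" and ?b = "F_map ?v \<Lambda>s - ?L ?v" and ?c = "L_op \<Lambda>s ?v - ?L ?v"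
    \<comment> \<open>The norm of \<open>Y\<close> bounds values only for functions of finite norm. For \<open>?a\<close> this is the remainder estimate, and
  \<open>?b\<close> differs from it by an element of \<open>Y\<close>.\<close>
    have ab: "?n ?a \<le> e' * nX ?v" "?n ?b \<le> e' * nX ?v"
      using d1(2)[OF vX small(1)] d2(2)[OF vX small(2)] O by (simp_all add: F_map_0[OF U_Lambda])
    obtain A where A: "hoelder_le_line 1 \<beta> A (fst ?a)"
      by (rule of_orderE[OF F_remainder_of_order(1)[OF beta U_Lambda, of \<kappa>]]) (use vN X_norm_nonneg[OF vX] in blast)
    obtain B where "hoelder_le strip \<beta> B (snd ?a)"
      by (rule of_orderE[OF F_remainder_of_order(2)[OF beta U_Lambda, of \<kappa>]]) (use vN X_norm_nonneg[OF vX] in blast)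
    then have B: "hoelder_le_strip 0 \<beta> B (snd ?a)" by (auto simp: L_op_def on_strip_def F_map_def F2_off)
    have cY: "?c \<in> ?Y" using inY[OF vX] by (intro subspace_diff[OF subspace_Y])
    have ha: "hoelder_line 1 \<beta> (fst ?a)" "hoelder_strip 0 \<beta> (snd ?a)"
      using hoelder_le_line_norm_le[OF A] hoelder_le_strip_norm_le[OF B] by auto
    have beq: "?b = ?a + ?c" by simp
    have "hoelder_le_line 1 \<beta> (A + ?n ?c) (fst ?b)" "hoelder_le_strip 0 \<beta> (B + ?n ?c) (snd ?b)"
      unfolding beq fst_add snd_add fun_plus_eta by (intro hoelder_le_line_add hoelder_le_strip_add A B Y_hoelder_le[OF cY])+
    then have hoelder_le: "hoelder_line 1 \<beta> (fst ?b)" "hoelder_strip 0 \<beta> (snd ?b)"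
      using hoelder_le_line_norm_le hoelder_le_strip_norm_le by blast+
    have td: "t *\<^sub>R d = ?a - ?b"
      unfolding d_def inY(3)[OF h] L_op_scale[OF h] by (simp add: scaleR_diff_right)
    have e'': "2 * (e' * nX ?v) \<le> t * e"
    proof -
      have "2 * (e' * nX ?v) \<le> 2 * (e' * (22 * (t * nX h)))" using nv e' by simp
      also have "\<dots> \<le> t * (e' * (44 * (nX h + 1)))" using e' t by (simp add: algebra_simps)
      also have "\<dots> = t * e" using n0 by (simp add: e'_def)
      finally show ?thesis .
    qed
    have "t * fst d x = fst ?a x - fst ?b x" using arg_cong[OF td, of "\<lambda>u. fst u x"] by (simp add: scaleR_fun_def)
    then have "t * \<bar>fst d x\<bar> \<le> t * e"
      using Y_pointwise_bound(1)[OF ha, of x] Y_pointwise_bound(1)[OF hoelder_le, of x] ab e'' t abs_mult[of t "fst d x"] by linarith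
    moreover have "t * snd d p = snd ?a p - snd ?b p" using arg_cong[OF td, of "\<lambda>u. snd u p"] by (simp add: scaleR_fun_def)
    then have "t * \<bar>snd d p\<bar> \<le> t * e"
      using Y_pointwise_bound(2)[OF ha, of p] Y_pointwise_bound(2)[OF hoelder_le, of p] ab e'' t abs_mult[of t "snd d p"] by linarith
    ultimately show ?thesis using t by simp
  qed
  have z: "y = 0" if "\<And>e. e > 0 \<Longrightarrow> \<bar>y\<bar> \<le> e" for y :: real
    using that[of "\<bar>y\<bar> / 2"] by (cases "y = 0") auto
  have "fst d x = 0" for x by (rule z) (use bound in blast)
  moreover have "snd d p = 0" for p by (rule z) (use bound in blast)
  ultimately have "d = 0" by (auto simp: prod_eq_iff fun_eq_iff)
  then show ?thesis by (simp add: d_def)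
qed

lemma ker_DwF_eq: "ker_DwF \<kappa> \<beta> \<Lambda>s = {v \<in> X. L_op \<Lambda>s v = 0}"
  using DwF_eq by (auto simp: ker_DwF_def)

lemma w_in_ker: "n \<in> {1, 2} \<Longrightarrow> w n \<in> ker_DwF \<kappa> \<beta> \<Lambda>s"
  by (simp add: ker_DwF_eq w_in_X L_op_w)

lemma subspace_ker: "subspace (ker_DwF \<kappa> \<beta> \<Lambda>s)"
  unfolding ker_DwF_eq
proof (rule subspaceI)
  show "0 \<in> {v \<in> X. L_op \<Lambda>s v = 0}" using subspace_0[OF subspace_X] L_op_zero by blast
next
  fix u v assume a: "u \<in> {v \<in> X. L_op \<Lambda>s v = 0}" "v \<in> {v \<in> X. L_op \<Lambda>s v = 0}"
  then have "L_op \<Lambda>s (u + v) = 0" using L_op_add[of u \<kappa> \<beta> v \<Lambda>s] by simp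
  then show "u + v \<in> {v \<in> X. L_op \<Lambda>s v = 0}" using a subspace_add[OF subspace_X] by blast
next
  fix c u assume a: "u \<in> {v \<in> X. L_op \<Lambda>s v = 0}"
  then have "L_op \<Lambda>s (c *\<^sub>R u) = 0" using L_op_scale[of u \<kappa> \<beta> \<Lambda>s c] by simp
  then show "c *\<^sub>R u \<in> {v \<in> X. L_op \<Lambda>s v = 0}" using a subspace_scale[OF subspace_X] by blast
qed

lemma jet_continuous: "jet \<kappa> \<beta> A j \<Longrightarrow> v \<in> X \<Longrightarrow> continuous_on A (j v)"
  using hoelder_le_continuous[OF _ beta(1)] unfolding jet_def by blast

lemma box_subset: "cbox (0, 0) (T, 1) \<subseteq> strip" by (auto simp: strip_def)

lemma wt_continuous:
  assumes n: "n \<in> {1, 2}"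
  shows "continuous_on A (\<lambda>x. amp n * cos (freq n * x))" "continuous_on A' (\<lambda>p. cos (freq n * fst p) * S n (snd p))"
  by (intro continuous_intros continuous_on_compose2[OF S_cont(1)[OF n, of UNIV]]; simp)+

lemma inner_wt:
  assumes n: "n \<in> {1, 2}" and g: "continuous_on strip g"
  shows "inner_Y \<kappa> (f, g) (wt n) = integral {0..T} (\<lambda>x. f x * (amp n * cos (freq n * x))) +
    integral (cbox (0, 0) (T, 1)) (\<lambda>(x, s). g (x, s) * (cos (freq n * x) * S n s))"
proof -
  let ?h = "\<lambda>(x, s). g (x, s) * (cos (freq n * x) * S n s)"
  have c: "continuous_on (cbox (0, 0) (T, 1)) ?h"
    using continuous_on_mult[OF continuous_on_subset[OF g box_subset] wt_continuous(2)[OF n]]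
    by (simp add: case_prod_unfold)
  have "integral (cbox (0, 0) (T, 1)) ?h = integral (cbox 0 1) (\<lambda>s. integral (cbox 0 T) (\<lambda>x. g (x, s) * (cos (freq n * x) * S n s)))"
    using integral_prod_continuous[OF c] integral_swap_continuous[OF c] by simp
  also have "\<dots> = integral (cbox 0 1) (\<lambda>s. integral (cbox 0 T) (\<lambda>x. g (x, s) * snd (wt n) (x, s)))"
    by (intro integral_cong) (simp add: w_star_value(2)[OF n] sep_apply)
  finally show ?thesis
    by (simp add: inner_Y_def w_star_value(2)[OF n])
qed

lemma X_continuous:
  assumes v: "v \<in> X"
  shows "continuous_on A (fst v)" "continuous_on A (deriv (fst v))" "continuous_on A (deriv (deriv (fst v)))"
    "continuous_on strip (snd v)" "continuous_on strip (dx (dx (snd v)))" "continuous_on strip (ds (ds (snd v)))"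
    "continuous_on A (\<lambda>x. ds (snd v) (x, 1))"
  using jet_continuous[OF jet_line(1)[OF beta] v] jet_continuous[OF jet_line(2)[OF beta] v]
    jet_continuous[OF jet_line(3)[OF beta] v] jet_continuous[OF jet_strip(1)[OF beta] v]
    jet_continuous[OF jet_strip(4)[OF beta] v] jet_continuous[OF jet_strip(7)[OF beta] v]
    jet_continuous[OF jet_surface(1)[OF beta] v] continuous_on_subset[OF _ subset_UNIV] by blast+

lemma L_op_value:
  "fst (L_op \<Lambda>s v) x = - ds (snd v) (x, 1)"
  "s \<in> {0..1} \<Longrightarrow> snd (L_op \<Lambda>s v) (x, s) = dx (dx (snd v)) (x, s) + ds (ds (snd v)) (x, s) + 4 * \<kappa>\<^sup>2 * snd v (x, s)
     + s * Co s * deriv (deriv (fst v)) x - 4 * \<kappa> * Si s * fst v x"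
  by (simp_all add: L_op_def psi0s_value psi0ss_value alpha_value Co_values)

lemma L_op_continuous: assumes v: "v \<in> X" shows "continuous_on strip (snd (L_op \<Lambda>s v))"
proof -
  have "continuous_on strip (\<lambda>p. dx (dx (snd v)) p + ds (ds (snd v)) p + 4 * \<kappa>\<^sup>2 * snd v p
     + snd p * Co (snd p) * deriv (deriv (fst v)) (fst p) - 4 * \<kappa> * Si (snd p) * fst v (fst p))"
    by (intro continuous_intros X_continuous[OF v] continuous_on_compose2[OF Co_cont(1)[of UNIV]] continuous_on_compose2[OF Co_cont(2)[of UNIV]]
       continuous_on_compose2[OF X_continuous(1)[OF v, of UNIV]] continuous_on_compose2[OF X_continuous(3)[OF v, of UNIV]]) auto
  then show ?thesis by (rule continuous_on_eq) (auto simp: L_op_value split: prod.splits)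
qed

text \<open>Subtracting the displacement \<open>s \<psi>\<^sub>0\<^sub>s \<eta>\<close> turns the second component of \<open>L\<close> into \<open>(\<Delta> - \<alpha>) Z\<close> with
  \<open>Z = \<phi> + s Co \<eta>\<close>. Green's identity leaves surface terms, and they cancel against the first component of \<open>L\<close> because the
  profile satisfies \<open>S' = S\<close> at the surface, which is the dispersion relation \<open>l(n, \<alpha>) = 1\<close>.\<close>

lemma inner_L_op_wt:
  assumes n: "n \<in> {1, 2}" and v: "v \<in> X" shows "inner_Y \<kappa> (L_op \<Lambda>s v) (wt n) = 0"
proof -
  let ?\<eta> = "fst v" and ?\<phi> = "snd v" and ?m = "freq n"
  note D = X_diff[OF v]
  have d\<eta>: "(?\<eta> has_real_derivative deriv ?\<eta> x) (at x)" "(deriv ?\<eta> has_real_derivative deriv (deriv ?\<eta>) x) (at x)" for x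
    using D(1,2) by (auto simp: DERIV_deriv_iff_real_differentiable)
  note dCo = has_field_derivative_at_within[OF Co_deriv(1)] has_field_derivative_at_within[OF Co_deriv(2)]
  define Z where "Z x s = ?\<phi> (x, s) + s * Co s * ?\<eta> x" for x s
  define Zx where "Zx x s = dx ?\<phi> (x, s) + s * Co s * deriv ?\<eta> x" for x s
  define Zxx where "Zxx x s = dx (dx ?\<phi>) (x, s) + s * Co s * deriv (deriv ?\<eta>) x" for x s
  define Zs where "Zs x s = ds ?\<phi> (x, s) + (Co s - 2 * \<kappa> * s * Si s) * ?\<eta> x" for x s
  define Zss where "Zss x s = ds (ds ?\<phi>) (x, s) + (- 4 * \<kappa> * Si s - 4 * \<kappa>\<^sup>2 * s * Co s) * ?\<eta> x" for x s
  have bot: "?\<phi> (x, 0) = 0" "?\<phi> (x, 1) = 0" for x using v by (auto simp: X_carrier)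
  have st: "UNIV \<times> {0..1} = strip" by (simp add: strip_def)
  have cont: "continuous_on strip (\<lambda>p. f p + c (snd p) * g (fst p))"
    if "continuous_on strip f" "continuous_on UNIV c" "continuous_on UNIV g" for f :: "real \<times> real \<Rightarrow> real" and c g :: "real \<Rightarrow> real"
    by (intro continuous_intros that continuous_on_compose2[OF that(2)] continuous_on_compose2[OF that(3)]) auto
  have g: "integral (cbox (0, 0) (T, 1)) (\<lambda>(x, s). (Zxx x s + Zss x s - (- 4 * \<kappa>\<^sup>2) * Z x s) * (cos (?m * x) * S n s)) =
    integral {0..T} (\<lambda>x. (Zs x 1 * S n 1 - Z x 1 * Sd n 1) * cos (?m * x))"
  proof (rule green_identity[where Zx = Zx])
    fix x s :: real assume s: "s \<in> {0..1}"
    show "((\<lambda>t. Z t s) has_real_derivative Zx x s) (at x)" unfolding Z_def Zx_def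
      by (intro DERIV_add DERIV_cmult dx_deriv D s d\<eta>)
    show "((\<lambda>t. Zx t s) has_real_derivative Zxx x s) (at x)" unfolding Zxx_def Zx_def
      by (intro DERIV_add DERIV_cmult dx_deriv D s d\<eta>)
    show "((\<lambda>t. Z x t) has_real_derivative Zs x s) (at s within {0..1})" unfolding Z_def Zs_def
      by (rule derivative_eq_intros ds_deriv[OF D(3) s] dCo refl)+ (simp add: algebra_simps)
    show "((\<lambda>t. Zs x t) has_real_derivative Zss x s) (at s within {0..1})" unfolding Zss_def Zs_def
      by (rule derivative_eq_intros ds_deriv[OF D(5) s] dCo refl)+ (simp add: algebra_simps power2_eq_square)
  next
    show "continuous_on (UNIV \<times> {0..1}) (\<lambda>(x, s). Z x s)" "continuous_on (UNIV \<times> {0..1}) (\<lambda>(x, s). Zxx x s)"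
      "continuous_on (UNIV \<times> {0..1}) (\<lambda>(x, s). Zss x s)"
      using cont[OF X_continuous(4)[OF v] _ X_continuous(1)[OF v], of "\<lambda>s. s * Co s"]
        cont[OF X_continuous(5)[OF v] _ X_continuous(3)[OF v], of "\<lambda>s. s * Co s"]
        cont[OF X_continuous(6)[OF v] _ X_continuous(1)[OF v], of "\<lambda>s. - 4 * \<kappa> * Si s - 4 * \<kappa>\<^sup>2 * s * Co s"]
      unfolding st Z_def Zxx_def Zss_def case_prod_unfold prod.collapse by (simp_all add: continuous_intros Co_cont)
    show "0 \<le> T" using kappa_pos by simp
    show "sin (?m * T) = 0" "cos (?m * T) = 1" by (rule trig_period)+
    show "Z (x + T) s = Z x s" "Zx (x + T) s = Zx x s" for x s
      using X_line_symmetric[OF v] X_strip_symmetric[OF v] by (simp_all add: Z_def Zx_def)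
    show "Z x 0 = 0" for x by (simp add: Z_def bot)
    show "(S n has_real_derivative Sd n s) (at s)" for s by (rule S_deriv[OF n])
    show "(Sd n has_real_derivative (?m\<^sup>2 + - 4 * \<kappa>\<^sup>2) * S n s) (at s)" for s
      using S_deriv(2)[OF n, of s] by (simp add: theta_sq_def power_mult_distrib)
    show "S n 0 = 0" by (rule S_values)
  qed
  have "integral (cbox (0, 0) (T, 1)) (\<lambda>(x, s). snd (L_op \<Lambda>s v) (x, s) * (cos (?m * x) * S n s)) =
    integral (cbox (0, 0) (T, 1)) (\<lambda>(x, s). (Zxx x s + Zss x s - (- 4 * \<kappa>\<^sup>2) * Z x s) * (cos (?m * x) * S n s))"
    by (intro integral_cong) (auto simp: L_op_value Z_def Zxx_def Zss_def algebra_simps)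
  also have "\<dots> = integral {0..T} (\<lambda>x. ds ?\<phi> (x, 1) * (amp n * cos (?m * x)))"
    unfolding g by (intro integral_cong) (simp add: Zs_def Z_def bot Co_values S_values(4)[OF n] S_values(5) algebra_simps)
  finally have 1: "integral (cbox (0, 0) (T, 1)) (\<lambda>(x, s). snd (L_op \<Lambda>s v) (x, s) * (cos (?m * x) * S n s)) =
    integral {0..T} (\<lambda>x. ds ?\<phi> (x, 1) * (amp n * cos (?m * x)))" .
  have "inner_Y \<kappa> (L_op \<Lambda>s v) (wt n) = inner_Y \<kappa> (fst (L_op \<Lambda>s v), snd (L_op \<Lambda>s v)) (wt n)" by simp
  also have "\<dots> = 0"
    unfolding inner_wt[OF n L_op_continuous[OF v]] 1 L_op_value by simp
  finally show ?thesis .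
qed

end

section \<open>Second variation of the equations\<close>

lemma jet2_cmult: "jet2 U P0 h k f a b c d \<Longrightarrow> jet2 U P0 h k (\<lambda>P. r * f P) (r * a) (r * b) (r * c) (r * d)"
  using jet2_mult[OF jet2_const[of U P0 h k r]] by simp

lemma jet2_diff:
  assumes "jet2 U P0 h k f a b c d" "jet2 U P0 h k g a' b' c' d'"
  shows "jet2 U P0 h k (\<lambda>P. f P - g P) (a - a') (b - b') (c - c') (d - d')"
  using jet2_add[OF assms(1) jet2_cmult[OF assms(2), of "-1"]] by simp

lemma jet2_power2:
  assumes "jet2 U P0 h k f a b c d"
  shows "jet2 U P0 h k (\<lambda>P. (f P)\<^sup>2) (a\<^sup>2) (2 * a * b) (2 * a * c) (2 * (b * c + a * d))"
  using jet2_mult[OF assms assms] by (simp add: power2_eq_square algebra_simps)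

lemma jet2_divide: "jet2 U P0 h k f a b c d \<Longrightarrow> jet2 U P0 h k (\<lambda>P. f P / r) (a / r) (b / r) (c / r) (d / r)"
  using jet2_cmult[of U P0 h k f a b c d "1 / r"] by simp

lemma jet2_eqI:
  assumes "jet2 U P0 h k f a b c d" "a = a'" "b = b'" "d = d'" shows "\<exists>c. jet2 U P0 h k f a' b' c d'"
  using assms by auto

text \<open>Values, first and second derivatives of all jets at a point where \<open>w = 0\<close>. The letters \<open>h\<close>, \<open>k\<close>, \<open>z\<close> in the names mark the first derivatives
  in the two directions and the mixed second derivative. Only the direction \<open>k\<close> moves the parameters
  \<open>\<alpha>\<close>, \<open>p\<close>, \<open>q\<close>. The second-order jets marked \<open>z\<close> enter through the same linear expression as first-order ones, namely \<open>L\<close>.\<close>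

lemma jet2_vorticity:
  assumes "jet2 U P0 h k \<alpha> \<alpha>0 0 a 0" "jet2 U P0 h k p p0 0 pk 0" "jet2 U P0 h k q q0 0 qk 0"
    and "jet2 U P0 h k g 0 (- eh) (- ek) (2 * eh * ek - ez)" "jet2 U P0 h k \<eta>x 0 ehx ekx ezx" "jet2 U P0 h k \<eta>xx 0 ehxx ekxx ezxx"
    and "jet2 U P0 h k \<phi> 0 fh fk fz" "jet2 U P0 h k \<phi>s 0 fhs fks fzs" "jet2 U P0 h k \<phi>ss 0 fhss fkss fzss"
    and "jet2 U P0 h k \<phi>xx 0 fhxx fkxx fzxx" "jet2 U P0 h k \<phi>sx 0 fhsx fksx fzsx" "jet2 U P0 h k \<phi>xs 0 fhxs fkxs fzxs"
  shows "\<exists>c. jet2 U P0 h k (\<lambda>P. vorticity (\<alpha> P) s (p P) (q P) (g P) (\<eta>x P) (\<eta>xx P) (\<phi> P) (\<phi>s P) (\<phi>ss P) (\<phi>xx P) (\<phi>sx P) (\<phi>xs P)) 0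
     (fhxx + fhss - \<alpha>0 * fh - s * ehxx * p0 - 2 * eh * q0) c
     ((fzxx + fzss - \<alpha>0 * fz - s * ezxx * p0 - 2 * ez * q0) - a * fh - s * ehxx * pk - 2 * eh * qk
      + s * (ehxx * ek + ekxx * eh) * p0 - s * (ehxx * fks + ekxx * fhs) + 4 * s * ehx * ekx * p0
      - s * (ehx * fksx + ekx * fhsx) - s * (ehx * fkxs + ekx * fhxs) + 2 * s\<^sup>2 * ehx * ekx * q0
      + 6 * q0 * eh * ek - 2 * (fhss * ek + fkss * eh))"
  unfolding vorticity_def
  apply (rule jet2_eqI)
     apply (rule jet2_add jet2_diff jet2_mult jet2_power2 jet2_const assms)+
    apply simp
   apply (simp add: algebra_simps)
  apply (simp add: algebra_simps power2_eq_square)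
  done

lemma jet2_bernoulli:
  assumes "jet2 U P0 h k p (- 1) 0 pk 0"
    and "jet2 U P0 h k g 0 (- eh) (- ek) (2 * eh * ek - ez)" "jet2 U P0 h k \<eta> 0 eh ek ez" "jet2 U P0 h k \<eta>x 0 ehx ekx ezx"
    and "jet2 U P0 h k b 0 bh bk bz"
  shows "\<exists>c. jet2 U P0 h k (\<lambda>P. bernoulli (p P) (\<eta> P) (\<eta>x P) (b P) (g P)) 0 (- bh) c
     (- bz + pk * bh + bh * bk + 3 * eh * ek + 2 * bh * ek + 2 * bk * eh + 2 * pk * eh + ehx * ekx)"
  unfolding bernoulli_def
  apply (rule jet2_eqI)
     apply (rule jet2_add jet2_diff jet2_mult jet2_power2 jet2_divide jet2_const assms)+
    apply simp
   apply (simp add: field_simps)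
  apply (simp add: field_simps power2_eq_square)
  done

context double_point
begin

text \<open>Coefficients of the two kernel modes: all derivatives of \<open>h\<^sub>1 w\<^sub>1 + h\<^sub>2 w\<^sub>2\<close> are of this form.\<close>

definition lin_comb :: "real \<times> real \<Rightarrow> (nat \<Rightarrow> real) \<Rightarrow> real" where
  "lin_comb h F = fst h * F 1 + snd h * F 2"

abbreviation "C0 n x \<equiv> cos (freq n * x)"
abbreviation "C1 n x \<equiv> - freq n * sin (freq n * x)"
abbreviation "C2 n x \<equiv> - (freq n)\<^sup>2 * cos (freq n * x)"

lemma C_deriv: "(C0 n has_real_derivative C1 n x) (at x)" "(C1 n has_real_derivative C2 n x) (at x)"
  by (auto intro!: derivative_eq_intros simp: power2_eq_square)

text \<open>The derivatives of \<open>\<psi>\<^sub>0\<^sub>s\<close> and \<open>\<psi>\<^sub>0\<^sub>s\<^sub>s\<close> with respect to the parameters, in the direction in which \<open>\<surd>\<bar>\<alpha>\<bar>\<close> has velocity \<open>b\<close>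
  and \<open>\<lambda>\<close> has velocity \<open>l\<close>. In terms of \<open>\<alpha>\<close> the velocity is \<open>- 4\<kappa>b\<close>.\<close>

definition pk :: "real \<Rightarrow> real \<Rightarrow> real \<Rightarrow> real" where
  "pk b l s = - (b / (2 * \<kappa>)) * Co s + Si s * (b * (s - 1) + l)"
definition qk :: "real \<Rightarrow> real \<Rightarrow> real \<Rightarrow> real" where
  "qk b l s = 2 * b * Si s + 2 * \<kappa> * Co s * (b * (s - 1) + l)"
definition qks :: "real \<Rightarrow> real \<Rightarrow> real \<Rightarrow> real" where
  "qks b l s = 6 * \<kappa> * b * Co s - 4 * \<kappa>\<^sup>2 * Si s * (b * (s - 1) + l)"

lemma pk_deriv: "(pk b l has_real_derivative qk b l s) (at s)" "(qk b l has_real_derivative qks b l s) (at s)"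
proof -
  show "(pk b l has_real_derivative qk b l s) (at s)" unfolding pk_def[abs_def]
    using kappa_pos by (auto intro!: derivative_eq_intros Co_deriv simp: qk_def algebra_simps)
  show "(qk b l has_real_derivative qks b l s) (at s)" unfolding qk_def[abs_def]
    by (auto intro!: derivative_eq_intros Co_deriv simp: qks_def algebra_simps power2_eq_square)
qed

text \<open>The left-hand side is the quadratic part of the second variation of \<open>vorticity\<close> at kernel elements, the right-hand
  side is \<open>(\<Delta> + 4\<kappa>\<^sup>2) Z - a \<phi>\<^sub>h\<close> for
  \<open>Z = - (s\<^sup>2 \<psi>\<^sub>0\<^sub>s\<^sub>s \<eta>\<^sub>h \<eta>\<^sub>k + s (\<eta>\<^sub>h \<phi>\<^sub>k\<^sub>s + \<eta>\<^sub>k \<phi>\<^sub>h\<^sub>s)) - s p\<^sub>k \<eta>\<^sub>h\<close>. This is the term of second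
  order in the expansion of a solution of the linear equation in the displaced variable \<open>s (1 + \<eta>)\<close>, with the opposite sign, and explains
  why the identity holds; the hypotheses say that \<open>\<phi>\<^sub>h\<close>, \<open>\<phi>\<^sub>k\<close> solve that equation.\<close>

lemma vorticity_identity:
  fixes Co Si b l s :: real
  assumes "phss = - 4 * \<kappa>\<^sup>2 * ph - phxx" "pkss = - 4 * \<kappa>\<^sup>2 * pkk - pkxx"
    "phsss = - 4 * \<kappa>\<^sup>2 * phs - phsxx" "pksss = - 4 * \<kappa>\<^sup>2 * pks - pksxx"
    and "f = - s * Co" "fd = - Co + 2 * \<kappa> * s * Si" "fdd = 4 * \<kappa> * Si + 4 * \<kappa>\<^sup>2 * s * Co"
    and "pv = - (b / (2 * \<kappa>)) * Co + Si * (b * (s - 1) + l)" "qv = 2 * b * Si + 2 * \<kappa> * Co * (b * (s - 1) + l)"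
    and "qvs = 6 * \<kappa> * b * Co - 4 * \<kappa>\<^sup>2 * Si * (b * (s - 1) + l)"
    and "a = - 4 * \<kappa> * b"
  shows "- a * (ph + f * eh) - s * ehxx * pv - 2 * eh * qv
      + s * (ehxx * ek + ekxx * eh) * (- Co) - s * (ehxx * (pks + fd * ek) + ekxx * (phs + fd * eh)) + 4 * s * ehx * ekx * (- Co)
      - s * (ehx * (pksx + fd * ekx) + ekx * (phsx + fd * ehx)) - s * (ehx * (pksx + fd * ekx) + ekx * (phsx + fd * ehx))
      + 2 * s\<^sup>2 * ehx * ekx * (2 * \<kappa> * Si)
      + 6 * (2 * \<kappa> * Si) * eh * ek - 2 * ((phss + fdd * eh) * ek + (pkss + fdd * ek) * eh)
    = (- (s\<^sup>2 * (2 * \<kappa> * Si) * (ehxx * ek + 2 * ehx * ekx + eh * ekxx)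
          + s * (ehxx * pks + 2 * ehx * pksx + eh * pksxx + ekxx * phs + 2 * ekx * phsx + ek * phsxx)) - s * pv * ehxx)
      + (- (eh * ek * (4 * \<kappa> * Si + 16 * \<kappa>\<^sup>2 * s * Co - 8 * \<kappa> ^ 3 * s\<^sup>2 * Si) + 2 * (eh * pkss + ek * phss)
          + s * (eh * pksss + ek * phsss)) - (2 * qv + s * qvs) * eh)
      + 4 * \<kappa>\<^sup>2 * (- (s\<^sup>2 * (2 * \<kappa> * Si) * eh * ek + s * (eh * pks + ek * phs)) - s * pv * eh) - a * ph"
  unfolding assms using kappa_pos
  by (simp add: field_simps power2_eq_square power3_eq_cube)

text \<open>Elevation and stream function of the kernel element with coefficients \<open>h\<close>, in the untransformed form
  \<open>\<phi> = h\<^sub>1 \<phi>\<^sub>1 + h\<^sub>2 \<phi>\<^sub>2\<close>, and their derivatives.\<close>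

definition eta :: "real \<times> real \<Rightarrow> real \<Rightarrow> real" where "eta h x = lin_comb h (\<lambda>n. amp n * C0 n x)"
definition etax :: "real \<times> real \<Rightarrow> real \<Rightarrow> real" where "etax h x = lin_comb h (\<lambda>n. amp n * C1 n x)"
definition etaxx :: "real \<times> real \<Rightarrow> real \<Rightarrow> real" where "etaxx h x = lin_comb h (\<lambda>n. amp n * C2 n x)"
definition ph :: "real \<times> real \<Rightarrow> real \<Rightarrow> real \<Rightarrow> real" where "ph h x s = lin_comb h (\<lambda>n. C0 n x * S n s)"
definition phs :: "real \<times> real \<Rightarrow> real \<Rightarrow> real \<Rightarrow> real" where "phs h x s = lin_comb h (\<lambda>n. C0 n x * Sd n s)"
definition phsx :: "real \<times> real \<Rightarrow> real \<Rightarrow> real \<Rightarrow> real" where "phsx h x s = lin_comb h (\<lambda>n. C1 n x * Sd n s)"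
definition phsxx :: "real \<times> real \<Rightarrow> real \<Rightarrow> real \<Rightarrow> real" where "phsxx h x s = lin_comb h (\<lambda>n. C2 n x * Sd n s)"
definition phss :: "real \<times> real \<Rightarrow> real \<Rightarrow> real \<Rightarrow> real" where "phss h x s = lin_comb h (\<lambda>n. C0 n x * (theta_sq n * S n s))"
definition phsss :: "real \<times> real \<Rightarrow> real \<Rightarrow> real \<Rightarrow> real" where "phsss h x s = lin_comb h (\<lambda>n. C0 n x * (theta_sq n * Sd n s))"

lemma lin_comb_deriv:
  assumes "\<And>n. n \<in> {1, 2} \<Longrightarrow> ((\<lambda>t. F t n) has_real_derivative F' n) (at x within A)"
  shows "((\<lambda>t. lin_comb h (F t)) has_real_derivative lin_comb h F') (at x within A)"
  unfolding lin_comb_def using assms by (intro DERIV_add DERIV_cmult) auto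

lemma mode_derivs:
  "(eta h has_real_derivative etax h x) (at x)" "(etax h has_real_derivative etaxx h x) (at x)"
  "((\<lambda>t. phs h t s) has_real_derivative phsx h x s) (at x)" "((\<lambda>t. phsx h t s) has_real_derivative phsxx h x s) (at x)"
  "((\<lambda>t. phs h x t) has_real_derivative phss h x s) (at s)" "((\<lambda>t. phss h x t) has_real_derivative phsss h x s) (at s)"
  unfolding eta_def[abs_def] etax_def[abs_def] etaxx_def phs_def[abs_def] phsx_def[abs_def] phsxx_def phss_def[abs_def] phsss_def
  by (intro lin_comb_deriv DERIV_cmult DERIV_cmult_right C_deriv S_deriv; assumption)+

lemma lin_comb_continuous:
  assumes "\<And>n. n \<in> {1, 2} \<Longrightarrow> continuous_on A (\<lambda>p. F p n)"
  shows "continuous_on A (\<lambda>p. lin_comb h (F p))"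
  unfolding lin_comb_def using assms by (intro continuous_intros) auto

lemma mode_continuous:
  fixes A :: "(real \<times> real) set"
  shows "continuous_on A (\<lambda>p. eta h (fst p))" "continuous_on A (\<lambda>p. etax h (fst p))" "continuous_on A (\<lambda>p. etaxx h (fst p))"
    "continuous_on A (\<lambda>p. phs h (fst p) (snd p))" "continuous_on A (\<lambda>p. phsx h (fst p) (snd p))" "continuous_on A (\<lambda>p. phsxx h (fst p) (snd p))"
    "continuous_on A (\<lambda>p. phss h (fst p) (snd p))" "continuous_on A (\<lambda>p. phsss h (fst p) (snd p))" "continuous_on A (\<lambda>p. ph h (fst p) (snd p))"
proof -
  have S: "continuous_on A (\<lambda>p. S n (snd p))" "continuous_on A (\<lambda>p. Sd n (snd p))" if "n \<in> {1, 2}" for n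
    using continuous_on_compose2[OF S_cont(1)[OF that, of UNIV], of A snd] continuous_on_compose2[OF S_cont(2)[OF that, of UNIV], of A snd]
    by (auto simp: continuous_on_snd)
  show "continuous_on A (\<lambda>p. eta h (fst p))" "continuous_on A (\<lambda>p. etax h (fst p))" "continuous_on A (\<lambda>p. etaxx h (fst p))"
    unfolding eta_def etax_def etaxx_def by (intro lin_comb_continuous continuous_intros)+
  show "continuous_on A (\<lambda>p. phs h (fst p) (snd p))" "continuous_on A (\<lambda>p. phsx h (fst p) (snd p))" "continuous_on A (\<lambda>p. phsxx h (fst p) (snd p))"
    "continuous_on A (\<lambda>p. phss h (fst p) (snd p))" "continuous_on A (\<lambda>p. phsss h (fst p) (snd p))" "continuous_on A (\<lambda>p. ph h (fst p) (snd p))"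
    unfolding phs_def phsx_def phsxx_def phss_def phsss_def ph_def by (intro lin_comb_continuous continuous_intros S; assumption)+
qed

text \<open>Second variation of the vorticity equation without the contribution of the second derivative of the unknown, in
  the form provided by \<open>vorticity_identity\<close>.\<close>

definition second_var :: "real \<times> real \<Rightarrow> real \<times> real \<Rightarrow> real \<Rightarrow> real \<Rightarrow> real \<Rightarrow> real \<Rightarrow> real" where
  "second_var h k b l x s =
     (- (s\<^sup>2 * (2 * \<kappa> * Si s) * (etaxx h x * eta k x + 2 * etax h x * etax k x + eta h x * etaxx k x)
          + s * (etaxx h x * phs k x s + 2 * etax h x * phsx k x s + eta h x * phsxx k x s
               + etaxx k x * phs h x s + 2 * etax k x * phsx h x s + eta k x * phsxx h x s)) - s * pk b l s * etaxx h x)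
      + (- (eta h x * eta k x * (4 * \<kappa> * Si s + 16 * \<kappa>\<^sup>2 * s * Co s - 8 * \<kappa> ^ 3 * s\<^sup>2 * Si s) + 2 * (eta h x * phss k x s + eta k x * phss h x s)
          + s * (eta h x * phsss k x s + eta k x * phsss h x s)) - (2 * qk b l s + s * qks b l s) * eta h x)
      + 4 * \<kappa>\<^sup>2 * (- (s\<^sup>2 * (2 * \<kappa> * Si s) * eta h x * eta k x + s * (eta h x * phs k x s + eta k x * phs h x s)) - s * pk b l s * eta h x)
      + 4 * \<kappa> * b * ph h x s"

lemma pk_continuous: "continuous_on A (pk b l)" "continuous_on A (qk b l)" "continuous_on A (qks b l)"
  unfolding pk_def[abs_def] qk_def[abs_def] qks_def[abs_def] by (intro continuous_intros Co_cont)+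

lemma coefficient_continuous:
  fixes A :: "(real \<times> real) set"
  assumes "\<And>B. continuous_on B c" shows "continuous_on A (\<lambda>p. c (snd p))"
  by (rule continuous_on_compose2[OF assms[of UNIV]]) (auto intro: continuous_intros)

lemma second_var_continuous: "continuous_on A (\<lambda>(x, s). second_var h k b l x s)"
  unfolding second_var_def case_prod_unfold
  by (intro continuous_intros mode_continuous coefficient_continuous[OF pk_continuous(1)] coefficient_continuous[OF pk_continuous(2)]
      coefficient_continuous[OF pk_continuous(3)] coefficient_continuous[OF Co_cont(1)] coefficient_continuous[OF Co_cont(2)])

lemma surface_values:
  "phs h x 1 = eta h x" "phss h x 1 = - 4 * \<kappa>\<^sup>2 * eta h x - etaxx h x" "pk b l 1 = - b / (2 * \<kappa>)" "qk b l 1 = 2 * \<kappa> * l"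
  using S_values(4)[of 1] S_values(4)[of 2]
  by (simp_all add: phs_def eta_def lin_comb_def phss_def etaxx_def theta_sq_def S_values(5) pk_def qk_def Co_values algebra_simps power_mult_distrib)

text \<open>All interior terms but \<open>4\<kappa>b \<phi>\<^sub>h\<close> are of the form \<open>(\<Delta> - \<alpha>) Z\<close>, so Green's identity reduces them to the
  values of \<open>Z\<close> and \<open>Z\<^sub>s\<close> at the surface.\<close>

lemma second_var_green:
  assumes n: "n \<in> {1, 2}"
  shows "integral (cbox (0, 0) (T, 1)) (\<lambda>(x, s). second_var h k b l x s * (C0 n x * S n s)) =
    integral {0..T} (\<lambda>x. (eta h x * etaxx k x + eta k x * etaxx h x + 4 * \<kappa>\<^sup>2 * eta h x * eta k x - 2 * \<kappa> * l * eta h x) * (amp n * C0 n x))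
    + 4 * \<kappa> * b * integral (cbox (0, 0) (T, 1)) (\<lambda>(x, s). ph h x s * (C0 n x * S n s))"
proof -
  \<comment> \<open>\<open>Z\<close> is the displacement term of \<open>vorticity_identity\<close>, the others are its partial derivatives.\<close>
  define Z where "Z x s = - (s\<^sup>2 * (2 * \<kappa> * Si s) * (eta h x * eta k x) + s * (eta h x * phs k x s + eta k x * phs h x s)) - s * pk b l s * eta h x" for x s
  define Zx where "Zx x s = - (s\<^sup>2 * (2 * \<kappa> * Si s) * (etax h x * eta k x + eta h x * etax k x)
     + s * (etax h x * phs k x s + eta h x * phsx k x s + (etax k x * phs h x s + eta k x * phsx h x s))) - s * pk b l s * etax h x" for x s
  define Zxx where "Zxx x s = - (s\<^sup>2 * (2 * \<kappa> * Si s) * (etaxx h x * eta k x + 2 * etax h x * etax k x + eta h x * etaxx k x)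
          + s * (etaxx h x * phs k x s + 2 * etax h x * phsx k x s + eta h x * phsxx k x s
               + etaxx k x * phs h x s + 2 * etax k x * phsx h x s + eta k x * phsxx h x s)) - s * pk b l s * etaxx h x" for x s
  define Zs where "Zs x s = - (eta h x * eta k x * (4 * \<kappa> * s * Si s + 4 * \<kappa>\<^sup>2 * s\<^sup>2 * Co s) + (eta h x * phs k x s + eta k x * phs h x s)
     + s * (eta h x * phss k x s + eta k x * phss h x s)) - (pk b l s + s * qk b l s) * eta h x" for x s
  define Zss where "Zss x s = - (eta h x * eta k x * (4 * \<kappa> * Si s + 16 * \<kappa>\<^sup>2 * s * Co s - 8 * \<kappa> ^ 3 * s\<^sup>2 * Si s) + 2 * (eta h x * phss k x s + eta k x * phss h x s)
          + s * (eta h x * phsss k x s + eta k x * phsss h x s)) - (2 * qk b l s + s * qks b l s) * eta h x" for x s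
  note [derivative_intros] = mode_derivs[THEN DERIV_chain2] Co_deriv[THEN DERIV_chain2] pk_deriv[THEN DERIV_chain2]
  have per: "C0 m (x + T) = C0 m x" "sin (freq m * (x + T)) = sin (freq m * x)" for m x
  proof -
    have "freq m * (x + T) = freq m * x + freq m * T" by (simp add: distrib_left)
    then show "sin (freq m * (x + T)) = sin (freq m * x)"
      using trig_period[of m] by (simp add: sin_add del: times_divide_eq_right)
  qed (rule cos_periodic_freq)
  have g: "integral (cbox (0, 0) (T, 1)) (\<lambda>(x, s). (Zxx x s + Zss x s - (- 4 * \<kappa>\<^sup>2) * Z x s) * (C0 n x * S n s)) =
    integral {0..T} (\<lambda>x. (Zs x 1 * S n 1 - Z x 1 * Sd n 1) * C0 n x)"
  proof (rule green_identity[where Zx = Zx])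
    fix x s :: real
    show "((\<lambda>t. Z t s) has_real_derivative Zx x s) (at x)" unfolding Z_def Zx_def
      by (rule derivative_eq_intros mode_derivs refl)+ (simp add: algebra_simps)
    show "((\<lambda>t. Zx t s) has_real_derivative Zxx x s) (at x)" unfolding Zxx_def Zx_def
      by (rule derivative_eq_intros mode_derivs refl)+ (simp add: algebra_simps)
    have "((\<lambda>t. Z x t) has_real_derivative Zs x s) (at s)" unfolding Z_def Zs_def
      by (rule derivative_eq_intros mode_derivs Co_deriv pk_deriv refl)+ (simp add: algebra_simps power2_eq_square)
    then show "((\<lambda>t. Z x t) has_real_derivative Zs x s) (at s within {0..1})" by (rule has_field_derivative_at_within)
    have "((\<lambda>t. Zs x t) has_real_derivative Zss x s) (at s)" unfolding Zss_def Zs_def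
      by (rule derivative_eq_intros mode_derivs Co_deriv pk_deriv refl)+ (simp add: algebra_simps power2_eq_square power3_eq_cube)
    then show "((\<lambda>t. Zs x t) has_real_derivative Zss x s) (at s within {0..1})" by (rule has_field_derivative_at_within)
  next
    show "continuous_on (UNIV \<times> {0..1}) (\<lambda>(x, s). Z x s)" "continuous_on (UNIV \<times> {0..1}) (\<lambda>(x, s). Zxx x s)"
      "continuous_on (UNIV \<times> {0..1}) (\<lambda>(x, s). Zss x s)"
      unfolding Z_def Zxx_def Zss_def case_prod_unfold
      by (intro continuous_intros mode_continuous coefficient_continuous[OF pk_continuous(1)] coefficient_continuous[OF pk_continuous(2)]
      coefficient_continuous[OF pk_continuous(3)] coefficient_continuous[OF Co_cont(1)] coefficient_continuous[OF Co_cont(2)])+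
    show "0 \<le> T" using kappa_pos by simp
    show "sin (freq n * T) = 0" "cos (freq n * T) = 1" by (rule trig_period)+
    show "Z (x + T) s = Z x s" "Zx (x + T) s = Zx x s" for x s
      by (simp_all only: Z_def Zx_def eta_def etax_def phs_def phsx_def per)
    show "Z x 0 = 0" for x by (simp add: Z_def)
    show "(S n has_real_derivative Sd n s) (at s)" for s by (rule S_deriv[OF n])
    show "(Sd n has_real_derivative ((freq n)\<^sup>2 + - 4 * \<kappa>\<^sup>2) * S n s) (at s)" for s
      using S_deriv(2)[OF n, of s] by (simp add: theta_sq_def power_mult_distrib)
    show "S n 0 = 0" by (rule S_values)
  qed
  have c1: "continuous_on (cbox (0, 0) (T, 1)) (\<lambda>(x, s). second_var h k b l x s * (C0 n x * S n s))"
    using continuous_on_mult[OF second_var_continuous wt_continuous(2)[OF n]] by (simp add: case_prod_unfold)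
  have c2: "continuous_on (cbox (0, 0) (T, 1)) (\<lambda>(x, s). ph h x s * (C0 n x * S n s))"
    using continuous_on_mult[OF mode_continuous(9) wt_continuous(2)[OF n]] by (simp add: case_prod_unfold)
  have "integral (cbox (0, 0) (T, 1)) (\<lambda>(x, s). (Zxx x s + Zss x s - (- 4 * \<kappa>\<^sup>2) * Z x s) * (C0 n x * S n s)) =
    integral (cbox (0, 0) (T, 1)) (\<lambda>p. (\<lambda>(x, s). second_var h k b l x s * (C0 n x * S n s)) p - 4 * \<kappa> * b * (\<lambda>(x, s). ph h x s * (C0 n x * S n s)) p)"
    by (intro integral_cong) (auto simp: second_var_def Z_def Zxx_def Zss_def algebra_simps)
  also have "\<dots> = integral (cbox (0, 0) (T, 1)) (\<lambda>(x, s). second_var h k b l x s * (C0 n x * S n s))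
      - 4 * \<kappa> * b * integral (cbox (0, 0) (T, 1)) (\<lambda>(x, s). ph h x s * (C0 n x * S n s))"
    using integral_diff[OF integrable_continuous[OF c1] integrable_on_cmult_left[OF integrable_continuous[OF c2], of "4 * \<kappa> * b"]] by simp
  finally have e1: "integral (cbox (0, 0) (T, 1)) (\<lambda>(x, s). (Zxx x s + Zss x s - (- 4 * \<kappa>\<^sup>2) * Z x s) * (C0 n x * S n s)) =
    integral (cbox (0, 0) (T, 1)) (\<lambda>(x, s). second_var h k b l x s * (C0 n x * S n s))
      - 4 * \<kappa> * b * integral (cbox (0, 0) (T, 1)) (\<lambda>(x, s). ph h x s * (C0 n x * S n s))" .
  have "integral {0..T} (\<lambda>x. (Zs x 1 * S n 1 - Z x 1 * Sd n 1) * C0 n x) =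
    integral {0..T} (\<lambda>x. (eta h x * etaxx k x + eta k x * etaxx h x + 4 * \<kappa>\<^sup>2 * eta h x * eta k x - 2 * \<kappa> * l * eta h x) * (amp n * C0 n x))"
    by (intro integral_cong) (simp add: Zs_def Z_def surface_values Co_values S_values(4)[OF n] S_values(5) algebra_simps)
  then show ?thesis using g e1 by simp
qed

lemma integral_cos_int: "((\<lambda>x. cos (real_of_int m * \<kappa> * x)) has_integral (if m = 0 then T else 0)) {0..T}"
proof -
  have "cos (real_of_int m * \<kappa> * x) = cos (real (nat \<bar>m\<bar>) * \<kappa> * x)" for x
  proof (cases "m \<ge> 0")
    case False
    then have "real (nat \<bar>m\<bar>) * \<kappa> * x = - (real_of_int m * \<kappa> * x)" by simp
    then show ?thesis by simp
  qed simp
  then show ?thesis using integral_cos_harmonic[OF kappa_pos, of "nat \<bar>m\<bar>"] by simp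
qed

definition kron :: "int \<Rightarrow> real" where "kron m = (if m = 0 then 1 else 0)"

text \<open>The product of three cosines has mean \<open>1/4\<close> times the number of vanishing integers among \<open>i \<pm> j \<pm> n\<close>; with two
  sines in place of cosines, two of the four contributions change sign. This is where the resonances are found.\<close>

lemma integral_triple:
  fixes i j n :: nat
  shows "((\<lambda>x. C0 i x * C0 j x * C0 n x) has_integral (T / 4) *
      (kron (int i + int j + int n) + kron (int i + int j - int n) + kron (int i - int j + int n) + kron (int i - int j - int n))) {0..T}"
    "((\<lambda>x. sin (freq i * x) * sin (freq j * x) * C0 n x) has_integral (T / 4) *
      (kron (int i - int j + int n) + kron (int i - int j - int n) - kron (int i + int j + int n) - kron (int i + int j - int n))) {0..T}"
proof -
  let ?I = "\<lambda>m x. cos (real_of_int m * \<kappa> * x)"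
  have I: "(?I m has_integral T * kron m) {0..T}" for m using integral_cos_int[of m] by (auto simp: kron_def)
  have e: "?I (int i + int j + int n) x = cos (freq i * x + freq j * x + freq n * x)"
    "?I (int i + int j - int n) x = cos (freq i * x + freq j * x - freq n * x)"
    "?I (int i - int j + int n) x = cos (freq i * x - freq j * x + freq n * x)"
    "?I (int i - int j - int n) x = cos (freq i * x - freq j * x - freq n * x)" for x
    by (simp_all add: algebra_simps)
  have "((\<lambda>x. 1 / 4 * (?I (int i + int j + int n) x + ?I (int i + int j - int n) x + ?I (int i - int j + int n) x + ?I (int i - int j - int n) x))
     has_integral 1 / 4 * (T * kron (int i + int j + int n) + T * kron (int i + int j - int n) + T * kron (int i - int j + int n) + T * kron (int i - int j - int n))) {0..T}"
    by (intro has_integral_mult_right has_integral_add I)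
  then show "((\<lambda>x. C0 i x * C0 j x * C0 n x) has_integral (T / 4) *
      (kron (int i + int j + int n) + kron (int i + int j - int n) + kron (int i - int j + int n) + kron (int i - int j - int n))) {0..T}"
    unfolding e by (simp add: cos_add cos_diff sin_add sin_diff algebra_simps add_divide_distrib)
  have "((\<lambda>x. 1 / 4 * (?I (int i - int j + int n) x + ?I (int i - int j - int n) x - ?I (int i + int j + int n) x - ?I (int i + int j - int n) x))
     has_integral 1 / 4 * (T * kron (int i - int j + int n) + T * kron (int i - int j - int n) - T * kron (int i + int j + int n) - T * kron (int i + int j - int n))) {0..T}"
    by (intro has_integral_mult_right has_integral_add has_integral_diff I)
  then show "((\<lambda>x. sin (freq i * x) * sin (freq j * x) * C0 n x) has_integral (T / 4) *
      (kron (int i - int j + int n) + kron (int i - int j - int n) - kron (int i + int j + int n) - kron (int i + int j - int n))) {0..T}"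
    unfolding e by (simp add: cos_add cos_diff sin_add sin_diff algebra_simps add_divide_distrib diff_divide_distrib)
qed

lemma integral_pair: "((\<lambda>x. C0 i x * C0 n x) has_integral (T / 2) * (kron (int i + int n) + kron (int i - int n))) {0..T}"
  using integral_triple(1)[of i n 0] by (simp add: algebra_simps)

text \<open>For the first mode the antiderivative gives \<open>(1 - (cos \<sigma>)\<^sup>2) / (2 \<sigma>\<^sup>2)\<close>, by \<open>sin \<sigma> = \<sigma> cos \<sigma>\<close>, and
  \<open>1 - (cos \<sigma>)\<^sup>2 = \<sigma>\<^sup>2 (cos \<sigma>)\<^sup>2\<close>.\<close>

lemma integral_S_sq: "integral {0..1} (\<lambda>s. S 1 s * S 1 s) = (cos \<sigma>)\<^sup>2 / 2" "integral {0..1} (\<lambda>s. S 2 s * S 2 s) = 1 / 3"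
proof -
  have "((\<lambda>s. S 1 s * S 1 s) has_integral (1 / (2 * \<sigma>\<^sup>2) - sin (\<sigma> * 1) * cos (\<sigma> * 1) / (2 * \<sigma> ^ 3)) -
      (0 / (2 * \<sigma>\<^sup>2) - sin (\<sigma> * 0) * cos (\<sigma> * 0) / (2 * \<sigma> ^ 3))) {0..1}"
  proof (rule fundamental_theorem_of_calculus)
    fix s :: real
    have "((\<lambda>s. s / (2 * \<sigma>\<^sup>2) - sin (\<sigma> * s) * cos (\<sigma> * s) / (2 * \<sigma> ^ 3)) has_real_derivative S 1 s * S 1 s) (at s within {0..1})"
    proof -
      have coef: "cos (\<sigma> * s) * (cos (\<sigma> * s) * \<sigma>) = (1 - sin (\<sigma> * s) * sin (\<sigma> * s)) * \<sigma>"
      proof -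
        have "cos (\<sigma> * s) * cos (\<sigma> * s) = 1 - sin (\<sigma> * s) * sin (\<sigma> * s)"
          using sin_cos_squared_add3[of "\<sigma> * s"] by linarith
        then show ?thesis by (metis mult.assoc)
      qed
      have "((\<lambda>s. s / (2 * \<sigma>\<^sup>2) - sin (\<sigma> * s) * cos (\<sigma> * s) / (2 * \<sigma> ^ 3)) has_real_derivative
          1 / (2 * \<sigma>\<^sup>2) - (cos (\<sigma> * s) * (cos (\<sigma> * s) * \<sigma>) - sin (\<sigma> * s) * (sin (\<sigma> * s) * \<sigma>)) / (2 * \<sigma> ^ 3)) (at s within {0..1})"
      proof -
        have "((\<lambda>s. sin (\<sigma> * s) * cos (\<sigma> * s)) has_real_derivative
          cos (\<sigma> * s) * (cos (\<sigma> * s) * \<sigma>) - sin (\<sigma> * s) * (sin (\<sigma> * s) * \<sigma>)) (at s within {0..1})"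
          by (auto intro!: derivative_eq_intros simp: algebra_simps)
        from DERIV_diff[OF DERIV_cdivide[OF DERIV_ident, of "2 * \<sigma>\<^sup>2"] DERIV_cdivide[OF this, of "2 * \<sigma> ^ 3"]]
        show ?thesis .
      qed
      also have "1 / (2 * \<sigma>\<^sup>2) - (cos (\<sigma> * s) * (cos (\<sigma> * s) * \<sigma>) - sin (\<sigma> * s) * (sin (\<sigma> * s) * \<sigma>)) / (2 * \<sigma> ^ 3) = S 1 s * S 1 s"
        unfolding coef using sigma(1) by (simp add: S_def field_simps power2_eq_square power3_eq_cube)
      finally show ?thesis .
    qed
    then show "((\<lambda>s. s / (2 * \<sigma>\<^sup>2) - sin (\<sigma> * s) * cos (\<sigma> * s) / (2 * \<sigma> ^ 3)) has_vector_derivative S 1 s * S 1 s) (at s within {0..1})"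
      by (rule has_derivative_subinterval)
  qed simp
  then have "integral {0..1} (\<lambda>s. S 1 s * S 1 s) = 1 / (2 * \<sigma>\<^sup>2) - sin \<sigma> * cos \<sigma> / (2 * \<sigma> ^ 3)" by (auto dest: integral_unique)
  also have "\<dots> = (1 - (cos \<sigma>)\<^sup>2) / (2 * \<sigma>\<^sup>2)"
    using sigma(1) unfolding sin_sigma by (simp add: field_simps power2_eq_square power3_eq_cube)
  also have "\<dots> = (cos \<sigma>)\<^sup>2 / 2"
  proof -
    have "1 - (cos \<sigma>)\<^sup>2 = \<sigma>\<^sup>2 * (cos \<sigma>)\<^sup>2" using cos_sigma_sq by (simp add: algebra_simps)
    then show ?thesis using sigma(1) by simp
  qed
  finally show "integral {0..1} (\<lambda>s. S 1 s * S 1 s) = (cos \<sigma>)\<^sup>2 / 2" .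
  have "((\<lambda>s. S 2 s * S 2 s) has_integral 1 ^ 3 / 3 - 0 ^ 3 / 3) {0..1}"
    by (rule fundamental_theorem_of_calculus)
      (auto intro!: derivative_eq_intros has_derivative_subinterval simp: S_def power2_eq_square)
  then show "integral {0..1} (\<lambda>s. S 2 s * S 2 s) = 1 / 3" by (auto dest: integral_unique)
qed

lemma box_mode:
  assumes "n \<in> {1, 2}"
  shows "integral (cbox (0, 0) (T, 1)) (\<lambda>(x, s). ph h x s * (C0 n x * S n s)) =
    lin_comb h (\<lambda>i. T / 2 * kron (int i - int n)) * integral {0..1} (\<lambda>s. S n s * S n s)"
proof -
  have c: "continuous_on A (\<lambda>x. C0 i x * C0 n x)" for i A by (intro continuous_intros)
  have g: "continuous_on A (\<lambda>s. S i s * S n s)" if "i \<in> {1, 2}" for i A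
    by (intro continuous_intros S_cont that assms)
  have b: "integral (cbox (0, 0) (T, 1)) (\<lambda>(x, s). (C0 i x * C0 n x) * (S i s * S n s)) =
      T / 2 * kron (int i - int n) * integral {0..1} (\<lambda>s. S n s * S n s)" if i: "i \<in> {1, 2}" for i
  proof -
    have "integral {0..T} (\<lambda>x. C0 i x * C0 n x) = T / 2 * (kron (int i + int n) + kron (int i - int n))"
      by (rule integral_unique[OF integral_pair])
    moreover have "kron (int i + int n) = 0" using i by (auto simp: kron_def)
    ultimately show ?thesis unfolding integral_box_product[OF c g[OF i]] by (auto simp: kron_def)
  qed
  have ci: "(\<lambda>(x, s). (C0 i x * C0 n x) * (S i s * S n s)) integrable_on cbox (0, 0) (T, 1)" if i: "i \<in> {1, 2}" for i
  proof (rule integrable_continuous)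
    show "continuous_on (cbox (0, 0) (T, 1)) (\<lambda>(x, s). (C0 i x * C0 n x) * (S i s * S n s))"
      unfolding case_prod_unfold
      by (intro continuous_intros coefficient_continuous[OF S_cont(1)[OF i]] coefficient_continuous[OF S_cont(1)[OF assms]])
  qed
  have "integral (cbox (0, 0) (T, 1)) (\<lambda>(x, s). ph h x s * (C0 n x * S n s)) =
    integral (cbox (0, 0) (T, 1)) (\<lambda>p. fst h * (\<lambda>(x, s). (C0 1 x * C0 n x) * (S 1 s * S n s)) p
       + snd h * (\<lambda>(x, s). (C0 2 x * C0 n x) * (S 2 s * S n s)) p)"
    by (intro integral_cong) (auto simp: ph_def lin_comb_def algebra_simps)
  also have "\<dots> = fst h * (T / 2 * kron (int 1 - int n) * integral {0..1} (\<lambda>s. S n s * S n s)) +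
      snd h * (T / 2 * kron (int 2 - int n) * integral {0..1} (\<lambda>s. S n s * S n s))"
    using integral_add[OF integrable_on_cmult_left[OF ci[of 1], of "fst h"] integrable_on_cmult_left[OF ci[of 2], of "snd h"]] b[of 1] b[of 2]
    by simp
  also have "\<dots> = lin_comb h (\<lambda>i. T / 2 * kron (int i - int n)) * integral {0..1} (\<lambda>s. S n s * S n s)"
    unfolding lin_comb_def by (simp only: distrib_right mult.assoc)
  finally show ?thesis .
qed

lemma norm_wt: "inner_Y \<kappa> (wt 1) (wt 1) = T / 2 * (3 / 2 * (cos \<sigma>)\<^sup>2)" "inner_Y \<kappa> (wt 2) (wt 2) = T / 2 * (4 / 3)"
proof -
  have i: "inner_Y \<kappa> (wt n) (wt n) = T / 2 * (amp n * amp n + integral {0..1} (\<lambda>s. S n s * S n s))" if n: "n \<in> {1, 2}" for n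
  proof -
    have c: "continuous_on strip (snd (wt n))"
      using hoelder_le_continuous[OF _ beta(1)] Y_hoelder_le(2)[OF wt_in_Y[OF n]] by auto
    have dl0: "kron (int n + int n) = 0" "kron (int n - int n) = 1" using n by (auto simp: kron_def)
    have "integral {0..T} (\<lambda>x. amp n * C0 n x * (amp n * C0 n x)) = amp n * amp n * (T / 2)"
      using has_integral_mult_right[OF integral_pair[of n n], of "amp n * amp n"] dl0
      by (intro integral_unique) (simp add: mult_ac)
    moreover have "integral (cbox (0, 0) (T, 1)) (\<lambda>(x, s). snd (wt n) (x, s) * (C0 n x * S n s)) =
        T / 2 * integral {0..1} (\<lambda>s. S n s * S n s)"
    proof -
      have "integral (cbox (0, 0) (T, 1)) (\<lambda>(x, s). snd (wt n) (x, s) * (C0 n x * S n s)) =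
        integral (cbox (0, 0) (T, 1)) (\<lambda>(x, s). (C0 n x * C0 n x) * (S n s * S n s))"
        by (intro integral_cong) (auto simp: w_star_value(2)[OF n] sep_apply)
      also have "\<dots> = integral {0..T} (\<lambda>x. C0 n x * C0 n x) * integral {0..1} (\<lambda>s. S n s * S n s)"
        by (intro integral_box_product continuous_intros S_cont n)
      also have "integral {0..T} (\<lambda>x. C0 n x * C0 n x) = T / 2"
        using integral_unique[OF integral_pair[of n n]] dl0 by simp
      finally show ?thesis .
    qed
    ultimately show ?thesis
      using inner_wt[OF n c, of "fst (wt n)"] by (simp add: w_star_value(2)[OF n] distrib_left mult_ac)
  qed
  show "inner_Y \<kappa> (wt 1) (wt 1) = T / 2 * (3 / 2 * (cos \<sigma>)\<^sup>2)"
    using i[of 1] unfolding S_values integral_S_sq by (simp add: power2_eq_square)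
  show "inner_Y \<kappa> (wt 2) (wt 2) = T / 2 * (4 / 3)"
    using i[of 2] unfolding S_values integral_S_sq by simp
qed

text \<open>The integrand collects the quadratic terms of the Bernoulli equation and the surface terms left over by
  \<open>second_var_green\<close>. Products of modes \<open>i\<close> and \<open>j\<close> have the coefficient \<open>3 + 4\<kappa>\<^sup>2 - (i\<^sup>2 + j\<^sup>2) \<kappa>\<^sup>2\<close> for cosines
  and \<open>i j \<kappa>\<^sup>2\<close> for sines.\<close>

lemma surface_integral:
  "integral {0..T} (\<lambda>x. (3 * eta h x * eta k x + etax h x * etax k x - b / \<kappa> * eta h x
      + (eta h x * etaxx k x + eta k x * etaxx h x + 4 * \<kappa>\<^sup>2 * eta h x * eta k x - 2 * \<kappa> * l * eta h x)) * (amp 1 * C0 1 x)) =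
    T / 2 * (cos \<sigma>)\<^sup>2 * ((3 + \<kappa>\<^sup>2) / 2 * (fst h * snd k + snd h * fst k) - (b / \<kappa> + 2 * \<kappa> * l) * fst h)" (is ?A)
  "integral {0..T} (\<lambda>x. (3 * eta h x * eta k x + etax h x * etax k x - b / \<kappa> * eta h x
      + (eta h x * etaxx k x + eta k x * etaxx h x + 4 * \<kappa>\<^sup>2 * eta h x * eta k x - 2 * \<kappa> * l * eta h x)) * (amp 2 * C0 2 x)) =
    T / 2 * ((3 + \<kappa>\<^sup>2) / 2 * (cos \<sigma>)\<^sup>2 * (fst h * fst k) - (b / \<kappa> + 2 * \<kappa> * l) * snd h)" (is ?B)
proof -
  let ?c = "\<lambda>i j. 3 + 4 * \<kappa>\<^sup>2 - ((real i)\<^sup>2 + (real j)\<^sup>2) * \<kappa>\<^sup>2"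
  let ?CC = "\<lambda>n i j x. C0 i x * C0 j x * C0 n x" and ?SS = "\<lambda>n i j x. sin (freq i * x) * sin (freq j * x) * C0 n x"
  let ?a = "\<lambda>n i j x. ?c i j * ?CC n i j x + real i * real j * \<kappa>\<^sup>2 * ?SS n i j x"
  let ?I = "\<lambda>n i j. ?c i j * ((T / 4) * (kron (int i + int j + int n) + kron (int i + int j - int n) + kron (int i - int j + int n) + kron (int i - int j - int n)))
     + real i * real j * \<kappa>\<^sup>2 * ((T / 4) * (kron (int i - int j + int n) + kron (int i - int j - int n) - kron (int i + int j + int n) - kron (int i + int j - int n)))"
  have a: "(?a n i j has_integral ?I n i j) {0..T}" for n i j :: nat
    by (intro has_integral_add has_integral_mult_right integral_triple)
  have "((\<lambda>x. amp n * (fst h * fst k * (amp 1 * amp 1) * ?a n 1 1 x + fst h * snd k * (amp 1 * amp 2) * ?a n 1 2 x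
      + snd h * fst k * (amp 2 * amp 1) * ?a n 2 1 x + snd h * snd k * (amp 2 * amp 2) * ?a n 2 2 x
      - (b / \<kappa> + 2 * \<kappa> * l) * (fst h * amp 1 * (C0 1 x * C0 n x) + snd h * amp 2 * (C0 2 x * C0 n x)))) has_integral
     amp n * (fst h * fst k * (amp 1 * amp 1) * ?I n 1 1 + fst h * snd k * (amp 1 * amp 2) * ?I n 1 2
      + snd h * fst k * (amp 2 * amp 1) * ?I n 2 1 + snd h * snd k * (amp 2 * amp 2) * ?I n 2 2
      - (b / \<kappa> + 2 * \<kappa> * l) * (fst h * amp 1 * ((T / 2) * (kron (int 1 + int n) + kron (int 1 - int n)))
      + snd h * amp 2 * ((T / 2) * (kron (int 2 + int n) + kron (int 2 - int n)))))) {0..T}" for n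
    by (intro has_integral_diff has_integral_add has_integral_mult_right a integral_pair)
  moreover have "amp n * (fst h * fst k * (amp 1 * amp 1) * ?a n 1 1 x + fst h * snd k * (amp 1 * amp 2) * ?a n 1 2 x
      + snd h * fst k * (amp 2 * amp 1) * ?a n 2 1 x + snd h * snd k * (amp 2 * amp 2) * ?a n 2 2 x
      - (b / \<kappa> + 2 * \<kappa> * l) * (fst h * amp 1 * (C0 1 x * C0 n x) + snd h * amp 2 * (C0 2 x * C0 n x))) =
     (3 * eta h x * eta k x + etax h x * etax k x - b / \<kappa> * eta h x
      + (eta h x * etaxx k x + eta k x * etaxx h x + 4 * \<kappa>\<^sup>2 * eta h x * eta k x - 2 * \<kappa> * l * eta h x)) * (amp n * C0 n x)" for n x
    unfolding eta_def etax_def etaxx_def lin_comb_def by (simp add: algebra_simps power2_eq_square)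
  ultimately have r: "((\<lambda>x. (3 * eta h x * eta k x + etax h x * etax k x - b / \<kappa> * eta h x
      + (eta h x * etaxx k x + eta k x * etaxx h x + 4 * \<kappa>\<^sup>2 * eta h x * eta k x - 2 * \<kappa> * l * eta h x)) * (amp n * C0 n x)) has_integral
     amp n * (fst h * fst k * (amp 1 * amp 1) * ?I n 1 1 + fst h * snd k * (amp 1 * amp 2) * ?I n 1 2
      + snd h * fst k * (amp 2 * amp 1) * ?I n 2 1 + snd h * snd k * (amp 2 * amp 2) * ?I n 2 2
      - (b / \<kappa> + 2 * \<kappa> * l) * (fst h * amp 1 * ((T / 2) * (kron (int 1 + int n) + kron (int 1 - int n)))
      + snd h * amp 2 * ((T / 2) * (kron (int 2 + int n) + kron (int 2 - int n)))))) {0..T}" for n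
    by (simp only:)
  show ?A unfolding integral_unique[OF r[of 1]]
    by (simp add: S_values[unfolded One_nat_def] kron_def) (simp add: field_simps power2_eq_square)
  show ?B unfolding integral_unique[OF r[of 2]]
    by (simp add: S_values[unfolded One_nat_def] kron_def) (simp add: field_simps power2_eq_square)
qed

end

section \<open>The Lyapunov-Schmidt reduction\<close>

lemma Ck_fam_diff: assumes "Ck_fam k U Q f" "Ck_fam k U Q g" shows "Ck_fam k U Q (\<lambda>P q. f P q - g P q)"
  using Ck_fam_add[OF assms(1) Ck_fam_mult[OF Ck_fam_const[of k U Q "-1"] assms(2)]] by simp

lemma Ck_fam_power2: assumes "Ck_fam k U Q f" shows "Ck_fam k U Q (\<lambda>P q. (f P q)\<^sup>2)"
  using Ck_fam_mult[OF assms assms] by (simp add: power2_eq_square)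

lemma Ck_fam_divide: assumes "Ck_fam k U Q f" shows "Ck_fam k U Q (\<lambda>P q. f P q / r)"
  using Ck_fam_mult[OF Ck_fam_const[of k U Q "1 / r"] assms] by simp

lemma Ck_fam_slice: assumes "Ck_fam k U Q f" "P \<in> U" shows "continuous_on Q (f P)"
proof -
  have "continuous_on Q (\<lambda>q. (\<lambda>(P, q). f P q) (P, q))"
    by (rule continuous_on_compose2[OF Ck_fam_continuous[OF assms(1)]]) (use assms(2) in \<open>auto intro!: continuous_intros\<close>)
  then show ?thesis by simp
qed

lemma Ck_fam_subset: "Ck_fam k U Q f \<Longrightarrow> R \<subseteq> Q \<Longrightarrow> Ck_fam k U R f"
proof (induction k arbitrary: f)
  case 0
  then show ?case using continuous_on_subset[of "U \<times> Q" _ "U \<times> R"] by auto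
next
  case (Suc k)
  obtain D where D: "\<And>P q. P \<in> U \<Longrightarrow> q \<in> Q \<Longrightarrow> ((\<lambda>P. f P q) has_derivative D P q) (at P)"
      "\<And>h. Ck_fam k U Q (\<lambda>P q. D P q h)" using Suc.prems(1) by auto
  have "continuous_on (U \<times> R) (\<lambda>(P, q). f P q)"
    using continuous_on_subset[OF Ck_fam_continuous[OF Suc.prems(1)], of "U \<times> R"] Suc.prems(2) by auto
  then show ?case unfolding Ck_fam.simps(2)
    using D Suc.IH Suc.prems(2) by (intro conjI exI[of _ D]) auto
qed

text \<open>Points \<open>(t\<^sub>1, t\<^sub>2, \<Lambda>)\<close>.\<close>

type_synonym rparam = "real \<times> real \<times> param"

context double_point
begin

abbreviation "K \<equiv> ker_DwF \<kappa> \<beta> \<Lambda>s"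
abbreviation "nK \<equiv> (\<lambda>(v, \<Lambda>). nX v + norm (\<Lambda> :: param))"
definition P0 :: rparam where "P0 = (0, 0, \<Lambda>s)"
definition wP :: "rparam \<Rightarrow> fpair" where "wP P = fst P *\<^sub>R w 1 + fst (snd P) *\<^sub>R w 2"
definition xP :: "rparam \<Rightarrow> fpair \<times> param" where "xP P = (wP P, snd (snd P))"

lemma wP_add: "wP (P + R) = wP P + wP R"
  by (simp add: wP_def scaleR_add_left)

lemma wP_scale: "wP (c *\<^sub>R P) = c *\<^sub>R wP P"
  by (simp add: wP_def scaleR_add_right)

lemma xP_add: "xP (P + R) = xP P + xP R" by (simp add: xP_def wP_add)
lemma xP_scale: "xP (c *\<^sub>R P) = c *\<^sub>R xP P" by (simp add: xP_def wP_scale)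

lemma wP_K: "wP P \<in> K"
  unfolding wP_def by (intro subspace_add[OF subspace_ker] subspace_scale[OF subspace_ker] w_in_ker) auto

lemma K_X: "v \<in> K \<Longrightarrow> v \<in> X" by (simp add: ker_DwF_eq)

text \<open>The Lipschitz constant of \<open>P \<mapsto> (w, \<Lambda>)\<close> into the normed product of \<open>X\<close> and the parameters; \<open>484 = 22\<^sup>2\<close> comes from using
  both \<open>X_norm_add\<close> and \<open>X_norm_scale\<close>.\<close>

definition lift_bound :: real where "lift_bound = 484 * (nX (w 1) + nX (w 2)) + 1"

lemma lift_bound_pos: "lift_bound > 0"
  using X_norm_nonneg[OF w_in_X[of 1]] X_norm_nonneg[OF w_in_X[of 2]] by (simp add: lift_bound_def)

lemma wP_norm: "nX (wP P) + norm (snd (snd P)) \<le> lift_bound * norm P"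
proof -
  have w12: "w 1 \<in> X" "w 2 \<in> X" by (simp_all add: w_in_X)
  have t: "\<bar>fst P\<bar> \<le> norm P" "\<bar>fst (snd P)\<bar> \<le> norm P" "norm (snd (snd P)) \<le> norm P"
    using norm_fst_le[of "fst P" "snd P"] norm_snd_le[of "snd P" "fst P"]
      norm_fst_le[of "fst (snd P)" "snd (snd P)"] norm_snd_le[of "snd (snd P)" "fst (snd P)"] by auto
  have "nX (wP P) \<le> 22 * (nX (fst P *\<^sub>R w 1) + nX (fst (snd P) *\<^sub>R w 2))"
    unfolding wP_def by (intro X_norm_add subspace_scale[OF subspace_X] w12)
  also have "\<dots> \<le> 22 * (22 * (\<bar>fst P\<bar> * nX (w 1)) + 22 * (\<bar>fst (snd P)\<bar> * nX (w 2)))"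
    using X_norm_scale[OF w12(1), of "fst P"] X_norm_scale[OF w12(2), of "fst (snd P)"] by simp
  also have "\<dots> \<le> 22 * (22 * (norm P * nX (w 1)) + 22 * (norm P * nX (w 2)))"
    using t X_norm_nonneg[OF w12(1)] X_norm_nonneg[OF w12(2)] by (intro mult_left_mono add_mono mult_right_mono) auto
  finally show ?thesis using t(3) by (simp add: lift_bound_def algebra_simps)
qed

end

locale reduction = double_point +
  fixes X0 :: "fpair set" and \<psi> :: "fpair \<times> param \<Rightarrow> fpair"
  assumes X0: "closed_subspace (X_space \<kappa> \<beta>) X0"
    and split: "direct_sum (fst (X_space \<kappa> \<beta>)) (ker_DwF \<kappa> \<beta> \<Lambda>s) X0"
    and LS: "LS_function \<kappa> \<beta> \<Lambda>s 1 2 X0 \<psi>"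
begin

lemma X0_subspace: "subspace X0" and X0_X: "v \<in> X0 \<Longrightarrow> v \<in> X"
  using X0 by (auto simp: closed_subspace_def)

definition nbhd :: "real \<Rightarrow> (fpair \<times> param) set" where
  "nbhd \<rho> = {(v, \<Lambda>). v \<in> K \<and> \<Lambda> \<in> U_set \<and> nX v < \<rho> \<and> dist \<Lambda> \<Lambda>s < \<rho>}"

abbreviation "solves \<epsilon> v \<Lambda> y \<equiv> y \<in> X0 \<and> nX y < \<epsilon> \<and> v + y \<in> O_set \<kappa> \<beta> \<and>
   F_map (v + y) \<Lambda> - Pi_Z \<kappa> \<Lambda>s 1 2 (F_map (v + y) \<Lambda>) = 0"

lemma LS_data:
  obtains \<rho> \<epsilon> where "\<rho> > 0" "\<epsilon> > 0" "\<And>k. Ck_map k (K \<times> UNIV, nK) (X0, nX) (nbhd \<rho>) \<psi>"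
    "\<And>v \<Lambda>. (v, \<Lambda>) \<in> nbhd \<rho> \<Longrightarrow> solves \<epsilon> v \<Lambda> (\<psi> (v, \<Lambda>))"
    "\<And>v \<Lambda> y. (v, \<Lambda>) \<in> nbhd \<rho> \<Longrightarrow> solves \<epsilon> v \<Lambda> y \<Longrightarrow> y = \<psi> (v, \<Lambda>)"
proof -
  obtain \<rho> \<epsilon> where "\<rho> > 0" "\<epsilon> > 0" "smooth_map (K \<times> UNIV, nK) (X0, nX) (nbhd \<rho>) \<psi> \<and>
      (\<forall>(v, \<Lambda>)\<in>nbhd \<rho>. solves \<epsilon> v \<Lambda> (\<psi> (v, \<Lambda>)) \<and> (\<forall>y. solves \<epsilon> v \<Lambda> y \<longrightarrow> y = \<psi> (v, \<Lambda>)))"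
    using LS unfolding LS_function_def Let_def nbhd_def by blast
  then show ?thesis using that[of \<rho> \<epsilon>] unfolding smooth_map_def by blast
qed

lemma open_U_set: "open U_set"
proof -
  have e: "U_set = {\<Lambda>. fst \<Lambda> \<noteq> 0} \<inter> {\<Lambda>. fst (snd \<Lambda>) < 0} \<inter> {\<Lambda>. 0 < snd (snd \<Lambda>)} \<inter> {\<Lambda>. snd (snd \<Lambda>) < pi}"
    by (auto simp: U_set_def)
  show ?thesis unfolding e
    by (intro open_Int open_Collect_neq open_Collect_less continuous_intros)
qed

lemma small_ball:
  assumes "\<rho> > 0"
  obtains \<delta> where "\<delta> > 0" "\<And>P. P \<in> ball P0 \<delta> \<Longrightarrow> xP P \<in> nbhd \<rho>" "\<And>P. P \<in> ball P0 \<delta> \<Longrightarrow> snd (snd P) \<in> U_set"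
    "\<And>P. P \<in> ball P0 \<delta> \<Longrightarrow> (0, snd (snd P)) \<in> nbhd \<rho>"
proof -
  obtain \<delta>1 where d1: "\<delta>1 > 0" "ball \<Lambda>s \<delta>1 \<subseteq> U_set" using open_U_set U_Lambda by (meson openE)
  define \<delta> where "\<delta> = min \<delta>1 (min \<rho> (\<rho> / lift_bound))"
  have d: "\<delta> > 0" using d1 assms lift_bound_pos by (simp add: \<delta>_def)
  have main: "xP P \<in> nbhd \<rho> \<and> snd (snd P) \<in> U_set \<and> (0, snd (snd P)) \<in> nbhd \<rho>" if P: "P \<in> ball P0 \<delta>" for P
  proof -
    have n: "norm (P - P0) < \<delta>" using P by (simp add: dist_norm norm_minus_commute)
    have "dist (snd (snd P)) \<Lambda>s \<le> norm (P - P0)"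
    proof -
      have "dist (snd (snd P)) (snd (snd P0)) \<le> dist P P0"
        by (rule order_trans[OF dist_snd_le dist_snd_le])
      then show ?thesis by (simp add: P0_def dist_norm)
    qed
    then have kron: "dist (snd (snd P)) \<Lambda>s < \<delta>" using n by linarith
    have "snd (snd P) \<in> ball \<Lambda>s \<delta>1" using kron by (simp add: \<delta>_def dist_commute)
    then have U: "snd (snd P) \<in> U_set" using d1(2) by blast
    have "nX (wP (P - P0)) \<le> lift_bound * norm (P - P0)" using wP_norm[of "P - P0"] norm_ge_zero[of "snd (snd (P - P0))"] by linarith
    moreover have "wP (P - P0) = wP P" by (simp add: wP_def P0_def)
    ultimately have "nX (wP P) < \<rho>" using n lift_bound_pos mult_strict_left_mono[OF n lift_bound_pos] by (auto simp: \<delta>_def field_simps)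
    moreover have "nX 0 = 0"
      using X_norm_scale[OF subspace_0[OF subspace_X[of \<kappa> \<beta>]], of 0] X_norm_nonneg[OF subspace_0[OF subspace_X[of \<kappa> \<beta>]]] by simp
    ultimately show ?thesis using U kron wP_K subspace_0[OF subspace_ker] assms by (auto simp: nbhd_def xP_def \<delta>_def)
  qed
  show ?thesis by (rule that[OF d]) (use main in auto)
qed

lemma jet_diff:
  assumes "jet \<kappa> \<beta> Q j" "u \<in> X" "v \<in> X" shows "j (u - v) q = j u q - j v q"
proof -
  have "j (u + (-1) *\<^sub>R v) q = j u q + j ((-1) *\<^sub>R v) q"
    using assms subspace_scale[OF subspace_X assms(3), of "-1"] unfolding jet_def by blast
  moreover have "j ((-1) *\<^sub>R v) q = (-1) * j v q" using assms unfolding jet_def by blast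
  ultimately show ?thesis by simp
qed

lemma jet_bound: "jet \<kappa> \<beta> Q j \<Longrightarrow> u \<in> X \<Longrightarrow> q \<in> Q \<Longrightarrow> \<bar>j u q\<bar> \<le> 4 * nX u"
  unfolding jet_def using hoelder_le_bound by fast

lemma xP_E: "xP P \<in> fst (K \<times> (UNIV :: param set), nK)" by (simp add: xP_def wP_K)

lemma nK_xP: "nK (xP P) \<le> lift_bound * norm P" using wP_norm[of P] by (simp add: xP_def)

text \<open>Composing with a jet at a point turns Frechet differentiability of maps between function spaces into
  ordinary differentiability of real functions of finitely many variables. All later calculus takes place
  on that side.\<close>

lemma fderiv_jet:
  assumes j: "jet \<kappa> \<beta> Q j" and q: "q \<in> Q" and U: "open U" "P \<in> U" "\<And>P. P \<in> U \<Longrightarrow> xP P \<in> N"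
    and f: "\<And>x. x \<in> N \<Longrightarrow> f x \<in> X0" and L: "has_fderiv (K \<times> UNIV, nK) (X0, nX) N f L (xP P)"
  shows "((\<lambda>P. j (f (xP P)) q) has_derivative (\<lambda>h. j (L (xP h)) q)) (at P)"
  unfolding has_derivative_at_alt
proof (intro conjI allI impI)
  have LX: "L (xP h) \<in> X0" for h using L xP_E[of h] unfolding has_fderiv_def bounded_linear_between_def by auto
  have "linear (\<lambda>h. j (L (xP h)) q)"
  proof (rule linearI)
    fix h k c
    have "L (xP h + xP k) = L (xP h) + L (xP k)" "L (c *\<^sub>R xP h) = c *\<^sub>R L (xP h)"
      using L xP_E[of h] xP_E[of k] unfolding has_fderiv_def bounded_linear_between_def by blast+
    then show "j (L (xP (h + k))) q = j (L (xP h)) q + j (L (xP k)) q"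
      "j (L (xP (c *\<^sub>R h))) q = c *\<^sub>R j (L (xP h)) q"
      using j X0_X[OF LX] unfolding jet_def xP_add xP_scale by auto
  qed
  then show "bounded_linear (\<lambda>h. j (L (xP h)) q)" by (simp add: linear_conv_bounded_linear)
  fix e :: real assume e: "e > 0"
  define e' where "e' = e / (4 * lift_bound)"
  have e': "e' > 0" using e lift_bound_pos by (simp add: e'_def)
  obtain d where d: "d > 0" "\<And>h. h \<in> K \<times> UNIV \<Longrightarrow> nK h < d \<Longrightarrow> xP P + h \<in> N \<Longrightarrow>
      nX (f (xP P + h) - f (xP P) - L h) \<le> e' * nK h"
    using L e' unfolding has_fderiv_def by auto
  obtain \<rho> where \<rho>: "\<rho> > 0" "ball P \<rho> \<subseteq> U" using U by (meson openE)
  show "\<exists>d>0. \<forall>R. norm (R - P) < d \<longrightarrow> norm (j (f (xP R)) q - j (f (xP P)) q - j (L (xP (R - P))) q) \<le> e * norm (R - P)"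
  proof (intro exI[of _ "min \<rho> (d / lift_bound)"] conjI allI impI)
    show "0 < min \<rho> (d / lift_bound)" using \<rho> d lift_bound_pos by simp
    fix R assume R: "norm (R - P) < min \<rho> (d / lift_bound)"
    then have "R \<in> ball P \<rho>" by (simp add: dist_norm norm_minus_commute)
    then have RU: "R \<in> U" using \<rho>(2) by blast
    have xR: "xP P + xP (R - P) = xP R" by (simp add: xP_add[symmetric])
    have "lift_bound * norm (R - P) < d" using R lift_bound_pos by (simp add: field_simps)
    then have nk: "nK (xP (R - P)) < d" using nK_xP[of "R - P"] by linarith
    have b: "nX (f (xP R) - f (xP P) - L (xP (R - P))) \<le> e' * nK (xP (R - P))"
      using d(2)[OF _ nk] xP_E[of "R - P"] U(3)[OF RU] unfolding xR by simp
    have fX: "f (xP R) \<in> X" "f (xP P) \<in> X" using f U RU X0_X by blast+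
    have "j (f (xP R)) q - j (f (xP P)) q - j (L (xP (R - P))) q = j (f (xP R) - f (xP P) - L (xP (R - P))) q"
      using fX LX X0_X subspace_diff[OF subspace_X] by (simp add: jet_diff[OF j])
    also have "\<bar>\<dots>\<bar> \<le> 4 * nX (f (xP R) - f (xP P) - L (xP (R - P)))"
      by (intro jet_bound[OF j _ q] subspace_diff[OF subspace_X] fX X0_X[OF LX])
    also have "\<dots> \<le> 4 * (e' * (lift_bound * norm (R - P)))"
      using b nK_xP[of "R - P"] e' mult_left_mono[of "nK (xP (R - P))" "lift_bound * norm (R - P)" e'] by linarith
    also have "\<dots> = e * norm (R - P)" using lift_bound_pos by (simp add: e'_def)
    finally show "norm (j (f (xP R)) q - j (f (xP P)) q - j (L (xP (R - P))) q) \<le> e * norm (R - P)" by simp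
  qed
qed

text \<open>The same passage to finitely many variables for higher smoothness, uniformly in the point at which the jet is evaluated.\<close>

lemma Ck_jet:
  assumes j: "jet \<kappa> \<beta> Q j" and U: "open U" "\<And>P. P \<in> U \<Longrightarrow> xP P \<in> N"
    and "Ck_map k (K \<times> UNIV, nK) (X0, nX) N f"
  shows "Ck_fam k U Q (\<lambda>P q. j (f (xP P)) q)"
proof -
  have cont: "continuous_on (U \<times> Q) (\<lambda>(P, q). j (f (xP P)) q)"
    if nc: "ncontinuous_on (K \<times> UNIV, nK) (X0, nX) N f" for f
    unfolding continuous_on_iff
  proof (intro ballI allI impI, clarify)
    fix P q and e :: real assume P: "P \<in> U" and q: "q \<in> Q" and e: "e > 0"
    have fX: "f (xP R) \<in> X" if "R \<in> U" for R using nc U(2)[OF that] X0_X unfolding ncontinuous_on_def by auto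
    obtain d1 where d1: "d1 > 0" "\<And>y. y \<in> N \<Longrightarrow> nK (y - xP P) < d1 \<Longrightarrow> nX (f y - f (xP P)) < e / 8"
    proof -
      have "e / 8 > 0" using e by simp
      then have "\<exists>d>0. \<forall>y\<in>N. nK (y - xP P) < d \<longrightarrow> nX (f y - f (xP P)) < e / 8"
        using nc U(2)[OF P] unfolding ncontinuous_on_def fst_conv snd_conv by blast
      then show ?thesis using that by blast
    qed
    have "continuous_on Q (j (f (xP P)))" by (rule jet_continuous[OF j fX[OF P]])
    then obtain d2 where d2: "d2 > 0" "\<And>r. r \<in> Q \<Longrightarrow> dist r q < d2 \<Longrightarrow> dist (j (f (xP P)) r) (j (f (xP P)) q) < e / 2"
      using q e unfolding continuous_on_iff by (meson half_gt_zero)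
    show "\<exists>d>0. \<forall>x'\<in>U \<times> Q. dist x' (P, q) < d \<longrightarrow>
        dist (case x' of (P, q) \<Rightarrow> j (f (xP P)) q) (j (f (xP P)) q) < e"
    proof (intro exI[of _ "min (d1 / lift_bound) d2"] conjI ballI impI, goal_cases)
      case 1
      show ?case using d1 d2 lift_bound_pos by simp
    next
      case (2 x')
      obtain R r where x': "x' = (R, r)" by (cases x')
      have R: "R \<in> U" "r \<in> Q" using 2 x' by auto
      have "dist R P \<le> dist x' (P, q)" "dist r q \<le> dist x' (P, q)"
        using dist_fst_le[of x' "(P, q)"] dist_snd_le[of x' "(P, q)"] by (auto simp: x')
      then have dd: "norm (R - P) < d1 / lift_bound" "dist r q < d2" using 2(2) by (auto simp: dist_norm)
      have "xP R - xP P = xP (R - P)" using xP_add[of "R - P" P] by simp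
      then have "nK (xP R - xP P) < d1" using nK_xP[of "R - P"] dd(1) lift_bound_pos by (auto simp: field_simps)
      then have "nX (f (xP R) - f (xP P)) < e / 8" using d1(2) U(2)[OF R(1)] by blast
      moreover have "\<bar>j (f (xP R) - f (xP P)) r\<bar> \<le> 4 * nX (f (xP R) - f (xP P))"
        by (intro jet_bound[OF j _ R(2)] subspace_diff[OF subspace_X] fX R P)
      ultimately have "\<bar>j (f (xP R)) r - j (f (xP P)) r\<bar> < e / 2"
        unfolding jet_diff[OF j fX[OF R(1)] fX[OF P]] by linarith
      moreover have "\<bar>j (f (xP P)) r - j (f (xP P)) q\<bar> < e / 2" using d2(2)[OF R(2) dd(2)] by (simp add: dist_real_def)
      ultimately show ?case unfolding x' dist_real_def prod.case by linarith
    qed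
  qed
  show ?thesis using assms(4)
  proof (induction k arbitrary: f)
    case 0
    then show ?case using cont by simp
  next
    case (Suc k)
  obtain D where D: "\<And>x. x \<in> N \<Longrightarrow> has_fderiv (K \<times> UNIV, nK) (X0, nX) N f (D x) x"
    "\<And>h. h \<in> K \<times> UNIV \<Longrightarrow> Ck_map k (K \<times> UNIV, nK) (X0, nX) N (\<lambda>x. D x h)"
    and nc: "ncontinuous_on (K \<times> UNIV, nK) (X0, nX) N f"
    using Suc.prems unfolding Ck_map.simps(2) fst_conv by blast
  have f: "\<And>x. x \<in> N \<Longrightarrow> f x \<in> X0" using nc by (auto simp: ncontinuous_on_def)
  have 1: "((\<lambda>P. j (f (xP P)) q) has_derivative (\<lambda>h. j (D (xP P) (xP h)) q)) (at P)" if "P \<in> U" "q \<in> Q" for P q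
    by (rule fderiv_jet[OF j that(2) U(1) that(1) U(2) f D(1)[OF U(2)[OF that(1)]]])
  have 2: "Ck_fam k U Q (\<lambda>P q. j (D (xP P) (xP h)) q)" for h
    by (rule Suc.IH[of "\<lambda>x. D x (xP h)"], rule D(2)) (use xP_E[of h] in simp)
  show ?case unfolding Ck_fam.simps(2) using cont[OF nc] 1 2
    by (intro conjI exI[of _ "\<lambda>P q h. j (D (xP P) (xP h)) q"]) auto
  qed
qed

end

section \<open>The reduced family\<close>

text \<open>The data that the implicit function \<open>\<psi>\<close> comes with: radii, smoothness, the projected equation and uniqueness, and a
  ball \<open>U\<close> of points \<open>P\<close> at which all of these are available.\<close>

locale reduced_family = reduction +
  fixes \<rho> \<epsilon> \<delta> :: real
  assumes \<epsilon>_pos: "\<epsilon> > 0" and \<delta>_pos: "\<delta> > 0"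
    and Ck: "\<And>k. Ck_map k (K \<times> UNIV, nK) (X0, nX) (nbhd \<rho>) \<psi>"
    and sol: "\<And>v \<Lambda>. (v, \<Lambda>) \<in> nbhd \<rho> \<Longrightarrow> solves \<epsilon> v \<Lambda> (\<psi> (v, \<Lambda>))"
    and uniq: "\<And>v \<Lambda> y. (v, \<Lambda>) \<in> nbhd \<rho> \<Longrightarrow> solves \<epsilon> v \<Lambda> y \<Longrightarrow> y = \<psi> (v, \<Lambda>)"
    and ball: "\<And>P. P \<in> ball P0 \<delta> \<Longrightarrow> xP P \<in> nbhd \<rho>" "\<And>P. P \<in> ball P0 \<delta> \<Longrightarrow> snd (snd P) \<in> U_set"
      "\<And>P. P \<in> ball P0 \<delta> \<Longrightarrow> (0, snd (snd P)) \<in> nbhd \<rho>"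
begin

abbreviation "U \<equiv> ball P0 \<delta>"

lemma U_facts: "open U" "convex U" "P0 \<in> U" using \<delta>_pos by auto

definition state :: "rparam \<Rightarrow> fpair" where "state P = wP P + \<psi> (xP P)"

lemma state_solves: "P \<in> U \<Longrightarrow> solves \<epsilon> (wP P) (snd (snd P)) (\<psi> (xP P))"
  using sol[of "wP P" "snd (snd P)"] ball(1)[of P] by (simp add: xP_def)

lemma psi_X0: "x \<in> nbhd \<rho> \<Longrightarrow> \<psi> x \<in> X0" using sol[of "fst x" "snd x"] by simp

lemma state_O: "P \<in> U \<Longrightarrow> state P \<in> O_set \<kappa> \<beta>" using state_solves by (simp add: state_def)

lemma Pi_mode_zero: "Pi_mode \<kappa> \<Lambda>s n 0 = 0"
proof -
  have "inner_Y \<kappa> 0 v = 0" for v by (cases v) (simp add: inner_Y_def zero_prod_def)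
  then show ?thesis by (simp add: Pi_mode_def)
qed

lemma nX_zero: "nX 0 = 0"
  using X_norm_scale[OF subspace_0[OF subspace_X[of \<kappa> \<beta>]], of 0] X_norm_nonneg[OF subspace_0[OF subspace_X[of \<kappa> \<beta>]]] by simp

text \<open>The trivial flow solves the projected equation for every parameter, so uniqueness identifies \<open>\<psi>\<close> there.\<close>

lemma psi_trivial: assumes "P \<in> U" shows "\<psi> (0, snd (snd P)) = 0"
proof -
  have "solves \<epsilon> 0 (snd (snd P)) 0"
    using subspace_0[OF X0_subspace] \<epsilon>_pos zero_in_O by (simp add: nX_zero F_map_0[OF ball(2)[OF assms]] Pi_Z_def Pi_mode_zero)
  then show ?thesis using uniq[OF ball(3)[OF assms]] by metis
qed

lemma wP_zero: "fst P = 0 \<Longrightarrow> fst (snd P) = 0 \<Longrightarrow> wP P = 0" by (simp add: wP_def)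

lemma state_P0: "state P0 = 0"
proof -
  have "xP P0 = (0, snd (snd P0))" by (simp add: xP_def wP_zero P0_def)
  then show ?thesis using psi_trivial[OF U_facts(3)] by (simp add: state_def wP_zero P0_def)
qed

text \<open>The coordinate of the projection of \<open>F\<close> onto the line spanned by \<open>wt n\<close>, as a real function of finitely many variables.\<close>

definition coef :: "nat \<Rightarrow> rparam \<Rightarrow> real" where
  "coef n P = inner_Y \<kappa> (F_map (state P) (snd (snd P))) (wt n) / inner_Y \<kappa> (wt n) (wt n)"

lemma range_equation:
  assumes "P \<in> U" shows "F_map (state P) (snd (snd P)) = coef 1 P *\<^sub>R wt 1 + coef 2 P *\<^sub>R wt 2"
  using state_solves[OF assms] by (simp add: Pi_Z_def Pi_mode_def coef_def state_def)

definition Dpsi :: "fpair \<times> param \<Rightarrow> fpair \<times> param \<Rightarrow> fpair" where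
  "Dpsi = (SOME D. (\<forall>x\<in>nbhd \<rho>. has_fderiv (K \<times> UNIV, nK) (X0, nX) (nbhd \<rho>) \<psi> (D x) x) \<and>
     (\<forall>h\<in>K \<times> UNIV. Ck_map (Suc 0) (K \<times> UNIV, nK) (X0, nX) (nbhd \<rho>) (\<lambda>x. D x h)))"

lemma Dpsi:
  "x \<in> nbhd \<rho> \<Longrightarrow> has_fderiv (K \<times> UNIV, nK) (X0, nX) (nbhd \<rho>) \<psi> (Dpsi x) x"
  "Ck_map (Suc 0) (K \<times> UNIV, nK) (X0, nX) (nbhd \<rho>) (\<lambda>x. Dpsi x (xP h))"
proof -
  have "\<exists>D. (\<forall>x\<in>nbhd \<rho>. has_fderiv (K \<times> UNIV, nK) (X0, nX) (nbhd \<rho>) \<psi> (D x) x) \<and>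
     (\<forall>h\<in>K \<times> UNIV. Ck_map (Suc 0) (K \<times> UNIV, nK) (X0, nX) (nbhd \<rho>) (\<lambda>x. D x h))"
    using Ck[of "Suc (Suc 0)"] unfolding Ck_map.simps(2)[of "Suc 0"] fst_conv by blast
  from someI_ex[OF this] show "x \<in> nbhd \<rho> \<Longrightarrow> has_fderiv (K \<times> UNIV, nK) (X0, nX) (nbhd \<rho>) \<psi> (Dpsi x) x"
  "Ck_map (Suc 0) (K \<times> UNIV, nK) (X0, nX) (nbhd \<rho>) (\<lambda>x. Dpsi x (xP h))"
    unfolding Dpsi_def[symmetric] using xP_E[of h] by auto
qed

definition D2psi :: "rparam \<Rightarrow> fpair \<times> param \<Rightarrow> fpair \<times> param \<Rightarrow> fpair" where
  "D2psi h = (SOME D. \<forall>x\<in>nbhd \<rho>. has_fderiv (K \<times> UNIV, nK) (X0, nX) (nbhd \<rho>) (\<lambda>x. Dpsi x (xP h)) (D x) x)"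

lemma D2psi: "x \<in> nbhd \<rho> \<Longrightarrow> has_fderiv (K \<times> UNIV, nK) (X0, nX) (nbhd \<rho>) (\<lambda>x. Dpsi x (xP h)) (D2psi h x) x"
proof -
  have "\<exists>D. \<forall>x\<in>nbhd \<rho>. has_fderiv (K \<times> UNIV, nK) (X0, nX) (nbhd \<rho>) (\<lambda>x. Dpsi x (xP h)) (D x) x"
    using Dpsi(2)[of h] unfolding Ck_map.simps(2) by blast
  from someI_ex[OF this] show "x \<in> nbhd \<rho> \<Longrightarrow> has_fderiv (K \<times> UNIV, nK) (X0, nX) (nbhd \<rho>) (\<lambda>x. Dpsi x (xP h)) (D2psi h x) x"
    unfolding D2psi_def[symmetric] by auto
qed

lemma fderiv_range: "has_fderiv (K \<times> UNIV, nK) (X0, nX) N f L x \<Longrightarrow> L (xP h) \<in> X0"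
  unfolding has_fderiv_def bounded_linear_between_def using xP_E[of h] by auto

lemma Dpsi_X0: "x \<in> nbhd \<rho> \<Longrightarrow> Dpsi x (xP h) \<in> X0" by (rule fderiv_range[OF Dpsi(1)])

text \<open>First and second derivative of \<open>state\<close> at the base point. The second one consists of the second
  derivative of \<open>\<psi>\<close> alone, as the other part of \<open>state\<close> is linear; it is not determined explicitly and will drop out by orthogonality.\<close>

definition Dstate :: "rparam \<Rightarrow> fpair" where "Dstate h = wP h + Dpsi (xP P0) (xP h)"
definition D2state :: "rparam \<Rightarrow> rparam \<Rightarrow> fpair" where "D2state h k = D2psi h (xP P0) (xP k)"

lemma wP_X: "wP h \<in> X" by (rule K_X[OF wP_K])

lemma Dstate_X: "Dstate h \<in> X"
  unfolding Dstate_def by (intro subspace_add[OF subspace_X] wP_X X0_X[OF Dpsi_X0] ball U_facts)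

lemma D2state_X: "D2state h k \<in> X"
  unfolding D2state_def by (rule X0_X[OF fderiv_range[OF D2psi[OF ball(1)[OF U_facts(3)]]]])

lemma jet_wP: assumes "jet \<kappa> \<beta> Q j" shows "j (wP P) q = fst P * j (w 1) q + fst (snd P) * j (w 2) q"
proof -
  have m: "w 1 \<in> X" "w 2 \<in> X" "fst P *\<^sub>R w 1 \<in> X" "fst (snd P) *\<^sub>R w 2 \<in> X"
    by (simp_all add: w_in_X subspace_scale[OF subspace_X])
  then show ?thesis using assms unfolding jet_def wP_def by simp
qed

lemma jet_state:
  assumes "jet \<kappa> \<beta> Q j" "P \<in> U"
  shows "j (state P) q = fst P * j (w 1) q + fst (snd P) * j (w 2) q + j (\<psi> (xP P)) q"
proof -
  have "j (wP P + \<psi> (xP P)) q = j (wP P) q + j (\<psi> (xP P)) q"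
    using assms(1) wP_X X0_X[OF psi_X0[OF ball(1)[OF assms(2)]]] unfolding jet_def by blast
  then show ?thesis by (simp add: state_def jet_wP[OF assms(1)])
qed

lemma Ck_fam_jet_state:
  assumes "jet \<kappa> \<beta> Q j" shows "Ck_fam k U Q (\<lambda>P q. j (state P) q)"
proof (rule Ck_fam_cong[OF _ U_facts(1)])
  have c: "continuous_on Q (j (w 1))" "continuous_on Q (j (w 2))" by (intro jet_continuous[OF assms] w_in_X; simp)+
  have l: "bounded_linear (\<lambda>P :: rparam. fst P)" "bounded_linear (\<lambda>P :: rparam. fst (snd P))"
    by (rule bounded_linear_fst, rule bounded_linear_compose[OF bounded_linear_fst bounded_linear_snd])
  show "Ck_fam k U Q (\<lambda>P q. fst P * j (w 1) q + fst (snd P) * j (w 2) q + j (\<psi> (xP P)) q)"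
    by (rule Ck_fam_add[OF Ck_fam_add[OF Ck_fam_mult[OF Ck_fam_linear[OF l(1)] Ck_fam_fixed[OF c(1)]] Ck_fam_mult[OF Ck_fam_linear[OF l(2)] Ck_fam_fixed[OF c(2)]]]
      Ck_jet[OF assms U_facts(1) ball(1) Ck]])
qed (simp add: jet_state[OF assms])

lemma jet2_jet_state:
  assumes j: "jet \<kappa> \<beta> Q j" and q: "q \<in> Q"
  shows "jet2 U P0 h k (\<lambda>P. j (state P) q) 0 (j (Dstate h) q) (j (Dstate k) q) (j (D2state h k) q)"
proof -
  define fh where "fh h P = j (wP h) q + j (Dpsi (xP P) (xP h)) q" for h P
  have dy: "((\<lambda>P. j (state P) q) has_derivative (\<lambda>h. fh h P)) (at P)" if P: "P \<in> U" for P
  proof (rule has_derivative_transform_within_open[OF _ U_facts(1) P])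
    have "bounded_linear (\<lambda>h :: rparam. fst h * j (w 1) q + fst (snd h) * j (w 2) q)"
      by (intro bounded_linear_add bounded_linear_mult_const bounded_linear_fst
          bounded_linear_compose[OF bounded_linear_fst bounded_linear_snd])
    note bl = bounded_linear_imp_has_derivative[OF this]
    have "((\<lambda>P. fst P * j (w 1) q + fst (snd P) * j (w 2) q + j (\<psi> (xP P)) q) has_derivative
        (\<lambda>h. (fst h * j (w 1) q + fst (snd h) * j (w 2) q) + j (Dpsi (xP P) (xP h)) q)) (at P)"
      by (rule has_derivative_add[OF bl fderiv_jet[OF j q U_facts(1) P ball(1) psi_X0 Dpsi(1)[OF ball(1)[OF P]]]])
    then show "((\<lambda>P. fst P * j (w 1) q + fst (snd P) * j (w 2) q + j (\<psi> (xP P)) q) has_derivative (\<lambda>h. fh h P)) (at P)"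
      by (simp add: fh_def jet_wP[OF j])
  qed (simp add: jet_state[OF j])
  have base: "fh h P0 = j (Dstate h) q" for h
    using j wP_X[of h] X0_X[OF Dpsi_X0[OF ball(1)[OF U_facts(3)]]] unfolding jet_def fh_def Dstate_def by simp
  have "j (0 *\<^sub>R (0 :: fpair)) q = 0 * j 0 q" using j subspace_0[OF subspace_X[of \<kappa> \<beta>]] unfolding jet_def by blast
  then have z: "j (state P0) q = 0" by (simp add: state_P0)
  have "((\<lambda>P. j (Dpsi (xP P) (xP h)) q) has_derivative (\<lambda>k. j (D2psi h (xP P0) (xP k)) q)) (at P0)"
    by (rule fderiv_jet[OF j q U_facts(1,3) ball(1) Dpsi_X0 D2psi[OF ball(1)[OF U_facts(3)]]])
  from has_derivative_direction[OF this, of k]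
  have "((\<lambda>\<tau>. fh h (P0 + \<tau> *\<^sub>R k)) has_real_derivative 0 + j (D2state h k) q) (at 0)"
    unfolding fh_def D2state_def by (intro DERIV_add DERIV_const)
  then show ?thesis unfolding jet2_def
    using has_derivative_direction[OF dy[OF U_facts(3)], of k] has_derivative_direction[OF dy, of _ h] z base
    by (intro conjI exI[of _ "fh h"]) auto
qed

text \<open>The two components of \<open>F\<close> along the reduced family, as real functions.\<close>

definition surf_eq :: "rparam \<Rightarrow> real \<Rightarrow> real" where
  "surf_eq P x = bernoulli (psi0s (snd (snd P)) 1) (fst (state P) x) (deriv (fst (state P)) x) (ds (snd (state P)) (x, 1)) (1 / (1 + fst (state P) x) - 1)"

definition vort_eq :: "rparam \<Rightarrow> real \<times> real \<Rightarrow> real" where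
  "vort_eq P p = vorticity (fst (snd (snd (snd P)))) (snd p) (psi0s (snd (snd P)) (snd p)) (psi0ss (snd (snd P)) (snd p)) (1 / (1 + fst (state P) (fst p)) - 1)
     (deriv (fst (state P)) (fst p)) (deriv (deriv (fst (state P))) (fst p)) (snd (state P) p) (ds (snd (state P)) p) (ds (ds (snd (state P))) p)
     (dx (dx (snd (state P))) p) (dx (ds (snd (state P))) p) (ds (dx (snd (state P))) p)"

lemma F_map_eqs:
  assumes P: "P \<in> U" shows "F_map (state P) (snd (snd P)) = (surf_eq P, on_strip (vort_eq P))"
proof -
  have "F1 (state P) (snd (snd P)) x = surf_eq P x" for x
    unfolding surf_eq_def by (rule F1_bernoulli[OF state_O[OF P] ball(2)[OF P]])
  moreover have "F2 (state P) (snd (snd P)) p = on_strip (vort_eq P) p" for p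
  proof (cases "p \<in> strip")
    case True
    then obtain x s where p: "p = (x, s)" "s \<in> {0..1}" by (cases p) auto
    then show ?thesis using F2_vorticity[OF state_O[OF P] ball(2)[OF P] p(2), of x] by (simp add: vort_eq_def)
  qed (simp add: F2_off)
  ultimately show ?thesis by (simp add: F_map_def fun_eq_iff)
qed

lemma Ck_fam_param:
  "Ck_fam k U Q (\<lambda>P q. fst (snd (snd P)))" "Ck_fam k U Q (\<lambda>P q. fst (snd (snd (snd P))))" "Ck_fam k U Q (\<lambda>P q. snd (snd (snd (snd P))))"
  by (intro Ck_fam_linear bounded_linear_compose[OF bounded_linear_fst] bounded_linear_compose[OF bounded_linear_snd] bounded_linear_snd bounded_linear_fst)+

lemma Ck_fam_psi0:
  assumes c: "continuous_on Q c"
  shows "Ck_fam k U Q (\<lambda>P q. psi0s (snd (snd P)) (c q))" "Ck_fam k U Q (\<lambda>P q. psi0ss (snd (snd P)) (c q))"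
proof -
  let ?\<mu> = "\<lambda>P :: rparam. fst (snd (snd P))" and ?\<alpha> = "\<lambda>P :: rparam. fst (snd (snd (snd P)))" and ?l = "\<lambda>P :: rparam. snd (snd (snd (snd P)))"
  have neg: "?\<alpha> P < 0" if "P \<in> U" for P using ball(2)[OF that] by (auto simp: U_set_def)
  have a: "Ck_fam k U Q (\<lambda>P q. (-1) * ?\<alpha> P)" by (rule Ck_fam_mult[OF Ck_fam_const Ck_fam_param(2)])
  have r: "Ck_fam k U Q (\<lambda>P q. sqrt ((-1) * ?\<alpha> P))" by (rule Ck_fam_sqrt[OF a _ U_facts(1)]) (use neg in auto)
  have ph: "Ck_fam k U Q (\<lambda>P q. sqrt ((-1) * ?\<alpha> P) * (c q - 1) + ?l P)"
    by (rule Ck_fam_add[OF Ck_fam_mult[OF r Ck_fam_fixed[OF continuous_on_diff[OF c continuous_on_const]]] Ck_fam_param(3)])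
  have 1: "Ck_fam k U Q (\<lambda>P q. (((-1) * ?\<mu> P) * sqrt ((-1) * ?\<alpha> P)) * sin (sqrt ((-1) * ?\<alpha> P) * (c q - 1) + ?l P))"
    by (rule Ck_fam_mult[OF Ck_fam_mult[OF Ck_fam_mult[OF Ck_fam_const Ck_fam_param(1)] r] Ck_fam_sin[OF ph]])
  have 2: "Ck_fam k U Q (\<lambda>P q. (((-1) * ?\<mu> P) * ((-1) * ?\<alpha> P)) * cos (sqrt ((-1) * ?\<alpha> P) * (c q - 1) + ?l P))"
    by (rule Ck_fam_mult[OF Ck_fam_mult[OF Ck_fam_mult[OF Ck_fam_const Ck_fam_param(1)] a] Ck_fam_cos[OF ph]])
  show "Ck_fam k U Q (\<lambda>P q. psi0s (snd (snd P)) (c q))"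
  proof (rule Ck_fam_cong[OF 1 U_facts(1)])
    fix P q assume "P \<in> U"
    from neg[OF this] have "\<bar>?\<alpha> P\<bar> = (-1) * ?\<alpha> P" by simp
    then show "(((-1) * ?\<mu> P) * sqrt ((-1) * ?\<alpha> P)) * sin (sqrt ((-1) * ?\<alpha> P) * (c q - 1) + ?l P) = psi0s (snd (snd P)) (c q)"
      by (simp add: psi0s_def case_prod_unfold)
  qed
  show "Ck_fam k U Q (\<lambda>P q. psi0ss (snd (snd P)) (c q))"
  proof (rule Ck_fam_cong[OF 2 U_facts(1)])
    fix P q assume "P \<in> U"
    from neg[OF this] have "\<bar>?\<alpha> P\<bar> = (-1) * ?\<alpha> P" by simp
    then show "(((-1) * ?\<mu> P) * ((-1) * ?\<alpha> P)) * cos (sqrt ((-1) * ?\<alpha> P) * (c q - 1) + ?l P) = psi0ss (snd (snd P)) (c q)"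
      by (simp add: psi0ss_def case_prod_unfold)
  qed
qed

lemma eta_pos: "P \<in> U \<Longrightarrow> 0 < 1 + fst (state P) x"
proof -
  assume "P \<in> U"
  from state_O[OF this] have "fst (state P) x > - 1" by (cases "state P") (auto simp: O_set_def)
  then show ?thesis by linarith
qed

lemma Ck_fam_reciprocal_eta:
  assumes "Ck_fam k U Q (\<lambda>P q. fst (state P) (c q))"
  shows "Ck_fam k U Q (\<lambda>P q. 1 / (1 + fst (state P) (c q)) - 1)"
  by (rule Ck_fam_diff[OF Ck_fam_reciprocal[OF Ck_fam_add[OF Ck_fam_const assms] eta_pos U_facts(1)] Ck_fam_const])

lemma Ck_fam_surf_eq: "Ck_fam k U UNIV surf_eq"
proof -
  note j = Ck_fam_jet_state[OF jet_line(1)[OF beta]] Ck_fam_jet_state[OF jet_line(2)[OF beta]] Ck_fam_jet_state[OF jet_surface(1)[OF beta]]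
  have g: "Ck_fam k U UNIV (\<lambda>P q. 1 / (1 + fst (state P) q) - 1)" using Ck_fam_reciprocal_eta[of k UNIV "\<lambda>x. x"] j(1) by simp
  have p: "Ck_fam k U UNIV (\<lambda>P q. psi0s (snd (snd P)) 1)" by (rule Ck_fam_psi0(1)) simp
  show ?thesis unfolding surf_eq_def[abs_def] bernoulli_def
    by (rule Ck_fam_add Ck_fam_diff Ck_fam_mult Ck_fam_power2 Ck_fam_divide Ck_fam_const j g p)+
qed

lemma Ck_fam_vort_eq: "Ck_fam k U strip vort_eq"
proof -
  note j = Ck_fam_jet_state[OF jet_strip(1)[OF beta]] Ck_fam_jet_state[OF jet_strip(2)[OF beta]] Ck_fam_jet_state[OF jet_strip(3)[OF beta]]
    Ck_fam_jet_state[OF jet_strip(4)[OF beta]] Ck_fam_jet_state[OF jet_strip(5)[OF beta]] Ck_fam_jet_state[OF jet_strip(6)[OF beta]]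
    Ck_fam_jet_state[OF jet_strip(7)[OF beta]] Ck_fam_jet_state[OF jet_eta(1)[OF beta]] Ck_fam_jet_state[OF jet_eta(2)[OF beta]] Ck_fam_jet_state[OF jet_eta(3)[OF beta]]
  have g: "Ck_fam k U strip (\<lambda>P q. 1 / (1 + fst (state P) (fst q)) - 1)" by (rule Ck_fam_reciprocal_eta[OF j(8)])
  have c: "continuous_on strip (snd :: real \<times> real \<Rightarrow> real)" by (intro continuous_intros)
  show ?thesis unfolding vort_eq_def[abs_def] vorticity_def
    by (rule Ck_fam_add Ck_fam_diff Ck_fam_mult Ck_fam_power2 Ck_fam_const Ck_fam_fixed[OF c] j g Ck_fam_psi0[OF c] Ck_fam_param(2))+
qed

lemma sqrt_curve: "((\<lambda>\<tau>. sqrt \<bar>- 4 * \<kappa>\<^sup>2 + \<tau> * (- 4 * \<kappa> * b)\<bar>) has_real_derivative b) (at 0)"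
proof -
  have d: "((\<lambda>\<tau>. sqrt (4 * \<kappa>\<^sup>2 + \<tau> * (4 * \<kappa> * b))) has_real_derivative b) (at 0)"
    using kappa_pos by (auto intro!: derivative_eq_intros simp: real_sqrt_mult field_simps)
  have eq: "sqrt (4 * \<kappa>\<^sup>2 + \<tau> * (4 * \<kappa> * b)) = sqrt \<bar>- 4 * \<kappa>\<^sup>2 + \<tau> * (- 4 * \<kappa> * b)\<bar>" if "dist \<tau> 0 < \<kappa> / (\<bar>b\<bar> + 1)" for \<tau>
  proof -
    have "4 * \<kappa>\<^sup>2 + \<tau> * (4 * \<kappa> * b) = \<bar>- 4 * \<kappa>\<^sup>2 + \<tau> * (- 4 * \<kappa> * b)\<bar>"
  proof -
    have "\<bar>\<tau>\<bar> * (\<bar>b\<bar> + 1) < \<kappa>" using that by (simp add: dist_real_def less_divide_eq)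
    moreover have "\<bar>\<tau> * b\<bar> \<le> \<bar>\<tau>\<bar> * (\<bar>b\<bar> + 1)" unfolding abs_mult by (intro mult_left_mono) auto
    ultimately have "\<bar>\<tau> * b\<bar> < \<kappa>" by linarith
    then have "- \<kappa> < \<tau> * b" by linarith
    then have "\<kappa> * 0 < \<kappa> * (\<kappa> + \<tau> * b)" using kappa_pos by (intro mult_strict_left_mono) auto
    then show ?thesis by (simp add: algebra_simps power2_eq_square)
  qed
    then show ?thesis by (rule arg_cong)
  qed
  have "0 < \<kappa> / (\<bar>b\<bar> + 1)" using kappa_pos by simp
  then show ?thesis by (rule has_field_derivative_transform_within[OF d _ UNIV_I eq])
qed

text \<open>The curve \<open>r\<close> stands for \<open>\<surd>\<bar>\<alpha>\<bar>\<close>.\<close>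

lemma shear_curve:
  assumes r: "(r has_real_derivative b) (at 0)" "r 0 = 2 * \<kappa>"
  shows "((\<lambda>\<tau>. - (1 / (2 * \<kappa>)) * r \<tau> * sin (r \<tau> * (s - 1) + (pi / 2 + \<tau> * l))) has_real_derivative pk b l s) (at 0)"
    "((\<lambda>\<tau>. - (1 / (2 * \<kappa>)) * (r \<tau>)\<^sup>2 * cos (r \<tau> * (s - 1) + (pi / 2 + \<tau> * l))) has_real_derivative qk b l s) (at 0)"
proof -
  have sc: "sin (2 * \<kappa> * (s - 1) + pi / 2) = Co s" "cos (2 * \<kappa> * (s - 1) + pi / 2) = - Si s"
    by (simp_all add: sin_add cos_add Co_def Si_def)
  show "((\<lambda>\<tau>. - (1 / (2 * \<kappa>)) * r \<tau> * sin (r \<tau> * (s - 1) + (pi / 2 + \<tau> * l))) has_real_derivative pk b l s) (at 0)"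
    apply (rule derivative_eq_intros r refl)+
    unfolding r(2) mult_zero_left add_0_right sc pk_def using kappa_pos by (simp add: field_simps)
  show "((\<lambda>\<tau>. - (1 / (2 * \<kappa>)) * (r \<tau>)\<^sup>2 * cos (r \<tau> * (s - 1) + (pi / 2 + \<tau> * l))) has_real_derivative qk b l s) (at 0)"
    apply (rule derivative_eq_intros r refl)+
    unfolding r(2) mult_zero_left add_0_right sc qk_def using kappa_pos by (simp add: field_simps power2_eq_square)
qed

lemma psi0_curve:
  "((\<lambda>\<tau>. psi0s (\<Lambda>s + \<tau> *\<^sub>R (0, - 4 * \<kappa> * b, l)) s) has_real_derivative pk b l s) (at 0)"
  "((\<lambda>\<tau>. psi0ss (\<Lambda>s + \<tau> *\<^sub>R (0, - 4 * \<kappa> * b, l)) s) has_real_derivative qk b l s) (at 0)"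
proof -
  let ?r = "\<lambda>\<tau>. sqrt \<bar>- 4 * \<kappa>\<^sup>2 + \<tau> * (- 4 * \<kappa> * b)\<bar>"
  have r0: "?r 0 = 2 * \<kappa>" using kappa_pos by (simp add: real_sqrt_mult)
  have Lam: "\<Lambda>s + \<tau> *\<^sub>R (0, - 4 * \<kappa> * b, l) = (1 / (2 * \<kappa>), - 4 * \<kappa>\<^sup>2 + \<tau> * (- 4 * \<kappa> * b), pi / 2 + \<tau> * l)" for \<tau>
    unfolding Lambda by simp
  have p: "psi0s (\<Lambda>s + \<tau> *\<^sub>R (0, - 4 * \<kappa> * b, l)) s = - (1 / (2 * \<kappa>)) * ?r \<tau> * sin (?r \<tau> * (s - 1) + (pi / 2 + \<tau> * l))" for \<tau>
    unfolding Lam psi0s_def prod.case ..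
  have q: "psi0ss (\<Lambda>s + \<tau> *\<^sub>R (0, - 4 * \<kappa> * b, l)) s = - (1 / (2 * \<kappa>)) * (?r \<tau>)\<^sup>2 * cos (?r \<tau> * (s - 1) + (pi / 2 + \<tau> * l))" for \<tau>
    unfolding Lam psi0ss_def prod.case real_sqrt_pow2[OF abs_ge_zero] ..
  note g = shear_curve[OF sqrt_curve r0]
  show "((\<lambda>\<tau>. psi0s (\<Lambda>s + \<tau> *\<^sub>R (0, - 4 * \<kappa> * b, l)) s) has_real_derivative pk b l s) (at 0)"
    unfolding p by (rule g(1))
  show "((\<lambda>\<tau>. psi0ss (\<Lambda>s + \<tau> *\<^sub>R (0, - 4 * \<kappa> * b, l)) s) has_real_derivative qk b l s) (at 0)"
    unfolding q by (rule g(2))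
qed

end

section \<open>First and second derivatives of the reduced functions\<close>

lemma has_derivative_divide_const:
  fixes f :: "'a::real_normed_vector \<Rightarrow> real"
  shows "(f has_derivative f') F \<Longrightarrow> ((\<lambda>x. f x / c) has_derivative (\<lambda>h. f' h / c)) F"
  using has_derivative_mult_left[of f f' F "1 / c"] by simp

context reduced_family
begin

text \<open>Directions at the base point: \<open>kernel_dir\<close> moves the coordinates of the kernel only, \<open>curve_dir\<close> also the parameters, with
  \<open>\<mu>\<close> fixed. The velocity \<open>- 4\<kappa>b\<close> of \<open>\<alpha>\<close> makes \<open>b\<close> the velocity of \<open>\<surd>\<bar>\<alpha>\<bar>\<close>.\<close>

definition kernel_dir :: "real \<times> real \<Rightarrow> rparam" where "kernel_dir h = (fst h, snd h, 0)"
definition curve_dir :: "real \<times> real \<Rightarrow> real \<Rightarrow> real \<Rightarrow> rparam" where "curve_dir k b l = (fst k, snd k, (0, - 4 * \<kappa> * b, l))"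

lemma jet2_coefficients:
  "jet2 U P0 (kernel_dir h) (curve_dir k b l) (\<lambda>P. psi0s (snd (snd P)) s) (- Co s) 0 (pk b l s) 0"
  "jet2 U P0 (kernel_dir h) (curve_dir k b l) (\<lambda>P. psi0ss (snd (snd P)) s) (2 * \<kappa> * Si s) 0 (qk b l s) 0"
  "jet2 U P0 (kernel_dir h) (curve_dir k b l) (\<lambda>P. fst (snd (snd (snd P)))) (- 4 * \<kappa>\<^sup>2) 0 (- 4 * \<kappa> * b) 0"
proof -
  have inv: "snd (snd (P + \<tau> *\<^sub>R kernel_dir h)) = snd (snd P)" for P :: rparam and \<tau> by (simp add: kernel_dir_def)
  have cur: "snd (snd (P0 + \<tau> *\<^sub>R curve_dir k b l)) = \<Lambda>s + \<tau> *\<^sub>R (0, - 4 * \<kappa> * b, l)" for \<tau> by (simp add: P0_def curve_dir_def)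
  have base: "snd (snd P0) = \<Lambda>s" by (simp add: P0_def)
  show "jet2 U P0 (kernel_dir h) (curve_dir k b l) (\<lambda>P. psi0s (snd (snd P)) s) (- Co s) 0 (pk b l s) 0"
    by (rule jet2_invariant; unfold inv cur base psi0s_value) (rule refl psi0_curve)+
  show "jet2 U P0 (kernel_dir h) (curve_dir k b l) (\<lambda>P. psi0ss (snd (snd P)) s) (2 * \<kappa> * Si s) 0 (qk b l s) 0"
    by (rule jet2_invariant; unfold inv cur base psi0ss_value) (rule refl psi0_curve)+
  show "jet2 U P0 (kernel_dir h) (curve_dir k b l) (\<lambda>P. fst (snd (snd (snd P)))) (- 4 * \<kappa>\<^sup>2) 0 (- 4 * \<kappa> * b) 0"
  proof (rule jet2_invariant; unfold inv cur base alpha_value)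
    show "((\<lambda>\<tau>. fst (snd (\<Lambda>s + \<tau> *\<^sub>R (0, - 4 * \<kappa> * b, l)))) has_real_derivative - 4 * \<kappa> * b) (at 0)"
      by (auto simp: alpha_value intro!: derivative_eq_intros)
  qed (rule refl)+
qed

lemma jet2_first:
  "jet2 V Q h k f a b c d \<Longrightarrow> Q \<in> V \<Longrightarrow> ((\<lambda>\<tau>. f (Q + \<tau> *\<^sub>R h)) has_real_derivative b) (at 0)"
  unfolding jet2_def by auto

lemma jet2_surf_eq:
  fixes h k b l
  defines "yh \<equiv> Dstate (kernel_dir h)" and "yk \<equiv> Dstate (curve_dir k b l)" and "z \<equiv> D2state (kernel_dir h) (curve_dir k b l)"
  shows "\<exists>c. jet2 U P0 (kernel_dir h) (curve_dir k b l) (\<lambda>P. surf_eq P x) 0 (fst (L_op \<Lambda>s yh) x) c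
    (fst (L_op \<Lambda>s z) x + (pk b l 1 * ds (snd yh) (x, 1) + ds (snd yh) (x, 1) * ds (snd yk) (x, 1) + 3 * fst yh x * fst yk x
      + 2 * ds (snd yh) (x, 1) * fst yk x + 2 * ds (snd yk) (x, 1) * fst yh x + 2 * pk b l 1 * fst yh x
      + deriv (fst yh) x * deriv (fst yk) x))"
proof -
  note t = jet2_jet_state[OF jet_line(1)[OF beta] UNIV_I[of x]] jet2_jet_state[OF jet_line(2)[OF beta] UNIV_I[of x]]
    jet2_jet_state[OF jet_surface(1)[OF beta] UNIV_I[of x]]
  note p = jet2_coefficients(1)[of h k b l 1, unfolded Co_values]
  have "\<exists>c. jet2 U P0 (kernel_dir h) (curve_dir k b l) (\<lambda>P. surf_eq P x) 0 (- ds (snd yh) (x, 1)) c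
     (- ds (snd z) (x, 1) + pk b l 1 * ds (snd yh) (x, 1) + ds (snd yh) (x, 1) * ds (snd yk) (x, 1) + 3 * fst yh x * fst yk x
      + 2 * ds (snd yh) (x, 1) * fst yk x + 2 * ds (snd yk) (x, 1) * fst yh x + 2 * pk b l 1 * fst yh x
      + deriv (fst yh) x * deriv (fst yk) x)"
    unfolding surf_eq_def yh_def yk_def z_def
    by (rule jet2_bernoulli[OF p jet2_reciprocal[OF t(1) eta_pos] t])
  then show ?thesis by (simp add: L_op_value algebra_simps)
qed

lemma jet2_vort_eq:
  fixes h k b l
  defines "yh \<equiv> Dstate (kernel_dir h)" and "yk \<equiv> Dstate (curve_dir k b l)" and "z \<equiv> D2state (kernel_dir h) (curve_dir k b l)"
  assumes p: "(x, s) \<in> strip"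
  shows "\<exists>c. jet2 U P0 (kernel_dir h) (curve_dir k b l) (\<lambda>P. vort_eq P (x, s)) 0 (snd (L_op \<Lambda>s yh) (x, s)) c
    (snd (L_op \<Lambda>s z) (x, s) + (- (- 4 * \<kappa> * b) * snd yh (x, s) - s * deriv (deriv (fst yh)) x * pk b l s - 2 * fst yh x * qk b l s
      + s * (deriv (deriv (fst yh)) x * fst yk x + deriv (deriv (fst yk)) x * fst yh x) * (- Co s)
      - s * (deriv (deriv (fst yh)) x * ds (snd yk) (x, s) + deriv (deriv (fst yk)) x * ds (snd yh) (x, s))
      + 4 * s * deriv (fst yh) x * deriv (fst yk) x * (- Co s)
      - s * (deriv (fst yh) x * dx (ds (snd yk)) (x, s) + deriv (fst yk) x * dx (ds (snd yh)) (x, s))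
      - s * (deriv (fst yh) x * ds (dx (snd yk)) (x, s) + deriv (fst yk) x * ds (dx (snd yh)) (x, s))
      + 2 * s\<^sup>2 * deriv (fst yh) x * deriv (fst yk) x * (2 * \<kappa> * Si s)
      + 6 * (2 * \<kappa> * Si s) * fst yh x * fst yk x
      - 2 * (ds (ds (snd yh)) (x, s) * fst yk x + ds (ds (snd yk)) (x, s) * fst yh x)))"
proof -
  note e = jet2_jet_state[OF jet_eta(1)[OF beta] p, unfolded fst_conv] jet2_jet_state[OF jet_eta(2)[OF beta] p, unfolded fst_conv]
    jet2_jet_state[OF jet_eta(3)[OF beta] p, unfolded fst_conv]
  note t = jet2_jet_state[OF jet_strip(1)[OF beta] p] jet2_jet_state[OF jet_strip(3)[OF beta] p] jet2_jet_state[OF jet_strip(7)[OF beta] p]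
    jet2_jet_state[OF jet_strip(4)[OF beta] p] jet2_jet_state[OF jet_strip(5)[OF beta] p] jet2_jet_state[OF jet_strip(6)[OF beta] p]
  obtain c where c: "jet2 U P0 (kernel_dir h) (curve_dir k b l) (\<lambda>P. vort_eq P (x, s)) 0
     (dx (dx (snd yh)) (x, s) + ds (ds (snd yh)) (x, s) - (- 4 * \<kappa>\<^sup>2) * snd yh (x, s) - s * deriv (deriv (fst yh)) x * (- Co s) - 2 * fst yh x * (2 * \<kappa> * Si s)) c
     ((dx (dx (snd z)) (x, s) + ds (ds (snd z)) (x, s) - (- 4 * \<kappa>\<^sup>2) * snd z (x, s) - s * deriv (deriv (fst z)) x * (- Co s) - 2 * fst z x * (2 * \<kappa> * Si s))
      - (- 4 * \<kappa> * b) * snd yh (x, s) - s * deriv (deriv (fst yh)) x * pk b l s - 2 * fst yh x * qk b l s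
      + s * (deriv (deriv (fst yh)) x * fst yk x + deriv (deriv (fst yk)) x * fst yh x) * (- Co s)
      - s * (deriv (deriv (fst yh)) x * ds (snd yk) (x, s) + deriv (deriv (fst yk)) x * ds (snd yh) (x, s))
      + 4 * s * deriv (fst yh) x * deriv (fst yk) x * (- Co s)
      - s * (deriv (fst yh) x * dx (ds (snd yk)) (x, s) + deriv (fst yk) x * dx (ds (snd yh)) (x, s))
      - s * (deriv (fst yh) x * ds (dx (snd yk)) (x, s) + deriv (fst yk) x * ds (dx (snd yh)) (x, s))
      + 2 * s\<^sup>2 * deriv (fst yh) x * deriv (fst yk) x * (2 * \<kappa> * Si s)
      + 6 * (2 * \<kappa> * Si s) * fst yh x * fst yk x
      - 2 * (ds (ds (snd yh)) (x, s) * fst yk x + ds (ds (snd yk)) (x, s) * fst yh x))"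
    unfolding vort_eq_def yh_def yk_def z_def fst_conv snd_conv
    using jet2_vorticity[OF jet2_coefficients(3) jet2_coefficients(1) jet2_coefficients(2) jet2_reciprocal[OF e(1) eta_pos] e(2,3) t] by blast
  have s: "s \<in> {0..1}" using p by simp
  have L: "snd (L_op \<Lambda>s v) (x, s) = dx (dx (snd v)) (x, s) + ds (ds (snd v)) (x, s) - (- 4 * \<kappa>\<^sup>2) * snd v (x, s) - s * deriv (deriv (fst v)) x * (- Co s) - 2 * fst v x * (2 * \<kappa> * Si s)" for v
    unfolding L_op_value(2)[OF s] by simp
  show ?thesis
    by (rule exI[of _ c], rule back_subst[of "jet2 _ _ _ _ _ _ _ _", OF c[folded L]]) simp
qed

lemma coef_integral:
  assumes n: "n \<in> {1, 2}" and P: "P \<in> U"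
  shows "coef n P = (integral (cbox 0 T) (\<lambda>x. surf_eq P x * (amp n * C0 n x)) +
    integral (cbox (0, 0) (T, 1)) (\<lambda>p. vort_eq P p * (C0 n (fst p) * S n (snd p)))) / inner_Y \<kappa> (wt n) (wt n)"
proof -
  have c: "continuous_on strip (vort_eq P)" by (rule Ck_fam_slice[OF Ck_fam_vort_eq[of 0] P])
  have c': "continuous_on strip (on_strip (vort_eq P))" by (rule continuous_on_eq[OF c]) simp
  have "integral (cbox (0, 0) (T, 1)) (\<lambda>(x, s). on_strip (vort_eq P) (x, s) * (C0 n x * S n s)) =
    integral (cbox (0, 0) (T, 1)) (\<lambda>p. vort_eq P p * (C0 n (fst p) * S n (snd p)))"
    by (intro integral_cong) auto
  then show ?thesis unfolding coef_def F_map_eqs[OF P] inner_wt[OF n c'] by simp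
qed

text \<open>\<open>coef n\<close> is twice differentiable, and its derivatives at the base point are integrals of second-order expansions of the two
  equations. The last clause allows these expansions to be supplied pointwise.\<close>

lemma coef_derivatives:
  assumes n: "n \<in> {1, 2}"
  obtains G G2 where "\<And>P. P \<in> U \<Longrightarrow> (coef n has_derivative G P) (at P)"
    "\<And>h. continuous_on U (\<lambda>P. G P h)" "\<And>h. ((\<lambda>P. G P h) has_derivative G2 h) (at P0)"
    "\<And>h k b1 d1 b2 d2. (\<And>x. \<exists>c. jet2 U P0 h k (\<lambda>P. surf_eq P x) 0 (b1 x) c (d1 x)) \<Longrightarrow>
       (\<And>p. p \<in> strip \<Longrightarrow> \<exists>c. jet2 U P0 h k (\<lambda>P. vort_eq P p) 0 (b2 p) c (d2 p)) \<Longrightarrow>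
       G P0 h = (integral (cbox 0 T) (\<lambda>x. b1 x * (amp n * C0 n x)) +
         integral (cbox (0, 0) (T, 1)) (\<lambda>p. b2 p * (C0 n (fst p) * S n (snd p)))) / inner_Y \<kappa> (wt n) (wt n) \<and>
       G2 h k = (integral (cbox 0 T) (\<lambda>x. d1 x * (amp n * C0 n x)) +
         integral (cbox (0, 0) (T, 1)) (\<lambda>p. d2 p * (C0 n (fst p) * S n (snd p)))) / inner_Y \<kappa> (wt n) (wt n)"
proof -
  let ?N = "inner_Y \<kappa> (wt n) (wt n)"
  have I1: "Ck_fam 2 U (cbox 0 T) (\<lambda>P x. surf_eq P x * (amp n * C0 n x))"
    by (rule Ck_fam_mult[OF Ck_fam_subset[OF Ck_fam_surf_eq subset_UNIV] Ck_fam_fixed[OF wt_continuous(1)[OF n]]])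
  have I2: "Ck_fam 2 U (cbox (0, 0) (T, 1)) (\<lambda>P p. vort_eq P p * (C0 n (fst p) * S n (snd p)))"
    by (rule Ck_fam_mult[OF Ck_fam_subset[OF Ck_fam_vort_eq box_subset] Ck_fam_fixed[OF wt_continuous(2)[OF n]]])
  show ?thesis
  proof (rule Ck_fam2_integral[OF I1 U_facts])
  fix A A2 assume A: "\<And>P. P \<in> U \<Longrightarrow> ((\<lambda>P. integral (cbox 0 T) (\<lambda>x. surf_eq P x * (amp n * C0 n x))) has_derivative A P) (at P)"
    "\<And>h. continuous_on U (\<lambda>P. A P h)" "\<And>h. ((\<lambda>P. A P h) has_derivative A2 h) (at P0)"
    "\<And>h k a b c d. (\<And>x. x \<in> cbox 0 T \<Longrightarrow> jet2 U P0 h k (\<lambda>P. surf_eq P x * (amp n * C0 n x)) (a x) (b x) (c x) (d x)) \<Longrightarrow>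
       A P0 h = integral (cbox 0 T) b \<and> A2 h k = integral (cbox 0 T) d"
  show ?thesis
  proof (rule Ck_fam2_integral[OF I2 U_facts])
  fix B B2 assume B: "\<And>P. P \<in> U \<Longrightarrow> ((\<lambda>P. integral (cbox (0, 0) (T, 1)) (\<lambda>p. vort_eq P p * (C0 n (fst p) * S n (snd p)))) has_derivative B P) (at P)"
    "\<And>h. continuous_on U (\<lambda>P. B P h)" "\<And>h. ((\<lambda>P. B P h) has_derivative B2 h) (at P0)"
    "\<And>h k a b c d. (\<And>p. p \<in> cbox (0, 0) (T, 1) \<Longrightarrow> jet2 U P0 h k (\<lambda>P. vort_eq P p * (C0 n (fst p) * S n (snd p))) (a p) (b p) (c p) (d p)) \<Longrightarrow>
       B P0 h = integral (cbox (0, 0) (T, 1)) b \<and> B2 h k = integral (cbox (0, 0) (T, 1)) d"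
  show ?thesis
  proof (rule that[of "\<lambda>P h. (A P h + B P h) / ?N" "\<lambda>h k. (A2 h k + B2 h k) / ?N"])
    show "(coef n has_derivative (\<lambda>h. (A P h + B P h) / ?N)) (at P)" if P: "P \<in> U" for P
    proof (rule has_derivative_transform_within_open[OF _ U_facts(1) P])
      show "((\<lambda>P. (integral (cbox 0 T) (\<lambda>x. surf_eq P x * (amp n * C0 n x)) +
        integral (cbox (0, 0) (T, 1)) (\<lambda>p. vort_eq P p * (C0 n (fst p) * S n (snd p)))) / ?N) has_derivative (\<lambda>h. (A P h + B P h) / ?N)) (at P)"
        by (rule has_derivative_divide_const[OF has_derivative_add[OF A(1)[OF P] B(1)[OF P]]])
    qed (simp add: coef_integral[OF n])
    show "continuous_on U (\<lambda>P. (A P h + B P h) / ?N)" for h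
      using continuous_on_mult[OF continuous_on_add[OF A(2) B(2)] continuous_on_const[of U "1 / ?N"]] by simp
    show "((\<lambda>P. (A P h + B P h) / ?N) has_derivative (\<lambda>k. (A2 h k + B2 h k) / ?N)) (at P0)" for h
      by (rule has_derivative_divide_const[OF has_derivative_add[OF A(3) B(3)]])
    fix h k b1 d1 b2 d2
    assume t1: "\<And>x. \<exists>c. jet2 U P0 h k (\<lambda>P. surf_eq P x) 0 (b1 x) c (d1 x)"
      and t2: "\<And>p. p \<in> strip \<Longrightarrow> \<exists>c. jet2 U P0 h k (\<lambda>P. vort_eq P p) 0 (b2 p) c (d2 p)"
    obtain c1 where c1: "\<And>x. jet2 U P0 h k (\<lambda>P. surf_eq P x) 0 (b1 x) (c1 x) (d1 x)" using t1 by metis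
    obtain c2 where c2: "\<And>p. p \<in> strip \<Longrightarrow> jet2 U P0 h k (\<lambda>P. vort_eq P p) 0 (b2 p) (c2 p) (d2 p)" using t2 by metis
    have "A P0 h = integral (cbox 0 T) (\<lambda>x. b1 x * (amp n * C0 n x)) \<and> A2 h k = integral (cbox 0 T) (\<lambda>x. d1 x * (amp n * C0 n x))"
    proof (rule A(4))
      fix x
      show "jet2 U P0 h k (\<lambda>P. surf_eq P x * (amp n * C0 n x)) 0 (b1 x * (amp n * C0 n x)) (c1 x * (amp n * C0 n x)) (d1 x * (amp n * C0 n x))"
        using jet2_mult[OF c1[of x] jet2_const[of U P0 h k "amp n * C0 n x"]] by simp
    qed
    moreover have "B P0 h = integral (cbox (0, 0) (T, 1)) (\<lambda>p. b2 p * (C0 n (fst p) * S n (snd p))) \<and>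
        B2 h k = integral (cbox (0, 0) (T, 1)) (\<lambda>p. d2 p * (C0 n (fst p) * S n (snd p)))"
    proof (rule B(4))
      fix p :: "real \<times> real" assume "p \<in> cbox (0, 0) (T, 1)"
      then have "p \<in> strip" using box_subset by blast
      then show "jet2 U P0 h k (\<lambda>P. vort_eq P p * (C0 n (fst p) * S n (snd p))) 0 (b2 p * (C0 n (fst p) * S n (snd p)))
          (c2 p * (C0 n (fst p) * S n (snd p))) (d2 p * (C0 n (fst p) * S n (snd p)))"
        using jet2_mult[OF c2 jet2_const[of U P0 h k "C0 n (fst p) * S n (snd p)"]] by simp
    qed
    ultimately show "(A P0 h + B P0 h) / ?N = (integral (cbox 0 T) (\<lambda>x. b1 x * (amp n * C0 n x)) +
         integral (cbox (0, 0) (T, 1)) (\<lambda>p. b2 p * (C0 n (fst p) * S n (snd p)))) / ?N \<and>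
       (A2 h k + B2 h k) / ?N = (integral (cbox 0 T) (\<lambda>x. d1 x * (amp n * C0 n x)) +
         integral (cbox (0, 0) (T, 1)) (\<lambda>p. d2 p * (C0 n (fst p) * S n (snd p)))) / ?N" by simp
  qed
  qed
  qed
qed

lemma inner_L_op_integral:
  assumes n: "n \<in> {1, 2}" and v: "v \<in> X"
  shows "integral (cbox 0 T) (\<lambda>x. fst (L_op \<Lambda>s v) x * (amp n * C0 n x)) +
    integral (cbox (0, 0) (T, 1)) (\<lambda>p. snd (L_op \<Lambda>s v) p * (C0 n (fst p) * S n (snd p))) = 0"
  using inner_L_op_wt[OF n v] inner_wt[OF n L_op_continuous[OF v], of "fst (L_op \<Lambda>s v)"]
  by (simp add: case_prod_unfold)

text \<open>The first derivative of \<open>F\<close> lies in the range of \<open>L\<close>, which is orthogonal to \<open>wt n\<close>.\<close>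

lemma coef_stationary:
  assumes n: "n \<in> {1, 2}" shows "((\<lambda>\<tau>. coef n (P0 + \<tau> *\<^sub>R kernel_dir h)) has_real_derivative 0) (at 0)"
proof -
  obtain G G2 where G: "\<And>P. P \<in> U \<Longrightarrow> (coef n has_derivative G P) (at P)"
    "\<And>h k b1 d1 b2 d2. (\<And>x. \<exists>c. jet2 U P0 h k (\<lambda>P. surf_eq P x) 0 (b1 x) c (d1 x)) \<Longrightarrow>
       (\<And>p. p \<in> strip \<Longrightarrow> \<exists>c. jet2 U P0 h k (\<lambda>P. vort_eq P p) 0 (b2 p) c (d2 p)) \<Longrightarrow>
       G P0 h = (integral (cbox 0 T) (\<lambda>x. b1 x * (amp n * C0 n x)) +
         integral (cbox (0, 0) (T, 1)) (\<lambda>p. b2 p * (C0 n (fst p) * S n (snd p)))) / inner_Y \<kappa> (wt n) (wt n) \<and>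
       G2 h k = (integral (cbox 0 T) (\<lambda>x. d1 x * (amp n * C0 n x)) +
         integral (cbox (0, 0) (T, 1)) (\<lambda>p. d2 p * (C0 n (fst p) * S n (snd p)))) / inner_Y \<kappa> (wt n) (wt n)"
    by (rule coef_derivatives[OF n]) blast
  have "\<forall>p. \<exists>d. p \<in> strip \<longrightarrow> (\<exists>c. jet2 U P0 (kernel_dir h) (curve_dir 0 0 0) (\<lambda>P. vort_eq P p) 0 (snd (L_op \<Lambda>s (Dstate (kernel_dir h))) p) c d)"
  proof
    fix p :: "real \<times> real"
    obtain x s where p: "p = (x, s)" by (cases p)
    show "\<exists>d. p \<in> strip \<longrightarrow> (\<exists>c. jet2 U P0 (kernel_dir h) (curve_dir 0 0 0) (\<lambda>P. vort_eq P p) 0 (snd (L_op \<Lambda>s (Dstate (kernel_dir h))) p) c d)"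
      using jet2_vort_eq[of x s h 0 0 0] unfolding p by blast
  qed
  then obtain d2 where d2: "\<And>p. p \<in> strip \<Longrightarrow> \<exists>c. jet2 U P0 (kernel_dir h) (curve_dir 0 0 0) (\<lambda>P. vort_eq P p) 0 (snd (L_op \<Lambda>s (Dstate (kernel_dir h))) p) c (d2 p)"
    by metis
  have "G P0 (kernel_dir h) = 0"
    using G(2)[OF jet2_surf_eq[of h 0 0 0] d2] inner_L_op_integral[OF n Dstate_X] by simp
  then show ?thesis using has_derivative_direction[OF G(1)[OF U_facts(3)], of "kernel_dir h"] by simp
qed

lemma curve_in_U: "\<forall>\<^sub>F \<tau> in nhds (0::real). P0 + \<tau> *\<^sub>R h \<in> U"
proof -
  have "open ((\<lambda>\<tau>::real. P0 + \<tau> *\<^sub>R h) -` U)" by (intro open_vimage continuous_intros) auto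
  then have "\<forall>\<^sub>F \<tau> in nhds 0. \<tau> \<in> (\<lambda>\<tau>::real. P0 + \<tau> *\<^sub>R h) -` U"
    using U_facts(3) by (intro eventually_nhds_in_open) auto
  then show ?thesis by simp
qed

lemma DERIV_unique_eventually:
  assumes "(f has_real_derivative a) (at 0)" "(g has_real_derivative b) (at 0)" "\<forall>\<^sub>F \<tau> in nhds 0. f \<tau> = g \<tau>"
  shows "a = b"
proof -
  have "(g has_real_derivative a) (at 0)" using assms(1) DERIV_cong_ev[OF refl assms(3) refl] by simp
  then show ?thesis using assms(2) by (rule DERIV_unique)
qed

text \<open>Along the family \<open>F = c\<^sub>1 wt\<^sub>1 + c\<^sub>2 wt\<^sub>2\<close>. The derivative of the right-hand side in a kernel
  direction vanishes by \<open>coef_stationary\<close>, the derivative of the left-hand side is \<open>L\<close> applied to the derivative of the state.\<close>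

lemma Dstate_kernel: "L_op \<Lambda>s (Dstate (kernel_dir h)) = 0"
proof -
  have z: "((\<lambda>\<tau>. coef 1 (P0 + \<tau> *\<^sub>R kernel_dir h) * a + coef 2 (P0 + \<tau> *\<^sub>R kernel_dir h) * c) has_real_derivative 0) (at 0)" for a c
    using DERIV_add[OF DERIV_cmult_right[OF coef_stationary[of 1 h], of a] DERIV_cmult_right[OF coef_stationary[of 2 h], of c]] by simp
  have "fst (L_op \<Lambda>s (Dstate (kernel_dir h))) x = 0" for x
  proof (rule DERIV_unique_eventually)
    show "((\<lambda>\<tau>. surf_eq (P0 + \<tau> *\<^sub>R kernel_dir h) x) has_real_derivative fst (L_op \<Lambda>s (Dstate (kernel_dir h))) x) (at 0)"
      using jet2_surf_eq[of h 0 0 0 x] by (auto dest: jet2_first[OF _ U_facts(3)])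
    show "((\<lambda>\<tau>. coef 1 (P0 + \<tau> *\<^sub>R kernel_dir h) * fst (wt 1) x + coef 2 (P0 + \<tau> *\<^sub>R kernel_dir h) * fst (wt 2) x) has_real_derivative 0) (at 0)" by (rule z)
    show "\<forall>\<^sub>F \<tau> in nhds 0. surf_eq (P0 + \<tau> *\<^sub>R kernel_dir h) x = coef 1 (P0 + \<tau> *\<^sub>R kernel_dir h) * fst (wt 1) x + coef 2 (P0 + \<tau> *\<^sub>R kernel_dir h) * fst (wt 2) x"
      using curve_in_U[of "kernel_dir h"]
    proof eventually_elim
      case (elim \<tau>)
      from arg_cong[OF range_equation[OF elim], of "\<lambda>v. fst v x"] show ?case
        unfolding F_map_eqs[OF elim] by (simp add: scaleR_fun_def)
    qed
  qed
  moreover have "snd (L_op \<Lambda>s (Dstate (kernel_dir h))) p = 0" for p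
  proof (cases "p \<in> strip")
    case True
    obtain x s where p: "p = (x, s)" by (cases p)
    show ?thesis
    proof (rule DERIV_unique_eventually)
      show "((\<lambda>\<tau>. vort_eq (P0 + \<tau> *\<^sub>R kernel_dir h) p) has_real_derivative snd (L_op \<Lambda>s (Dstate (kernel_dir h))) p) (at 0)"
        using jet2_vort_eq[of x s h 0 0 0] True unfolding p by (auto dest: jet2_first[OF _ U_facts(3)])
      show "((\<lambda>\<tau>. coef 1 (P0 + \<tau> *\<^sub>R kernel_dir h) * snd (wt 1) p + coef 2 (P0 + \<tau> *\<^sub>R kernel_dir h) * snd (wt 2) p) has_real_derivative 0) (at 0)" by (rule z)
      show "\<forall>\<^sub>F \<tau> in nhds 0. vort_eq (P0 + \<tau> *\<^sub>R kernel_dir h) p = coef 1 (P0 + \<tau> *\<^sub>R kernel_dir h) * snd (wt 1) p + coef 2 (P0 + \<tau> *\<^sub>R kernel_dir h) * snd (wt 2) p"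
        using curve_in_U[of "kernel_dir h"]
      proof eventually_elim
        case (elim \<tau>)
        from arg_cong[OF range_equation[OF elim], of "\<lambda>v. snd v p"] show ?case
          unfolding F_map_eqs[OF elim] using True by (simp add: scaleR_fun_def)
      qed
    qed
  qed (simp add: L_op_def)
  ultimately show ?thesis by (simp add: prod_eq_iff fun_eq_iff)
qed

text \<open>The derivative of \<open>\<psi>\<close> in a kernel direction is in the kernel by \<open>Dstate_kernel\<close> and in the complement \<open>X0\<close>.\<close>

lemma Dstate_kernel_dir: "Dstate (kernel_dir h) = wP (kernel_dir h)" "Dpsi (xP P0) (xP (kernel_dir h)) = 0"
proof -
  have k: "Dstate (kernel_dir h) \<in> K" using Dstate_kernel Dstate_X by (simp add: ker_DwF_eq)
  have "Dpsi (xP P0) (xP (kernel_dir h)) = Dstate (kernel_dir h) - wP (kernel_dir h)" by (simp add: Dstate_def)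
  then have "Dpsi (xP P0) (xP (kernel_dir h)) \<in> K" using k wP_K subspace_diff[OF subspace_ker] by simp
  moreover have "Dpsi (xP P0) (xP (kernel_dir h)) \<in> X0" by (intro Dpsi_X0 ball U_facts)
  ultimately show "Dpsi (xP P0) (xP (kernel_dir h)) = 0" using split unfolding direct_sum_def by blast
  then show "Dstate (kernel_dir h) = wP (kernel_dir h)" by (simp add: Dstate_def)
qed

text \<open>Along the trivial flows \<open>\<psi>\<close> is identically zero.\<close>

lemma Dpsi_parameter: "Dpsi (xP P0) (xP (0, 0, \<Lambda>)) = 0"
proof -
  have jz: "j (Dpsi (xP P0) (xP (0, 0, \<Lambda>))) q = 0" if j: "jet \<kappa> \<beta> Q j" and q: "q \<in> Q" for j and Q :: "'q::metric_space set" and q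
  proof (rule DERIV_unique_eventually)
    show "((\<lambda>\<tau>. j (\<psi> (xP (P0 + \<tau> *\<^sub>R (0, 0, \<Lambda>)))) q) has_real_derivative j (Dpsi (xP P0) (xP (0, 0, \<Lambda>))) q) (at 0)"
      by (rule has_derivative_direction[OF fderiv_jet[OF j q U_facts(1,3) ball(1) psi_X0 Dpsi(1)[OF ball(1)[OF U_facts(3)]]]])
    show "((\<lambda>\<tau>. 0) has_real_derivative 0) (at 0)" by simp
    show "\<forall>\<^sub>F \<tau> in nhds 0. j (\<psi> (xP (P0 + \<tau> *\<^sub>R (0, 0, \<Lambda>)))) q = 0"
      using curve_in_U[of "(0, 0, \<Lambda>)"]
    proof eventually_elim
      case (elim \<tau>)
      have "xP (P0 + \<tau> *\<^sub>R (0, 0, \<Lambda>)) = (0, snd (snd (P0 + \<tau> *\<^sub>R (0, 0, \<Lambda>))))"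
        by (simp add: xP_def wP_zero P0_def)
      then have "\<psi> (xP (P0 + \<tau> *\<^sub>R (0, 0, \<Lambda>))) = 0" using psi_trivial[OF elim] by simp
      moreover have "j (0 *\<^sub>R (0 :: fpair)) q = 0 * j 0 q" using j subspace_0[OF subspace_X[of \<kappa> \<beta>]] unfolding jet_def by blast
      ultimately show ?case by simp
    qed
  qed
  have X: "Dpsi (xP P0) (xP (0, 0, \<Lambda>)) \<in> X" by (intro X0_X Dpsi_X0 ball U_facts)
  have "fst (Dpsi (xP P0) (xP (0, 0, \<Lambda>))) x = 0" for x by (rule jz[OF jet_line(1)[OF beta] UNIV_I])
  moreover have "snd (Dpsi (xP P0) (xP (0, 0, \<Lambda>))) p = 0" for p
    using jz[OF jet_strip(1)[OF beta], of p] hoelder_le_strip_off[OF X_hoelder_le(2)[OF X], of p] by (cases "p \<in> strip") auto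
  ultimately show ?thesis by (simp add: prod_eq_iff fun_eq_iff)
qed

lemma Dstate_curve_dir: "Dstate (curve_dir k b l) = wP (kernel_dir k)"
proof -
  have "curve_dir k b l = kernel_dir k + (0, 0, (0, - 4 * \<kappa> * b, l))" by (simp add: curve_dir_def kernel_dir_def zero_prod_def)
  then have x: "xP (curve_dir k b l) = xP (kernel_dir k) + xP (0, 0, (0, - 4 * \<kappa> * b, l))" by (simp only: xP_add)
  have "Dpsi (xP P0) (xP (kernel_dir k) + xP (0, 0, (0, - 4 * \<kappa> * b, l))) = Dpsi (xP P0) (xP (kernel_dir k)) + Dpsi (xP P0) (xP (0, 0, (0, - 4 * \<kappa> * b, l)))"
    using Dpsi(1)[OF ball(1)[OF U_facts(3)]] xP_E[of "kernel_dir k"] xP_E[of "(0, 0, (0, - 4 * \<kappa> * b, l))"]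
    unfolding has_fderiv_def bounded_linear_between_def by blast
  then have "Dpsi (xP P0) (xP (curve_dir k b l)) = 0" by (simp add: x Dstate_kernel_dir Dpsi_parameter)
  moreover have "wP (curve_dir k b l) = wP (kernel_dir k)" by (simp add: wP_def curve_dir_def kernel_dir_def)
  ultimately show ?thesis by (simp add: Dstate_def)
qed

end

context reduced_family
begin

lemma wP_lin_comb:
  assumes "jet \<kappa> \<beta> Q j" shows "j (wP (kernel_dir h)) q = lin_comb h (\<lambda>n. j (w n) q)"
  using jet_wP[OF assms, of "kernel_dir h" q] by (simp add: kernel_dir_def lin_comb_def)

lemma lin_comb_cong: "(\<And>n. n \<in> {1, 2} \<Longrightarrow> F n = G n) \<Longrightarrow> lin_comb h F = lin_comb h G"
  by (simp add: lin_comb_def)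

lemma lin_comb_sum: "lin_comb h (\<lambda>n. F n + c * G n) = lin_comb h F + c * lin_comb h G"
  by (simp add: lin_comb_def algebra_simps)

lemma wP_jets:
  "fst (wP (kernel_dir h)) x = eta h x" "deriv (fst (wP (kernel_dir h))) x = etax h x" "deriv (deriv (fst (wP (kernel_dir h)))) x = etaxx h x"
  "s \<in> {0..1} \<Longrightarrow> snd (wP (kernel_dir h)) (x, s) = ph h x s + (- s * Co s) * eta h x"
  "s \<in> {0..1} \<Longrightarrow> ds (snd (wP (kernel_dir h))) (x, s) = phs h x s + (- Co s + 2 * \<kappa> * s * Si s) * eta h x"
  "s \<in> {0..1} \<Longrightarrow> ds (ds (snd (wP (kernel_dir h)))) (x, s) = phss h x s + (4 * \<kappa> * Si s + 4 * \<kappa>\<^sup>2 * s * Co s) * eta h x"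
  "s \<in> {0..1} \<Longrightarrow> dx (ds (snd (wP (kernel_dir h)))) (x, s) = phsx h x s + (- Co s + 2 * \<kappa> * s * Si s) * etax h x"
  "s \<in> {0..1} \<Longrightarrow> ds (dx (snd (wP (kernel_dir h)))) (x, s) = phsx h x s + (- Co s + 2 * \<kappa> * s * Si s) * etax h x"
proof -
  note j = jet_line[OF beta, THEN wP_lin_comb] jet_strip[OF beta, THEN wP_lin_comb]
  show "fst (wP (kernel_dir h)) x = eta h x" "deriv (fst (wP (kernel_dir h))) x = etax h x" "deriv (deriv (fst (wP (kernel_dir h)))) x = etaxx h x"
    unfolding j eta_def etax_def etaxx_def by (rule lin_comb_cong, erule w_jets(1-3))+
  assume s: "s \<in> {0..1}"
  show "snd (wP (kernel_dir h)) (x, s) = ph h x s + (- s * Co s) * eta h x"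
    "ds (snd (wP (kernel_dir h))) (x, s) = phs h x s + (- Co s + 2 * \<kappa> * s * Si s) * eta h x"
    "ds (ds (snd (wP (kernel_dir h)))) (x, s) = phss h x s + (4 * \<kappa> * Si s + 4 * \<kappa>\<^sup>2 * s * Co s) * eta h x"
    "dx (ds (snd (wP (kernel_dir h)))) (x, s) = phsx h x s + (- Co s + 2 * \<kappa> * s * Si s) * etax h x"
    "ds (dx (snd (wP (kernel_dir h)))) (x, s) = phsx h x s + (- Co s + 2 * \<kappa> * s * Si s) * etax h x"
    unfolding j eta_def etax_def ph_def phs_def phss_def phsx_def lin_comb_sum[symmetric]
    by (rule lin_comb_cong, subst w_jets(4-10)[OF _ s], assumption,
        simp add: Gn_def Gd_def Gdd_def algebra_simps)+
qed

text \<open>Connects the quadratic part delivered by the expansion of \<open>vorticity\<close>, with the transformed second components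
  \<open>\<phi> - s Co \<eta>\<close> of the kernel elements, to \<open>second_var\<close>.\<close>

lemma second_var_raw:
  fixes h k :: "real \<times> real" and b l :: real
  assumes s: "s \<in> {0..1}"
  defines "yh \<equiv> wP (kernel_dir h)" and "yk \<equiv> wP (kernel_dir k)"
  shows "- (- 4 * \<kappa> * b) * snd yh (x, s) - s * deriv (deriv (fst yh)) x * pk b l s - 2 * fst yh x * qk b l s
      + s * (deriv (deriv (fst yh)) x * fst yk x + deriv (deriv (fst yk)) x * fst yh x) * (- Co s)
      - s * (deriv (deriv (fst yh)) x * ds (snd yk) (x, s) + deriv (deriv (fst yk)) x * ds (snd yh) (x, s))
      + 4 * s * deriv (fst yh) x * deriv (fst yk) x * (- Co s)
      - s * (deriv (fst yh) x * dx (ds (snd yk)) (x, s) + deriv (fst yk) x * dx (ds (snd yh)) (x, s))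
      - s * (deriv (fst yh) x * ds (dx (snd yk)) (x, s) + deriv (fst yk) x * ds (dx (snd yh)) (x, s))
      + 2 * s\<^sup>2 * deriv (fst yh) x * deriv (fst yk) x * (2 * \<kappa> * Si s)
      + 6 * (2 * \<kappa> * Si s) * fst yh x * fst yk x
      - 2 * (ds (ds (snd yh)) (x, s) * fst yk x + ds (ds (snd yk)) (x, s) * fst yh x) = second_var h k b l x s"
proof -
  have ss: "phsss g x s = - 4 * \<kappa>\<^sup>2 * phs g x s - phsxx g x s" for g
    by (simp add: phsss_def phs_def phsxx_def lin_comb_def theta_sq_def algebra_simps power_mult_distrib)
  have "phss g x s = - 4 * \<kappa>\<^sup>2 * ph g x s - (- 4 * \<kappa>\<^sup>2 * ph g x s - phss g x s)" for g by simp
  from vorticity_identity[where eh = "eta h x" and ehx = "etax h x" and ehxx = "etaxx h x" and ek = "eta k x"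
      and ekx = "etax k x" and ekxx = "etaxx k x" and phsx = "phsx h x s" and pksx = "phsx k x s" and s = s
      and Co = "Co s" and Si = "Si s" and b = b and l = l,
      OF this[of h] this[of k] ss[of h] ss[of k] refl refl refl refl refl refl refl]
  show ?thesis unfolding yh_def yk_def wP_jets(1-3) wP_jets(4-8)[OF s] second_var_def pk_def qk_def qks_def by simp
qed

text \<open>The Hessian of \<open>coef n\<close> at the base point in the directions \<open>kernel_dir h\<close> and \<open>curve_dir k b l\<close>.\<close>

definition hess :: "nat \<Rightarrow> real \<times> real \<Rightarrow> real \<times> real \<Rightarrow> real \<Rightarrow> real \<Rightarrow> real" where
  "hess n h k b l = (if n = 1
     then (1 + \<kappa>\<^sup>2 / 3) * (fst h * snd k + snd h * fst k) + 2 / 3 * fst h * (2 * \<kappa> * b - b / \<kappa> - 2 * \<kappa> * l)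
     else 3 / 8 * (3 + \<kappa>\<^sup>2) * (cos \<sigma>)\<^sup>2 * (fst h * fst k) + 3 / 4 * snd h * (4 * \<kappa> * b / 3 - b / \<kappa> - 2 * \<kappa> * l))"

lemma hess_integral:
  assumes n: "n \<in> {1, 2}"
  shows "(integral {0..T} (\<lambda>x. (3 * eta h x * eta k x + etax h x * etax k x - b / \<kappa> * eta h x) * (amp n * C0 n x))
    + integral (cbox (0, 0) (T, 1)) (\<lambda>(x, s). second_var h k b l x s * (C0 n x * S n s))) / inner_Y \<kappa> (wt n) (wt n) = hess n h k b l"
proof -
  have c: "continuous_on A (eta g)" "continuous_on A (etax g)" "continuous_on A (etaxx g)" for g A
    unfolding eta_def[abs_def] etax_def[abs_def] etaxx_def[abs_def] by (intro lin_comb_continuous continuous_intros)+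
  let ?f = "\<lambda>x. (3 * eta h x * eta k x + etax h x * etax k x - b / \<kappa> * eta h x) * (amp n * C0 n x)"
  let ?g = "\<lambda>x. (eta h x * etaxx k x + eta k x * etaxx h x + 4 * \<kappa>\<^sup>2 * eta h x * eta k x - 2 * \<kappa> * l * eta h x) * (amp n * C0 n x)"
  have fg: "integral {0..T} ?f + integral {0..T} ?g = integral {0..T} (\<lambda>x. (3 * eta h x * eta k x + etax h x * etax k x - b / \<kappa> * eta h x
      + (eta h x * etaxx k x + eta k x * etaxx h x + 4 * \<kappa>\<^sup>2 * eta h x * eta k x - 2 * \<kappa> * l * eta h x)) * (amp n * C0 n x))"
    by (subst integral_add[symmetric]; (intro integrable_continuous_real continuous_intros c)?) (simp add: algebra_simps)
  have e: "integral {0..T} ?f + integral (cbox (0, 0) (T, 1)) (\<lambda>(x, s). second_var h k b l x s * (C0 n x * S n s)) =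
    integral {0..T} (\<lambda>x. (3 * eta h x * eta k x + etax h x * etax k x - b / \<kappa> * eta h x
      + (eta h x * etaxx k x + eta k x * etaxx h x + 4 * \<kappa>\<^sup>2 * eta h x * eta k x - 2 * \<kappa> * l * eta h x)) * (amp n * C0 n x))
    + 4 * \<kappa> * b * (lin_comb h (\<lambda>i. T / 2 * kron (int i - int n)) * integral {0..1} (\<lambda>s. S n s * S n s))"
    unfolding second_var_green[OF n] box_mode[OF n] fg[symmetric] by simp
  have T: "T / 2 > 0" using kappa_pos by simp
  show ?thesis
  proof (cases "n = 1")
    case True
    have "lin_comb h (\<lambda>i. T / 2 * kron (int i - int 1)) = T / 2 * fst h" by (simp add: lin_comb_def kron_def)
    then have "integral {0..T} ?f + integral (cbox (0, 0) (T, 1)) (\<lambda>(x, s). second_var h k b l x s * (C0 n x * S n s)) =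
      T / 2 * (cos \<sigma>)\<^sup>2 * ((3 + \<kappa>\<^sup>2) / 2 * (fst h * snd k + snd h * fst k) - (b / \<kappa> + 2 * \<kappa> * l) * fst h) + 4 * \<kappa> * b * (T / 2 * fst h * ((cos \<sigma>)\<^sup>2 / 2))"
      unfolding e unfolding True surface_integral integral_S_sq by simp
    also have "\<dots> = hess n h k b l * (T / 2 * (3 / 2 * (cos \<sigma>)\<^sup>2))"
      using True by (simp add: hess_def field_simps)
    finally have e1: "integral {0..T} ?f + integral (cbox (0, 0) (T, 1)) (\<lambda>(x, s). second_var h k b l x s * (C0 n x * S n s)) =
      hess n h k b l * (T / 2 * (3 / 2 * (cos \<sigma>)\<^sup>2))" .
    have "T / 2 * (3 / 2 * (cos \<sigma>)\<^sup>2) \<noteq> 0" using T cos_sigma_nz by auto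
    moreover have "inner_Y \<kappa> (wt n) (wt n) = T / 2 * (3 / 2 * (cos \<sigma>)\<^sup>2)" unfolding True norm_wt ..
    ultimately show ?thesis unfolding e1 by (metis nonzero_mult_div_cancel_right)
  next
    case False
    then have n2: "n = 2" using n by simp
    have "lin_comb h (\<lambda>i. T / 2 * kron (int i - int 2)) = T / 2 * snd h" by (simp add: lin_comb_def kron_def)
    then have "integral {0..T} ?f + integral (cbox (0, 0) (T, 1)) (\<lambda>(x, s). second_var h k b l x s * (C0 n x * S n s)) =
      T / 2 * ((3 + \<kappa>\<^sup>2) / 2 * (cos \<sigma>)\<^sup>2 * (fst h * fst k) - (b / \<kappa> + 2 * \<kappa> * l) * snd h) + 4 * \<kappa> * b * (T / 2 * snd h * (1 / 3))"
      unfolding e unfolding n2 surface_integral integral_S_sq by simp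
    also have "\<dots> = hess n h k b l * (T / 2 * (4 / 3))"
      using n2 by (simp add: hess_def field_simps)
    finally have e2: "integral {0..T} ?f + integral (cbox (0, 0) (T, 1)) (\<lambda>(x, s). second_var h k b l x s * (C0 n x * S n s)) =
      hess n h k b l * (T / 2 * (4 / 3))" .
    have "T / 2 * (4 / 3) \<noteq> 0" using T by auto
    moreover have "inner_Y \<kappa> (wt n) (wt n) = T / 2 * (4 / 3)" unfolding n2 norm_wt ..
    ultimately show ?thesis unfolding e2 by (metis nonzero_mult_div_cancel_right)
  qed
qed

text \<open>The unknown second derivative of \<open>\<psi>\<close> contributes \<open>L_op\<close> of an element of \<open>X\<close>, which is orthogonal to \<open>wt n\<close>; the rest is evaluated by
  \<open>hess_integral\<close>.\<close>

lemma coef_hessian: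
  assumes n: "n \<in> {1, 2}"
  obtains G G2 where "\<And>P. P \<in> U \<Longrightarrow> (coef n has_derivative G P) (at P)"
    "\<And>h. continuous_on U (\<lambda>P. G P h)" "\<And>h. ((\<lambda>P. G P h) has_derivative G2 h) (at P0)"
    "\<And>h k b l. G2 (kernel_dir h) (curve_dir k b l) = hess n h k b l"
proof (rule coef_derivatives[OF n])
  fix G G2
  assume G: "\<And>P. P \<in> U \<Longrightarrow> (coef n has_derivative G P) (at P)"
    "\<And>h. continuous_on U (\<lambda>P. G P h)" "\<And>h. ((\<lambda>P. G P h) has_derivative G2 h) (at P0)"
    "\<And>h k b1 d1 b2 d2. (\<And>x. \<exists>c. jet2 U P0 h k (\<lambda>P. surf_eq P x) 0 (b1 x) c (d1 x)) \<Longrightarrow>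
       (\<And>p. p \<in> strip \<Longrightarrow> \<exists>c. jet2 U P0 h k (\<lambda>P. vort_eq P p) 0 (b2 p) c (d2 p)) \<Longrightarrow>
       G P0 h = (integral (cbox 0 T) (\<lambda>x. b1 x * (amp n * C0 n x)) +
         integral (cbox (0, 0) (T, 1)) (\<lambda>p. b2 p * (C0 n (fst p) * S n (snd p)))) / inner_Y \<kappa> (wt n) (wt n) \<and>
       G2 h k = (integral (cbox 0 T) (\<lambda>x. d1 x * (amp n * C0 n x)) +
         integral (cbox (0, 0) (T, 1)) (\<lambda>p. d2 p * (C0 n (fst p) * S n (snd p)))) / inner_Y \<kappa> (wt n) (wt n)"
  have "G2 (kernel_dir h) (curve_dir k b l) = hess n h k b l" for h k b l
  proof -
    let ?z = "D2state (kernel_dir h) (curve_dir k b l)"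
    let ?q1 = "\<lambda>x. 3 * eta h x * eta k x + etax h x * etax k x - b / \<kappa> * eta h x"
    have b0: "ds (snd (wP (kernel_dir g))) (x, 1) = 0" for g x
      by (simp add: wP_jets surface_values Co_values)
    have t1: "\<exists>c. jet2 U P0 (kernel_dir h) (curve_dir k b l) (\<lambda>P. surf_eq P x) 0 (fst (L_op \<Lambda>s (Dstate (kernel_dir h))) x) c (fst (L_op \<Lambda>s ?z) x + ?q1 x)" for x
      using jet2_surf_eq[of h k b l x] unfolding Dstate_kernel_dir Dstate_curve_dir wP_jets(1-3) b0 surface_values by (simp add: algebra_simps)
    have t2: "\<exists>c. jet2 U P0 (kernel_dir h) (curve_dir k b l) (\<lambda>P. vort_eq P p) 0 (snd (L_op \<Lambda>s (Dstate (kernel_dir h))) p) c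
        (snd (L_op \<Lambda>s ?z) p + second_var h k b l (fst p) (snd p))" if "p \<in> strip" for p
    proof -
      obtain x s where p: "p = (x, s)" by (cases p)
      then have s: "s \<in> {0..1}" using that by simp
      show ?thesis using jet2_vort_eq[of x s h k b l] that unfolding Dstate_kernel_dir Dstate_curve_dir second_var_raw[OF s] p by simp
    qed
    have c1: "continuous_on {0..T} (\<lambda>x. fst (L_op \<Lambda>s ?z) x * (amp n * C0 n x))" unfolding L_op_value
      by (intro continuous_intros X_continuous D2state_X)
    have ce: "continuous_on A (eta g)" "continuous_on A (etax g)" for g A
      unfolding eta_def[abs_def] etax_def[abs_def] by (intro lin_comb_continuous continuous_intros)+
    have c2: "continuous_on {0..T} (\<lambda>x. ?q1 x * (amp n * C0 n x))"
      by (intro continuous_intros ce)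
    have c3: "continuous_on (cbox (0, 0) (T, 1)) (\<lambda>p. snd (L_op \<Lambda>s ?z) p * (C0 n (fst p) * S n (snd p)))"
      by (intro continuous_on_mult continuous_on_subset[OF L_op_continuous[OF D2state_X] box_subset] wt_continuous(2)[OF n])
    have c4: "continuous_on (cbox (0, 0) (T, 1)) (\<lambda>p. second_var h k b l (fst p) (snd p) * (C0 n (fst p) * S n (snd p)))"
      using continuous_on_mult[OF second_var_continuous wt_continuous(2)[OF n]] by (simp add: case_prod_unfold)
    have i1: "integral (cbox 0 T) (\<lambda>x. (fst (L_op \<Lambda>s ?z) x + ?q1 x) * (amp n * C0 n x)) =
      integral (cbox 0 T) (\<lambda>x. fst (L_op \<Lambda>s ?z) x * (amp n * C0 n x)) + integral (cbox 0 T) (\<lambda>x. ?q1 x * (amp n * C0 n x))"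
      using integral_add[OF integrable_continuous_real[OF c1] integrable_continuous_real[OF c2]] by (simp add: distrib_right)
    have i2: "integral (cbox (0, 0) (T, 1)) (\<lambda>p. (snd (L_op \<Lambda>s ?z) p + second_var h k b l (fst p) (snd p)) * (C0 n (fst p) * S n (snd p))) =
      integral (cbox (0, 0) (T, 1)) (\<lambda>p. snd (L_op \<Lambda>s ?z) p * (C0 n (fst p) * S n (snd p))) +
      integral (cbox (0, 0) (T, 1)) (\<lambda>p. second_var h k b l (fst p) (snd p) * (C0 n (fst p) * S n (snd p)))"
      using integral_add[OF integrable_continuous[OF c3] integrable_continuous[OF c4]] by (simp add: distrib_right)
    have "G2 (kernel_dir h) (curve_dir k b l) = (integral (cbox 0 T) (\<lambda>x. ?q1 x * (amp n * C0 n x)) +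
      integral (cbox (0, 0) (T, 1)) (\<lambda>p. second_var h k b l (fst p) (snd p) * (C0 n (fst p) * S n (snd p)))) / inner_Y \<kappa> (wt n) (wt n)"
      using G(4)[OF t1 t2] inner_L_op_integral[OF n D2state_X[of "kernel_dir h" "curve_dir k b l"]] unfolding i1 i2 by simp
    then show ?thesis using hess_integral[OF n, of h k b l] by (simp add: case_prod_unfold)
  qed
  then show ?thesis using G(1-3) that by blast
qed

end

section \<open>Curves in Y along a fixed direction\<close>

lemma Y_norm_nonneg: "v \<in> fst (Y_space \<kappa> \<beta>) \<Longrightarrow> 0 \<le> snd (Y_space \<kappa> \<beta>) v"
  using Y_hoelder_le(1) hoelder_le_line_nonneg by blast

lemma has_nderiv_scaled:
  assumes v: "v \<in> fst (Y_space \<kappa> \<beta>)" and c: "(c has_real_derivative c') (at t)"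
    and f: "\<forall>\<^sub>F \<tau> in nhds t. f \<tau> = c \<tau> *\<^sub>R v"
  shows "has_nderiv (Y_space \<kappa> \<beta>) f (c' *\<^sub>R v) t"
  unfolding has_nderiv_def
proof (intro conjI)
  have sc: "r *\<^sub>R v \<in> fst (Y_space \<kappa> \<beta>)" for r using v subspace_scale[OF subspace_Y] by blast
  show "c' *\<^sub>R v \<in> fst (Y_space \<kappa> \<beta>)" by (rule sc)
  show "\<forall>\<^sub>F \<tau> in nhds t. f \<tau> \<in> fst (Y_space \<kappa> \<beta>)" using f by eventually_elim (simp add: sc)
  have ft: "f t = c t *\<^sub>R v" using eventually_nhds_x_imp_x[OF f] .
  have "filterlim (\<lambda>h. t + h) (nhds t) (at 0)" by (auto intro!: tendsto_eq_intros)
  then have ev: "\<forall>\<^sub>F h in at 0. f (t + h) = c (t + h) *\<^sub>R v" using f by (auto simp: filterlim_iff)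
  have eq: "\<forall>\<^sub>F h in at 0. (1 / h) *\<^sub>R (f (t + h) - f t) - c' *\<^sub>R v = ((c (t + h) - c t) / h - c') *\<^sub>R v"
    using ev by eventually_elim (simp add: ft scaleR_diff_left[symmetric] diff_divide_distrib)
  have "((\<lambda>h. (c (t + h) - c t) / h) \<longlongrightarrow> c') (at 0)" using c by (simp add: DERIV_def)
  then have l: "((\<lambda>h. (c (t + h) - c t) / h - c') \<longlongrightarrow> 0) (at 0)" by (rule LIM_zero)
  have "((\<lambda>h. 5 * (\<bar>(c (t + h) - c t) / h - c'\<bar> * snd (Y_space \<kappa> \<beta>) v)) \<longlongrightarrow> 5 * (\<bar>0\<bar> * snd (Y_space \<kappa> \<beta>) v)) (at 0)"
    by (intro tendsto_intros l)
  then have "((\<lambda>h. 5 * (\<bar>(c (t + h) - c t) / h - c'\<bar> * snd (Y_space \<kappa> \<beta>) v)) \<longlongrightarrow> 0) (at 0)" by simp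
  moreover have "\<forall>\<^sub>F h in at 0. norm (snd (Y_space \<kappa> \<beta>) ((1 / h) *\<^sub>R (f (t + h) - f t) - c' *\<^sub>R v)) \<le>
      5 * (\<bar>(c (t + h) - c t) / h - c'\<bar> * snd (Y_space \<kappa> \<beta>) v)"
    using eq
  proof eventually_elim
    case (elim h)
    show ?case unfolding elim using Y_norm_scale[OF v] Y_norm_nonneg[OF sc] by simp
  qed
  ultimately show "((\<lambda>h. snd (Y_space \<kappa> \<beta>) ((1 / h) *\<^sub>R (f (t + h) - f t) - c' *\<^sub>R v)) \<longlongrightarrow> 0) (at 0)"
    by (rule Lim_null_comparison[rotated])
qed

text \<open>The value of \<open>nderiv\<close> is a definite description, so it is determined by any derivative only once derivatives are known to be unique.\<close>

lemma has_nderiv_unique: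
  assumes d: "has_nderiv (Y_space \<kappa> \<beta>) f d t" and e: "has_nderiv (Y_space \<kappa> \<beta>) f e t"
  shows "d = e"
proof -
  let ?Y = "fst (Y_space \<kappa> \<beta>)" and ?n = "snd (Y_space \<kappa> \<beta>)"
  have Y: "d \<in> ?Y" "e \<in> ?Y" and fe: "\<forall>\<^sub>F \<tau> in nhds t. f \<tau> \<in> ?Y"
    and ld: "((\<lambda>h. ?n ((1 / h) *\<^sub>R (f (t + h) - f t) - d)) \<longlongrightarrow> 0) (at 0)"
    and le: "((\<lambda>h. ?n ((1 / h) *\<^sub>R (f (t + h) - f t) - e)) \<longlongrightarrow> 0) (at 0)"
    using d e unfolding has_nderiv_def by auto
  have ft: "f t \<in> ?Y" using eventually_nhds_x_imp_x[OF fe] .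
  have "filterlim (\<lambda>h. t + h) (nhds t) (at 0)" by (auto intro!: tendsto_eq_intros)
  then have ev: "\<forall>\<^sub>F h in at 0. f (t + h) \<in> ?Y" using fe by (auto simp: filterlim_iff)
  have "\<forall>\<^sub>F h in at 0. ?n (d - e) \<le> 5 * (?n ((1 / h) *\<^sub>R (f (t + h) - f t) - e) + 5 * ?n ((1 / h) *\<^sub>R (f (t + h) - f t) - d))"
    using ev
  proof eventually_elim
    case (elim h)
    let ?q = "(1 / h) *\<^sub>R (f (t + h) - f t)"
    have q: "?q \<in> ?Y" using elim ft subspace_diff[OF subspace_Y] subspace_scale[OF subspace_Y] by blast
    have qd: "?q - d \<in> ?Y" "?q - e \<in> ?Y" "(-1) *\<^sub>R (?q - d) \<in> ?Y"
      using q Y subspace_diff[OF subspace_Y] subspace_scale[OF subspace_Y] by blast+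
    have "d - e = (?q - e) + (-1) *\<^sub>R (?q - d)" by simp
    then have "?n (d - e) \<le> 5 * (?n (?q - e) + ?n ((-1) *\<^sub>R (?q - d)))" using Y_norm_add[OF qd(2,3)] by simp
    then show ?case using Y_norm_scale[OF qd(1), of "-1"] by simp
  qed
  moreover have "((\<lambda>h. 5 * (?n ((1 / h) *\<^sub>R (f (t + h) - f t) - e) + 5 * ?n ((1 / h) *\<^sub>R (f (t + h) - f t) - d))) \<longlongrightarrow> 5 * (0 + 5 * 0)) (at 0)"
    by (intro tendsto_intros ld le)
  ultimately have "?n (d - e) \<le> 5 * (0 + 5 * 0)"
    by (intro tendsto_lowerbound[of _ "5 * (0 + 5 * 0)" "at (0::real)"]) auto
  then have "d - e = 0" using Y by (intro Y_norm_zero_imp[of "d - e" \<kappa> \<beta>] subspace_diff[OF subspace_Y]) auto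
  then show ?thesis by simp
qed

lemma nderiv_scaled:
  assumes "v \<in> fst (Y_space \<kappa> \<beta>)" "(c has_real_derivative c') (at t)"
  shows "nderiv (Y_space \<kappa> \<beta>) (\<lambda>\<tau>. c \<tau> *\<^sub>R v) t = c' *\<^sub>R v"
  unfolding nderiv_def
proof (rule the_equality)
  show "has_nderiv (Y_space \<kappa> \<beta>) (\<lambda>\<tau>. c \<tau> *\<^sub>R v) (c' *\<^sub>R v) t"
    by (rule has_nderiv_scaled[OF assms]) simp
  then show "d = c' *\<^sub>R v" if "has_nderiv (Y_space \<kappa> \<beta>) (\<lambda>\<tau>. c \<tau> *\<^sub>R v) d t" for d
    using has_nderiv_unique that by blast
qed

lemma integral01_scaled: "integral01 (\<lambda>z. g z *\<^sub>R v) = integral {0..1} g *\<^sub>R v"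
  by (simp add: integral01_def prod_eq_iff fun_eq_iff scaleR_fun_def)

section \<open>Isolated zeros and smooth functions of two variables\<close>

lemma not_islimpt_arithmetic: "\<not> x islimpt (range (\<lambda>n :: int. c + real_of_int n * pi))"
proof -
  let ?N = "\<lceil>\<bar>x\<bar> + \<bar>c\<bar> + 1\<rceil>"
  have "range (\<lambda>n :: int. c + real_of_int n * pi) \<inter> ball x 1 \<subseteq> (\<lambda>n. c + real_of_int n * pi) ` {- ?N..?N}"
  proof (clarify, rule imageI)
    fix n :: int assume a: "c + real_of_int n * pi \<in> ball x 1"
    have "\<bar>real_of_int n\<bar> * 1 \<le> \<bar>real_of_int n\<bar> * pi" using pi_gt3 by (intro mult_left_mono) auto
    also have "\<dots> = \<bar>real_of_int n * pi\<bar>" by (simp add: abs_mult)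
    also have "\<dots> \<le> \<bar>x\<bar> + \<bar>c\<bar> + 1" using a by (auto simp: dist_real_def)
    also have "\<dots> \<le> of_int ?N" by (rule le_of_int_ceiling)
    finally have "\<bar>n\<bar> \<le> ?N" by linarith
    then show "n \<in> {- ?N..?N}" by auto
  qed
  then have "finite (range (\<lambda>n :: int. c + real_of_int n * pi) \<inter> ball x 1)" by (rule finite_subset) simp
  then show ?thesis unfolding islimpt_eq_infinite_ball using zero_less_one by blast
qed

text \<open>In terms of the double angle the form is \<open>((p + q) - (p - q) cos (2v)) / 2\<close>. Unless it has no zero, \<open>p \<noteq> q\<close> and its zeros are
  those \<open>v\<close> with \<open>cos (2v) = cos (2u)\<close> for one zero \<open>u\<close>: two arithmetic progressions of step \<open>\<pi>\<close>.\<close>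

lemma sparse_quadratic_form:
  fixes p q :: real
  assumes "p \<noteq> 0 \<or> q \<noteq> 0"
  shows "{v. p * (sin v)\<^sup>2 + q * (cos v)\<^sup>2 = 0} sparse_in A"
proof (cases "\<exists>u. p * (sin u)\<^sup>2 + q * (cos u)\<^sup>2 = 0")
  case False
  then have "{v. p * (sin v)\<^sup>2 + q * (cos v)\<^sup>2 = 0} = {}" by auto
  then show ?thesis by simp
next
  case True
  then obtain u where u: "p * (sin u)\<^sup>2 + q * (cos u)\<^sup>2 = 0" by auto
  have e: "p * (sin v)\<^sup>2 + q * (cos v)\<^sup>2 = ((p + q) - (p - q) * cos (2 * v)) / 2" for v
    unfolding cos_double_cos sin_squared_eq by (simp add: field_simps)
  have pq: "p - q \<noteq> 0"
  proof
    assume "p - q = 0"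
    then have "p * ((sin u)\<^sup>2 + (cos u)\<^sup>2) = 0" using u by (simp only: distrib_left) simp
    then show False using assms \<open>p - q = 0\<close> by simp
  qed
  have "{v. p * (sin v)\<^sup>2 + q * (cos v)\<^sup>2 = 0} \<subseteq> range (\<lambda>n :: int. u + real_of_int n * pi) \<union> range (\<lambda>n :: int. - u + real_of_int n * pi)"
  proof
    fix v assume "v \<in> {v. p * (sin v)\<^sup>2 + q * (cos v)\<^sup>2 = 0}"
    then have "(p - q) * cos (2 * v) = (p - q) * cos (2 * u)" using u unfolding e by simp
    then have "cos (2 * v) = cos (2 * u)" using pq by simp
    then obtain n where n: "n \<in> \<int>" "2 * v = 2 * u + 2 * n * pi \<or> 2 * v = - (2 * u) + 2 * n * pi"
      unfolding cos_eq by auto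
    obtain m :: int where m: "n = real_of_int m" using n(1) by (auto elim: Ints_cases)
    have "v = u + real_of_int m * pi \<or> v = - u + real_of_int m * pi" using n(2) unfolding m by (auto simp: algebra_simps)
    then show "v \<in> range (\<lambda>n :: int. u + real_of_int n * pi) \<union> range (\<lambda>n :: int. - u + real_of_int n * pi)" by blast
  qed
  moreover have "(range (\<lambda>n :: int. u + real_of_int n * pi) \<union> range (\<lambda>n :: int. - u + real_of_int n * pi)) sparse_in A"
    unfolding sparse_in_def islimpt_Un
    using not_islimpt_arithmetic[of _ u] not_islimpt_arithmetic[of _ "- u"] by (intro ballI exI[of _ UNIV]) blast
  ultimately show ?thesis by (rule sparse_in_subset2[rotated])
qed

lemma smooth_map_partial:
  fixes a :: "real \<times> real \<Rightarrow> real"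
  assumes "smooth_map (UNIV, norm) (UNIV, norm) A a" "(0, v) \<in> A" "\<And>r. \<bar>r\<bar> < e \<Longrightarrow> (r, v) \<in> A" "e > 0"
  shows "\<exists>d. ((\<lambda>r. a (r, v)) has_real_derivative d) (at 0)"
proof -
  have "Ck_map (Suc 0) (UNIV, norm) (UNIV, norm) A a" using assms(1) unfolding smooth_map_def by blast
  then obtain D where "\<forall>x\<in>A. has_fderiv (UNIV, norm) (UNIV, norm) A a (D x) x" unfolding Ck_map.simps(2) by blast
  then have D: "has_fderiv (UNIV, norm) (UNIV, norm) A a (D (0, v)) (0, v)" using assms(2) by blast
  let ?L = "D (0, v)"
  have sc: "?L (r *\<^sub>R (1, 0)) = r *\<^sub>R ?L (1, 0)" for r
  proof -
    have "\<forall>c. \<forall>x\<in>fst (UNIV :: (real \<times> real) set, norm :: real \<times> real \<Rightarrow> real). ?L (c *\<^sub>R x) = c *\<^sub>R ?L x"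
      using D unfolding has_fderiv_def bounded_linear_between_def by (elim conjE)
    then show ?thesis unfolding fst_conv by blast
  qed
  have "((\<lambda>r. a (r, v)) has_derivative (\<lambda>r. r * ?L (1, 0))) (at 0)"
    unfolding has_derivative_at_alt
  proof (intro conjI allI impI)
    show "bounded_linear (\<lambda>r. r * ?L (1, 0))" by (rule bounded_linear_mult_left)
    fix c :: real assume c: "c > 0"
    obtain d where d: "d > 0" "\<And>h. norm h < d \<Longrightarrow> (0, v) + h \<in> A \<Longrightarrow> norm (a ((0, v) + h) - a (0, v) - ?L h) \<le> c * norm h"
      using D c unfolding has_fderiv_def by auto
    show "\<exists>d>0. \<forall>y. norm (y - 0) < d \<longrightarrow> norm (a (y, v) - a (0, v) - (y - 0) * ?L (1, 0)) \<le> c * norm (y - 0)"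
    proof (intro exI[of _ "min d e"] conjI allI impI)
      fix r :: real assume r: "norm (r - 0) < min d e"
      then have "norm (r, 0::real) < d" "(0, v) + (r, 0) \<in> A" using assms(3) by (auto simp: norm_Pair)
      from d(2)[OF this] show "norm (a (r, v) - a (0, v) - (r - 0) * ?L (1, 0)) \<le> c * norm (r - 0)"
        using sc[of r] by (simp add: norm_Pair)
    qed (use d assms(4) in simp)
  qed
  moreover have "(\<lambda>r. r * ?L (1, 0)) = (*) (?L (1, 0))" by (simp add: fun_eq_iff)
  ultimately show ?thesis unfolding has_field_derivative_def by (intro exI[of _ "?L (1, 0)"]) simp
qed

section \<open>Second-order terms of the bifurcation equations and slopes of the sheet\<close>

context reduced_family
begin

lemma Phi_coef: "Phi \<kappa> \<Lambda>s 1 2 \<psi> n t1 t2 \<Lambda> = coef n (t1, t2, \<Lambda>) *\<^sub>R wt n"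
  by (simp add: Phi_def Pi_mode_def coef_def state_def wP_def xP_def Let_def)

lemma nderiv_Phi:
  assumes n: "n \<in> {1, 2}" and g: "(coef n has_derivative g) (at (t1, t2, \<Lambda>))"
  shows "nderiv (Y_space \<kappa> \<beta>) (\<lambda>t1. Phi \<kappa> \<Lambda>s 1 2 \<psi> n t1 t2 \<Lambda>) t1 = g (kernel_dir (1, 0)) *\<^sub>R wt n"
    "nderiv (Y_space \<kappa> \<beta>) (\<lambda>t2. Phi \<kappa> \<Lambda>s 1 2 \<psi> n t1 t2 \<Lambda>) t2 = g (kernel_dir (0, 1)) *\<^sub>R wt n"
proof -
  have "((\<lambda>\<tau>. coef n (\<tau> + t1, t2, \<Lambda>)) has_real_derivative g (kernel_dir (1, 0))) (at 0)"
    using has_derivative_direction[OF g, of "kernel_dir (1, 0)"] by (simp add: kernel_dir_def add.commute)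
  then have "((\<lambda>\<tau>. coef n (\<tau>, t2, \<Lambda>)) has_real_derivative g (kernel_dir (1, 0))) (at (0 + t1))"
    by (subst DERIV_shift)
  then show "nderiv (Y_space \<kappa> \<beta>) (\<lambda>t1. Phi \<kappa> \<Lambda>s 1 2 \<psi> n t1 t2 \<Lambda>) t1 = g (kernel_dir (1, 0)) *\<^sub>R wt n"
    unfolding Phi_coef add_0 by (rule nderiv_scaled[OF wt_in_Y[OF n]])
  have "((\<lambda>\<tau>. coef n (t1, \<tau> + t2, \<Lambda>)) has_real_derivative g (kernel_dir (0, 1))) (at 0)"
    using has_derivative_direction[OF g, of "kernel_dir (0, 1)"] by (simp add: kernel_dir_def add.commute)
  then have "((\<lambda>\<tau>. coef n (t1, \<tau>, \<Lambda>)) has_real_derivative g (kernel_dir (0, 1))) (at (0 + t2))"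
    by (subst DERIV_shift)
  then show "nderiv (Y_space \<kappa> \<beta>) (\<lambda>t2. Phi \<kappa> \<Lambda>s 1 2 \<psi> n t1 t2 \<Lambda>) t2 = g (kernel_dir (0, 1)) *\<^sub>R wt n"
    unfolding Phi_coef add_0 by (rule nderiv_scaled[OF wt_in_Y[OF n]])
qed

lemma integral01_cong:
  assumes "\<And>z. z \<in> {0..1} \<Longrightarrow> f z = g z" shows "integral01 f = integral01 g"
  unfolding integral01_def using assms by (auto intro!: ext integral_cong)

lemma eventually_U:
  assumes "(C has_vector_derivative C') (at 0)" "C 0 = P0"
  shows "\<forall>\<^sub>F r in nhds 0. C r \<in> U"
proof -
  have "isCont C 0" using assms(1) by (rule has_vector_derivative_continuous)
  then have "\<forall>e>0. \<forall>\<^sub>F r in nhds 0. dist (C r) (C 0) < e"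
    unfolding continuous_at_eps_delta eventually_nhds_metric by (simp add: dist_norm)
  then have "\<forall>\<^sub>F r in nhds 0. dist (C r) P0 < \<delta>" using \<delta>_pos assms(2) by simp
  then show ?thesis by eventually_elim (simp add: dist_commute)
qed

text \<open>The parameters may depend on \<open>r\<close>: constant parameters give the derivatives of \<open>\<Psi>\<close> at the bifurcation point, the parameters of the sheet
  give the equations for its slopes. \<open>\<Psi>\<^sub>1\<close> is a mean over a segment in the first variable that starts at
  \<open>(0, r sin v)\<close>, and \<open>\<Psi>\<^sub>2\<close> a mean over the segment from the origin to \<open>(r cos v, r sin v)\<close>.\<close>

lemma Psi_expansion:
  assumes Lam: "(Lam has_vector_derivative (0, - 4 * \<kappa> * b, l)) (at 0)" "Lam 0 = \<Lambda>s"
  obtains f1 f2 where "\<forall>\<^sub>F r in nhds 0. Psi1 \<kappa> \<beta> \<Lambda>s 1 2 \<psi> r v (Lam r) = f1 r *\<^sub>R wt 1"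
    "(f1 has_real_derivative (1 + \<kappa>\<^sup>2 / 3) * sin v + 2 / 3 * (2 * \<kappa> * b - b / \<kappa> - 2 * \<kappa> * l)) (at 0)"
    "\<forall>\<^sub>F r in nhds 0. Psi2 \<kappa> \<beta> \<Lambda>s 1 2 \<psi> r v (Lam r) = f2 r *\<^sub>R wt 2"
    "(f2 has_real_derivative 3 / 16 * (3 + \<kappa>\<^sup>2) * (cos \<sigma>)\<^sup>2 * (cos v)\<^sup>2
        + 3 / 4 * sin v * (4 * \<kappa> * b / 3 - b / \<kappa> - 2 * \<kappa> * l)) (at 0)"
proof -
  obtain G H where G: "\<And>P. P \<in> U \<Longrightarrow> (coef 1 has_derivative G P) (at P)"
    "\<And>h. continuous_on U (\<lambda>P. G P h)" "\<And>h. ((\<lambda>P. G P h) has_derivative H h) (at P0)"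
    "\<And>h k b l. H (kernel_dir h) (curve_dir k b l) = hess 1 h k b l" by (rule coef_hessian[of 1]) auto
  obtain G' H' where G': "\<And>P. P \<in> U \<Longrightarrow> (coef 2 has_derivative G' P) (at P)"
    "\<And>h. continuous_on U (\<lambda>P. G' P h)" "\<And>h. ((\<lambda>P. G' P h) has_derivative H' h) (at P0)"
    "\<And>h k b l. H' (kernel_dir h) (curve_dir k b l) = hess 2 h k b l" by (rule coef_hessian[of 2]) auto
  define A where "A r = (0 :: real, r * sin v, Lam r)" for r
  define B where "B r = (r * cos v, 0 :: real, 0 :: param)" for r
  define A' where "A' r = (0 :: real, 0 :: real, Lam r)" for r
  define B' where "B' r = (r * cos v, r * sin v, 0 :: param)" for r
  have m: "((\<lambda>r. r * c) has_vector_derivative c) (at 0)" for c :: real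
    using DERIV_cmult_right[OF DERIV_ident, of c 0] by (simp add: has_real_derivative_iff_has_vector_derivative)
  note z = has_vector_derivative_const
  have dA: "(A has_vector_derivative curve_dir (0, sin v) b l) (at 0)" "(A' has_vector_derivative curve_dir (0, 0) b l) (at 0)"
    unfolding A_def[abs_def] A'_def[abs_def] curve_dir_def fst_conv snd_conv by (intro has_vector_derivative_Pair z m Lam(1))+
  have k0: "curve_dir k 0 0 = (fst k, snd k, 0)" for k by (simp add: curve_dir_def zero_prod_def)
  have dB: "(B has_vector_derivative curve_dir (cos v, 0) 0 0) (at 0)" "(B' has_vector_derivative curve_dir (cos v, sin v) 0 0) (at 0)"
    unfolding B_def[abs_def] B'_def[abs_def] k0 fst_conv snd_conv by (intro has_vector_derivative_Pair z m)+
  have AB: "A 0 = P0" "A' 0 = P0" "B 0 = 0" "B' 0 = 0"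
    using Lam(2) by (simp_all add: A_def A'_def B_def B'_def P0_def zero_prod_def)
  have seg: "\<forall>\<^sub>F r in nhds 0. \<forall>z\<in>{0..1}. A r + z *\<^sub>R B r \<in> U"
    if "(A has_vector_derivative a) (at 0)" "A 0 = P0" "(B has_vector_derivative b) (at 0)" "B 0 = 0" for A B a b
  proof -
    have "((\<lambda>r. A r + B r) has_vector_derivative a + b) (at 0)" by (rule has_vector_derivative_add[OF that(1,3)])
    then have "\<forall>\<^sub>F r in nhds 0. A r + B r \<in> U" by (rule eventually_U) (simp add: that)
    moreover have "\<forall>\<^sub>F r in nhds 0. A r \<in> U" by (rule eventually_U[OF that(1,2)])
    ultimately show ?thesis
    proof eventually_elim
      case (elim r)
      show ?case
      proof
        fix z :: real assume z: "z \<in> {0..1}"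
        have "(1 - z) *\<^sub>R A r + z *\<^sub>R (A r + B r) \<in> U"
          using convexD[OF U_facts(2) elim(2,1), of "1 - z" z] z by auto
        then show "A r + z *\<^sub>R B r \<in> U" by (simp add: algebra_simps)
      qed
    qed
  qed
  show ?thesis
  proof (rule that)
    show "\<forall>\<^sub>F r in nhds 0. Psi1 \<kappa> \<beta> \<Lambda>s 1 2 \<psi> r v (Lam r) = integral {0..1} (\<lambda>z. G (A r + z *\<^sub>R B r) (kernel_dir (1, 0))) *\<^sub>R wt 1"
      using seg[OF dA(1) AB(1) dB(1) AB(3)]
    proof eventually_elim
      case (elim r)
      have "nderiv (Y_space \<kappa> \<beta>) (\<lambda>t1. Phi \<kappa> \<Lambda>s 1 2 \<psi> 1 t1 (r * sin v) (Lam r)) (z * r * cos v)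
          = G (A r + z *\<^sub>R B r) (kernel_dir (1, 0)) *\<^sub>R wt 1" if "z \<in> {0..1}" for z
      proof (rule nderiv_Phi)
        have "A r + z *\<^sub>R B r = (z * r * cos v, r * sin v, Lam r)" by (simp add: A_def B_def)
        then show "(coef 1 has_derivative G (A r + z *\<^sub>R B r)) (at (z * r * cos v, r * sin v, Lam r))"
          using G(1)[OF elim[rule_format, OF that]] by simp
      qed simp
      from integral01_cong[OF this] show ?case unfolding Psi1_def by (simp only: integral01_scaled)
    qed
    have "((\<lambda>r. integral {0..1} (\<lambda>z. G (A r + z *\<^sub>R B r) (kernel_dir (1, 0)))) has_real_derivative
        hess 1 (1, 0) (0, sin v) b l + hess 1 (1, 0) (cos v, 0) 0 0 / 2) (at 0)"
      unfolding G(4)[symmetric]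
      by (rule average_along_segment[OF G(3) G(2) U_facts(1,3) dA(1) AB(1) dB(1) AB(3)])
    then show "((\<lambda>r. integral {0..1} (\<lambda>z. G (A r + z *\<^sub>R B r) (kernel_dir (1, 0)))) has_real_derivative
        (1 + \<kappa>\<^sup>2 / 3) * sin v + 2 / 3 * (2 * \<kappa> * b - b / \<kappa> - 2 * \<kappa> * l)) (at 0)"
      by (simp add: hess_def)
    show "\<forall>\<^sub>F r in nhds 0. Psi2 \<kappa> \<beta> \<Lambda>s 1 2 \<psi> r v (Lam r) =
        integral {0..1} (\<lambda>z. G' (A' r + z *\<^sub>R B' r) (kernel_dir (cos v, sin v))) *\<^sub>R wt 2"
      using seg[OF dA(2) AB(2) dB(2) AB(4)]
    proof eventually_elim
      case (elim r)
      have "cos v *\<^sub>R nderiv (Y_space \<kappa> \<beta>) (\<lambda>t1. Phi \<kappa> \<Lambda>s 1 2 \<psi> 2 t1 (z * r * sin v) (Lam r)) (z * r * cos v)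
          + sin v *\<^sub>R nderiv (Y_space \<kappa> \<beta>) (\<lambda>t2. Phi \<kappa> \<Lambda>s 1 2 \<psi> 2 (z * r * cos v) t2 (Lam r)) (z * r * sin v)
          = G' (A' r + z *\<^sub>R B' r) (kernel_dir (cos v, sin v)) *\<^sub>R wt 2" if "z \<in> {0..1}" for z
      proof -
        let ?g = "G' (A' r + z *\<^sub>R B' r)"
        have P: "A' r + z *\<^sub>R B' r = (z * r * cos v, z * r * sin v, Lam r)" by (simp add: A'_def B'_def)
        have g: "(coef 2 has_derivative ?g) (at (z * r * cos v, z * r * sin v, Lam r))"
          using G'(1)[OF elim[rule_format, OF that]] unfolding P .
        have lin: "linear ?g" by (rule has_derivative_linear[OF g])
        have "kernel_dir (cos v, sin v) = cos v *\<^sub>R kernel_dir (1, 0) + sin v *\<^sub>R kernel_dir (0, 1)" by (simp add: kernel_dir_def)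
        then have "?g (kernel_dir (cos v, sin v)) = cos v * ?g (kernel_dir (1, 0)) + sin v * ?g (kernel_dir (0, 1))"
          by (simp add: linear_add[OF lin] linear_scale[OF lin])
        moreover note nderiv_Phi[OF _ g]
        ultimately show ?thesis by (simp add: scaleR_add_left)
      qed
      from integral01_cong[OF this] show ?case unfolding Psi2_def by (simp only: integral01_scaled)
    qed
    have "((\<lambda>r. integral {0..1} (\<lambda>z. G' (A' r + z *\<^sub>R B' r) (kernel_dir (cos v, sin v)))) has_real_derivative
        hess 2 (cos v, sin v) (0, 0) b l + hess 2 (cos v, sin v) (cos v, sin v) 0 0 / 2) (at 0)"
      unfolding G'(4)[symmetric]
      by (rule average_along_segment[OF G'(3) G'(2) U_facts(1,3) dA(2) AB(2) dB(2) AB(4)])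
    then show "((\<lambda>r. integral {0..1} (\<lambda>z. G' (A' r + z *\<^sub>R B' r) (kernel_dir (cos v, sin v)))) has_real_derivative
        3 / 16 * (3 + \<kappa>\<^sup>2) * (cos \<sigma>)\<^sup>2 * (cos v)\<^sup>2 + 3 / 4 * sin v * (4 * \<kappa> * b / 3 - b / \<kappa> - 2 * \<kappa> * l)) (at 0)"
      by (simp add: hess_def power2_eq_square algebra_simps)
  qed
qed

text \<open>Follows from \<open>(1 + 3\<kappa>\<^sup>2) (cos \<sigma>)\<^sup>2 = 1\<close>.\<close>

lemma quadratic_coefficient: "3 / 16 * (3 + \<kappa>\<^sup>2) * (cos \<sigma>)\<^sup>2 = 1 / 16 + (cos \<sigma>)\<^sup>2 / 2"
  using cos_sigma_sq unfolding kappa_sq[symmetric] by (simp add: algebra_simps)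

lemma Psi_derivatives:
  "has_nderiv (Y_space \<kappa> \<beta>) (\<lambda>r. Psi1 \<kappa> \<beta> \<Lambda>s 1 2 \<psi> r v \<Lambda>s) (((1 + \<kappa>\<^sup>2 / 3) * sin v) *\<^sub>R wt 1) 0"
  "has_nderiv (Y_space \<kappa> \<beta>) (\<lambda>r. Psi2 \<kappa> \<beta> \<Lambda>s 1 2 \<psi> r v \<Lambda>s)
     (((1 / 16 + (cos \<sigma>)\<^sup>2 / 2) * (cos v)\<^sup>2) *\<^sub>R wt 2) 0"
proof -
  have L: "((\<lambda>r. \<Lambda>s) has_vector_derivative (0, - 4 * \<kappa> * 0, 0)) (at 0)"
    using has_vector_derivative_const[of \<Lambda>s "at (0::real)"] by (simp add: zero_prod_def)
  obtain f1 f2 where f: "\<forall>\<^sub>F r in nhds 0. Psi1 \<kappa> \<beta> \<Lambda>s 1 2 \<psi> r v \<Lambda>s = f1 r *\<^sub>R wt 1"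
    "(f1 has_real_derivative (1 + \<kappa>\<^sup>2 / 3) * sin v + 2 / 3 * (2 * \<kappa> * 0 - 0 / \<kappa> - 2 * \<kappa> * 0)) (at 0)"
    "\<forall>\<^sub>F r in nhds 0. Psi2 \<kappa> \<beta> \<Lambda>s 1 2 \<psi> r v \<Lambda>s = f2 r *\<^sub>R wt 2"
    "(f2 has_real_derivative 3 / 16 * (3 + \<kappa>\<^sup>2) * (cos \<sigma>)\<^sup>2 * (cos v)\<^sup>2
        + 3 / 4 * sin v * (4 * \<kappa> * 0 / 3 - 0 / \<kappa> - 2 * \<kappa> * 0)) (at 0)"
    by (rule Psi_expansion[OF L refl])
  have d: "(f1 has_real_derivative (1 + \<kappa>\<^sup>2 / 3) * sin v) (at 0)"
    "(f2 has_real_derivative (1 / 16 + (cos \<sigma>)\<^sup>2 / 2) * (cos v)\<^sup>2) (at 0)"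
    using f(2,4) unfolding quadratic_coefficient by simp_all
  show "has_nderiv (Y_space \<kappa> \<beta>) (\<lambda>r. Psi1 \<kappa> \<beta> \<Lambda>s 1 2 \<psi> r v \<Lambda>s) (((1 + \<kappa>\<^sup>2 / 3) * sin v) *\<^sub>R wt 1) 0"
    by (rule has_nderiv_scaled[OF wt_in_Y d(1) f(1)]) simp
  show "has_nderiv (Y_space \<kappa> \<beta>) (\<lambda>r. Psi2 \<kappa> \<beta> \<Lambda>s 1 2 \<psi> r v \<Lambda>s)
     (((1 / 16 + (cos \<sigma>)\<^sup>2 / 2) * (cos v)\<^sup>2) *\<^sub>R wt 2) 0"
    by (rule has_nderiv_scaled[OF wt_in_Y d(2) f(3)]) simp
qed

lemma wt_nz: assumes "n \<in> {1, 2}" shows "wt n \<noteq> 0"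
proof
  assume "wt n = 0"
  then have "inner_Y \<kappa> (wt n) (wt n) = 0" by (simp add: inner_Y_def zero_prod_def)
  then show False using assms norm_wt kappa_pos cos_sigma_nz by auto
qed

lemma derivative_of_zero:
  assumes "(f has_real_derivative d) (at 0)" "\<forall>\<^sub>F r in nhds 0. f r = (0 :: real)" shows "d = 0"
proof -
  have "(f has_real_derivative d) (at 0) = ((\<lambda>r. 0 :: real) has_real_derivative d) (at 0)"
    by (rule DERIV_cong_ev[OF refl assms(2) refl])
  then show ?thesis using assms(1) DERIV_unique[OF _ DERIV_const] by blast
qed

text \<open>Differentiation of \<open>\<Psi>\<^sub>1 = \<Psi>\<^sub>2 = 0\<close> along the sheet at \<open>r = 0\<close>.\<close>

lemma sheet_derivatives:
  assumes sheet: "sheet_functions \<kappa> \<beta> \<Lambda>s 1 2 \<psi> \<delta>' a l" and v: "\<bar>sin v\<bar> > \<delta>'"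
  defines "a' \<equiv> deriv (\<lambda>r. a (r, v)) 0" and "l' \<equiv> deriv (\<lambda>r. l (r, v)) 0"
  shows "(1 + \<kappa>\<^sup>2 / 3) * sin v + 2 / 3 * (a' / (4 * \<kappa>\<^sup>2) - a' / 2 - 2 * \<kappa> * l') = 0"
    "(1 / 16 + (cos \<sigma>)\<^sup>2 / 2) * (cos v)\<^sup>2 + 3 / 4 * sin v * (a' / (4 * \<kappa>\<^sup>2) - a' / 3 - 2 * \<kappa> * l') = 0"
proof -
  obtain e where e: "e > 0" "smooth_map (UNIV, norm) (UNIV, norm) {(r, v). \<bar>r\<bar> < e \<and> \<bar>sin v\<bar> > \<delta>'} a"
      "smooth_map (UNIV, norm) (UNIV, norm) {(r, v). \<bar>r\<bar> < e \<and> \<bar>sin v\<bar> > \<delta>'} l"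
      "a (0, v) = fst (snd \<Lambda>s)" "l (0, v) = snd (snd \<Lambda>s)"
      "\<And>r. \<bar>r\<bar> < e \<Longrightarrow> Psi1 \<kappa> \<beta> \<Lambda>s 1 2 \<psi> r v (fst \<Lambda>s, a (r, v), l (r, v)) = 0 \<and>
                       Psi2 \<kappa> \<beta> \<Lambda>s 1 2 \<psi> r v (fst \<Lambda>s, a (r, v), l (r, v)) = 0"
    using sheet v unfolding sheet_functions_def Let_def by fast
  have d: "((\<lambda>r. a (r, v)) has_real_derivative a') (at 0)" "((\<lambda>r. l (r, v)) has_real_derivative l') (at 0)"
    unfolding a'_def l'_def
    using smooth_map_partial[OF e(2), of v e] smooth_map_partial[OF e(3), of v e] e(1) v DERIV_imp_deriv by fastforce+
  let ?Lam = "\<lambda>r. (fst \<Lambda>s, a (r, v), l (r, v))"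
  \<comment> \<open>The velocity of \<open>\<surd>\<bar>\<alpha>\<bar>\<close> that belongs to \<open>a'\<close>.\<close>
  define b where "b = - a' / (4 * \<kappa>)"
  have b: "- 4 * \<kappa> * b = a'" using kappa_pos by (simp add: b_def)
  have L: "(?Lam has_vector_derivative (0, - 4 * \<kappa> * b, l')) (at 0)" "?Lam 0 = \<Lambda>s"
    unfolding b using d e(4,5) by (auto intro!: has_vector_derivative_Pair has_vector_derivative_const
        simp: has_real_derivative_iff_has_vector_derivative)
  obtain f1 f2 where f: "\<forall>\<^sub>F r in nhds 0. Psi1 \<kappa> \<beta> \<Lambda>s 1 2 \<psi> r v (?Lam r) = f1 r *\<^sub>R wt 1"
    "(f1 has_real_derivative (1 + \<kappa>\<^sup>2 / 3) * sin v + 2 / 3 * (2 * \<kappa> * b - b / \<kappa> - 2 * \<kappa> * l')) (at 0)"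
    "\<forall>\<^sub>F r in nhds 0. Psi2 \<kappa> \<beta> \<Lambda>s 1 2 \<psi> r v (?Lam r) = f2 r *\<^sub>R wt 2"
    "(f2 has_real_derivative 3 / 16 * (3 + \<kappa>\<^sup>2) * (cos \<sigma>)\<^sup>2 * (cos v)\<^sup>2
        + 3 / 4 * sin v * (4 * \<kappa> * b / 3 - b / \<kappa> - 2 * \<kappa> * l')) (at 0)"
    by (rule Psi_expansion[OF L])
  have ev: "\<forall>\<^sub>F r in nhds 0. \<bar>r\<bar> < e"
    unfolding eventually_nhds_metric using e(1) by (auto simp: dist_real_def)
  have "\<forall>\<^sub>F r in nhds 0. f1 r = 0" using ev f(1) by eventually_elim (use e(6) wt_nz[of 1] in auto)
  note 1 = derivative_of_zero[OF f(2) this]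
  have "\<forall>\<^sub>F r in nhds 0. f2 r = 0" using ev f(3) by eventually_elim (use e(6) wt_nz[of 2] in auto)
  note 2 = derivative_of_zero[OF f(4) this]
  have s: "2 * \<kappa> * b = - (a' / 2)" "4 * \<kappa> * b / 3 = - (a' / 3)" "b / \<kappa> = - (a' / (4 * \<kappa>\<^sup>2))"
    using kappa_pos by (simp_all add: b_def power2_eq_square)
  show "(1 + \<kappa>\<^sup>2 / 3) * sin v + 2 / 3 * (a' / (4 * \<kappa>\<^sup>2) - a' / 2 - 2 * \<kappa> * l') = 0"
    using 1 unfolding s by simp
  show "(1 / 16 + (cos \<sigma>)\<^sup>2 / 2) * (cos v)\<^sup>2 + 3 / 4 * sin v * (a' / (4 * \<kappa>\<^sup>2) - a' / 3 - 2 * \<kappa> * l') = 0"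
    using 2 unfolding s quadratic_coefficient by simp
qed

text \<open>The inverse of the coefficient matrix of the two equations, with the sign that moves the inhomogeneity to the other side.
  Subtracting \<open>8\<close> times the second equation from \<open>9\<close> times the first one eliminates the second slope and leaves
  the row \<open>(9, -8)\<close>.\<close>

definition sheet_matrix :: "real^2^2" where
  "sheet_matrix = vector [vector [9, - 8],
     vector [(9 / (4 * \<kappa>\<^sup>2) - 3) / (2 * \<kappa>), (4 - 8 / (4 * \<kappa>\<^sup>2)) / (2 * \<kappa>)]]"

lemma invertible_sheet_matrix: "invertible sheet_matrix"
proof -
  have "det sheet_matrix = 6 / \<kappa>"
    using kappa_pos by (simp add: sheet_matrix_def det_2 field_simps)
  then show ?thesis using kappa_pos by (simp add: invertible_det_nz)
qed

text \<open>The second equation is divided by \<open>sin v\<close>, which is nonzero on the sheet; this produces \<open>cot v\<close>.\<close>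

lemma sheet_slopes:
  assumes sheet: "sheet_functions \<kappa> \<beta> \<Lambda>s 1 2 \<psi> \<delta>' a l" and v: "\<bar>sin v\<bar> > \<delta>'" "\<delta>' > 0"
  defines "p \<equiv> (1 + \<kappa>\<^sup>2 / 3) * sin v" and "q \<equiv> (1 / 16 + (cos \<sigma>)\<^sup>2 / 2) * cos v * cot v"
  shows "deriv (\<lambda>r. a (r, v)) 0 = 9 * p - 8 * q"
    "deriv (\<lambda>r. l (r, v)) 0 = (9 / (4 * \<kappa>\<^sup>2) - 3) / (2 * \<kappa>) * p + (4 - 8 / (4 * \<kappa>\<^sup>2)) / (2 * \<kappa>) * q"
proof -
  let ?a = "deriv (\<lambda>r. a (r, v)) 0" and ?l = "deriv (\<lambda>r. l (r, v)) 0"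
  define t where "t = ?a / (4 * \<kappa>\<^sup>2)"
  have sv: "sin v \<noteq> 0" using v by auto
  have q: "(1 / 16 + (cos \<sigma>)\<^sup>2 / 2) * (cos v)\<^sup>2 = sin v * q"
    using sv by (simp add: q_def cot_def power2_eq_square)
  have 1: "p + 2 / 3 * (t - ?a / 2 - 2 * \<kappa> * ?l) = 0"
    using sheet_derivatives(1)[OF sheet v(1)] by (simp add: p_def t_def)
  have "sin v * (q + 3 / 4 * (t - ?a / 3 - 2 * \<kappa> * ?l)) = 0"
    using sheet_derivatives(2)[OF sheet v(1)] unfolding q t_def[symmetric] by (simp add: algebra_simps)
  then have 2: "q + 3 / 4 * (t - ?a / 3 - 2 * \<kappa> * ?l) = 0" using sv by simp
  show a: "?a = 9 * p - 8 * q" using 1 2 by argo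
  have "2 * \<kappa> * ?l = t + 3 / 2 * p - (9 * p - 8 * q) / 2" using 1 a by argo
  also have "t = (9 * p - 8 * q) / (4 * \<kappa>\<^sup>2)" by (simp only: t_def a)
  finally have "?l = ((9 * p - 8 * q) / (4 * \<kappa>\<^sup>2) + 3 / 2 * p - (9 * p - 8 * q) / 2) / (2 * \<kappa>)"
    using kappa_pos by (simp only: nonzero_eq_divide_eq) (simp add: mult.commute)
  also have "\<dots> = (9 / (4 * \<kappa>\<^sup>2) - 3) / (2 * \<kappa>) * p + (4 - 8 / (4 * \<kappa>\<^sup>2)) / (2 * \<kappa>) * q"
    using kappa_pos by (simp add: field_simps)
  finally show "?l = (9 / (4 * \<kappa>\<^sup>2) - 3) / (2 * \<kappa>) * p + (4 - 8 / (4 * \<kappa>\<^sup>2)) / (2 * \<kappa>) * q" .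
qed

lemma sheet_system:
  assumes "sheet_functions \<kappa> \<beta> \<Lambda>s 1 2 \<psi> \<delta>' a l" "\<bar>sin v\<bar> > \<delta>'" "\<delta>' > 0"
  shows "(vector [deriv (\<lambda>r. a (r, v)) 0, deriv (\<lambda>r. l (r, v)) 0] :: real^2) =
    sheet_matrix *v vector [(1 + \<kappa>\<^sup>2 / 3) * sin v, (1 / 16 + (cos \<sigma>)\<^sup>2 / 2) * cos v * cot v]"
  by (simp add: vec_eq_iff forall_2 matrix_vector_mult_def sum_2 sheet_matrix_def sheet_slopes[OF assms])

text \<open>Multiplying a slope by \<open>sin v\<close> gives a quadratic form in \<open>sin v\<close> and \<open>cos v\<close>. Up to the positive constants \<open>A\<close>, \<open>B\<close>, the
  form for \<open>a\<close> has the coefficients \<open>9\<close> and \<open>-8\<close>, and those of the form for \<open>l\<close> do not both vanish because the matrix is nonsingular.\<close>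

lemma sheet_slopes_sparse:
  assumes sheet: "sheet_functions \<kappa> \<beta> \<Lambda>s 1 2 \<psi> \<delta>' a l" and d: "\<delta>' > 0"
  shows "{v. \<bar>sin v\<bar> > \<delta>' \<and> (deriv (\<lambda>r. a (r, v)) 0 = 0 \<or> deriv (\<lambda>r. l (r, v)) 0 = 0)} sparse_in {v. \<bar>sin v\<bar> > \<delta>'}"
proof -
  define A where "A = 1 + \<kappa>\<^sup>2 / 3"
  define B where "B = 1 / 16 + (cos \<sigma>)\<^sup>2 / 2"
  define c1 c2 where "c1 = (9 / (4 * \<kappa>\<^sup>2) - 3) / (2 * \<kappa>)" and "c2 = (4 - 8 / (4 * \<kappa>\<^sup>2)) / (2 * \<kappa>)"
  have pos: "A > 0" "B > 0" unfolding A_def B_def by (auto intro!: add_pos_nonneg)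
  \<comment> \<open>The determinant of \<open>sheet_matrix\<close>.\<close>
  have "9 * c2 + 8 * c1 = 6 / \<kappa>" using kappa_pos unfolding c1_def c2_def by (simp add: field_simps)
  then have c: "c1 \<noteq> 0 \<or> c2 \<noteq> 0" using kappa_pos by auto
  let ?Z = "\<lambda>p q. {v. p * A * (sin v)\<^sup>2 + q * B * (cos v)\<^sup>2 = 0}"
  have "{v. \<bar>sin v\<bar> > \<delta>' \<and> (deriv (\<lambda>r. a (r, v)) 0 = 0 \<or> deriv (\<lambda>r. l (r, v)) 0 = 0)} \<subseteq> ?Z 9 (- 8) \<union> ?Z c1 c2"
  proof
    fix v assume "v \<in> {v. \<bar>sin v\<bar> > \<delta>' \<and> (deriv (\<lambda>r. a (r, v)) 0 = 0 \<or> deriv (\<lambda>r. l (r, v)) 0 = 0)}"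
    then have v: "\<bar>sin v\<bar> > \<delta>'" and or: "deriv (\<lambda>r. a (r, v)) 0 = 0 \<or> deriv (\<lambda>r. l (r, v)) 0 = 0" by auto
    have sv: "sin v \<noteq> 0" using v d by auto
    have m: "p * (A * sin v) + q * (B * cos v * cot v) = 0 \<Longrightarrow> v \<in> ?Z p q" for p q
    proof -
      assume e: "p * (A * sin v) + q * (B * cos v * cot v) = 0"
      have "p * A * (sin v)\<^sup>2 + q * B * (cos v)\<^sup>2 = sin v * (p * (A * sin v) + q * (B * cos v * cot v))"
        using sv by (simp add: cot_def field_simps power2_eq_square)
      then show "v \<in> ?Z p q" unfolding e by simp
    qed
    from or show "v \<in> ?Z 9 (- 8) \<union> ?Z c1 c2"
    proof
      assume "deriv (\<lambda>r. a (r, v)) 0 = 0"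
      then have "v \<in> ?Z 9 (- 8)" unfolding sheet_slopes(1)[OF sheet v d] by (intro m) (simp add: A_def B_def)
      then show ?thesis by blast
    next
      assume "deriv (\<lambda>r. l (r, v)) 0 = 0"
      then have "v \<in> ?Z c1 c2"
        unfolding sheet_slopes(2)[OF sheet v d] by (intro m) (simp add: A_def B_def c1_def c2_def)
      then show ?thesis by blast
    qed
  qed
  moreover have "(?Z 9 (- 8) \<union> ?Z c1 c2) sparse_in {v. \<bar>sin v\<bar> > \<delta>'}"
    by (intro sparse_in_union' sparse_quadratic_form) (use pos c in auto)
  ultimately show ?thesis by (rule sparse_in_subset2[rotated])
qed

end

lemma (in reduction) reduced_family_exists:
  obtains \<rho> \<epsilon> d where "reduced_family \<sigma> \<kappa> \<beta> \<Lambda>s X0 \<psi> \<rho> \<epsilon> d"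
proof (rule LS_data)
  fix \<rho> \<epsilon>
  assume r: "\<rho> > 0" "\<epsilon> > 0" "\<And>k. Ck_map k (K \<times> UNIV, nK) (X0, nX) (nbhd \<rho>) \<psi>"
    "\<And>v \<Lambda>. (v, \<Lambda>) \<in> nbhd \<rho> \<Longrightarrow> solves \<epsilon> v \<Lambda> (\<psi> (v, \<Lambda>))"
    "\<And>v \<Lambda> y. (v, \<Lambda>) \<in> nbhd \<rho> \<Longrightarrow> solves \<epsilon> v \<Lambda> y \<Longrightarrow> y = \<psi> (v, \<Lambda>)"
  show ?thesis
  proof (rule small_ball[OF r(1)])
    fix d assume "d > 0" "\<And>P. P \<in> ball P0 d \<Longrightarrow> xP P \<in> nbhd \<rho>" "\<And>P. P \<in> ball P0 d \<Longrightarrow> snd (snd P) \<in> U_set"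
      "\<And>P. P \<in> ball P0 d \<Longrightarrow> (0, snd (snd P)) \<in> nbhd \<rho>"
    with r(2-5) have "reduced_family \<sigma> \<kappa> \<beta> \<Lambda>s X0 \<psi> \<rho> \<epsilon> d" by unfold_locales
    then show ?thesis by (rule that)
  qed
qed

theorem proposition5p6:
  fixes \<sigma> \<kappa> \<beta> :: real and \<Lambda>s :: param
  assumes beta: "0 < \<beta>" "\<beta> < 1"
    and sigma: "0 < \<sigma>" "\<sigma> * cot \<sigma> = 1" "\<And>x::real. 0 < x \<Longrightarrow> x * cot x = 1 \<Longrightarrow> \<sigma> \<le> x"
    and kappa: "\<kappa> = \<sigma> / sqrt 3"
    and Lambda: "\<Lambda>s = (1 / (2 * \<kappa>), - 4 * \<kappa>\<^sup>2, pi / 2)"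
  shows "M_set \<kappa> \<Lambda>s = {1, 2} \<and>
    (\<forall>X0 \<psi>. closed_subspace (X_space \<kappa> \<beta>) X0 \<and>
       direct_sum (fst (X_space \<kappa> \<beta>)) (ker_DwF \<kappa> \<beta> \<Lambda>s) X0 \<and>
       LS_function \<kappa> \<beta> \<Lambda>s 1 2 X0 \<psi> \<longrightarrow>
       (\<forall>v. has_nderiv (Y_space \<kappa> \<beta>) (\<lambda>r. Psi1 \<kappa> \<beta> \<Lambda>s 1 2 \<psi> r v \<Lambda>s)
              (((1 + \<kappa>\<^sup>2 / 3) * sin v) *\<^sub>R wt_star \<kappa> \<Lambda>s 1) 0 \<and>
            has_nderiv (Y_space \<kappa> \<beta>) (\<lambda>r. Psi2 \<kappa> \<beta> \<Lambda>s 1 2 \<psi> r v \<Lambda>s)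
              (((1 / 16 + (cos \<sigma>)\<^sup>2 / 2) * (cos v)\<^sup>2) *\<^sub>R wt_star \<kappa> \<Lambda>s 2) 0) \<and>
       (\<exists>M :: real^2^2. invertible M \<and>
          (\<forall>\<delta> a l. 0 < \<delta> \<and> \<delta> < 1 \<and> sheet_functions \<kappa> \<beta> \<Lambda>s 1 2 \<psi> \<delta> a l \<longrightarrow>
             (\<forall>v. \<bar>sin v\<bar> > \<delta> \<longrightarrow>
                (vector [deriv (\<lambda>r. a (r, v)) 0, deriv (\<lambda>r. l (r, v)) 0] :: real^2) =
                M *v vector [(1 + \<kappa>\<^sup>2 / 3) * sin v,
                             (1 / 16 + (cos \<sigma>)\<^sup>2 / 2) * cos v * cot v]) \<and>
             {v. \<bar>sin v\<bar> > \<delta> \<and>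
                 (deriv (\<lambda>r. a (r, v)) 0 = 0 \<or> deriv (\<lambda>r. l (r, v)) 0 = 0)}
               sparse_in {v. \<bar>sin v\<bar> > \<delta>})))"
proof -
  interpret double_point \<sigma> \<kappa> \<beta> \<Lambda>s using assms by unfold_locales
  show ?thesis
  proof (intro conjI[OF M_set_value] allI impI, elim conjE)
    fix X0 \<psi>
    assume "closed_subspace (X_space \<kappa> \<beta>) X0" "direct_sum (fst (X_space \<kappa> \<beta>)) (ker_DwF \<kappa> \<beta> \<Lambda>s) X0"
      "LS_function \<kappa> \<beta> \<Lambda>s 1 2 X0 \<psi>"
    then interpret reduction \<sigma> \<kappa> \<beta> \<Lambda>s X0 \<psi> by unfold_locales
    obtain \<rho> \<epsilon> d where "reduced_family \<sigma> \<kappa> \<beta> \<Lambda>s X0 \<psi> \<rho> \<epsilon> d" by (rule reduced_family_exists)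
    then interpret reduced_family \<sigma> \<kappa> \<beta> \<Lambda>s X0 \<psi> \<rho> \<epsilon> d .
    show "(\<forall>v. has_nderiv (Y_space \<kappa> \<beta>) (\<lambda>r. Psi1 \<kappa> \<beta> \<Lambda>s 1 2 \<psi> r v \<Lambda>s)
              (((1 + \<kappa>\<^sup>2 / 3) * sin v) *\<^sub>R wt_star \<kappa> \<Lambda>s 1) 0 \<and>
            has_nderiv (Y_space \<kappa> \<beta>) (\<lambda>r. Psi2 \<kappa> \<beta> \<Lambda>s 1 2 \<psi> r v \<Lambda>s)
              (((1 / 16 + (cos \<sigma>)\<^sup>2 / 2) * (cos v)\<^sup>2) *\<^sub>R wt_star \<kappa> \<Lambda>s 2) 0) \<and>
       (\<exists>M :: real^2^2. invertible M \<and>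
          (\<forall>\<delta> a l. 0 < \<delta> \<and> \<delta> < 1 \<and> sheet_functions \<kappa> \<beta> \<Lambda>s 1 2 \<psi> \<delta> a l \<longrightarrow>
             (\<forall>v. \<bar>sin v\<bar> > \<delta> \<longrightarrow>
                (vector [deriv (\<lambda>r. a (r, v)) 0, deriv (\<lambda>r. l (r, v)) 0] :: real^2) =
                M *v vector [(1 + \<kappa>\<^sup>2 / 3) * sin v,
                             (1 / 16 + (cos \<sigma>)\<^sup>2 / 2) * cos v * cot v]) \<and>
             {v. \<bar>sin v\<bar> > \<delta> \<and>
                 (deriv (\<lambda>r. a (r, v)) 0 = 0 \<or> deriv (\<lambda>r. l (r, v)) 0 = 0)}
               sparse_in {v. \<bar>sin v\<bar> > \<delta>}))"
      using Psi_derivatives invertible_sheet_matrix sheet_system sheet_slopes_sparse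
      by (intro conjI allI exI[of _ sheet_matrix] impI; (elim conjE)?) blast+
  qed
qed

end
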